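(* Let $H<\mathrm{GL}(d,\mathbb{R})$ be a generalized shearlet dilation group, and let $Y=\mathrm{diag}(1,\lambda_2,\ldots,\lambda_d)$ be the infinitesimal generator of its scaling subgroup $D=\exp(\mathbb{R}Y)$. If $0<\lambda_i<1$ for all $2\le i\le d$, then $H$ characterizes the wavefront set.
   Context: Dilation groups. For a closed subgroup $H<\mathrm{GL}(d,\mathbb{R})$ let $G=\mathbb{R}^d\rtimes H$ with product $(x,h)(y,g)=(x+hy,hg)$, acting on $L^2(\mathbb{R}^d)$ by the quasi-regular representation $[\pi(x,h)f](y)=|\det h|^{-1/2}f(h^{-1}(y-x))$. $H$ is called irreducibly admissible if $\pi$ is an irreducible square-integrable representation; equivalently, the dual action $(\xi,h)\mapsto h^T\xi$ of $H$ on $\mathbb{R}^d$ has a single open orbit $\mathcal{O}$, this orbit has full measure, and the stabilizers $\{h\in H: h^T\xi_0=\xi_0\}$ of points $\xi_0\in\mathcal{O}$ are compact. Generalized shearlet dilation groups. Let $T(d,\mathbb{R})$ be the group of upper triangular real $d\times d$ matrices with ones on the diagonal. An irreducibly admissible dilation group $H<\mathrm{GL}(d,\mathbb{R})$ is a generalized shearlet dilation group if there are closed subgroups $S,D<H$ such that: (i) $S$ is a connected abelian Lie subgroup of $T(d,\mathbb{R})$; (ii) $D=\{\exp(rY):r\in\mathbb{R}\}$ is a one-parameter group with $Y$ a diagonal matrix; (iii) every $h\in H$ can be written uniquely as $h=\pm ds$ with $d\in D$, $s\in S$. $S$ is called the shearing subgroup and $D$ the scaling subgroup of $H$; $Y$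 is the infinitesimal generator of $D$. For such $H$ the open dual orbit is $\mathcal{O}=\mathbb{R}^\times\times\mathbb{R}^{d-1}$. Notation. $\|h\|$ is the operator norm of a matrix with respect to the Euclidean norm. $S^{d-1}\subset\mathbb{R}^d$ is the unit sphere; a $\xi$-neighborhood (for $\xi\in S^{d-1}$) is a relatively open $W\subset S^{d-1}$ with $\xi\in W$. $V\Subset\mathcal{O}$ means that the closure of $V$ inside $\mathcal{O}$ is compact. For $W\subset S^{d-1}$ open and $R>0$, $C(W)=\{r\xi':\xi'\in W,\ r>0\}$ and $C(W,R)=C(W)\setminus\overline{B_R}(0)$, with $\overline{B_R}(0)$ the closed ball. For nonempty open $W\subset S^{d-1}\cap\mathcal{O}$, $\emptyset\ne V\Subset\mathcal{O}$ and $R>0$, define $K_o(W,V,R)=\{h\in H: h^{-T}V\cap C(W,R)\neq\emptyset\}$, where $h^{-T}=(h^{-1})^T$. Wavelet transform of distributions. For $\psi\in\mathcal{S}(\mathbb{R}^d)$ and $u\in\mathcal{S}'(\mathbb{R}^d)$, $W_\psi u(y,h)=\langle u,\pi(y,h)\psi\rangle$, with $\langle\cdot,\cdot\rangle$ the sesquilinear extension of the $L^2$ scalar product to $\mathcal{S}'\times\mathcal{S}$. Regular directed points. For $u\in\mathcal{S}'(\mathbb{R}^d)$, $(x,\xi)\in\mathbb{R}^d\times S^{d-1}$ is a regular directed point of $u$ if there exist $\varphi\in C_c^\infty(\mathbb{R}^d)$, identically one in a neighborhood of $x$, and a $\xi$-neighborhood $W\subset S^{d-1}$ such that for all $N\in\mathbb{N}$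 there is $C_N>0$ with $|\widehat{\varphi u}(\xi')|\le C_N(1+|\xi'|)^{-N}$ for all $\xi'\in C(W)$. Characterizing the wavefront set. $H$ characterizes the wavefront set if there exists a nonempty open $V\Subset\mathcal{O}$ such that for all $0\ne\psi\in\mathcal{S}(\mathbb{R}^d)$ with $\mathrm{supp}(\widehat\psi)\subset V$, every $u\in\mathcal{S}'(\mathbb{R}^d)$ and all $(x,\xi)\in\mathbb{R}^d\times(\mathcal{O}\cap S^{d-1})$, the following are equivalent: (a) $(x,\xi)$ is a regular directed point of $u$; (b) there exist a neighborhood $U$ of $x$, some $R>0$ and a $\xi$-neighborhood $W\subset S^{d-1}\cap\mathcal{O}$ such that for all $N\in\mathbb{N}$ there is $C_N>0$ such that $|W_\psi u(y,h)|\le C_N\|h\|^N$ for all $y\in U$ and all $h\in K_o(W,V,R)$. *)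

theory Defs
  imports "HOL-Analysis.Analysis"
begin

text \<open>
  Vectors of dimension \<open>d\<close> are elements of \<^typ>\<open>real^'n\<close>; the order of the
  index type \<open>'n\<close> (a finite linear order) gives the meaning of ``upper triangular'' and
  ``first coordinate''.
\<close>

section \<open>Matrix groups\<close>

definition GL :: "(real^'n^'n) set" where
  "GL = {A. invertible A}"

definition matrix_group :: "(real^'n^'n) set \<Rightarrow> bool" where
  "matrix_group H \<longleftrightarrow> H \<subseteq> GL \<and> mat 1 \<in> H \<and>
     (\<forall>A\<in>H. \<forall>B\<in>H. A ** B \<in> H) \<and> (\<forall>A\<in>H. matrix_inv A \<in> H)"

definition closed_GL_subgroup :: "(real^'n^'n) set \<Rightarrow> bool" where
  "closed_GL_subgroup H \<longleftrightarrow> matrix_group H \<and> closedin (top_of_set GL) H"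

definition closed_subgroup_of :: "(real^'n^'n) set \<Rightarrow> (real^'n^'n) set \<Rightarrow> bool" where
  "closed_subgroup_of K H \<longleftrightarrow> matrix_group K \<and> K \<subseteq> H \<and> closedin (top_of_set H) K"

definition unitriangular :: "(real^('n::{finite,wellorder})^('n::_)) set" where
  "unitriangular = {A. (\<forall>i. A $ i $ i = 1) \<and> (\<forall>i j. j < i \<longrightarrow> A $ i $ j = 0)}"

definition diag_matrix :: "('n \<Rightarrow> real) \<Rightarrow> real^'n^'n" where
  "diag_matrix l = (\<chi> i j. if i = j then l i else 0)"

text \<open>The library's \<^const>\<open>exp\<close> is not available here: the ring structure of
  \<^typ>\<open>real^'n^'n\<close> in the library is componentwise.\<close>

definition matrix_exp :: "real^'n^'n \<Rightarrow> real^'n^'n" where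
  "matrix_exp A = (\<Sum>k. (1 / fact k) *\<^sub>R (((**) A ^^ k) (mat 1)))"


section \<open>The quasi-regular representation\<close>

text \<open>\<open>G = \<real>\<^sup>d \<rtimes> H\<close>, as a subset of \<^typ>\<open>(real^'n) \<times> (real^'n^'n)\<close>.\<close>

definition semidirect :: "(real^'n^'n) set \<Rightarrow> ((real^'n) \<times> (real^'n^'n)) set" where
  "semidirect H = UNIV \<times> H"

definition semidirect_mult ::
    "(real^'n) \<times> (real^'n^'n) \<Rightarrow> (real^'n) \<times> (real^'n^'n) \<Rightarrow> (real^'n) \<times> (real^'n^'n)" where
  "semidirect_mult a b = (fst a + snd a *v fst b, snd a ** snd b)"

definition quasi_regular ::
    "(real^'n) \<times> (real^'n^'n) \<Rightarrow> (real^'n \<Rightarrow> complex) \<Rightarrow> real^'n \<Rightarrow> complex" where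
  "quasi_regular g f z =
     complex_of_real (\<bar>det (snd g)\<bar> powr (- 1 / 2)) * f (matrix_inv (snd g) *v (z - fst g))"

text \<open>\<open>L\<^sup>2(\<real>\<^sup>d)\<close> is represented by square-integrable functions that are not identified almost
  everywhere. A set of functions closed under \<open>L\<^sup>2\<close>-convergence is automatically saturated with
  respect to almost everywhere equality.\<close>

definition L2_fun :: "(real^'n \<Rightarrow> complex) set" where
  "L2_fun = {f. f \<in> borel_measurable lborel \<and> integrable lborel (\<lambda>x. (norm (f x))\<^sup>2)}"

definition L2_inner :: "(real^'n \<Rightarrow> complex) \<Rightarrow> (real^'n \<Rightarrow> complex) \<Rightarrow> complex" where
  "L2_inner f g = (LINT x|lborel. f x * cnj (g x))"

definition L2_closed_subspace :: "(real^'n \<Rightarrow> complex) set \<Rightarrow> bool" where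
  "L2_closed_subspace E \<longleftrightarrow> E \<subseteq> L2_fun \<and> (\<lambda>_. 0) \<in> E \<and>
     (\<forall>f\<in>E. \<forall>g\<in>E. (\<lambda>x. f x + g x) \<in> E) \<and> (\<forall>c. \<forall>f\<in>E. (\<lambda>x. c * f x) \<in> E) \<and>
     (\<forall>F f. (\<forall>n. F n \<in> E) \<and> f \<in> L2_fun \<and>
        (\<lambda>n. LINT x|lborel. (norm (F n x - f x))\<^sup>2) \<longlonglongrightarrow> 0 \<longrightarrow> f \<in> E)"

definition quasi_regular_irreducible :: "(real^'n^'n) set \<Rightarrow> bool" where
  "quasi_regular_irreducible H \<longleftrightarrow>
     (\<forall>E. L2_closed_subspace E \<and> (\<forall>g\<in>semidirect H. \<forall>f\<in>E. quasi_regular g f \<in> E) \<longrightarrow>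
        E = {f\<in>L2_fun. AE x in lborel. f x = 0} \<or> E = L2_fun)"

definition left_haar_measure ::
    "(real^'n^'n) set \<Rightarrow> ((real^'n) \<times> (real^'n^'n)) measure \<Rightarrow> bool" where
  "left_haar_measure H \<mu> \<longleftrightarrow>
     sets \<mu> = sets (restrict_space borel (semidirect H)) \<and>
     (\<forall>K. compact K \<and> K \<subseteq> semidirect H \<longrightarrow> emeasure \<mu> K < \<infinity>) \<and>
     emeasure \<mu> (space \<mu>) \<noteq> 0 \<and>
     (\<forall>g\<in>semidirect H. \<forall>A\<in>sets \<mu>. emeasure \<mu> (semidirect_mult g ` A) = emeasure \<mu> A)"

definition quasi_regular_square_integrable :: "(real^'n^'n) set \<Rightarrow> bool" where
  "quasi_regular_square_integrable H \<longleftrightarrow>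
     (\<exists>\<mu> f. left_haar_measure H \<mu> \<and> f \<in> L2_fun \<and> \<not> (AE x in lborel. f x = 0) \<and>
        integrable \<mu> (\<lambda>g. (norm (L2_inner f (quasi_regular g f)))\<^sup>2))"

definition irreducibly_admissible :: "(real^'n^'n) set \<Rightarrow> bool" where
  "irreducibly_admissible H \<longleftrightarrow> closed_GL_subgroup H \<and>
     quasi_regular_irreducible H \<and> quasi_regular_square_integrable H"

definition dual_orbit :: "(real^'n^'n) set \<Rightarrow> real^'n \<Rightarrow> (real^'n) set" where
  "dual_orbit H \<xi> = {transpose h *v \<xi> | h. h \<in> H}"

text \<open>An irreducibly admissible group has exactly one open dual orbit.\<close>

definition open_dual_orbit :: "(real^'n^'n) set \<Rightarrow> (real^'n) set" where
  "open_dual_orbit H = (THE U. open U \<and> (\<exists>\<xi>. U = dual_orbit H \<xi>))"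


section \<open>Generalized shearlet dilation groups\<close>

text \<open>By Cartan's theorem, closed subgroups of \<open>GL(d,\<real>)\<close> are Lie subgroups carrying the subspace
  topology, so ``connected Lie subgroup'' is topological connectedness of the closed
  subgroup \<open>S\<close>.\<close>

definition generalized_shearlet_group ::
    "(real^('n::{finite,wellorder})^('n::_)) set \<Rightarrow> (real^('n::_)^('n::_)) set \<Rightarrow> (real^('n::_)^('n::_)) set
      \<Rightarrow> real^('n::_)^('n::_) \<Rightarrow> bool" where
  "generalized_shearlet_group H S D Y \<longleftrightarrow>
     irreducibly_admissible H \<and>
     closed_subgroup_of S H \<and> closed_subgroup_of D H \<and>
     S \<subseteq> unitriangular \<and> connected S \<and> (\<forall>A\<in>S. \<forall>B\<in>S. A ** B = B ** A) \<and>
     (\<forall>i j. i \<noteq> j \<longrightarrow> Y $ i $ j = 0) \<and> D = {matrix_exp (r *\<^sub>R Y) | r. True} \<and>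
     (\<forall>h\<in>H. \<exists>!(\<epsilon>, \<delta>, s). \<epsilon> \<in> {1, -1} \<and> \<delta> \<in> D \<and> s \<in> S \<and> h = \<epsilon> *\<^sub>R (\<delta> ** s))"


section \<open>Smooth functions, Schwartz functions and tempered distributions\<close>

definition partial_deriv :: "'n \<Rightarrow> (real^'n \<Rightarrow> complex) \<Rightarrow> real^'n \<Rightarrow> complex" where
  "partial_deriv i f x = vector_derivative (\<lambda>t. f (x + t *\<^sub>R axis i 1)) (at 0)"

definition partial_derivs :: "'n list \<Rightarrow> (real^'n \<Rightarrow> complex) \<Rightarrow> real^'n \<Rightarrow> complex" where
  "partial_derivs is f = foldr partial_deriv is f"

definition smooth :: "(real^'n \<Rightarrow> complex) \<Rightarrow> bool" where
  "smooth f \<longleftrightarrow> (\<forall>is. partial_derivs is f differentiable_on UNIV)"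

definition supp :: "(real^'n \<Rightarrow> complex) \<Rightarrow> (real^'n) set" where
  "supp f = closure {x. f x \<noteq> 0}"

definition test_function :: "(real^'n \<Rightarrow> complex) \<Rightarrow> bool" where
  "test_function f \<longleftrightarrow> smooth f \<and> compact (supp f)"

definition schwartz :: "(real^'n \<Rightarrow> complex) \<Rightarrow> bool" where
  "schwartz f \<longleftrightarrow> smooth f \<and>
     (\<forall>k is. \<exists>B. \<forall>x. (1 + norm x) ^ k * norm (partial_derivs is f x) \<le> B)"

definition schwartz_seminorm :: "nat \<Rightarrow> (real^'n \<Rightarrow> complex) \<Rightarrow> real" where
  "schwartz_seminorm k f =
     (SUP (x, is) \<in> UNIV \<times> {is. length is \<le> k}. (1 + norm x) ^ k * norm (partial_derivs is f x))"

text \<open>A tempered distribution is a linear functional on the Schwartz space that is continuous for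
  the increasing sequence of seminorms above; its values outside the Schwartz space are
  irrelevant.\<close>

definition tempered_distribution :: "((real^'n \<Rightarrow> complex) \<Rightarrow> complex) \<Rightarrow> bool" where
  "tempered_distribution u \<longleftrightarrow>
     (\<forall>f g. schwartz f \<and> schwartz g \<longrightarrow> u (\<lambda>x. f x + g x) = u f + u g) \<and>
     (\<forall>c f. schwartz f \<longrightarrow> u (\<lambda>x. c * f x) = c * u f) \<and>
     (\<exists>C k. \<forall>f. schwartz f \<longrightarrow> norm (u f) \<le> C * schwartz_seminorm k f)"

definition fourier :: "(real^'n \<Rightarrow> complex) \<Rightarrow> real^'n \<Rightarrow> complex" where
  "fourier f \<xi> = (LINT x|lborel. f x * cis (- 2 * pi * (x \<bullet> \<xi>)))"

text \<open>The distribution \<open>\<phi>u\<close> has compact support, so its Fourier transform is the smooth function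
  \<open>\<xi> \<mapsto> u(\<phi> e\<^sub>\<xi>)\<close> with \<open>e\<^sub>\<xi>(x) = exp(-2\<pi>i x\<cdot>\<xi>)\<close>.\<close>

definition fourier_localized ::
    "(real^'n \<Rightarrow> complex) \<Rightarrow> ((real^'n \<Rightarrow> complex) \<Rightarrow> complex) \<Rightarrow> real^'n \<Rightarrow> complex" where
  "fourier_localized \<phi> u \<xi> = u (\<lambda>x. \<phi> x * cis (- 2 * pi * (x \<bullet> \<xi>)))"

text \<open>The pairing that extends \<^const>\<open>L2_inner\<close>: a function \<open>w\<close> induces the distribution
  \<open>u(f) = \<integral> w f\<close>, for which \<open>u(cnj f)\<close> is the \<open>L\<^sup>2\<close> scalar product of \<open>w\<close> and \<open>f\<close>.\<close>

definition dist_inner ::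
    "((real^'n \<Rightarrow> complex) \<Rightarrow> complex) \<Rightarrow> (real^'n \<Rightarrow> complex) \<Rightarrow> complex" where
  "dist_inner u f = u (\<lambda>x. cnj (f x))"

definition wavelet_transform ::
    "(real^'n \<Rightarrow> complex) \<Rightarrow> ((real^'n \<Rightarrow> complex) \<Rightarrow> complex) \<Rightarrow> real^'n \<Rightarrow> real^'n^'n \<Rightarrow> complex"
  where "wavelet_transform \<psi> u y h = dist_inner u (quasi_regular (y, h) \<psi>)"


section \<open>Wavefront sets\<close>

definition cone :: "(real^'n) set \<Rightarrow> (real^'n) set" where
  "cone W = {r *\<^sub>R \<xi> | r \<xi>. \<xi> \<in> W \<and> r > 0}"

definition truncated_cone :: "(real^'n) set \<Rightarrow> real \<Rightarrow> (real^'n) set" where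
  "truncated_cone W R = cone W - cball 0 R"

definition sphere_nbhd :: "(real^'n) set \<Rightarrow> real^'n \<Rightarrow> bool" where
  "sphere_nbhd W \<xi> \<longleftrightarrow> openin (top_of_set (sphere 0 1)) W \<and> \<xi> \<in> W"

definition K_o :: "(real^'n^'n) set \<Rightarrow> (real^'n) set \<Rightarrow> (real^'n) set \<Rightarrow> real \<Rightarrow> (real^'n^'n) set" where
  "K_o H W V R =
     {h\<in>H. (\<lambda>v. transpose (matrix_inv h) *v v) ` V \<inter> truncated_cone W R \<noteq> {}}"

definition op_norm :: "real^'n^'n \<Rightarrow> real" where
  "op_norm h = onorm ((*v) h)"

definition regular_directed_point ::
    "((real^'n \<Rightarrow> complex) \<Rightarrow> complex) \<Rightarrow> real^'n \<Rightarrow> real^'n \<Rightarrow> bool" where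
  "regular_directed_point u x \<xi> \<longleftrightarrow>
     (\<exists>\<phi> W. test_function \<phi> \<and> (\<exists>U. open U \<and> x \<in> U \<and> (\<forall>y\<in>U. \<phi> y = 1)) \<and> sphere_nbhd W \<xi> \<and>
        (\<forall>N::nat. \<exists>C>0. \<forall>\<eta>\<in>cone W.
           norm (fourier_localized \<phi> u \<eta>) \<le> C * (1 + norm \<eta>) powr (- real N)))"

definition wavelet_decay_point ::
    "(real^'n^'n) set \<Rightarrow> (real^'n) set \<Rightarrow> (real^'n \<Rightarrow> complex) \<Rightarrow>
      ((real^'n \<Rightarrow> complex) \<Rightarrow> complex) \<Rightarrow> real^'n \<Rightarrow> real^'n \<Rightarrow> bool" where
  "wavelet_decay_point H V \<psi> u x \<xi> \<longleftrightarrow>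
     (\<exists>U R W. open U \<and> x \<in> U \<and> R > 0 \<and> sphere_nbhd W \<xi> \<and> W \<subseteq> open_dual_orbit H \<and>
        (\<forall>N::nat. \<exists>C>0. \<forall>y\<in>U. \<forall>h\<in>K_o H W V R.
           norm (wavelet_transform \<psi> u y h) \<le> C * op_norm h ^ N))"

definition compactly_inside :: "(real^'n) set \<Rightarrow> (real^'n) set \<Rightarrow> bool" where
  "compactly_inside V U \<longleftrightarrow> V \<subseteq> U \<and> compact (U \<inter> closure V)"

definition characterizes_wavefront_set :: "(real^'n^'n) set \<Rightarrow> bool" where
  "characterizes_wavefront_set H \<longleftrightarrow>
     (\<exists>V. V \<noteq> {} \<and> open V \<and> compactly_inside V (open_dual_orbit H) \<and>
        (\<forall>\<psi>. schwartz \<psi> \<and> \<psi> \<noteq> (\<lambda>_. 0) \<and> supp (fourier \<psi>) \<subseteq> V \<longrightarrow>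
          (\<forall>u x \<xi>. tempered_distribution u \<and> \<xi> \<in> open_dual_orbit H \<inter> sphere 0 1 \<longrightarrow>
             (regular_directed_point u x \<xi> \<longleftrightarrow> wavelet_decay_point H V \<psi> u x \<xi>))))"

end

theory Submission imports Defs "HOL-Probability.Probability"
begin

text \<open>The dual action of \<open>H\<close> moves frequencies by \<open>h\<^sup>T\<close>, and the wavelet transform \<open>W\<^sub>\<psi>u(y,h)\<close> sees the frequencies in
\<open>h\<^sup>-\<^sup>T V\<close>, where \<open>V\<close> contains the support of the Fourier transform of \<open>\<psi>\<close>. The theorem holds because these sets
behave, for small \<open>h\<close>, like points of a cone that tend to infinity: they shrink in direction, and every quantity
that grows along the way is bounded by a negative power of the norm of \<open>h\<close>, whereas rapid decay offers all positive
powers. Throughout, \<open>m\<close> denotes the first index and \<open>e\<^sub>m\<close> the first unit vector.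

\<^emph>\<open>Transitivity of the shears.\<close> If no element of \<open>H\<close> moved a point of the open set \<open>U1\<close> into the open set \<open>U2\<close>,
then by Parseval the functions orthogonal to the orbit of a function with frequencies in \<open>U1\<close> would form a proper
nonzero closed invariant subspace; so irreducibility makes the dual action topologically transitive
(\<open>irreducible_imp_transitive\<close>), and Baire's theorem gives a dense dual orbit (\<open>dense_dual_orbit\<close>). Dividing by signs
and dilations, the transposed shears have a dense orbit in the hyperplane \<open>x $ m = 1\<close>, which they preserve. They
generate a commutative algebra, so an element of their span that annihilates a vector with dense orbit annihilates
everything. Evaluation at that vector is therefore injective on a finite-dimensional space, hence bounded below, and
this makes the orbit closed: the shears are transitive on the hyperplane (\<open>ST_transitive\<close>), and a shear is bounded by
the image of \<open>e\<^sub>m\<close> (\<open>ST_norm_bound\<close>). In particular the open dual orbit is \<open>x $ m \<noteq> 0\<close>.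

\<^emph>\<open>Geometry of the dual action.\<close> Write \<open>h\<^sup>-\<^sup>T = \<plusminus> \<sigma> exp(-rY)\<close> with a transposed shear \<open>\<sigma>\<close>, and let \<open>V\<close> be a ball around
\<open>e\<^sub>m\<close>. For \<open>v\<close> in \<open>V\<close> the vector \<open>exp(-rY) v\<close> is a multiple of \<open>e\<^sub>m + z\<close> with
\<open>z\<^sub>i = exp(r(1 - \<lambda>\<^sub>i)) v\<^sub>i / v\<^sub>m\<close>. Since \<open>\<lambda>\<^sub>i < 1\<close>, the perturbation \<open>z\<close> is small for very negative \<open>r\<close>, uniformly in
\<open>v\<close>. If one point of \<open>h\<^sup>-\<^sup>T V\<close> is large and has a direction close to \<open>\<xi>\<close>, then \<open>r\<close> is very negative, \<open>\<sigma>\<close> is bounded,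
and all of \<open>h\<^sup>-\<^sup>T V\<close> has nearly the same direction (\<open>dual_window_in_cone\<close>). Conversely every large frequency in a
narrow cone around \<open>\<xi>\<close> is reached from a prescribed point of \<open>V\<close> (\<open>cone_covered_by_window\<close>). Since \<open>\<lambda>\<^sub>i > 0\<close>, the norm
of \<open>h\<close> is at most a positive power of \<open>exp r\<close> for bounded \<open>\<sigma>\<close>, while the inverse of \<open>h\<close>, the normalizing factor of
\<open>\<pi>(y,h)\<close> and the frequencies in \<open>h\<^sup>-\<^sup>T V\<close> are controlled by negative powers of \<open>exp r\<close>; the predicate \<open>controlled\<close> records this
comparison.

\<^emph>\<open>Regularity implies decay.\<close> Let \<open>\<phi>\<close> be the cutoff at \<open>x\<close>. The part of \<open>W\<^sub>\<psi>u(y,h)\<close> that is localized by \<open>\<phi>\<close> is the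
integral of the Fourier transform of \<open>\<phi>u\<close> against a function supported in \<open>h\<^sup>-\<^sup>T V\<close>, a set of frequencies of size at
least a multiple of \<open>1 / \<parallel>h\<parallel>\<close> inside the cone of rapid decay. The other part is small because \<open>\<pi>(y,h)\<psi>\<close>
decays rapidly away from \<open>y\<close> (\<open>wavelet_decay_of_regular\<close>).

\<^emph>\<open>Decay implies regularity.\<close> Each frequency is treated with a single group element. For a frequency \<open>\<eta>\<close> far out in the cone
choose one \<open>h\<close> with \<open>h\<^sup>T \<eta> = a\<close>, where \<open>a\<close> is a point at which the Fourier transform of \<open>\<psi>\<close> does not vanish. Near its
dominant frequency, the transform of \<open>\<phi> e\<^sub>\<eta>\<close> can be divided by that of the wavelet, so that this part of \<open>\<phi> e\<^sub>\<eta>\<close> is a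
convolution of the wavelet with a kernel concentrated near the support of \<open>\<phi>\<close>, and \<open>u\<close> applied to it is an integral of
wavelet coefficients (\<open>frequency_near_part\<close>). The remaining frequencies of \<open>\<phi> e\<^sub>\<eta>\<close> carry only rapidly decaying tails
of the transform of \<open>\<phi>\<close> (\<open>frequency_far_part\<close>). Together they bound the transform of \<open>\<phi>u\<close> at \<open>\<eta>\<close>
(\<open>regular_of_wavelet_decay\<close>).

Both analytic parts apply \<open>u\<close> under an integral. This is justified by quadrature rules that converge in the Schwartz
space (\<open>quadrature\<close>, \<open>tempered_integral\<close>).\<close>

section \<open>Calculus of smooth functions\<close>

lemma partial_deriv_eq:
  assumes "(f has_derivative D) (at x)"
  shows "partial_deriv i f x = D (axis i 1)"
proof -
  have l: "((\<lambda>t::real. x + t *\<^sub>R axis i (1::real)) has_derivative (\<lambda>t. t *\<^sub>R axis i 1)) (at 0)"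
    by (auto intro!: derivative_eq_intros)
  have "(f has_derivative D) (at (x + 0 *\<^sub>R axis i 1))" using assms by simp
  from diff_chain_at[OF l this] have "((\<lambda>t. f (x + t *\<^sub>R axis i 1)) has_derivative (\<lambda>t. D (t *\<^sub>R axis i 1))) (at 0)"
    by (simp add: o_def)
  moreover have "linear D" using assms has_derivative_linear by blast
  ultimately have "((\<lambda>t. f (x + t *\<^sub>R axis i 1)) has_vector_derivative D (axis i 1)) (at 0)"
    by (simp add: has_vector_derivative_def linear_scale)
  then show ?thesis unfolding partial_deriv_def by (rule vector_derivative_at)
qed

lemma linear_vec_expand:
  fixes D :: "real^'n \<Rightarrow> complex"
  assumes "linear D" shows "D v = (\<Sum>i\<in>UNIV. of_real (v $ i) * D (axis i 1))"
proof -
  have "D v = D (\<Sum>i\<in>UNIV. (v $ i) *\<^sub>R axis i 1)"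
    using basis_expansion[of v] by (simp add: scalar_mult_eq_scaleR)
  also have "\<dots> = (\<Sum>i\<in>UNIV. D ((v $ i) *\<^sub>R axis i 1))" using assms linear_sum by fastforce
  also have "\<dots> = (\<Sum>i\<in>UNIV. (v $ i) *\<^sub>R D (axis i 1))" by (simp only: linear_scale[OF assms])
  finally show ?thesis by (simp only: scaleR_conv_of_real)
qed

lemma has_derivative_partial_deriv:
  assumes "f differentiable (at x)"
  shows "(f has_derivative (\<lambda>v. \<Sum>i\<in>UNIV. of_real (v $ i) * partial_deriv i f x)) (at x)"
proof -
  obtain D where D: "(f has_derivative D) (at x)" using assms differentiable_def by blast
  have "D = (\<lambda>v. \<Sum>i\<in>UNIV. of_real (v $ i) * partial_deriv i f x)"
    unfolding partial_deriv_eq[OF D] by (rule ext, rule linear_vec_expand[OF has_derivative_linear[OF D]])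
  then show ?thesis using D by metis
qed

lemma partial_derivs_Nil [simp]: "partial_derivs [] f = f"
  by (simp add: partial_derivs_def)

lemma partial_derivs_snoc: "partial_derivs (is @ [i]) f = partial_derivs is (partial_deriv i f)"
  by (simp add: partial_derivs_def)

lemma partial_derivs_Cons: "partial_derivs (i # is) f = partial_deriv i (partial_derivs is f)"
  by (simp add: partial_derivs_def)

lemma smooth_partial_deriv: "smooth f \<Longrightarrow> smooth (partial_deriv i f)"
  unfolding smooth_def using partial_derivs_snoc by metis

lemma smooth_partial_derivs: "smooth f \<Longrightarrow> smooth (partial_derivs is f)"
  by (induction "is" arbitrary: f rule: rev_induct) (auto simp: partial_derivs_snoc smooth_partial_deriv)

lemma smooth_differentiable: "smooth f \<Longrightarrow> f differentiable (at x)"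
  unfolding smooth_def differentiable_on_def using partial_derivs_Nil by (metis UNIV_I)

lemma smooth_continuous_on: "smooth f \<Longrightarrow> continuous_on A f"
  by (meson continuous_at_imp_continuous_on differentiable_imp_continuous_within smooth_differentiable)

lemma smooth_measurable: "smooth f \<Longrightarrow> f \<in> borel_measurable borel"
  by (intro borel_measurable_continuous_onI smooth_continuous_on)

lemma smooth_has_derivative:
  "smooth f \<Longrightarrow> (f has_derivative (\<lambda>v. \<Sum>i\<in>UNIV. of_real (v $ i) * partial_deriv i f x)) (at x)"
  by (intro has_derivative_partial_deriv smooth_differentiable)

text \<open>Inductions on the number of derivatives run through the classes with finitely many derivatives:
  unlike \<open>smooth\<close> they relate a function to its partial derivatives by recursion.\<close>

primrec Ck :: "nat \<Rightarrow> (real^'n \<Rightarrow> complex) \<Rightarrow> bool" where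
  "Ck 0 f \<longleftrightarrow> (\<forall>x. f differentiable (at x))"
| "Ck (Suc n) f \<longleftrightarrow> (\<forall>x. f differentiable (at x)) \<and> (\<forall>i. Ck n (partial_deriv i f))"

lemma Ck_iff: "Ck n f \<longleftrightarrow> (\<forall>is. length is \<le> n \<longrightarrow> partial_derivs is f differentiable_on UNIV)"
proof (induction n arbitrary: f)
  case 0 then show ?case by (auto simp: differentiable_on_def)
next
  case (Suc n)
  show ?case (is "?L \<longleftrightarrow> ?R")
  proof
    assume L: ?L
    show ?R
    proof (intro allI impI)
      fix "is" :: "'a list" assume "length is \<le> Suc n"
      then show "partial_derivs is f differentiable_on UNIV"
        using L Suc by (cases "is" rule: rev_exhaust) (auto simp: partial_derivs_snoc differentiable_on_def)
    qed
  next
    assume R: ?R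
    have "f differentiable (at x)" for x
      using R[rule_format, of "[]"] by (auto simp: differentiable_on_def)
    moreover have "Ck n (partial_deriv i f)" for i
      unfolding Suc using R by (metis length_append_singleton not_less_eq_eq partial_derivs_snoc)
    ultimately show ?L by simp
  qed
qed

lemma smooth_iff_Ck: "smooth f \<longleftrightarrow> (\<forall>n. Ck n f)"
  unfolding smooth_def Ck_iff by auto

lemma Ck_Suc_imp: "Ck (Suc n) f \<Longrightarrow> Ck n f"
  unfolding Ck_iff by auto

lemma partial_deriv_add:
  assumes "f differentiable (at x)" "g differentiable (at x)"
  shows "partial_deriv i (\<lambda>x. f x + g x) x = partial_deriv i f x + partial_deriv i g x"
  using partial_deriv_eq[OF has_derivative_add[OF has_derivative_partial_deriv[OF assms(1)] has_derivative_partial_deriv[OF assms(2)]], of i]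
   partial_deriv_eq[OF has_derivative_partial_deriv[OF assms(1)], of i]
   partial_deriv_eq[OF has_derivative_partial_deriv[OF assms(2)], of i] by simp

lemma partial_deriv_mult:
  assumes "f differentiable (at x)" "g differentiable (at x)"
  shows "partial_deriv i (\<lambda>x. f x * g x) x = f x * partial_deriv i g x + partial_deriv i f x * g x"
  using partial_deriv_eq[OF has_derivative_mult[OF has_derivative_partial_deriv[OF assms(1)] has_derivative_partial_deriv[OF assms(2)]], of i]
   partial_deriv_eq[OF has_derivative_partial_deriv[OF assms(1)], of i]
   partial_deriv_eq[OF has_derivative_partial_deriv[OF assms(2)], of i] by simp

lemma partial_deriv_cnj:
  assumes "f differentiable (at x)"
  shows "partial_deriv i (\<lambda>x. cnj (f x)) x = cnj (partial_deriv i f x)"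
  using partial_deriv_eq[OF bounded_linear.has_derivative[OF bounded_linear_cnj has_derivative_partial_deriv[OF assms(1)]], of i]
   partial_deriv_eq[OF has_derivative_partial_deriv[OF assms(1)], of i] by simp

lemma partial_deriv_const [simp]: "partial_deriv i (\<lambda>x. c) = (\<lambda>x. 0)"
  using partial_deriv_eq[OF has_derivative_const] by auto

lemma Ck_const [simp]: "Ck n (\<lambda>x. c)"
  by (induction n arbitrary: c) auto

lemma Ck_add: "Ck n f \<Longrightarrow> Ck n g \<Longrightarrow> Ck n (\<lambda>x. f x + g x)"
proof (induction n arbitrary: f g)
  case 0 then show ?case by auto
next
  case (Suc n)
  have "partial_deriv i (\<lambda>x. f x + g x) = (\<lambda>x. partial_deriv i f x + partial_deriv i g x)" for i
    using Suc.prems by (intro ext partial_deriv_add) auto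
  with Suc show ?case by auto
qed

lemma Ck_mult: "Ck n f \<Longrightarrow> Ck n g \<Longrightarrow> Ck n (\<lambda>x. f x * g x)"
proof (induction n arbitrary: f g)
  case 0 then show ?case by auto
next
  case (Suc n)
  have "partial_deriv i (\<lambda>x. f x * g x) = (\<lambda>x. f x * partial_deriv i g x + partial_deriv i f x * g x)" for i
    using Suc.prems by (intro ext partial_deriv_mult) auto
  moreover have "Ck n f" "Ck n g" using Suc.prems Ck_Suc_imp by auto
  ultimately show ?case using Suc by (auto intro!: Ck_add)
qed

lemma differentiable_cnj: "f differentiable (at x) \<Longrightarrow> (\<lambda>x. cnj (f x)) differentiable (at x)"
  unfolding differentiable_def by (blast intro: bounded_linear.has_derivative[OF bounded_linear_cnj])

lemma Ck_cnj: "Ck n f \<Longrightarrow> Ck n (\<lambda>x. cnj (f x))"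
proof (induction n arbitrary: f)
  case 0 then show ?case by (simp add: differentiable_cnj)
next
  case (Suc n)
  have "partial_deriv i (\<lambda>x. cnj (f x)) = (\<lambda>x. cnj (partial_deriv i f x))" for i
    using Suc.prems by (intro ext partial_deriv_cnj) auto
  with Suc show ?case by (simp add: differentiable_cnj)
qed

lemma smooth_const [simp]: "smooth (\<lambda>x. c)" by (simp add: smooth_iff_Ck)
lemma smooth_add: "smooth f \<Longrightarrow> smooth g \<Longrightarrow> smooth (\<lambda>x. f x + g x)" by (simp add: smooth_iff_Ck Ck_add)
lemma smooth_mult: "smooth f \<Longrightarrow> smooth g \<Longrightarrow> smooth (\<lambda>x. f x * g x)" by (simp add: smooth_iff_Ck Ck_mult)
lemma smooth_cnj: "smooth f \<Longrightarrow> smooth (\<lambda>x. cnj (f x))" by (simp add: smooth_iff_Ck Ck_cnj)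
lemma smooth_diff: "smooth f \<Longrightarrow> smooth g \<Longrightarrow> smooth (\<lambda>x. f x - g x)"
  using smooth_add[of f "\<lambda>x. -1 * g x"] smooth_mult[of "\<lambda>x. -1" g] by simp
lemma smooth_sum: "(\<And>j. j \<in> J \<Longrightarrow> smooth (f j)) \<Longrightarrow> smooth (\<lambda>x. \<Sum>j\<in>J. f j x)"
  by (induction J rule: infinite_finite_induct) (auto intro: smooth_add)

lemma partial_deriv_affine:
  fixes A :: "real^'n^'n"
  assumes "f differentiable (at (A *v x + b))"
  shows "partial_deriv i (\<lambda>x. f (A *v x + b)) x = (\<Sum>j\<in>UNIV. of_real (A $ j $ i) * partial_deriv j f (A *v x + b))"
    and "(\<lambda>x. f (A *v x + b)) differentiable (at x)"
proof -
  have l: "((\<lambda>x. A *v x + b) has_derivative (*v) A) (at x)"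
    by (auto intro!: derivative_eq_intros bounded_linear.has_derivative[OF matrix_vector_mul_bounded_linear])
  note d = diff_chain_at[OF l has_derivative_partial_deriv[OF assms], unfolded o_def]
  from d show "(\<lambda>x. f (A *v x + b)) differentiable (at x)" using differentiable_def by blast
  show "partial_deriv i (\<lambda>x. f (A *v x + b)) x = (\<Sum>j\<in>UNIV. of_real (A $ j $ i) * partial_deriv j f (A *v x + b))"
    using partial_deriv_eq[OF d] by (simp add: matrix_vector_mul_component inner_axis column_def[symmetric])
qed

lemma Ck_sum: "(\<And>j. j \<in> J \<Longrightarrow> Ck n (f j)) \<Longrightarrow> Ck n (\<lambda>x. \<Sum>j\<in>J. f j x)"
  by (induction J rule: infinite_finite_induct) (auto intro: Ck_add)

lemma Ck_affine:
  fixes A :: "real^'n^'n"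
  shows "Ck n f \<Longrightarrow> Ck n (\<lambda>x. f (A *v x + b))"
proof (induction n arbitrary: f)
  case 0 then show ?case by (simp add: partial_deriv_affine(2))
next
  case (Suc n)
  have *: "partial_deriv i (\<lambda>x. f (A *v x + b)) = (\<lambda>x. \<Sum>j\<in>UNIV. of_real (A $ j $ i) * partial_deriv j f (A *v x + b))" for i
    using Suc.prems by (intro ext partial_deriv_affine) auto
  show ?case using Suc by (auto simp: * intro!: Ck_sum Ck_mult Ck_const Suc.IH partial_deriv_affine(2))
qed

lemma smooth_affine:
  fixes A :: "real^'n^'n"
  shows "smooth f \<Longrightarrow> smooth (\<lambda>x. f (A *v x + b))" by (simp add: smooth_iff_Ck Ck_affine)

lemma smooth_shift: "smooth f \<Longrightarrow> smooth (\<lambda>x. f (x - b))"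
  using smooth_affine[of f "mat 1" "-b"] by simp

text \<open>All seminorm estimates are phrased pointwise, as \<open>jet_le n f x (B / (1 + norm x)^N)\<close> for every
  \<open>x\<close>. At a fixed point the product rule and the chain rule become short inductions with explicit constants,
  and these constants have to be explicit because they are later compared for varying group elements.\<close>

definition jet_le :: "nat \<Rightarrow> (real^'n \<Rightarrow> complex) \<Rightarrow> real^'n \<Rightarrow> real \<Rightarrow> bool" where
  "jet_le n f x B \<longleftrightarrow> (\<forall>is. length is \<le> n \<longrightarrow> norm (partial_derivs is f x) \<le> B)"

lemma jet_le_0 [simp]: "jet_le 0 f x B \<longleftrightarrow> norm (f x) \<le> B"
  by (simp add: jet_le_def)

text \<open>The recursion differentiates \<open>f\<close> first, so that the rules for one partial derivative apply under the
  induction hypothesis.\<close>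

lemma jet_le_Suc: "jet_le (Suc n) f x B \<longleftrightarrow> norm (f x) \<le> B \<and> (\<forall>i. jet_le n (partial_deriv i f) x B)"
proof
  assume L: "jet_le (Suc n) f x B"
  have "norm (f x) \<le> B" using L[unfolded jet_le_def, rule_format, of "[]"] by simp
  moreover have "jet_le n (partial_deriv i f) x B" for i
    unfolding jet_le_def using L[unfolded jet_le_def] partial_derivs_snoc
    by (metis length_append_singleton not_less_eq_eq)
  ultimately show "norm (f x) \<le> B \<and> (\<forall>i. jet_le n (partial_deriv i f) x B)" by auto
next
  assume R: "norm (f x) \<le> B \<and> (\<forall>i. jet_le n (partial_deriv i f) x B)"
  show "jet_le (Suc n) f x B" unfolding jet_le_def
  proof (intro allI impI)
    fix "is" :: "'a list" assume "length is \<le> Suc n"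
    then show "norm (partial_derivs is f x) \<le> B"
      using R by (cases "is" rule: rev_exhaust) (auto simp: partial_derivs_snoc jet_le_def)
  qed
qed

lemma jet_le_norm: "jet_le n f x B \<Longrightarrow> norm (f x) \<le> B"
  by (cases n) (auto simp: jet_le_Suc)
lemma jet_le_nonneg: "jet_le n f x B \<Longrightarrow> 0 \<le> B"
  using jet_le_norm norm_ge_zero order_trans by blast
lemma jet_le_mono: "jet_le n f x A \<Longrightarrow> m \<le> n \<Longrightarrow> A \<le> B \<Longrightarrow> jet_le m f x B"
  unfolding jet_le_def by (meson order_trans)

lemma jet_le_const: "norm c \<le> B \<Longrightarrow> jet_le n (\<lambda>x. c) x B"
proof -
  have "jet_le n (\<lambda>x. 0::complex) x B" if "B \<ge> 0" for B
    using that by (induction n) (auto simp: jet_le_Suc)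
  moreover assume "norm c \<le> B"
  ultimately show ?thesis by (cases n) (auto simp: jet_le_Suc intro: order_trans[OF norm_ge_zero])
qed

lemma jet_le_add:
  "smooth f \<Longrightarrow> smooth g \<Longrightarrow> jet_le n f x A \<Longrightarrow> jet_le n g x B \<Longrightarrow> jet_le n (\<lambda>x. f x + g x) x (A + B)"
proof (induction n arbitrary: f g)
  case 0 then show ?case by (auto intro: norm_triangle_le)
next
  case (Suc n)
  have "partial_deriv i (\<lambda>x. f x + g x) = (\<lambda>x. partial_deriv i f x + partial_deriv i g x)" for i
    using Suc.prems by (intro ext partial_deriv_add) (auto intro: smooth_differentiable)
  with Suc show ?case by (auto simp: jet_le_Suc smooth_partial_deriv intro: norm_triangle_le)
qed

text \<open>Each use of the Leibniz rule doubles the number of products, whence \<open>2^n\<close>.\<close>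

lemma jet_le_mult:
  "smooth f \<Longrightarrow> smooth g \<Longrightarrow> jet_le n f x A \<Longrightarrow> jet_le n g x B \<Longrightarrow> jet_le n (\<lambda>x. f x * g x) x (2^n * A * B)"
proof (induction n arbitrary: f g)
  case 0 then show ?case by (auto simp: norm_mult intro!: mult_mono order_trans[OF norm_ge_zero])
next
  case (Suc n)
  have *: "partial_deriv i (\<lambda>x. f x * g x) = (\<lambda>x. f x * partial_deriv i g x + partial_deriv i f x * g x)" for i
    using Suc.prems by (intro ext partial_deriv_mult) (auto intro: smooth_differentiable)
  have A: "0 \<le> A" and B: "0 \<le> B" using Suc.prems jet_le_nonneg by blast+
  have "jet_le n (partial_deriv i (\<lambda>x. f x * g x)) x (2^n * A * B + 2^n * A * B)" for i
    unfolding * using Suc.prems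
    by (intro jet_le_add Suc.IH smooth_mult smooth_partial_deriv) (auto simp: jet_le_Suc intro: jet_le_mono[of "Suc n"])
  moreover have "norm (f x * g x) \<le> 1 * (A * B)"
    using Suc.prems A B by (auto simp: jet_le_Suc norm_mult intro!: mult_mono)
  moreover have "1 * (A * B) \<le> 2^Suc n * (A * B)"
    using A B by (intro mult_right_mono one_le_power) auto
  ultimately show ?case by (simp add: jet_le_Suc algebra_simps)
qed

lemma jet_le_cmult:
  assumes "smooth f" "jet_le n f x A" shows "jet_le n (\<lambda>x. c * f x) x (norm c * A)"
  using assms
proof (induction n arbitrary: f)
  case 0 then show ?case by (auto simp: norm_mult intro!: mult_left_mono)
next
  case (Suc n)
  have *: "partial_deriv i (\<lambda>x. c * f x) = (\<lambda>x. c * partial_deriv i f x)" for i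
    using Suc.prems by (intro ext, subst partial_deriv_mult) (auto intro: smooth_differentiable)
  show ?case using Suc by (auto simp: jet_le_Suc * norm_mult smooth_partial_deriv intro!: mult_left_mono)
qed

lemma jet_le_diff:
  "smooth f \<Longrightarrow> smooth g \<Longrightarrow> jet_le n f x A \<Longrightarrow> jet_le n g x B \<Longrightarrow> jet_le n (\<lambda>x. f x - g x) x (A + B)"
  using jet_le_add[of f "\<lambda>x. -1 * g x" n x A B] jet_le_cmult[of g n x B "-1"] smooth_mult[of "\<lambda>x. -1" g] by simp

lemma jet_le_sum:
  "finite J \<Longrightarrow> (\<And>j. j \<in> J \<Longrightarrow> smooth (f j)) \<Longrightarrow> (\<And>j. j \<in> J \<Longrightarrow> jet_le n (f j) x (B j)) \<Longrightarrow>
   jet_le n (\<lambda>x. \<Sum>j\<in>J. f j x) x (\<Sum>j\<in>J. B j)"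
  by (induction J rule: finite_induct) (auto intro!: jet_le_add jet_le_const smooth_sum)

lemma jet_le_cnj:
  "smooth f \<Longrightarrow> jet_le n f x A \<Longrightarrow> jet_le n (\<lambda>x. cnj (f x)) x A"
proof (induction n arbitrary: f)
  case 0 then show ?case by auto
next
  case (Suc n)
  have *: "partial_deriv i (\<lambda>x. cnj (f x)) = (\<lambda>x. cnj (partial_deriv i f x))" for i
    using Suc.prems by (intro ext partial_deriv_cnj) (auto intro: smooth_differentiable)
  show ?case using Suc by (auto simp: jet_le_Suc * smooth_partial_deriv)
qed

text \<open>One derivative of \<open>f (A x + b)\<close> is a sum of \<open>CARD('n)\<close> partial derivatives of \<open>f\<close>, weighted by entries of
  \<open>A\<close>.\<close>

lemma jet_le_affine:
  fixes A :: "real^'n^'n"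
  assumes a: "\<And>i j. \<bar>A $ i $ j\<bar> \<le> a"
  shows "smooth f \<Longrightarrow> jet_le n f (A *v x + b) B \<Longrightarrow> jet_le n (\<lambda>x. f (A *v x + b)) x ((1 + real CARD('n) * a)^n * B)"
proof (induction n arbitrary: f)
  case 0 then show ?case by auto
next
  case (Suc n)
  let ?q = "1 + real CARD('n) * a"
  have a0: "a \<ge> 0" using a abs_ge_zero order_trans by blast
  have B: "B \<ge> 0" using Suc.prems jet_le_nonneg by blast
  have *: "partial_deriv i (\<lambda>x. f (A *v x + b)) = (\<lambda>x. \<Sum>j\<in>UNIV. of_real (A $ j $ i) * partial_deriv j f (A *v x + b))" for i
    using Suc.prems by (intro ext partial_deriv_affine smooth_differentiable)
  have "jet_le n (partial_deriv i (\<lambda>x. f (A *v x + b))) x (\<Sum>j\<in>(UNIV::'n set). \<bar>A $ j $ i\<bar> * (?q ^ n * B))" for i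
    unfolding *
  proof (rule jet_le_sum)
    fix j
    have "jet_le n (\<lambda>x. of_real (A $ j $ i) * partial_deriv j f (A *v x + b)) x (norm (complex_of_real (A $ j $ i)) * (?q ^ n * B))"
      using Suc.prems
      by (intro jet_le_cmult Suc.IH smooth_affine smooth_partial_deriv) (auto simp: jet_le_Suc)
    then show "jet_le n (\<lambda>x. of_real (A $ j $ i) * partial_deriv j f (A *v x + b)) x (\<bar>A $ j $ i\<bar> * (?q ^ n * B))" by simp
  next
    fix j show "smooth (\<lambda>x. of_real (A $ j $ i) * partial_deriv j f (A *v x + b))"
      by (rule smooth_mult[OF smooth_const smooth_affine[OF smooth_partial_deriv[OF Suc.prems(1)]]])
  qed auto
  moreover have "(\<Sum>j\<in>(UNIV::'n set). \<bar>A $ j $ i\<bar> * (?q ^ n * B)) \<le> ?q ^ Suc n * B" for i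
  proof -
    have "(\<Sum>j\<in>(UNIV::'n set). \<bar>A $ j $ i\<bar> * (?q ^ n * B)) \<le> (\<Sum>j\<in>(UNIV::'n set). a * (?q ^ n * B))"
      using a a0 B by (intro sum_mono mult_right_mono) auto
    also have "\<dots> = (real CARD('n) * a) * (?q ^ n * B)" by simp
    also have "\<dots> \<le> ?q * (?q ^ n * B)" using a0 B by (intro mult_right_mono) auto
    finally show ?thesis by (simp add: algebra_simps)
  qed
  moreover have "norm (f (A *v x + b)) \<le> ?q ^ Suc n * B"
  proof -
    have "B \<le> ?q ^ Suc n * B" using mult_right_mono[OF one_le_power[of ?q "Suc n"] B] a0 by simp
    then show ?thesis using Suc.prems by (auto simp: jet_le_Suc)
  qed
  ultimately show ?case unfolding jet_le_Suc by (meson jet_le_mono order_refl)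
qed

lemma jet_le_shift: "smooth f \<Longrightarrow> jet_le n f (x - b) B \<Longrightarrow> jet_le n (\<lambda>x. f (x - b)) x B"
proof (induction n arbitrary: f)
  case 0 then show ?case by auto
next
  case (Suc n)
  have *: "partial_deriv i (\<lambda>x. f (x - b)) = (\<lambda>x. partial_deriv i f (x - b))" for i
    by (intro ext) (simp add: partial_deriv_def algebra_simps)
  show ?case using Suc by (auto simp: jet_le_Suc * smooth_partial_deriv)
qed

lemma partial_deriv_local:
  assumes "open U" "x \<in> U" "\<And>y. y \<in> U \<Longrightarrow> f y = g y"
  shows "partial_deriv i f x = partial_deriv i g x"
proof -
  have "eventually (\<lambda>t::real. x + t *\<^sub>R axis i 1 \<in> U) (nhds 0)"
  proof -
    have "((\<lambda>t::real. x + t *\<^sub>R axis i 1) \<longlongrightarrow> x + 0 *\<^sub>R axis i 1) (nhds 0)"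
      by (intro tendsto_intros filterlim_ident)
    then show ?thesis using assms(1,2) topological_tendstoD by fastforce
  qed
  then have "eventually (\<lambda>t::real. f (x + t *\<^sub>R axis i 1) = g (x + t *\<^sub>R axis i 1)) (nhds 0)"
    by eventually_elim (use assms in auto)
  then show ?thesis unfolding partial_deriv_def
    by (intro vector_derivative_cong_eq) (auto simp: eventually_at_filter elim: eventually_mono)
qed

lemma partial_derivs_local:
  assumes "open U" "x \<in> U" "\<And>y. y \<in> U \<Longrightarrow> f y = g y"
  shows "partial_derivs is f x = partial_derivs is g x"
  using assms(2,3)
proof (induction "is" arbitrary: f g rule: rev_induct)
  case Nil then show ?case by simp
next
  case (snoc i "is")
  have "partial_deriv i f y = partial_deriv i g y" if "y \<in> U" for y
    by (rule partial_deriv_local[OF assms(1) that snoc.prems(2)])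
  then show ?case unfolding partial_derivs_snoc by (rule snoc.IH[OF snoc.prems(1)])
qed

lemma jet_le_local:
  assumes "open U" "x \<in> U" "\<And>y. y \<in> U \<Longrightarrow> f y = g y" "jet_le n g x B"
  shows "jet_le n f x B"
proof -
  have "partial_derivs is f x = partial_derivs is g x" for "is"
    by (rule partial_derivs_local[OF assms(1-3)])
  then show ?thesis using assms(4) unfolding jet_le_def by metis
qed

section \<open>Schwartz functions and characters\<close>

lemma finite_lists_le: "finite {is :: 'n::finite list. length is \<le> n}"
  using finite_lists_length_le[of "UNIV :: 'n set" n] by simp

lemma schwartz_smooth: "schwartz f \<Longrightarrow> smooth f" by (simp add: schwartz_def)

text \<open>There are only finitely many derivatives up to order \<open>n\<close>, so one constant serves them all.\<close>

lemma schwartz_jet: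
  fixes f :: "real^'n \<Rightarrow> complex"
  assumes "schwartz f"
  obtains B where "B \<ge> 0" "\<And>x. jet_le n f x (B / (1 + norm x)^N)"
proof -
  obtain b where b: "\<And>is x. (1 + norm x) ^ N * norm (partial_derivs is f x) \<le> b is"
    using assms unfolding schwartz_def by metis
  define B where "B = (\<Sum>is\<in>{is :: 'n list. length is \<le> n}. \<bar>b is\<bar>)"
  have "jet_le n f x (B / (1 + norm x)^N)" for x
    unfolding jet_le_def
  proof (intro allI impI)
    fix "is" :: "'n list" assume "length is \<le> n"
    then have "\<bar>b is\<bar> \<le> B" unfolding B_def by (intro member_le_sum) (auto simp: finite_lists_le)
    then have "(1 + norm x) ^ N * norm (partial_derivs is f x) \<le> B" using b[of x "is"] by linarith
    moreover have "(1 + norm x) ^ N > 0" by (simp add: add_pos_nonneg)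
    ultimately show "norm (partial_derivs is f x) \<le> B / (1 + norm x)^N" by (simp add: pos_le_divide_eq mult.commute)
  qed
  moreover have "B \<ge> 0" unfolding B_def by (simp add: sum_nonneg)
  ultimately show thesis using that by blast
qed

lemma schwartzI:
  fixes f :: "real^'n \<Rightarrow> complex"
  assumes "smooth f" "\<And>n N. \<exists>B. \<forall>x. jet_le n f x (B / (1 + norm x)^N)"
  shows "schwartz f"
  unfolding schwartz_def
proof (intro conjI allI assms)
  fix k and "is" :: "'n list"
  obtain B where B: "\<And>x. jet_le (length is) f x (B / (1 + norm x)^k)" using assms by metis
  have "(1 + norm x) ^ k * norm (partial_derivs is f x) \<le> B" for x
  proof -
    have "norm (partial_derivs is f x) \<le> B / (1 + norm x)^k" using B unfolding jet_le_def by blast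
    moreover have "(1 + norm x) ^ k > 0" by (simp add: add_pos_nonneg)
    ultimately show ?thesis by (simp add: pos_le_divide_eq mult.commute)
  qed
  then show "\<exists>B. \<forall>x. (1 + norm x) ^ k * norm (partial_derivs is f x) \<le> B" by blast
qed

text \<open>Continuity of \<open>u\<close> without suprema: a single pointwise estimate of the jets of \<open>f\<close> bounds \<open>u f\<close>.\<close>

lemma tempered_bound:
  fixes u :: "(real^'n \<Rightarrow> complex) \<Rightarrow> complex"
  assumes "tempered_distribution u"
  obtains C k where "C \<ge> 0"
    "\<And>f B. schwartz f \<Longrightarrow> (\<And>x. jet_le k f x (B / (1 + norm x)^k)) \<Longrightarrow> norm (u f) \<le> C * B"
proof -
  obtain C k where C: "\<And>f. schwartz f \<Longrightarrow> norm (u f) \<le> C * schwartz_seminorm k f"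
    using assms unfolding tempered_distribution_def by blast
  show thesis
  proof (rule that[of "\<bar>C\<bar>" k])
    fix f :: "real^'n \<Rightarrow> complex" and B assume f: "schwartz f" and j: "\<And>x. jet_le k f x (B / (1 + norm x)^k)"
    have le: "(1 + norm x) ^ k * norm (partial_derivs is f x) \<le> B" if "length is \<le> k" for x "is"
    proof -
      have "norm (partial_derivs is f x) \<le> B / (1 + norm x)^k" using j that unfolding jet_le_def by blast
      moreover have "(1 + norm x) ^ k > 0" by (simp add: add_pos_nonneg)
      ultimately show ?thesis by (simp add: pos_le_divide_eq mult.commute)
    qed
    have "schwartz_seminorm k f \<le> B" unfolding schwartz_seminorm_def
      by (rule cSUP_least) (auto intro!: le exI[of _ "[]"])
    moreover have "0 \<le> schwartz_seminorm k f" unfolding schwartz_seminorm_def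
    proof (rule cSUP_upper2[where x = "(0, [])"])
      show "bdd_above ((\<lambda>(x, is). (1 + norm x) ^ k * norm (partial_derivs is f x)) ` (UNIV \<times> {is. length is \<le> k}))"
        by (rule bdd_aboveI[of _ B]) (auto intro: le)
    qed auto
    ultimately have "C * schwartz_seminorm k f \<le> \<bar>C\<bar> * B"
      by (meson abs_ge_self abs_ge_zero mult_mono order_trans)
    then show "norm (u f) \<le> \<bar>C\<bar> * B" using C[OF f] by linarith
  qed auto
qed

lemma tempered_add: "tempered_distribution u \<Longrightarrow> schwartz f \<Longrightarrow> schwartz g \<Longrightarrow> u (\<lambda>x. f x + g x) = u f + u g"
  unfolding tempered_distribution_def by blast
lemma tempered_cmult: "tempered_distribution u \<Longrightarrow> schwartz f \<Longrightarrow> u (\<lambda>x. c * f x) = c * u f"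
  unfolding tempered_distribution_def by blast

lemma schwartz_add:
  assumes "schwartz f" "schwartz g" shows "schwartz (\<lambda>x. f x + g x)"
proof (rule schwartzI)
  show "smooth (\<lambda>x. f x + g x)" using assms by (intro smooth_add schwartz_smooth)
  fix n N
  obtain A where A: "\<And>x. jet_le n f x (A / (1 + norm x)^N)" using schwartz_jet[OF assms(1)] by metis
  obtain B where B: "\<And>x. jet_le n g x (B / (1 + norm x)^N)" using schwartz_jet[OF assms(2)] by metis
  have "jet_le n (\<lambda>x. f x + g x) x ((A + B) / (1 + norm x)^N)" for x
    using jet_le_add[OF schwartz_smooth schwartz_smooth A B, OF assms] by (simp add: add_divide_distrib)
  then show "\<exists>B. \<forall>x. jet_le n (\<lambda>x. f x + g x) x (B / (1 + norm x)^N)" by blast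
qed

lemma schwartz_mult_bounded:
  assumes f: "schwartz f" and g: "smooth g" and b: "\<And>n. \<exists>C m. \<forall>x. jet_le n g x (C * (1 + norm x)^m)"
  shows "schwartz (\<lambda>x. g x * f x)"
proof (rule schwartzI)
  show "smooth (\<lambda>x. g x * f x)" by (rule smooth_mult[OF g schwartz_smooth[OF f]])
  fix n N
  obtain C m where C: "\<And>x. jet_le n g x (C * (1 + norm x)^m)" using b by metis
  obtain A where A: "\<And>x. jet_le n f x (A / (1 + norm x)^(N + m))" using schwartz_jet[OF assms(1)] by metis
  have "jet_le n (\<lambda>x. g x * f x) x (2^n * C * A / (1 + norm x)^N)" for x
  proof -
    have "1 + norm x > 0" by (simp add: add_pos_nonneg)
    then have "2^n * (C * (1 + norm x)^m) * (A / (1 + norm x)^(N + m)) = 2^n * C * A / (1 + norm x)^N"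
      by (simp add: field_simps power_add)
    with jet_le_mult[OF g schwartz_smooth[OF f] C A, of x] show ?thesis by simp
  qed
  then show "\<exists>B. \<forall>x. jet_le n (\<lambda>x. g x * f x) x (B / (1 + norm x)^N)" by blast
qed

lemma schwartz_jet_bounded:
  assumes "schwartz f" shows "\<exists>C m. \<forall>x. jet_le n f x (C * (1 + norm x)^m)"
proof -
  obtain A where "\<And>x. jet_le n f x (A / (1 + norm x)^0)" using schwartz_jet[OF assms(1)] by metis
  then have "\<forall>x. jet_le n f x (A * (1 + norm x)^0)" by simp
  then show ?thesis by blast
qed

lemma schwartz_mult: "schwartz f \<Longrightarrow> schwartz g \<Longrightarrow> schwartz (\<lambda>x. g x * f x)"
  by (rule schwartz_mult_bounded[OF _ schwartz_smooth schwartz_jet_bounded])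

lemma schwartz_cmult: "schwartz f \<Longrightarrow> schwartz (\<lambda>x. c * f x)"
proof (intro schwartz_mult_bounded smooth_const)
  fix n have "\<forall>x::real^'a. jet_le n (\<lambda>x. c) x (norm c * (1 + norm x)^0)" by (simp add: jet_le_const)
  then show "\<exists>C m. \<forall>x::real^'a. jet_le n (\<lambda>x. c) x (C * (1 + norm x)^m)" by blast
qed

lemma schwartz_0: "schwartz (\<lambda>x. 0)"
  by (rule schwartzI) (auto intro!: exI[of _ 0] jet_le_const)

lemma schwartz_diff: "schwartz f \<Longrightarrow> schwartz g \<Longrightarrow> schwartz (\<lambda>x. f x - g x)"
  using schwartz_add[of f "\<lambda>x. -1 * g x"] schwartz_cmult[of g "-1"] by simp

lemma schwartz_sum: "(\<And>j. j \<in> J \<Longrightarrow> schwartz (f j)) \<Longrightarrow> schwartz (\<lambda>x. \<Sum>j\<in>J. f j x)"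
  by (induction J rule: infinite_finite_induct) (auto intro: schwartz_add schwartz_0)

lemma tempered_0: "tempered_distribution u \<Longrightarrow> u (\<lambda>x. 0) = 0"
  using tempered_cmult[of u "\<lambda>x. 0" 0] schwartz_0 by simp

lemma tempered_diff: "tempered_distribution u \<Longrightarrow> schwartz f \<Longrightarrow> schwartz g \<Longrightarrow> u (\<lambda>x. f x - g x) = u f - u g"
  using tempered_add[of u f "\<lambda>x. -1 * g x"] tempered_cmult[of u g "-1"] schwartz_cmult[of g "-1"] by simp

lemma tempered_sum: "tempered_distribution u \<Longrightarrow> (\<And>j. j \<in> J \<Longrightarrow> schwartz (f j)) \<Longrightarrow>
   u (\<lambda>x. \<Sum>j\<in>J. f j x) = (\<Sum>j\<in>J. u (f j))"
proof (induction J rule: infinite_finite_induct)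
  case (insert a J)
  have "u (\<lambda>x. f a x + (\<Sum>j\<in>J. f j x)) = u (f a) + u (\<lambda>x. \<Sum>j\<in>J. f j x)"
    using insert.prems by (intro tempered_add schwartz_sum) auto
  then show ?case using insert by simp
qed (auto simp: tempered_0)

lemma schwartz_partial_deriv:
  assumes "schwartz f" shows "schwartz (partial_deriv i f)"
proof (rule schwartzI)
  show "smooth (partial_deriv i f)" using assms by (intro smooth_partial_deriv schwartz_smooth)
  fix n N
  obtain A where A: "\<And>x. jet_le (Suc n) f x (A / (1 + norm x)^N)" using schwartz_jet[OF assms(1)] by metis
  then show "\<exists>B. \<forall>x. jet_le n (partial_deriv i f) x (B / (1 + norm x)^N)" by (auto simp: jet_le_Suc)
qed

lemma schwartz_partial_derivs: "schwartz f \<Longrightarrow> schwartz (partial_derivs is f)"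
  by (induction "is" arbitrary: f rule: rev_induct) (auto simp: partial_derivs_snoc schwartz_partial_deriv)

lemma schwartz_cnj:
  assumes "schwartz f" shows "schwartz (\<lambda>x. cnj (f x))"
proof (rule schwartzI)
  show "smooth (\<lambda>x. cnj (f x))" using assms by (intro smooth_cnj schwartz_smooth)
  fix n N
  obtain A where A: "\<And>x. jet_le n f x (A / (1 + norm x)^N)" using schwartz_jet[OF assms(1)] by metis
  then show "\<exists>B. \<forall>x. jet_le n (\<lambda>x. cnj (f x)) x (B / (1 + norm x)^N)"
    using jet_le_cnj[OF schwartz_smooth[OF assms]] by blast
qed

lemma abs_entry_le_op_norm: "\<bar>A $ i $ j\<bar> \<le> op_norm A"
proof -
  have "\<bar>A $ i $ j\<bar> = \<bar>(A *v axis j 1) $ i\<bar>" by (simp add: matrix_vector_mult_basis column_def)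
  also have "\<dots> \<le> norm (A *v axis j 1)" by (rule component_le_norm_cart)
  also have "\<dots> \<le> op_norm A * norm (axis j (1::real))" unfolding op_norm_def
    by (rule onorm) (simp add: matrix_vector_mul_bounded_linear)
  finally show ?thesis by simp
qed

lemma op_norm: "norm (A *v x) \<le> op_norm A * norm x"
  unfolding op_norm_def by (rule onorm) (simp add: matrix_vector_mul_bounded_linear)

lemma op_norm_nonneg: "0 \<le> op_norm A"
  unfolding op_norm_def by (rule onorm_pos_le) (simp add: matrix_vector_mul_bounded_linear)

lemma one_add_norm_affine_inverse:
  fixes A A' :: "real^'n^'n"
  assumes "A' ** A = mat 1"
  shows "1 + norm x \<le> (1 + op_norm A') * (1 + norm b) * (1 + norm (A *v x + b))"
proof -
  have "x = A' *v (A *v x + b) - A' *v b"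
    by (simp add: matrix_vector_right_distrib matrix_vector_mul_assoc assms)
  then have "norm x \<le> norm (A' *v (A *v x + b)) + norm (A' *v b)" using norm_triangle_ineq4 by metis
  also have "\<dots> \<le> op_norm A' * norm (A *v x + b) + op_norm A' * norm b" by (intro add_mono op_norm)
  finally have "norm x \<le> op_norm A' * norm (A *v x + b) + op_norm A' * norm b" .
  moreover have "(1 + op_norm A') * (1 + norm b) * (1 + norm (A *v x + b)) =
     1 + op_norm A' * norm (A *v x + b) + op_norm A' * norm b + (op_norm A' + norm b + norm (A *v x + b)
      + norm b * norm (A *v x + b) + op_norm A' * norm b * norm (A *v x + b))" by (simp add: algebra_simps)
  moreover have "op_norm A' + norm b + norm (A *v x + b)
      + norm b * norm (A *v x + b) + op_norm A' * norm b * norm (A *v x + b) \<ge> 0"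
    by (intro add_nonneg_nonneg mult_nonneg_nonneg op_norm_nonneg norm_ge_zero)
  ultimately show ?thesis by linarith
qed

text \<open>The dependence on \<open>A\<close>, its inverse and \<open>b\<close> is kept explicit; this is what later bounds the functions
  \<open>\<pi>(y,h)\<psi>\<close> simultaneously for all \<open>y\<close> and \<open>h\<close>.\<close>

lemma jet_le_affine_decay:
  fixes A A' :: "real^'n^'n"
  assumes inv: "A' ** A = mat 1" and f: "smooth f" and B: "\<And>x. jet_le n f x (B / (1 + norm x)^N)"
  shows "jet_le n (\<lambda>x. f (A *v x + b)) x
     ((1 + real CARD('n) * op_norm A)^n * B * ((1 + op_norm A') * (1 + norm b))^N / (1 + norm x)^N)"
proof -
  have B0: "B \<ge> 0" using jet_le_nonneg[OF B, of 0] by simp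
  have p: "1 + norm x > 0" for x :: "real^'n" by (simp add: add_pos_nonneg)
  have "B / (1 + norm (A *v x + b))^N \<le> B * ((1 + op_norm A') * (1 + norm b))^N / (1 + norm x)^N"
  proof -
    have "(1 + norm x)^N \<le> ((1 + op_norm A') * (1 + norm b))^N * (1 + norm (A *v x + b))^N"
      using power_mono[OF one_add_norm_affine_inverse[OF inv, of x b], of N]
      by (simp add: power_mult_distrib add_nonneg_nonneg)
    then have "B * (1 + norm x)^N \<le> B * (((1 + op_norm A') * (1 + norm b))^N * (1 + norm (A *v x + b))^N)"
      by (rule mult_left_mono[OF _ B0])
    then show ?thesis using p[of x] p[of "A *v x + b"] by (simp add: field_simps)
  qed
  then have "jet_le n f (A *v x + b) (B * ((1 + op_norm A') * (1 + norm b))^N / (1 + norm x)^N)"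
    using B jet_le_mono by blast
  from jet_le_affine[OF abs_entry_le_op_norm f this] show ?thesis by (simp add: mult.assoc)
qed

lemma schwartz_affine:
  fixes A A' :: "real^'n^'n"
  assumes "A' ** A = mat 1" "schwartz f"
  shows "schwartz (\<lambda>x. f (A *v x + b))"
proof (rule schwartzI)
  show "smooth (\<lambda>x. f (A *v x + b))" using assms by (intro smooth_affine schwartz_smooth)
  fix n N
  obtain B where B: "\<And>x. jet_le n f x (B / (1 + norm x)^N)" using schwartz_jet[OF assms(2)] by metis
  show "\<exists>B. \<forall>x. jet_le n (\<lambda>x. f (A *v x + b)) x (B / (1 + norm x)^N)"
    using jet_le_affine_decay[OF assms(1) schwartz_smooth[OF assms(2)] B] by blast
qed

lemma schwartz_shift: "schwartz f \<Longrightarrow> schwartz (\<lambda>x. f (x - b))"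
  using schwartz_affine[of "mat 1" "mat 1" f "-b"] by simp

lemma matrix_vector_mult_minus_left: "(- A) *v (x::real^'n) = - (A *v x)"
  by (simp add: vec_eq_iff matrix_vector_mult_def sum_negf)

lemma schwartz_reflect:
  fixes f :: "real^'n \<Rightarrow> complex" shows "schwartz f \<Longrightarrow> schwartz (\<lambda>x. f (c - x))"
proof -
  have n: "(- mat 1 :: real^'n^'n) *v x = - x" for x
    by (metis matrix_vector_mul_lid matrix_vector_mult_minus_left)
  moreover have "(- (mat 1)) ** (- (mat 1)) = (mat 1 :: real^'n^'n)"
    by (simp add: matrix_eq matrix_vector_mul_assoc[symmetric] n)
  moreover assume "schwartz f"
  ultimately show ?thesis using schwartz_affine[of "- mat 1" "- mat 1" f c] by simp
qed

definition character :: "real^'n \<Rightarrow> real^'n \<Rightarrow> complex" where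
  "character \<eta> x = cis (- 2 * pi * (x \<bullet> \<eta>))"

lemma norm_character [simp]: "norm (character \<eta> x) = 1" by (simp add: character_def)

lemma has_derivative_character:
  "(character \<eta> has_derivative (\<lambda>v. (-2 * pi * \<i> * of_real (v \<bullet> \<eta>)) * character \<eta> x)) (at x)"
proof -
  have "bounded_linear (\<lambda>x. \<i> * complex_of_real (- 2 * pi * (x \<bullet> \<eta>)))"
    by (intro bounded_linear_compose[OF bounded_linear_mult_right] bounded_linear_compose[OF bounded_linear_of_real]
        bounded_linear_inner_left)
  then have "((\<lambda>x. \<i> * complex_of_real (- 2 * pi * (x \<bullet> \<eta>))) has_derivative (\<lambda>x. \<i> * complex_of_real (- 2 * pi * (x \<bullet> \<eta>)))) (at x)"
    by (rule bounded_linear_imp_has_derivative)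
  from diff_chain_at[OF this DERIV_exp[unfolded has_field_derivative_def]] show ?thesis
    unfolding character_def cis_conv_exp by (simp add: o_def mult_ac)
qed

lemma partial_deriv_character:
  "partial_deriv i (character \<eta>) = (\<lambda>x. (-2 * pi * \<i> * of_real (\<eta> $ i)) * character \<eta> x)"
  by (rule ext, subst partial_deriv_eq[OF has_derivative_character]) (simp add: inner_axis' inner_axis)

lemma smooth_character: "smooth (character \<eta>)"
proof -
  have "Ck n (character \<eta>)" for n
  proof (induction n)
    case 0 then show ?case using has_derivative_character differentiable_def by fastforce
  next
    case (Suc n)
    have "\<forall>x. character \<eta> differentiable (at x)" using has_derivative_character[of \<eta>] differentiable_def by blast
    then show ?case unfolding Ck.simps partial_deriv_character by (intro conjI allI Ck_mult Ck_const Suc) auto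
  qed
  then show ?thesis by (simp add: smooth_iff_Ck)
qed

lemma jet_le_character: "jet_le n (character \<eta>) x ((1 + 2 * pi * norm \<eta>)^n)"
proof (induction n)
  case 0 then show ?case by simp
next
  case (Suc n)
  have "jet_le n (partial_deriv i (character \<eta>)) x ((1 + 2 * pi * norm \<eta>)^Suc n)" for i
  proof -
    have "jet_le n (partial_deriv i (character \<eta>)) x (norm (-2 * pi * \<i> * of_real (\<eta> $ i)) * (1 + 2 * pi * norm \<eta>)^n)"
      unfolding partial_deriv_character by (rule jet_le_cmult[OF smooth_character Suc])
    moreover
    have "norm (-2 * pi * \<i> * complex_of_real (\<eta> $ i)) \<le> 1 + 2 * pi * norm \<eta>"
    proof -
      have "2 * pi * \<bar>\<eta> $ i\<bar> \<le> 2 * pi * norm \<eta>" by (intro mult_left_mono component_le_norm_cart) auto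
      moreover have "norm (-2 * pi * \<i> * complex_of_real (\<eta> $ i)) = 2 * pi * \<bar>\<eta> $ i\<bar>" by (simp add: norm_mult)
      ultimately show ?thesis by linarith
    qed
    from mult_right_mono[OF this, of "(1 + 2 * pi * norm \<eta>)^n"]
    have "norm (-2 * pi * \<i> * complex_of_real (\<eta> $ i)) * (1 + 2 * pi * norm \<eta>)^n \<le> (1 + 2 * pi * norm \<eta>)^Suc n" by simp
    ultimately show ?thesis using jet_le_mono[OF _ order_refl] by blast
  qed
  moreover have "1 \<le> (1 + 2 * pi * norm \<eta>)^Suc n" by (intro one_le_power) simp
  ultimately show ?case by (simp add: jet_le_Suc)
qed

lemma norm_cis_diff_1: "norm (cis t - 1) \<le> \<bar>t\<bar>"
proof -
  have "norm (cis t - 1) = 2 * \<bar>sin (t/2)\<bar>"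
    using dist_exp_i_1[of t] by (simp add: cis_conv_exp mult.commute)
  also have "\<dots> \<le> 2 * \<bar>t/2\<bar>" by (intro mult_left_mono abs_sin_x_le_abs_x) auto
  finally show ?thesis by simp
qed

text \<open>Characters depend on the frequency in a Lipschitz way, at the price of a factor \<open>1 + norm x\<close> that a
  Schwartz function absorbs.\<close>

lemma jet_le_character_diff_1:
  assumes "norm \<zeta> \<le> 1"
  shows "jet_le n (\<lambda>x. character \<zeta> x - 1) x (2 * pi * (1 + 2 * pi)^n * norm \<zeta> * (1 + norm x))"
proof -
  have a: "norm (character \<zeta> x - 1) \<le> 2 * pi * norm \<zeta> * (1 + norm x)"
  proof -
    have "norm (character \<zeta> x - 1) \<le> \<bar>- 2 * pi * (x \<bullet> \<zeta>)\<bar>" unfolding character_def by (rule norm_cis_diff_1)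
    also have "\<dots> = 2 * pi * \<bar>x \<bullet> \<zeta>\<bar>" by (simp add: abs_mult)
    also have "\<dots> \<le> 2 * pi * (norm x * norm \<zeta>)" by (intro mult_left_mono Cauchy_Schwarz_ineq2) auto
    also have "\<dots> \<le> 2 * pi * ((1 + norm x) * norm \<zeta>)" by (intro mult_left_mono mult_right_mono) auto
    finally show ?thesis by (simp add: mult_ac)
  qed
  have p: "1 \<le> (1 + 2 * pi)^m" for m by (intro one_le_power) simp
  have q: "0 \<le> 2 * pi * norm \<zeta> * (1 + norm x)" by simp
  show ?thesis
  proof (cases n)
    case 0 then show ?thesis using a by simp
  next
    case (Suc m)
    have "jet_le m (partial_deriv i (\<lambda>x. character \<zeta> x - 1)) x (2 * pi * (1 + 2 * pi)^n * norm \<zeta> * (1 + norm x))" for i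
    proof -
      have e: "partial_deriv i (\<lambda>x. character \<zeta> x - 1) = partial_deriv i (character \<zeta>)"
        using partial_deriv_add[where f="character \<zeta>" and g="\<lambda>x. -1" and i=i, OF smooth_differentiable[OF smooth_character] smooth_differentiable[OF smooth_const]]
        by (auto intro!: ext)
      have "jet_le m (partial_deriv i (character \<zeta>)) x (norm (-2 * pi * \<i> * of_real (\<zeta> $ i)) * (1 + 2 * pi * norm \<zeta>)^m)"
        unfolding partial_deriv_character by (rule jet_le_cmult[OF smooth_character jet_le_character])
      moreover have "norm (-2 * pi * \<i> * complex_of_real (\<zeta> $ i)) * (1 + 2 * pi * norm \<zeta>)^m \<le> (2 * pi * norm \<zeta>) * (1 + 2 * pi)^m"
        using component_le_norm_cart[of \<zeta> i] assms
        by (intro mult_mono power_mono) (auto simp: norm_mult)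
      moreover have "\<dots> \<le> (2 * pi * norm \<zeta>) * ((1 + 2 * pi)^n * (1 + norm x))"
      proof (intro mult_left_mono)
        have "(1 + 2 * pi)^m * 1 \<le> (1 + 2 * pi)^n * (1 + norm x)"
          using Suc by (intro mult_mono power_increasing) auto
        then show "(1 + 2 * pi)^m \<le> (1 + 2 * pi)^n * (1 + norm x)" by simp
      qed simp
      ultimately have "jet_le m (partial_deriv i (character \<zeta>)) x ((2 * pi * norm \<zeta>) * ((1 + 2 * pi)^n * (1 + norm x)))"
        using jet_le_mono[OF _ order_refl] order_trans by blast
      then show ?thesis unfolding e by (simp only: mult_ac)
    qed
    moreover have "norm (character \<zeta> x - 1) \<le> 2 * pi * (1 + 2 * pi)^n * norm \<zeta> * (1 + norm x)"
    proof -
      have "2 * pi * (1 + 2 * pi)^n * norm \<zeta> * (1 + norm x) = (1 + 2 * pi)^n * (2 * pi * norm \<zeta> * (1 + norm x))"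
        by (simp only: mult_ac)
      then show ?thesis using a mult_right_mono[OF p[of n] q] by linarith
    qed
    ultimately show ?thesis using Suc by (simp add: jet_le_Suc)
  qed
qed

lemma schwartz_character_mult: "schwartz f \<Longrightarrow> schwartz (\<lambda>x. character \<eta> x * f x)"
proof (intro schwartz_mult_bounded smooth_character)
  fix n have "\<forall>x. jet_le n (character \<eta>) x ((1 + 2 * pi * norm \<eta>)^n * (1 + norm x)^0)" by (simp add: jet_le_character)
  then show "\<exists>C m. \<forall>x. jet_le n (character \<eta>) x (C * (1 + norm x)^m)" by blast
qed

lemma partial_derivs_add:
  "smooth f \<Longrightarrow> smooth g \<Longrightarrow> partial_derivs is (\<lambda>x. f x + g x) x = partial_derivs is f x + partial_derivs is g x"
proof (induction "is" arbitrary: f g rule: rev_induct)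
  case (snoc i "is")
  have "partial_deriv i (\<lambda>x. f x + g x) = (\<lambda>x. partial_deriv i f x + partial_deriv i g x)"
    using snoc.prems by (intro ext partial_deriv_add) (auto intro: smooth_differentiable)
  then show ?case using snoc by (simp add: partial_derivs_snoc smooth_partial_deriv)
qed simp

lemma partial_derivs_cmult:
  "smooth f \<Longrightarrow> partial_derivs is (\<lambda>x. c * f x) x = c * partial_derivs is f x"
proof (induction "is" arbitrary: f rule: rev_induct)
  case (snoc i "is")
  have "partial_deriv i (\<lambda>x. c * f x) = (\<lambda>x. c * partial_deriv i f x)"
    using snoc.prems by (intro ext, subst partial_deriv_mult) (auto intro: smooth_differentiable)
  then show ?case using snoc by (simp add: partial_derivs_snoc smooth_partial_deriv)
qed simp

lemma partial_derivs_diff: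
  "smooth f \<Longrightarrow> smooth g \<Longrightarrow> partial_derivs is (\<lambda>x. f x - g x) x = partial_derivs is f x - partial_derivs is g x"
  using partial_derivs_add[of f "\<lambda>x. -1 * g x" "is" x] partial_derivs_cmult[of g "is" "-1" x] smooth_mult[of "\<lambda>x. -1" g] by simp

lemma partial_derivs_zero: "partial_derivs is (\<lambda>x. 0) = (\<lambda>x. 0)"
  by (induction "is" rule: rev_induct) (auto simp: partial_derivs_snoc)

lemma partial_derivs_sum:
  "(\<And>j. j \<in> J \<Longrightarrow> smooth (f j)) \<Longrightarrow> partial_derivs is (\<lambda>x. \<Sum>j\<in>J. f j x) x = (\<Sum>j\<in>J. partial_derivs is (f j) x)"
  by (induction J rule: infinite_finite_induct) (auto simp: partial_derivs_zero partial_derivs_add smooth_sum)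

lemma partial_derivs_shift: "partial_derivs is (\<lambda>x. f (x - b)) x = partial_derivs is f (x - b)"
proof (induction "is" arbitrary: f rule: rev_induct)
  case (snoc i "is")
  have "partial_deriv i (\<lambda>x. f (x - b)) = (\<lambda>x. partial_deriv i f (x - b))"
    by (intro ext) (simp add: partial_deriv_def algebra_simps)
  then show ?case using snoc by (simp add: partial_derivs_snoc)
qed simp

lemma smooth_convex_Lipschitz:
  fixes f :: "real^'n \<Rightarrow> complex"
  assumes "smooth f" and b: "\<And>i w. w \<in> S \<Longrightarrow> norm (partial_deriv i f w) \<le> B" and S: "convex S" "x \<in> S" "y \<in> S"
  shows "norm (f x - f y) \<le> real CARD('n) * B * norm (x - y)"
proof (rule differentiable_bound[OF S(1) _ _ S(2,3)])
  fix w assume w: "w \<in> S"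
  show "(f has_derivative (\<lambda>v. \<Sum>i\<in>UNIV. of_real (v $ i) * partial_deriv i f w)) (at w within S)"
    using smooth_has_derivative[OF assms(1)] has_derivative_at_withinI by blast
  show "onorm (\<lambda>v. \<Sum>i\<in>UNIV. of_real (v $ i) * partial_deriv i f w) \<le> real CARD('n) * B"
  proof (rule onorm_le)
    fix v :: "real^'n"
    have "norm (\<Sum>i\<in>UNIV. of_real (v $ i) * partial_deriv i f w) \<le> (\<Sum>i\<in>(UNIV::'n set). norm v * B)"
      by (intro order_trans[OF norm_sum] sum_mono)
         (auto simp: norm_mult intro!: mult_mono b w component_le_norm_cart)
    then show "norm (\<Sum>i\<in>UNIV. of_real (v $ i) * partial_deriv i f w) \<le> real CARD('n) * B * norm v"
      by (simp add: mult_ac)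
  qed
qed

text \<open>On the unit ball around \<open>y\<close> the weight \<open>1 + norm w\<close> is at least half of \<open>1 + norm y\<close>, so the mean value
  estimate inherits the decay of the gradient.\<close>

lemma schwartz_Lipschitz:
  fixes f :: "real^'n \<Rightarrow> complex"
  assumes "schwartz f"
  obtains C where "C \<ge> 0" "\<And>x y. norm (x - y) \<le> 1 \<Longrightarrow> norm (f x - f y) \<le> C * norm (x - y) / (1 + norm y)^N"
proof -
  obtain B where B: "B \<ge> 0" "\<And>x. jet_le (Suc 0) f x (B / (1 + norm x)^N)" using schwartz_jet[OF assms] by metis
  have "norm (f x - f y) \<le> (real CARD('n) * B * 2^N) * norm (x - y) / (1 + norm y)^N" if "norm (x - y) \<le> 1" for x y
  proof -
    have "norm (f x - f y) \<le> real CARD('n) * (B * 2^N / (1 + norm y)^N) * norm (x - y)"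
    proof (rule smooth_convex_Lipschitz[OF schwartz_smooth[OF assms], where S = "cball y 1"])
      fix i w assume w: "w \<in> cball y 1"
      have "norm (partial_deriv i f w) \<le> B / (1 + norm w)^N" using B(2)[of w] by (simp add: jet_le_Suc)
      also have "\<dots> \<le> B * 2^N / (1 + norm y)^N"
      proof -
        have "norm y \<le> norm w + 1" using w norm_triangle_sub[of y w] by (simp add: dist_norm)
        then have "1 + norm y \<le> 2 * (1 + norm w)" using norm_ge_zero[of w] by (simp del: norm_ge_zero)
        then have "(1 + norm y)^N \<le> (2 * (1 + norm w))^N" by (intro power_mono) auto
        then have "(1 + norm y)^N \<le> 2^N * (1 + norm w)^N" by (simp only: power_mult_distrib)
        from mult_left_mono[OF this B(1)] show ?thesis
          using add_pos_nonneg[OF zero_less_one norm_ge_zero, of w] add_pos_nonneg[OF zero_less_one norm_ge_zero, of y]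
          by (simp add: field_simps)
      qed
      finally show "norm (partial_deriv i f w) \<le> B * 2^N / (1 + norm y)^N" .
    qed (use that in \<open>auto simp: dist_norm norm_minus_commute\<close>)
    then show ?thesis by (simp add: mult_ac)
  qed
  then show thesis using that[of "real CARD('n) * B * 2^N"] B(1) by auto
qed

lemma schwartz_shift_Lipschitz:
  fixes f :: "real^'n \<Rightarrow> complex"
  assumes "schwartz f"
  obtains C where "C \<ge> 0" "\<And>x y y'. norm (y - y') \<le> 1 \<Longrightarrow>
     jet_le n (\<lambda>x. f (x - y') - f (x - y)) x (C * norm (y - y') / (1 + norm (x - y))^N)"
proof -
  have "\<exists>C\<ge>0. \<forall>x y. norm (x - y) \<le> 1 \<longrightarrow> norm (partial_derivs is f x - partial_derivs is f y) \<le> C * norm (x - y) / (1 + norm y)^N" for "is"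
    using schwartz_Lipschitz[OF schwartz_partial_derivs[OF assms, of "is"], where N = N] by metis
  then obtain c where c0: "\<And>is. c is \<ge> 0" and
    c: "\<And>is x y. norm (x - y) \<le> 1 \<Longrightarrow> norm (partial_derivs is f x - partial_derivs is f y) \<le> c is * norm (x - y) / (1 + norm y)^N"
    by metis
  define C where "C = (\<Sum>is\<in>{is :: 'n list. length is \<le> n}. c is)"
  have sm: "smooth f" using assms schwartz_smooth by blast
  have "jet_le n (\<lambda>x. f (x - y') - f (x - y)) x (C * norm (y - y') / (1 + norm (x - y))^N)" if "norm (y - y') \<le> 1" for x y y'
    unfolding jet_le_def
  proof (intro allI impI)
    fix "is" :: "'n list" assume "length is \<le> n"
    then have cC: "c is \<le> C" unfolding C_def by (intro member_le_sum) (auto simp: finite_lists_le c0)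
    have "norm (partial_derivs is (\<lambda>x. f (x - y') - f (x - y)) x) = norm (partial_derivs is f (x - y') - partial_derivs is f (x - y))"
      using partial_derivs_diff[OF smooth_shift[OF sm] smooth_shift[OF sm]] by (simp add: partial_derivs_shift)
    also have "\<dots> \<le> c is * norm (y - y') / (1 + norm (x - y))^N" using c[of "x - y'" "x - y" "is"] that by simp
    also have "\<dots> \<le> C * norm (y - y') / (1 + norm (x - y))^N"
      by (intro divide_right_mono mult_right_mono cC) (auto simp: add_nonneg_nonneg)
    finally show "norm (partial_derivs is (\<lambda>x. f (x - y') - f (x - y)) x) \<le> C * norm (y - y') / (1 + norm (x - y))^N" .
  qed
  moreover have "C \<ge> 0" unfolding C_def by (intro sum_nonneg c0)
  ultimately show thesis using that by blast
qed

lemma partial_derivs_outside_supp: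
  assumes "x \<notin> supp f" shows "partial_derivs is f x = 0"
proof -
  have "partial_derivs is f x = partial_derivs is (\<lambda>x. 0) x"
    by (rule partial_derivs_local[of "- supp f"]) (use assms closure_subset[of "{x. f x \<noteq> 0}"] in \<open>auto simp: supp_def\<close>)
  then show ?thesis by (simp add: partial_derivs_zero)
qed

lemma test_function_schwartz:
  assumes "test_function f" shows "schwartz f"
  unfolding schwartz_def
proof (intro conjI allI)
  show sm: "smooth f" using assms by (simp add: test_function_def)
  fix k "is"
  let ?g = "\<lambda>x. (1 + norm x) ^ k * norm (partial_derivs is f x)"
  have "continuous_on (supp f) ?g"
    by (intro continuous_intros smooth_continuous_on smooth_partial_derivs sm)
  moreover have "compact (supp f)" using assms by (simp add: test_function_def)
  ultimately have "bounded (?g ` supp f)" using compact_continuous_image compact_imp_bounded by blast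
  then obtain B where B: "\<And>x. x \<in> supp f \<Longrightarrow> \<bar>?g x\<bar> \<le> B" unfolding bounded_iff by force
  have "?g x \<le> max B 0" for x
    by (cases "x \<in> supp f") (use B[of x] in \<open>auto simp: partial_derivs_outside_supp le_max_iff_disj\<close>)
  then show "\<exists>B. \<forall>x. ?g x \<le> B" by blast
qed

text \<open>Since \<open>(1 + norm x)\<^sup>2\<close> dominates \<open>1 + t\<^sup>2\<close> for every coordinate \<open>t\<close> of \<open>x\<close>, the weight lies below a product of
  one-dimensional integrable functions.\<close>

lemma integrable_weight:
  "integrable lborel (\<lambda>x::real^'n. 1 / (1 + norm x)^(2 * CARD('n)))"
proof (rule integrableI_bounded)
  let ?h = "\<lambda>t::real. inverse (1 + t\<^sup>2)"
  have fin1: "(\<integral>\<^sup>+t. ennreal (?h t) \<partial>lborel) < \<infinity>"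
    using integrable_inverse_1_plus_square unfolding set_integrable_def integrable_iff_bounded by simp
  have "(\<integral>\<^sup>+(x::real^'n). ennreal (norm (1 / (1 + norm x)^(2 * CARD('n)))) \<partial>lborel) \<le>
     (\<integral>\<^sup>+(x::real^'n). (\<Prod>b\<in>Basis. ennreal (?h (x \<bullet> b))) \<partial>lborel)"
  proof (rule nn_integral_mono)
    fix x :: "real^'n"
    have "1 / (1 + norm x)^(2 * CARD('n)) = (\<Prod>b\<in>(Basis::(real^'n) set). 1 / (1 + norm x)^2)"
      by (simp add: power_mult power_divide)
    also have "\<dots> \<le> (\<Prod>b\<in>(Basis::(real^'n) set). ?h (x \<bullet> b))"
    proof (intro prod_mono conjI)
      fix b :: "real^'n" assume b: "b \<in> Basis"
      have "(x \<bullet> b)\<^sup>2 \<le> (norm x)\<^sup>2" using Basis_le_norm[OF b, of x] by (simp add: abs_le_square_iff[symmetric])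
      moreover have "(1 + norm x)\<^sup>2 = 1 + 2 * norm x + (norm x)\<^sup>2" by (simp add: power2_eq_square algebra_simps)
      moreover have "0 \<le> 2 * norm x" by simp
      ultimately have "1 + (x \<bullet> b)\<^sup>2 \<le> (1 + norm x)\<^sup>2" by linarith
      moreover have "0 < 1 + (x \<bullet> b)\<^sup>2" by (simp add: add_pos_nonneg)
      ultimately show "1 / (1 + norm x)\<^sup>2 \<le> ?h (x \<bullet> b)" by (simp add: inverse_eq_divide frac_le)
    qed simp
    finally show "ennreal (norm (1 / (1 + norm x)^(2 * CARD('n)))) \<le> (\<Prod>b\<in>Basis. ennreal (?h (x \<bullet> b)))"
      by (subst prod_ennreal) (auto intro!: ennreal_leI simp: add_nonneg_nonneg)
  qed
  also have "\<dots> = (\<Prod>b\<in>(Basis::(real^'n) set). (\<integral>\<^sup>+t. ennreal (?h t) \<partial>lborel))"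
    by (rule nn_integral_lborel_prod) auto
  also have "\<dots> < \<infinity>" using fin1 by (simp add: power_eq_top_ennreal ennreal_prod_eq_top less_top[symmetric])
  finally show "(\<integral>\<^sup>+(x::real^'n). ennreal (norm (1 / (1 + norm x)^(2 * CARD('n)))) \<partial>lborel) < \<infinity>" .
qed simp

lemma integrable_decay:
  fixes f :: "real^'n \<Rightarrow> complex"
  assumes "f \<in> borel_measurable borel" "\<And>x. norm (f x) \<le> B / (1 + norm x)^(2 * CARD('n))"
  shows "integrable lborel f"
proof (rule Bochner_Integration.integrable_bound)
  show "integrable lborel (\<lambda>x::real^'n. B * (1 / (1 + norm x)^(2 * CARD('n))))"
    by (intro integrable_mult_right integrable_weight)
  have "norm (f x) \<le> norm (B * (1 / (1 + norm x)^(2 * CARD('n))))" for x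
    using order_trans[OF assms(2)[of x] abs_ge_self] by simp
  then show "AE x in lborel. norm (f x) \<le> norm (B * (1 / (1 + norm x)^(2 * CARD('n))))" by simp
qed (use assms in simp)

lemma schwartz_integrable:
  fixes f :: "real^'n \<Rightarrow> complex"
  assumes "schwartz f" shows "integrable lborel f"
proof -
  obtain B where "\<And>x. jet_le 0 f x (B / (1 + norm x)^(2 * CARD('n)))" using schwartz_jet[OF assms] by blast
  then show ?thesis by (intro integrable_decay smooth_measurable schwartz_smooth assms) auto
qed

section \<open>Change of variables and differentiation under the integral\<close>

lemma matrix_vector_measurable [measurable]: "(*v) (A::real^'n^'n) \<in> borel_measurable borel"
  by (intro borel_measurable_continuous_onI matrix_vector_mult_linear_continuous_on)

text \<open>Both measures agree on boxes, by the volume formula for the image of a box under the inverse of \<open>A\<close>.\<close>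

lemma lborel_linear_image:
  fixes A :: "real^('n::{finite,wellorder})^('n::_)"
  assumes "invertible A"
  shows "lborel = density (distr lborel borel ((*v) A)) (\<lambda>_. ennreal \<bar>det A\<bar>)" (is "_ = ?M")
proof (rule lborel_eqI)
  obtain A' where A': "A ** A' = mat 1" "A' ** A = mat 1" using assms invertible_def by blast
  have det: "det A * det A' = 1" using A'(1) by (metis det_I det_mul)
  fix l u :: "real^('n::_)" assume le: "\<And>b. b \<in> Basis \<Longrightarrow> l \<bullet> b \<le> u \<bullet> b"
  have pre: "(*v) A -` box l u = (*v) A' ` box l u"
  proof (intro set_eqI iffI)
    fix x assume "x \<in> (*v) A -` box l u"
    then have "x = A' *v (A *v x)" "A *v x \<in> box l u" by (auto simp: matrix_vector_mul_assoc A')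
    then show "x \<in> (*v) A' ` box l u" by blast
  qed (auto simp: matrix_vector_mul_assoc A')
  have meas: "(*v) A -` box l u \<in> sets borel" using measurable_sets_borel[of "(*v) A" borel "box l u"] by simp
  have lm: "(*v) A' ` box l u \<in> lmeasurable"
    by (rule measurable_linear_image) auto
  have "emeasure lborel ((*v) A -` box l u) = emeasure lebesgue ((*v) A' ` box l u)"
    using meas by (simp add: pre)
  also have "\<dots> = ennreal (measure lebesgue ((*v) A' ` box l u))"
    using lm by (simp add: emeasure_eq_measure2 fmeasurableD2)
  also have "measure lebesgue ((*v) A' ` box l u) = \<bar>det A'\<bar> * measure lebesgue (box l u)"
    by (subst measure_linear_image) auto
  also have "measure lebesgue (box l u) = (\<Prod>b\<in>Basis. (u - l) \<bullet> b)"
    using le by (simp add: inner_diff_left measure_lborel_box_eq)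
  finally have e: "emeasure lborel ((*v) A -` box l u) = ennreal (\<bar>det A'\<bar> * (\<Prod>b\<in>Basis. (u - l) \<bullet> b))" .
  have "emeasure ?M (box l u) = ennreal \<bar>det A\<bar> * emeasure lborel ((*v) A -` box l u)"
    by (simp add: emeasure_density emeasure_distr nn_integral_cmult)
  also have "\<dots> = ennreal (\<bar>det A\<bar> * (\<bar>det A'\<bar> * (\<Prod>b\<in>Basis. (u - l) \<bullet> b)))"
    unfolding e by (simp add: ennreal_mult' del: prod_constant)
  also have "\<bar>det A\<bar> * (\<bar>det A'\<bar> * (\<Prod>b\<in>Basis. (u - l) \<bullet> b)) = (\<Prod>b\<in>Basis. (u - l) \<bullet> b)"
    using det by (simp add: mult.assoc[symmetric] abs_mult[symmetric])
  finally show "emeasure ?M (box l u) = ennreal (\<Prod>b\<in>Basis. (u - l) \<bullet> b)" .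
qed simp

lemma lborel_integral_translate:
  fixes f :: "real^'n \<Rightarrow> 'b::{banach, second_countable_topology}"
  assumes [measurable]: "f \<in> borel_measurable borel"
  shows "(\<integral>x. f (b + x) \<partial>lborel) = (\<integral>x. f x \<partial>lborel)"
  by (subst (2) lborel_distr_plus[of b, symmetric]) (simp add: integral_distr)

lemma lborel_integrable_translate:
  fixes f :: "real^'n \<Rightarrow> 'b::{banach, second_countable_topology}"
  assumes "integrable lborel f" shows "integrable lborel (\<lambda>x. f (b + x))"
proof -
  have [measurable]: "f \<in> borel_measurable borel" using assms by simp
  have "integrable (distr lborel borel ((+) b)) f" using assms by (simp add: lborel_distr_plus)
  then show ?thesis by (simp add: integrable_distr_eq)
qed

lemma lborel_integral_affine:
  fixes f :: "real^('n::{finite,wellorder}) \<Rightarrow> 'b::{banach, second_countable_topology}" and A :: "real^('n::_)^('n::_)"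
  assumes [measurable]: "f \<in> borel_measurable borel" and A: "invertible A"
  shows "\<bar>det A\<bar> *\<^sub>R (\<integral>x. f (A *v x + b) \<partial>lborel) = (\<integral>x. f x \<partial>lborel)"
proof -
  have "(\<integral>x. f x \<partial>lborel) = (\<integral>x. f (b + x) \<partial>lborel)" by (rule lborel_integral_translate[symmetric]) simp
  also have "\<dots> = (\<integral>x. f (b + x) \<partial>density (distr lborel borel ((*v) A)) (\<lambda>_. ennreal \<bar>det A\<bar>))"
    using lborel_linear_image[OF A] by simp
  also have "\<dots> = (\<integral>x. \<bar>det A\<bar> *\<^sub>R f (b + x) \<partial>distr lborel borel ((*v) A))"
    by (rule integral_density) auto
  also have "\<dots> = (\<integral>x. \<bar>det A\<bar> *\<^sub>R f (b + A *v x) \<partial>lborel)"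
    by (rule integral_distr) auto
  finally show ?thesis by (simp add: add.commute)
qed

lemma lborel_integrable_affine:
  fixes f :: "real^('n::{finite,wellorder}) \<Rightarrow> 'b::{banach, second_countable_topology}" and A :: "real^('n::_)^('n::_)"
  assumes f: "integrable lborel f" and A: "invertible A"
  shows "integrable lborel (\<lambda>x. f (A *v x + b))"
proof -
  have [measurable]: "f \<in> borel_measurable borel" using f by simp
  have d: "det A \<noteq> 0" using A invertible_det_nz by blast
  have "integrable (distr lborel borel ((+) b)) f" using f by (simp add: lborel_distr_plus)
  then have "integrable lborel (\<lambda>x. f (b + x))" by (simp add: integrable_distr_eq)
  then have "integrable (density (distr lborel borel ((*v) A)) (\<lambda>_. ennreal \<bar>det A\<bar>)) (\<lambda>x. f (b + x))"
    using lborel_linear_image[OF A] by simp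
  then have "integrable (distr lborel borel ((*v) A)) (\<lambda>x. \<bar>det A\<bar> *\<^sub>R f (b + x))"
    by (subst (asm) integrable_density) auto
  then have "integrable lborel (\<lambda>x. \<bar>det A\<bar> *\<^sub>R f (b + A *v x))"
    by (subst (asm) integrable_distr_eq) auto
  then have "integrable lborel (\<lambda>x. (1 / \<bar>det A\<bar>) *\<^sub>R (\<bar>det A\<bar> *\<^sub>R f (b + A *v x)))" by (rule integrable_scaleR_right)
  then show ?thesis using d by (simp add: add.commute)
qed

text \<open>Dominated convergence for difference quotients; the mean value estimate gives the majorant.\<close>

lemma has_derivative_integral:
  fixes F :: "real^'m \<Rightarrow> real^'n \<Rightarrow> complex"
  assumes sm: "\<And>\<eta>. smooth (F \<eta>)" and int: "\<And>x. integrable lborel (\<lambda>\<eta>. F \<eta> x)"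
    and meas: "\<And>i x. (\<lambda>\<eta>. partial_deriv i (F \<eta>) x) \<in> borel_measurable borel"
    and w: "integrable lborel w" and b: "\<And>i \<eta> x. norm (partial_deriv i (F \<eta>) x) \<le> w \<eta>"
  shows "((\<lambda>x. \<integral>\<eta>. F \<eta> x \<partial>lborel) has_derivative
     (\<lambda>v. \<Sum>i\<in>UNIV. of_real (v $ i) * (\<integral>\<eta>. partial_deriv i (F \<eta>) x \<partial>lborel))) (at x)"
proof -
  have [measurable]: "(\<lambda>\<eta>. F \<eta> y) \<in> borel_measurable borel" for y using int[of y] by simp
  note meas[measurable]
  have intp: "integrable lborel (\<lambda>\<eta>. partial_deriv i (F \<eta>) y)" for i y
    by (rule Bochner_Integration.integrable_bound[OF w]) (auto intro!: AE_I2 order_trans[OF b abs_ge_self])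
  define P where "P \<eta> v = (\<Sum>i\<in>UNIV. of_real (v $ i) * partial_deriv i (F \<eta>) x)" for \<eta> and v :: "real^'n"
  have [measurable]: "(\<lambda>\<eta>. P \<eta> v) \<in> borel_measurable borel" for v unfolding P_def by simp
  have intP: "integrable lborel (\<lambda>\<eta>. P \<eta> v)" for v unfolding P_def by (intro Bochner_Integration.integrable_sum integrable_mult_right intp)
  have P: "(\<Sum>i\<in>UNIV. of_real (v $ i) * (\<integral>\<eta>. partial_deriv i (F \<eta>) x \<partial>lborel)) = (\<integral>\<eta>. P \<eta> v \<partial>lborel)" for v
    unfolding P_def by (subst Bochner_Integration.integral_sum) (auto intro: integrable_mult_right intp)
  have d: "((\<lambda>y. (1 / norm (y - x)) *\<^sub>R (F \<eta> y - (F \<eta> x + P \<eta> (y - x)))) \<longlongrightarrow> 0) (at x)" for \<eta>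
    using smooth_has_derivative[OF sm[of \<eta>], of x] unfolding has_derivative_at2 P_def by simp
  have lin: "bounded_linear (\<lambda>v. \<integral>\<eta>. P \<eta> v \<partial>lborel)"
    unfolding P[symmetric]
    by (intro bounded_linear_sum bounded_linear_mult_left[THEN bounded_linear_compose]
        bounded_linear_compose[OF bounded_linear_of_real] bounded_linear_vec_nth)
  show ?thesis unfolding P has_derivative_at2
  proof (intro conjI lin, unfold tendsto_at_iff_sequentially, intro allI impI)
    fix X assume X0: "\<forall>i. X i \<in> UNIV - {x}" and X: "X \<longlonglongrightarrow> x"
    have e: "(1 / norm (y - x)) *\<^sub>R ((\<integral>\<eta>. F \<eta> y \<partial>lborel) - ((\<integral>\<eta>. F \<eta> x \<partial>lborel) + (\<integral>\<eta>. P \<eta> (y - x) \<partial>lborel)))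
       = (\<integral>\<eta>. (1 / norm (y - x)) *\<^sub>R (F \<eta> y - (F \<eta> x + P \<eta> (y - x))) \<partial>lborel)" for y
      by (simp add: int intP Bochner_Integration.integral_diff Bochner_Integration.integral_add)
    have "(\<lambda>n. \<integral>\<eta>. (1 / norm (X n - x)) *\<^sub>R (F \<eta> (X n) - (F \<eta> x + P \<eta> (X n - x))) \<partial>lborel)
        \<longlonglongrightarrow> (\<integral>\<eta>. (0::complex) \<partial>(lborel :: (real^'m) measure))"
    proof (rule integral_dominated_convergence)
      show "integrable lborel (\<lambda>\<eta>. 2 * real CARD('n) * w \<eta>)" using w by (rule integrable_mult_right)
      show "AE \<eta> in lborel. (\<lambda>n. (1 / norm (X n - x)) *\<^sub>R (F \<eta> (X n) - (F \<eta> x + P \<eta> (X n - x)))) \<longlonglongrightarrow> 0"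
        using d[unfolded tendsto_at_iff_sequentially o_def] X0 X by simp
      show "AE \<eta> in lborel. norm ((1 / norm (X n - x)) *\<^sub>R (F \<eta> (X n) - (F \<eta> x + P \<eta> (X n - x)))) \<le> 2 * real CARD('n) * w \<eta>" for n
      proof (rule AE_I2)
        fix \<eta>
        have nz: "norm (X n - x) > 0" using X0 by simp
        have "norm (F \<eta> (X n) - F \<eta> x) \<le> real CARD('n) * w \<eta> * norm (X n - x)"
          by (rule smooth_convex_Lipschitz[OF sm, where S = UNIV]) (use b in auto)
        moreover have "norm (P \<eta> (X n - x)) \<le> (\<Sum>i\<in>(UNIV::'n set). norm (X n - x) * w \<eta>)"
          unfolding P_def by (intro order_trans[OF norm_sum] sum_mono)
            (simp only: norm_mult norm_of_real, intro mult_mono b component_le_norm_cart, auto)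
        moreover have "(\<Sum>i\<in>(UNIV::'n set). norm (X n - x) * w \<eta>) = real CARD('n) * w \<eta> * norm (X n - x)" by simp
        moreover have "norm (F \<eta> (X n) - (F \<eta> x + P \<eta> (X n - x))) \<le> norm (F \<eta> (X n) - F \<eta> x) + norm (P \<eta> (X n - x))"
          by (metis diff_diff_eq norm_triangle_ineq4)
        ultimately have "norm (F \<eta> (X n) - (F \<eta> x + P \<eta> (X n - x))) \<le> (2 * real CARD('n) * w \<eta>) * norm (X n - x)"
          by linarith
        then show "norm ((1 / norm (X n - x)) *\<^sub>R (F \<eta> (X n) - (F \<eta> x + P \<eta> (X n - x)))) \<le> 2 * real CARD('n) * w \<eta>"
          using nz by (simp add: pos_divide_le_eq)
      qed
    qed auto
    then show "((\<lambda>y. (1 / norm (y - x)) *\<^sub>R ((\<integral>\<eta>. F \<eta> y \<partial>lborel) - ((\<integral>\<eta>. F \<eta> x \<partial>lborel) + (\<integral>\<eta>. P \<eta> (y - x) \<partial>lborel)))) \<circ> X) \<longlonglongrightarrow> 0"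
      unfolding e o_def by simp
  qed
qed

lemma partial_deriv_of_has_derivative_sum:
  assumes "(f has_derivative (\<lambda>v. \<Sum>i\<in>UNIV. of_real (v $ i) * c i)) (at x)"
  shows "partial_deriv i f x = c i"
proof -
  have "(\<Sum>j\<in>UNIV. of_real (axis i (1::real) $ j) * c j) = (\<Sum>j\<in>UNIV. if j = i then c j else 0)"
    by (intro sum.cong) (auto simp: axis_def)
  then show ?thesis using partial_deriv_eq[OF assms, of i] by simp
qed

lemma partial_derivs_integral:
  fixes F :: "real^'m \<Rightarrow> real^'n \<Rightarrow> complex"
  assumes sm: "\<And>\<eta>. smooth (F \<eta>)"
    and meas: "\<And>is x. (\<lambda>\<eta>. partial_derivs is (F \<eta>) x) \<in> borel_measurable borel"
    and w: "\<And>is. \<exists>w. integrable lborel w \<and> (\<forall>\<eta> x. norm (partial_derivs is (F \<eta>) x) \<le> w \<eta>)"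
  shows "partial_derivs is (\<lambda>x. \<integral>\<eta>. F \<eta> x \<partial>lborel) = (\<lambda>x. \<integral>\<eta>. partial_derivs is (F \<eta>) x \<partial>lborel)"
    and "smooth (\<lambda>x. \<integral>\<eta>. F \<eta> x \<partial>lborel)"
proof -
  have int: "integrable lborel (\<lambda>\<eta>. partial_derivs is (F \<eta>) x)" for "is" x
  proof -
    obtain v where v: "integrable lborel v" "\<And>\<eta> x. norm (partial_derivs is (F \<eta>) x) \<le> v \<eta>" using w by metis
    show ?thesis by (rule Bochner_Integration.integrable_bound[OF v(1)]) (use meas in \<open>auto intro!: AE_I2 order_trans[OF v(2) abs_ge_self]\<close>)
  qed
  have d: "((\<lambda>x. \<integral>\<eta>. partial_derivs is (F \<eta>) x \<partial>lborel) has_derivative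
     (\<lambda>v. \<Sum>i\<in>UNIV. of_real (v $ i) * (\<integral>\<eta>. partial_derivs (i # is) (F \<eta>) x \<partial>lborel))) (at x)" for "is" x
  proof -
    have "\<exists>v. integrable lborel v \<and> (\<forall>i \<eta> x. norm (partial_deriv i (partial_derivs is (F \<eta>)) x) \<le> v \<eta>)"
    proof -
      have "\<forall>i. \<exists>w. integrable lborel w \<and> (\<forall>\<eta> x. norm (partial_derivs (i # is) (F \<eta>) x) \<le> w \<eta>)" using w by blast
      from choice[OF this] obtain v where
        v: "\<And>i. integrable lborel (v i)" "\<And>i \<eta> x. norm (partial_derivs (i # is) (F \<eta>) x) \<le> v i \<eta>" by blast
      have vp: "0 \<le> v i \<eta>" for i \<eta> using v(2)[where x=0] norm_ge_zero order_trans by blast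
      have "norm (partial_deriv i (partial_derivs is (F \<eta>)) x) \<le> (\<Sum>i\<in>UNIV. v i \<eta>)" for i \<eta> x
        using v(2)[of i \<eta> x] member_le_sum[of i UNIV "\<lambda>i. v i \<eta>"] vp by (simp add: partial_derivs_Cons)
      moreover have "integrable lborel (\<lambda>\<eta>. \<Sum>i\<in>UNIV. v i \<eta>)" using v by simp
      ultimately show ?thesis by blast
    qed
    then obtain v where v: "integrable lborel v" "\<And>i \<eta> x. norm (partial_deriv i (partial_derivs is (F \<eta>)) x) \<le> v \<eta>" by blast
    have m: "(\<lambda>\<eta>. partial_deriv i (partial_derivs is (F \<eta>)) x) \<in> borel_measurable borel" for i x
      using meas[of "i # is" x] unfolding partial_derivs_Cons .
    show ?thesis unfolding partial_derivs_Cons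
      by (rule has_derivative_integral[OF smooth_partial_derivs[OF sm] int m v])
  qed
  show eq: "partial_derivs is (\<lambda>x. \<integral>\<eta>. F \<eta> x \<partial>lborel) = (\<lambda>x. \<integral>\<eta>. partial_derivs is (F \<eta>) x \<partial>lborel)" for "is"
  proof (induction "is")
    case (Cons i "is")
    show ?case unfolding partial_derivs_Cons[of i "is" "\<lambda>x. \<integral>\<eta>. F \<eta> x \<partial>lborel"] Cons
      by (rule ext) (rule partial_deriv_of_has_derivative_sum[OF d])
  qed simp
  show "smooth (\<lambda>x. \<integral>\<eta>. F \<eta> x \<partial>lborel)"
    unfolding smooth_def eq differentiable_on_def using d differentiable_at_withinI differentiable_def by blast
qed

section \<open>The Fourier transform of Schwartz functions\<close>

lemma fourier_character: "fourier f \<xi> = (\<integral>x. f x * character \<xi> x \<partial>lborel)"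
  by (simp add: fourier_def character_def)

lemma character_commute: "character \<xi> x = character x \<xi>"
  by (simp add: character_def inner_commute)

lemma character_add: "character (\<xi> + \<eta>) x = character \<xi> x * character \<eta> x"
  by (simp add: character_def cis_mult inner_add_right algebra_simps)

lemma character_add_right: "character \<xi> (x + y) = character \<xi> x * character \<xi> y"
  by (metis character_add character_commute)

lemma character_0 [simp]: "character 0 x = 1" "character \<xi> 0 = 1"
  by (simp_all add: character_def)

lemma cnj_character: "cnj (character \<xi> x) = character (- \<xi>) x"
  by (simp add: character_def cis_cnj)

lemma character_minus_right: "character \<xi> (- x) = character (- \<xi>) x"
  by (simp add: character_def)

lemma character_measurable [measurable]: "character \<xi> \<in> borel_measurable borel"
  by (rule smooth_measurable[OF smooth_character])

lemma integrable_mult_character: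
  assumes "integrable lborel f" shows "integrable lborel (\<lambda>x. f x * character \<xi> x)"
  by (rule Bochner_Integration.integrable_bound[OF assms]) (use assms in \<open>auto simp: norm_mult\<close>)

text \<open>Multiplication by this function on one side of the Fourier transform is, up to sign, the partial
  derivative on the other side.\<close>

definition deriv_symbol :: "'n \<Rightarrow> real^'n \<Rightarrow> complex" where
  "deriv_symbol i x = -2 * pi * \<i> * of_real (x $ i)"

lemma has_derivative_deriv_symbol: "(deriv_symbol i has_derivative deriv_symbol i) (at x)"
proof -
  have "bounded_linear (deriv_symbol i)" unfolding deriv_symbol_def
    by (intro bounded_linear_compose[OF bounded_linear_mult_right] bounded_linear_compose[OF bounded_linear_of_real] bounded_linear_vec_nth)
  then show ?thesis by (rule bounded_linear_imp_has_derivative)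
qed

lemma partial_deriv_deriv_symbol: "partial_deriv j (deriv_symbol i) = (\<lambda>x. deriv_symbol i (axis j 1))"
  using partial_deriv_eq[OF has_derivative_deriv_symbol] by blast

lemma smooth_deriv_symbol: "smooth (deriv_symbol i)"
proof -
  have "Ck n (deriv_symbol i)" for n
  proof (cases n)
    case 0 then show ?thesis using has_derivative_deriv_symbol by (auto simp: differentiable_def)
  next
    case (Suc m) then show ?thesis using has_derivative_deriv_symbol by (auto simp: differentiable_def partial_deriv_deriv_symbol)
  qed
  then show ?thesis by (simp add: smooth_iff_Ck)
qed

lemma norm_deriv_symbol_le: "norm (deriv_symbol i x) \<le> 2 * pi * norm x"
proof -
  have "norm (deriv_symbol i x) = 2 * pi * \<bar>x $ i\<bar>" by (simp add: deriv_symbol_def norm_mult)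
  also have "\<dots> \<le> 2 * pi * norm x" by (intro mult_left_mono component_le_norm_cart) auto
  finally show ?thesis .
qed

lemma jet_le_deriv_symbol: "jet_le n (deriv_symbol i) x (2 * pi * (1 + norm x))"
proof -
  have a: "norm (deriv_symbol i x) \<le> 2 * pi * (1 + norm x)"
    using norm_deriv_symbol_le[of i x] by (simp add: algebra_simps add_increasing)
  have b: "norm (deriv_symbol i (axis j 1)) \<le> 2 * pi * (1 + norm x)" for j
  proof -
    have "norm (deriv_symbol i (axis j 1)) \<le> 2 * pi * 1" using norm_deriv_symbol_le[of i "axis j 1"] by simp
    also have "\<dots> \<le> 2 * pi * (1 + norm x)" by (intro mult_left_mono) auto
    finally show ?thesis .
  qed
  show ?thesis using a b by (cases n) (auto simp: jet_le_Suc partial_deriv_deriv_symbol intro: jet_le_const)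
qed

lemma schwartz_deriv_symbol_mult: "schwartz f \<Longrightarrow> schwartz (\<lambda>x. deriv_symbol i x * f x)"
proof (intro schwartz_mult_bounded smooth_deriv_symbol)
  fix n have "\<forall>x. jet_le n (deriv_symbol i) x ((2 * pi) * (1 + norm x)^1)" by (simp add: jet_le_deriv_symbol)
  then show "\<exists>C m. \<forall>x. jet_le n (deriv_symbol i) x (C * (1 + norm x)^m)" by blast
qed

lemma has_derivative_fourier:
  assumes "schwartz f"
  shows "(fourier f has_derivative (\<lambda>v. \<Sum>i\<in>UNIV. of_real (v $ i) * fourier (\<lambda>x. deriv_symbol i x * f x) \<xi>)) (at \<xi>)"
proof -
  have [measurable]: "f \<in> borel_measurable borel" "deriv_symbol i \<in> borel_measurable borel" for i
    using assms schwartz_smooth smooth_measurable smooth_deriv_symbol by blast+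
  define F where "F x \<zeta> = f x * character x \<zeta>" for x \<zeta>
  have pd: "partial_deriv i (F x) \<zeta> = deriv_symbol i x * f x * character x \<zeta>" for i x \<zeta>
  proof -
    have "partial_deriv i (F x) \<zeta> = f x * partial_deriv i (character x) \<zeta>"
      unfolding F_def
      by (subst partial_deriv_mult) (auto intro: smooth_differentiable smooth_character)
    then show ?thesis by (simp add: partial_deriv_character deriv_symbol_def)
  qed
  have im: "integrable lborel (\<lambda>x. deriv_symbol i x * f x)" for i by (rule schwartz_integrable[OF schwartz_deriv_symbol_mult[OF assms]])
  have "((\<lambda>\<zeta>. \<integral>x. F x \<zeta> \<partial>lborel) has_derivative
     (\<lambda>v. \<Sum>i\<in>UNIV. of_real (v $ i) * (\<integral>x. partial_deriv i (F x) \<xi> \<partial>lborel))) (at \<xi>)"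
  proof (rule has_derivative_integral)
    show "smooth (F x)" for x unfolding F_def by (intro smooth_mult smooth_const smooth_character)
    show "integrable lborel (\<lambda>x. F x \<zeta>)" for \<zeta>
      unfolding F_def character_commute[of _ \<zeta>] using integrable_mult_character[OF schwartz_integrable[OF assms], of \<zeta>]
      by (simp add: character_commute[of \<zeta>])
    show "(\<lambda>x. partial_deriv i (F x) \<zeta>) \<in> borel_measurable borel" for i \<zeta>
      unfolding pd character_commute[of _ \<zeta>] by measurable
    show "integrable lborel (\<lambda>x. \<Sum>i\<in>UNIV. norm (deriv_symbol i x * f x))" using im by simp
    show "norm (partial_deriv i (F x) \<zeta>) \<le> (\<Sum>i\<in>UNIV. norm (deriv_symbol i x * f x))" for i x \<zeta>
      unfolding pd using member_le_sum[of i UNIV "\<lambda>i. norm (deriv_symbol i x * f x)"] by (simp add: norm_mult)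
  qed
  then show ?thesis unfolding pd F_def
    by (simp add: fourier_character[abs_def] character_commute[of _ "_::real^'a"] cong: if_cong)
qed

lemma partial_deriv_fourier: "schwartz f \<Longrightarrow> partial_deriv i (fourier f) = fourier (\<lambda>x. deriv_symbol i x * f x)"
  using partial_deriv_of_has_derivative_sum[OF has_derivative_fourier] by blast

lemma smooth_fourier:
  fixes f :: "real^'n \<Rightarrow> complex" shows "schwartz f \<Longrightarrow> smooth (fourier f)"
proof -
  have "\<forall>f::real^'n \<Rightarrow> complex. schwartz f \<longrightarrow> Ck n (fourier f)" for n :: nat
  proof (induction n)
    case 0 then show ?case using has_derivative_fourier by (auto simp: differentiable_def)
  next
    case (Suc n) then show ?case using has_derivative_fourier
      by (auto simp: differentiable_def partial_deriv_fourier schwartz_deriv_symbol_mult)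
  qed
  then show "schwartz f \<Longrightarrow> smooth (fourier f)" by (simp add: smooth_iff_Ck)
qed

lemma has_vector_derivative_at_0_quotient:
  fixes g :: "real \<Rightarrow> complex"
  assumes "(g has_vector_derivative D) (at 0)"
  shows "((\<lambda>s. (1 / s) *\<^sub>R (g s - g 0)) \<longlongrightarrow> D) (at 0)"
proof -
  have A: "((\<lambda>y. (1 / norm y) *\<^sub>R (g y - (g 0 + y *\<^sub>R D))) \<longlongrightarrow> 0) (at 0)"
    using assms unfolding has_vector_derivative_def has_derivative_at2 by simp
  have "((\<lambda>s. (1 / s) *\<^sub>R (g s - g 0) - D) \<longlongrightarrow> 0) (at 0)"
  proof (rule tendsto_norm_zero_cancel, rule Lim_transform_eventually[OF tendsto_norm_zero[OF A]])
    have "norm ((1 / norm s) *\<^sub>R (g s - (g 0 + s *\<^sub>R D))) = norm ((1 / s) *\<^sub>R (g s - g 0) - D)" if "s \<noteq> 0" for s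
    proof -
      have "(1 / s) *\<^sub>R (g s - g 0) - D = (1 / s) *\<^sub>R (g s - (g 0 + s *\<^sub>R D))"
        using that by (simp add: scaleR_diff_right scaleR_add_right)
      then show ?thesis by simp
    qed
    then show "\<forall>\<^sub>F s in at 0. norm ((1 / norm s) *\<^sub>R (g s - (g 0 + s *\<^sub>R D))) = norm ((1 / s) *\<^sub>R (g s - g 0) - D)"
      by (simp add: eventually_at_filter)
  qed
  then show ?thesis by (rule LIM_zero_cancel)
qed

text \<open>The difference quotients of \<open>f\<close> have integral zero by translation invariance, and they converge
  dominatedly.\<close>

lemma integral_partial_deriv:
  fixes f :: "real^'n \<Rightarrow> complex"
  assumes "schwartz f" shows "(\<integral>x. partial_deriv i f x \<partial>lborel) = 0"
proof -
  have sm: "smooth f" using assms schwartz_smooth by blast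
  have [measurable]: "f \<in> borel_measurable borel" using sm smooth_measurable by blast
  obtain C where C: "C \<ge> 0" "\<And>x y. norm (x - y) \<le> 1 \<Longrightarrow> norm (f x - f y) \<le> C * norm (x - y) / (1 + norm y)^(2 * CARD('n))"
    using schwartz_Lipschitz[OF assms] by metis
  define t where "t n = 1 / real (Suc n)" for n
  have t: "0 < t n" "t n \<le> 1" for n by (auto simp: t_def)
  have t0: "t \<longlonglongrightarrow> 0" unfolding t_def using LIMSEQ_Suc[OF lim_1_over_n] by simp
  define e where "e = axis i (1::real)"
  have ne: "norm e = 1" by (simp add: e_def)
  have "(\<lambda>n. \<integral>x. (1 / t n) *\<^sub>R (f (x + t n *\<^sub>R e) - f x) \<partial>lborel) \<longlonglongrightarrow> (\<integral>x. partial_deriv i f x \<partial>lborel)"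
  proof (rule integral_dominated_convergence)
    show "partial_deriv i f \<in> borel_measurable lborel" using smooth_measurable[OF smooth_partial_deriv[OF sm]] by simp
    show "integrable lborel (\<lambda>x::real^'n. C * (1 / (1 + norm x)^(2 * CARD('n))))" by (intro integrable_mult_right integrable_weight)
    show "AE x in lborel. (\<lambda>n. (1 / t n) *\<^sub>R (f (x + t n *\<^sub>R e) - f x)) \<longlonglongrightarrow> partial_deriv i f x"
    proof (rule AE_I2)
      fix x
      obtain D where D: "(f has_derivative D) (at x)" using smooth_differentiable[OF sm] differentiable_def by blast
      have l: "((\<lambda>s::real. x + s *\<^sub>R e) has_derivative (\<lambda>s. s *\<^sub>R e)) (at 0)" by (auto intro!: derivative_eq_intros)
      have "((\<lambda>s. f (x + s *\<^sub>R e)) has_derivative (\<lambda>s. D (s *\<^sub>R e))) (at 0)"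
        using diff_chain_at[OF l, of f D] D by (simp add: o_def)
      moreover have "D (s *\<^sub>R e) = s *\<^sub>R partial_deriv i f x" for s
        using partial_deriv_eq[OF D] linear_scale[OF has_derivative_linear[OF D]] by (simp add: e_def)
      ultimately have "((\<lambda>s. f (x + s *\<^sub>R e)) has_vector_derivative partial_deriv i f x) (at 0)"
        by (simp add: has_vector_derivative_def)
      then have "((\<lambda>s. (1 / s) *\<^sub>R (f (x + s *\<^sub>R e) - f x)) \<longlongrightarrow> partial_deriv i f x) (at 0)"
        using has_vector_derivative_at_0_quotient by fastforce
      moreover have "filterlim t (at 0) sequentially" using t0 t(1) by (auto simp: filterlim_at less_imp_neq[symmetric] intro!: always_eventually)
      ultimately show "(\<lambda>n. (1 / t n) *\<^sub>R (f (x + t n *\<^sub>R e) - f x)) \<longlonglongrightarrow> partial_deriv i f x"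
        by (rule filterlim_compose)
    qed
    show "AE x in lborel. norm ((1 / t n) *\<^sub>R (f (x + t n *\<^sub>R e) - f x)) \<le> C * (1 / (1 + norm x)^(2 * CARD('n)))" for n
    proof (rule AE_I2)
      fix x
      have "norm (f (x + t n *\<^sub>R e) - f x) \<le> C * t n / (1 + norm x)^(2 * CARD('n))"
        using C(2)[of "x + t n *\<^sub>R e" x] t[of n] ne by simp
      then have "(1 / t n) * norm (f (x + t n *\<^sub>R e) - f x) \<le> (1 / t n) * (C * t n / (1 + norm x)^(2 * CARD('n)))"
        using t(1)[of n] by (intro mult_left_mono) auto
      then show "norm ((1 / t n) *\<^sub>R (f (x + t n *\<^sub>R e) - f x)) \<le> C * (1 / (1 + norm x)^(2 * CARD('n)))"
        using t(1)[of n] by simp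
    qed
  qed auto
  moreover have "(\<integral>x. (1 / t n) *\<^sub>R (f (x + t n *\<^sub>R e) - f x) \<partial>lborel) = 0" for n
  proof -
    have "integrable lborel (\<lambda>x. f (x + t n *\<^sub>R e))"
      using lborel_integrable_translate[OF schwartz_integrable[OF assms], of "t n *\<^sub>R e"] by (simp add: add.commute)
    then have "(\<integral>x. f (x + t n *\<^sub>R e) - f x \<partial>lborel) = (\<integral>x. f (x + t n *\<^sub>R e) \<partial>lborel) - (\<integral>x. f x \<partial>lborel)"
      using schwartz_integrable[OF assms] by simp
    also have "\<dots> = 0" using lborel_integral_translate[of f "t n *\<^sub>R e"] by (simp add: add.commute)
    finally show ?thesis by simp
  qed
  ultimately have "(\<lambda>n::nat. 0::complex) \<longlonglongrightarrow> (\<integral>x. partial_deriv i f x \<partial>lborel)" by (simp only:)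
  then show ?thesis using LIMSEQ_unique[OF tendsto_const] by metis
qed

lemma fourier_partial_deriv:
  assumes "schwartz f" shows "fourier (partial_deriv i f) \<xi> = - (deriv_symbol i \<xi> * fourier f \<xi>)"
proof -
  have s: "schwartz (\<lambda>x. f x * character \<xi> x)" using schwartz_character_mult[OF assms, of \<xi>] by (simp add: mult.commute)
  have "partial_deriv i (\<lambda>x. f x * character \<xi> x) x = deriv_symbol i \<xi> * (f x * character \<xi> x) + partial_deriv i f x * character \<xi> x" for x
    using assms by (subst partial_deriv_mult)
      (auto intro: smooth_differentiable smooth_character schwartz_smooth simp: partial_deriv_character deriv_symbol_def)
  then have "0 = (\<integral>x. deriv_symbol i \<xi> * (f x * character \<xi> x) + partial_deriv i f x * character \<xi> x \<partial>lborel)"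
    using integral_partial_deriv[OF s, of i] by simp
  also have "\<dots> = deriv_symbol i \<xi> * fourier f \<xi> + fourier (partial_deriv i f) \<xi>"
  proof (subst Bochner_Integration.integral_add)
    show "integrable lborel (\<lambda>x. deriv_symbol i \<xi> * (f x * character \<xi> x))"
      by (rule integrable_mult_right[OF schwartz_integrable[OF s]])
    show "integrable lborel (\<lambda>x. partial_deriv i f x * character \<xi> x)"
      by (rule integrable_mult_character[OF schwartz_integrable[OF schwartz_partial_deriv[OF assms]]])
  qed (simp add: fourier_character)
  finally have "deriv_symbol i \<xi> * fourier f \<xi> + fourier (partial_deriv i f) \<xi> = 0" by (rule sym)
  from minus_unique[OF this] show ?thesis by (rule sym)
qed

definition weight_integral :: "'n::finite itself \<Rightarrow> real" where
  "weight_integral _ = (\<integral>(x::real^'n). 1 / (1 + norm x)^(2 * CARD('n)) \<partial>lborel)"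

lemma norm_fourier_le:
  fixes f :: "real^'n \<Rightarrow> complex"
  assumes "integrable lborel f" "\<And>x. norm (f x) \<le> B / (1 + norm x)^(2 * CARD('n))"
  shows "norm (fourier f \<xi>) \<le> B * weight_integral TYPE('n)"
proof -
  have "norm (fourier f \<xi>) \<le> (\<integral>x. norm (f x * character \<xi> x) \<partial>lborel)"
    unfolding fourier_character by (rule integral_norm_bound)
  also have "\<dots> = (\<integral>x. norm (f x) \<partial>lborel)" by (simp add: norm_mult)
  also have "\<dots> \<le> (\<integral>(x::real^'n). B * (1 / (1 + norm x)^(2 * CARD('n))) \<partial>lborel)"
    using assms by (intro integral_mono integrable_mult_right integrable_weight) auto
  also have "\<dots> = B * weight_integral TYPE('n)" unfolding weight_integral_def by (rule integral_mult_right_zero)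
  finally show ?thesis .
qed

lemma weight_integral_nonneg: "weight_integral TYPE('n::finite) \<ge> 0"
  unfolding weight_integral_def by (intro integral_nonneg_AE) (auto simp: add_nonneg_nonneg)

text \<open>Each induction step trades one derivative of \<open>f\<close> for one power of \<open>1 + norm \<xi>\<close>, which is at most
  \<open>1 + (\<Sum>i. \<bar>\<xi> $ i\<bar>)\<close>.\<close>

lemma fourier_decay:
  fixes f :: "real^'n \<Rightarrow> complex"
  shows "schwartz f \<Longrightarrow> (\<And>x. jet_le k f x (B / (1 + norm x)^(2 * CARD('n)))) \<Longrightarrow>
    norm (fourier f \<xi>) \<le> (1 + real CARD('n))^k * B * weight_integral TYPE('n) / (1 + norm \<xi>)^k"
proof (induction k arbitrary: f)
  case 0
  then show ?case using norm_fourier_le[OF schwartz_integrable] by auto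
next
  case (Suc k)
  let ?d = "real CARD('n)" and ?I = "weight_integral TYPE('n)"
  let ?Q = "(1 + ?d)^k * B * ?I / (1 + norm \<xi>)^k"
  have p: "1 + norm \<xi> > 0" by (simp add: add_pos_nonneg)
  have f0: "norm (fourier f \<xi>) \<le> ?Q"
    by (rule Suc.IH[OF Suc.prems(1)]) (rule jet_le_mono[OF Suc.prems(2)], auto)
  have fi: "\<bar>\<xi> $ i\<bar> * norm (fourier f \<xi>) \<le> ?Q" for i
  proof -
    have "norm (fourier (partial_deriv i f) \<xi>) \<le> ?Q"
      by (rule Suc.IH[OF schwartz_partial_deriv[OF Suc.prems(1)]]) (use Suc.prems(2) in \<open>simp add: jet_le_Suc\<close>)
    then have "2 * pi * (\<bar>\<xi> $ i\<bar> * norm (fourier f \<xi>)) \<le> ?Q"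
      unfolding fourier_partial_deriv[OF Suc.prems(1)] by (simp add: deriv_symbol_def norm_mult mult_ac)
    moreover have "1 * (\<bar>\<xi> $ i\<bar> * norm (fourier f \<xi>)) \<le> 2 * pi * (\<bar>\<xi> $ i\<bar> * norm (fourier f \<xi>))"
      using pi_ge_two by (intro mult_right_mono) auto
    ultimately show ?thesis by linarith
  qed
  have "(1 + norm \<xi>) * norm (fourier f \<xi>) \<le> (1 + (\<Sum>i\<in>UNIV. \<bar>\<xi> $ i\<bar>)) * norm (fourier f \<xi>)"
    using norm_le_l1_cart[of \<xi>] by (intro mult_right_mono) auto
  also have "\<dots> = norm (fourier f \<xi>) + (\<Sum>i\<in>UNIV. \<bar>\<xi> $ i\<bar> * norm (fourier f \<xi>))"
    by (simp add: distrib_right sum_distrib_right)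
  also have "\<dots> \<le> ?Q + (\<Sum>i\<in>(UNIV::'n set). ?Q)" by (intro add_mono f0 sum_mono fi)
  also have "\<dots> = (1 + ?d) * ?Q" by (subst distrib_right) simp
  finally have "norm (fourier f \<xi>) \<le> (1 + ?d) * ?Q / (1 + norm \<xi>)" by (subst pos_le_divide_eq[OF p]) (simp only: mult.commute)
  also have "\<dots> = (1 + ?d)^Suc k * B * ?I / (1 + norm \<xi>)^Suc k" by (simp add: mult_ac)
  finally show ?case .
qed

text \<open>The constant of the estimate below. It does not depend on the function that is transformed, so the
  estimate applies uniformly to families of functions.\<close>

definition fourier_jet_const :: "'n::finite itself \<Rightarrow> nat \<Rightarrow> nat \<Rightarrow> real" where
  "fourier_jet_const _ k n = (1 + real CARD('n))^k * weight_integral TYPE('n::finite) * (1 + 2^k * (2 * pi))^n"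

lemma fourier_jet_const_nonneg: "fourier_jet_const TYPE('n::finite) k n \<ge> 0"
  unfolding fourier_jet_const_def by (intro mult_nonneg_nonneg weight_integral_nonneg zero_le_power add_nonneg_nonneg) auto

lemma pow_Suc_cancel:
  fixes a :: real assumes "0 < a" shows "c * (d * a) * (B / a ^ Suc m) = c * d * B / a ^ m"
  using assms by (simp add: field_simps)

text \<open>Derivatives of the transform come from multiplying \<open>f\<close> by coordinates: \<open>n\<close> of them use up \<open>n\<close> powers of
  decay, and \<open>k\<close> derivatives of \<open>f\<close> produce \<open>k\<close> powers of decay.\<close>

lemma jet_le_fourier:
  fixes f :: "real^'n \<Rightarrow> complex"
  shows "schwartz f \<Longrightarrow> (\<And>x. jet_le k f x (B / (1 + norm x)^(2 * CARD('n) + n))) \<Longrightarrow>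
    jet_le n (fourier f) \<xi> (fourier_jet_const TYPE('n) k n * B / (1 + norm \<xi>)^k)"
proof (induction n arbitrary: f B)
  case 0
  then show ?case using fourier_decay[of f k B \<xi>] by (simp add: fourier_jet_const_def mult_ac)
next
  case (Suc n)
  let ?q = "2^k * (2 * pi)"
  have B: "B \<ge> 0" using jet_le_nonneg[OF Suc.prems(2), of 0] by simp
  have "jet_le k (\<lambda>x. deriv_symbol i x * f x) x (?q * B / (1 + norm x)^(2 * CARD('n) + n))" for i x
  proof -
    have "1 + norm x > 0" by (simp add: add_pos_nonneg)
    then have "2^k * (2 * pi * (1 + norm x)) * (B / (1 + norm x)^(2 * CARD('n) + Suc n)) = ?q * B / (1 + norm x)^(2 * CARD('n) + n)"
      using pow_Suc_cancel by simp
    with jet_le_mult[OF smooth_deriv_symbol schwartz_smooth[OF Suc.prems(1)] jet_le_deriv_symbol Suc.prems(2), of i x] show ?thesis by simp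
  qed
  from Suc.IH[OF schwartz_deriv_symbol_mult[OF Suc.prems(1)] this]
  have "jet_le n (partial_deriv i (fourier f)) \<xi> (fourier_jet_const TYPE('n) k n * (?q * B) / (1 + norm \<xi>)^k)" for i
    unfolding partial_deriv_fourier[OF Suc.prems(1)] by simp
  moreover have "fourier_jet_const TYPE('n) k n * (?q * B) / (1 + norm \<xi>)^k \<le> fourier_jet_const TYPE('n) k (Suc n) * B / (1 + norm \<xi>)^k"
  proof (rule divide_right_mono)
    have "fourier_jet_const TYPE('n) k n * B * ?q \<le> fourier_jet_const TYPE('n) k n * B * (1 + ?q)"
      by (intro mult_left_mono mult_nonneg_nonneg fourier_jet_const_nonneg B) auto
    then show "fourier_jet_const TYPE('n) k n * (?q * B) \<le> fourier_jet_const TYPE('n) k (Suc n) * B"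
      by (simp add: fourier_jet_const_def mult_ac)
  qed (simp add: add_nonneg_nonneg)
  moreover have "norm (fourier f \<xi>) \<le> fourier_jet_const TYPE('n) k (Suc n) * B / (1 + norm \<xi>)^k"
  proof -
    have "jet_le k f x (B / (1 + norm x)^(2 * CARD('n)))" for x
    proof (rule jet_le_mono[OF Suc.prems(2)])
      have "1 + norm x > 0" "1 \<le> 1 + norm x" by (simp_all add: add_pos_nonneg)
      then show "B / (1 + norm x) ^ (2 * CARD('n) + Suc n) \<le> B / (1 + norm x) ^ (2 * CARD('n))"
        by (intro divide_left_mono power_increasing B mult_pos_pos zero_less_power) (auto simp: add_pos_nonneg)
    qed simp
    from fourier_decay[OF Suc.prems(1) this]
    have "norm (fourier f \<xi>) \<le> (1 + real CARD('n))^k * B * weight_integral TYPE('n) / (1 + norm \<xi>)^k" by simp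
    also have "\<dots> \<le> fourier_jet_const TYPE('n) k (Suc n) * B / (1 + norm \<xi>)^k"
    proof (rule divide_right_mono)
      have "((1 + real CARD('n))^k * B * weight_integral TYPE('n)) * 1 \<le> ((1 + real CARD('n))^k * B * weight_integral TYPE('n)) * (1 + ?q)^Suc n"
        by (intro mult_left_mono mult_nonneg_nonneg weight_integral_nonneg B one_le_power) auto
      then show "(1 + real CARD('n))^k * B * weight_integral TYPE('n) \<le> fourier_jet_const TYPE('n) k (Suc n) * B"
        by (simp add: fourier_jet_const_def mult_ac)
    qed (simp add: add_nonneg_nonneg)
    finally show ?thesis .
  qed
  ultimately show ?case unfolding jet_le_Suc by (meson jet_le_mono order_refl)
qed

lemma schwartz_fourier:
  fixes f :: "real^'n \<Rightarrow> complex"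
  assumes "schwartz f" shows "schwartz (fourier f)"
proof (rule schwartzI[OF smooth_fourier[OF assms]])
  fix n N
  obtain B where "\<And>x. jet_le N f x (B / (1 + norm x)^(2 * CARD('n) + n))" using schwartz_jet[OF assms] by metis
  from jet_le_fourier[OF assms this]
  show "\<exists>B. \<forall>x. jet_le n (fourier f) x (B / (1 + norm x)^N)" by blast
qed

lemma lborel_integral_scale:
  fixes f :: "real^'n \<Rightarrow> complex"
  assumes [measurable]: "f \<in> borel_measurable borel" and "c \<noteq> 0"
  shows "\<bar>c\<bar>^CARD('n) *\<^sub>R (\<integral>x. f (b + c *\<^sub>R x) \<partial>lborel) = (\<integral>x. f x \<partial>lborel)"
proof -
  have "(\<integral>x. f x \<partial>lborel) = (\<integral>x. f x \<partial>density (distr lborel borel (\<lambda>x. b + c *\<^sub>R x)) (\<lambda>_. ennreal (\<bar>c\<bar>^CARD('n))))"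
    using lborel_affine[OF assms(2), of b] by simp
  also have "\<dots> = (\<integral>x. \<bar>c\<bar>^CARD('n) *\<^sub>R f x \<partial>distr lborel borel (\<lambda>x. b + c *\<^sub>R x))"
    by (rule integral_density) auto
  also have "\<dots> = (\<integral>x. \<bar>c\<bar>^CARD('n) *\<^sub>R f (b + c *\<^sub>R x) \<partial>lborel)"
    by (rule integral_distr) auto
  finally show ?thesis by simp
qed

lemma lborel_integral_reflect:
  fixes f :: "real^'n \<Rightarrow> complex"
  assumes "f \<in> borel_measurable borel"
  shows "(\<integral>x. f (b - x) \<partial>lborel) = (\<integral>x. f x \<partial>lborel)"
  using lborel_integral_scale[OF assms, of "-1" b] by simp

text \<open>The kernel \<open>K\<close> will always be a character in \<open>x\<close> and \<open>y\<close>.\<close>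

lemma Fubini_bounded:
  fixes f :: "real^'n \<Rightarrow> complex" and g :: "real^'m \<Rightarrow> complex"
  assumes f: "integrable lborel f" and g: "integrable lborel g"
    and K: "continuous_on UNIV (case_prod K)" "\<And>x y. norm (K x y) \<le> 1"
  shows "(\<integral>x. (\<integral>y. f x * g y * K x y \<partial>lborel) \<partial>lborel) = (\<integral>y. (\<integral>x. f x * g y * K x y \<partial>lborel) \<partial>lborel)"
proof -
  have [measurable]: "f \<in> borel_measurable borel" "g \<in> borel_measurable borel" using f g by auto
  have "case_prod K \<in> borel_measurable borel" using K(1) by (rule borel_measurable_continuous_onI)
  then have [measurable]: "case_prod K \<in> borel_measurable (borel \<Otimes>\<^sub>M borel)" by (simp add: borel_prod)
  have Km[measurable]: "(\<lambda>p. K (fst p) (snd p)) \<in> borel_measurable (borel \<Otimes>\<^sub>M borel)"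
    using \<open>case_prod K \<in> borel_measurable (borel \<Otimes>\<^sub>M borel)\<close> by (simp add: case_prod_beta')
  have kx: "(\<lambda>y. K x y) \<in> borel_measurable borel" for x
    by (intro borel_measurable_continuous_onI continuous_on_compose2[OF K(1), of _ "\<lambda>y. (x, y)", simplified])
       (auto intro!: continuous_intros)
  have intg: "integrable lborel (\<lambda>y. f x * g y * K x y)" for x
  proof (rule Bochner_Integration.integrable_bound)
    show "integrable lborel (\<lambda>y. f x * g y)" using g by simp
    show "(\<lambda>y. f x * g y * K x y) \<in> borel_measurable lborel" using kx[of x] by simp
    show "AE y in lborel. norm (f x * g y * K x y) \<le> norm (f x * g y)"
      using K(2) by (intro AE_I2) (simp add: norm_mult mult_left_le)
  qed
  have m: "(\<lambda>p. f (fst p) * g (snd p) * K (fst p) (snd p)) \<in> borel_measurable (lborel \<Otimes>\<^sub>M lborel)"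
  proof -
    have "(\<lambda>p. f (fst p) * g (snd p) * K (fst p) (snd p)) \<in> borel_measurable (borel \<Otimes>\<^sub>M borel)" by measurable
    moreover have "sets (lborel \<Otimes>\<^sub>M lborel :: ((real^'n) \<times> (real^'m)) measure) = sets (borel \<Otimes>\<^sub>M borel)"
      by (intro sets_pair_measure_cong) auto
    ultimately show ?thesis using measurable_cong_sets by blast
  qed
  have "integrable (lborel \<Otimes>\<^sub>M lborel) (\<lambda>p. f (fst p) * g (snd p) * K (fst p) (snd p))"
  proof (rule lborel_pair.Fubini_integrable[OF m])
    show "integrable lborel (\<lambda>x. \<integral>y. norm (f (fst (x, y)) * g (snd (x, y)) * K (fst (x, y)) (snd (x, y))) \<partial>lborel)"
    proof (rule Bochner_Integration.integrable_bound)
      show "integrable lborel (\<lambda>x. norm (f x) * (\<integral>y. norm (g y) \<partial>lborel))" using f by simp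
      have "(\<lambda>p. norm (f (fst p) * g (snd p) * K (fst p) (snd p))) \<in> borel_measurable (lborel \<Otimes>\<^sub>M lborel)"
        using m by simp
      from lborel.borel_measurable_lebesgue_integral[of "\<lambda>x y. norm (f x * g y * K x y)" "lborel"] this
      show "(\<lambda>x. \<integral>y. norm (f (fst (x, y)) * g (snd (x, y)) * K (fst (x, y)) (snd (x, y))) \<partial>lborel) \<in> borel_measurable lborel"
        by (simp add: case_prod_beta')
      show "AE x in lborel. norm (\<integral>y. norm (f (fst (x, y)) * g (snd (x, y)) * K (fst (x, y)) (snd (x, y))) \<partial>lborel)
          \<le> norm (norm (f x) * (\<integral>y. norm (g y) \<partial>lborel))"
      proof (rule AE_I2)
        fix x
        have "(\<integral>y. norm (f x * g y * K x y) \<partial>lborel) \<le> (\<integral>y. norm (f x) * norm (g y) \<partial>lborel)"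
          using integrable_norm[OF intg[of x]] g K(2) by (intro integral_mono) (auto simp: norm_mult mult_left_le)
        moreover have "0 \<le> (\<integral>y. norm (f x * g y * K x y) \<partial>lborel)" by (intro integral_nonneg_AE) auto
        ultimately show "norm (\<integral>y. norm (f (fst (x, y)) * g (snd (x, y)) * K (fst (x, y)) (snd (x, y))) \<partial>lborel)
          \<le> norm (norm (f x) * (\<integral>y. norm (g y) \<partial>lborel))" by simp
      qed
    qed
  qed (use intg in simp)
  from lborel_pair.Fubini_integral[of "\<lambda>x y. f x * g y * K x y"] this show ?thesis by (simp add: case_prod_beta')
qed

lemma lborel_integral_coordinate_prod:
  fixes g :: "'n::finite \<Rightarrow> real \<Rightarrow> complex"
  assumes g: "\<And>i. integrable lborel (g i)"
  shows "integrable lborel (\<lambda>x::real^'n. \<Prod>i\<in>UNIV. g i (x $ i))"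
    and "(\<integral>(x::real^'n). (\<Prod>i\<in>UNIV. g i (x $ i)) \<partial>lborel) = (\<Prod>i\<in>UNIV. \<integral>t. g i t \<partial>lborel)"
proof -
  interpret product_sigma_finite "\<lambda>_::real^'n. lborel :: real measure" ..
  define ix where "ix b = (THE i. b = axis i (1::real))" for b :: "real^'n"
  have ix: "ix (axis i 1) = i" for i unfolding ix_def by (auto simp: axis_eq_axis)
  have B: "(Basis :: (real^'n) set) = range (\<lambda>i. axis i 1)" by (auto simp: Basis_vec_def)
  have inj: "inj (\<lambda>i::'n. axis i (1::real))" by (auto simp: inj_def axis_eq_axis)
  have pr: "(\<Prod>i\<in>UNIV. G i (axis i (1::real))) = (\<Prod>b\<in>(Basis :: (real^'n) set). G (ix b) b)" for G :: "'n \<Rightarrow> real^'n \<Rightarrow> complex"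
    unfolding B prod.reindex[OF inj] by (simp add: ix)
  have [measurable]: "g i \<in> borel_measurable borel" for i using g[of i] by simp
  have [measurable]: "(\<lambda>x::real^'n. \<Prod>i\<in>UNIV. g i (x $ i)) \<in> borel_measurable borel"
  proof (intro borel_measurable_prod)
    fix i show "(\<lambda>x::real^'n. g i (x $ i)) \<in> borel_measurable borel"
      by (rule measurable_compose[of "\<lambda>x. x $ i" _ borel]) (auto intro: borel_measurable_continuous_onI continuous_intros)
  qed
  have e: "(\<Prod>i\<in>UNIV. g i ((\<Sum>b\<in>Basis. f b *\<^sub>R b) $ i)) = (\<Prod>b\<in>Basis. g (ix b) (f b))" for f :: "real^'n \<Rightarrow> real"
  proof -
    have "(\<Sum>b\<in>Basis. f b *\<^sub>R b) $ i = f (axis i 1)" for i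
    proof -
      have "(\<Sum>b\<in>Basis. f b *\<^sub>R b) \<bullet> (axis i 1 :: real^'n) = f (axis i 1)" by (rule inner_sum_left_Basis) (simp add: B)
      then show ?thesis by (simp add: inner_axis)
    qed
    then show ?thesis using pr[of "\<lambda>i b. g i (f b)"] by simp
  qed
  note P = product_integrable_prod[where I = Basis and f = "\<lambda>b. g (ix b)"] product_integral_prod[where I = Basis and f = "\<lambda>b. g (ix b)"]
  show "integrable lborel (\<lambda>x::real^'n. \<Prod>i\<in>UNIV. g i (x $ i))"
  proof (subst lborel_eq, subst integrable_distr_eq)
    show "integrable (\<Pi>\<^sub>M b\<in>Basis. lborel) (\<lambda>f. \<Prod>i\<in>UNIV. g i ((\<Sum>b\<in>Basis. f b *\<^sub>R b) $ i))"
      unfolding e by (rule P) (auto intro: g)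
  qed simp_all
  have "(\<integral>(x::real^'n). (\<Prod>i\<in>UNIV. g i (x $ i)) \<partial>lborel) = (\<Prod>b\<in>(Basis :: (real^'n) set). \<integral>t. g (ix b) t \<partial>lborel)"
  proof (subst lborel_eq, subst integral_distr)
    show "(\<integral>f. (\<Prod>i\<in>UNIV. g i ((\<Sum>b\<in>Basis. f b *\<^sub>R b) $ i)) \<partial>(\<Pi>\<^sub>M b\<in>(Basis :: (real^'n) set). lborel))
      = (\<Prod>b\<in>(Basis :: (real^'n) set). \<integral>t. g (ix b) t \<partial>lborel)"
      unfolding e by (rule P) (auto intro: g)
  qed simp_all
  then show "(\<integral>(x::real^'n). (\<Prod>i\<in>UNIV. g i (x $ i)) \<partial>lborel) = (\<Prod>i\<in>UNIV. \<integral>t. g i t \<partial>lborel)"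
    using pr[of "\<lambda>i b. \<integral>t. g i t \<partial>lborel"] by simp
qed

definition gauss :: "real^'n \<Rightarrow> complex" where
  "gauss x = (\<Prod>i\<in>UNIV. of_real (exp (- (x $ i)\<^sup>2 / 2)))"

text \<open>The Fourier transform of \<open>gauss\<close>. As a product of normal densities its dilates form an approximate
  identity.\<close>

definition gauss_hat :: "real^'n \<Rightarrow> complex" where
  "gauss_hat y = (\<Prod>i\<in>UNIV. of_real (normal_density 0 (1 / (2 * pi)) (y $ i)))"

lemma fourier_gauss_1d:
  "(\<integral>t. of_real (exp (- t\<^sup>2 / 2)) * cis (- 2 * pi * (t * y)) \<partial>lborel) = of_real (normal_density 0 (1 / (2 * pi)) y)"
proof -
  have "(\<integral>t. of_real (exp (- t\<^sup>2 / 2)) * cis (- 2 * pi * (t * y)) \<partial>lborel)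
     = (\<integral>t. of_real (sqrt (2 * pi)) * (std_normal_density t *\<^sub>R exp (\<i> * of_real (- 2 * pi * y * t))) \<partial>lborel)"
    by (intro Bochner_Integration.integral_cong)
       (simp_all add: std_normal_density_def cis_conv_exp scaleR_conv_of_real mult_ac)
  also have "\<dots> = of_real (sqrt (2 * pi)) * (\<integral>t. std_normal_density t *\<^sub>R exp (\<i> * of_real (- 2 * pi * y * t)) \<partial>lborel)"
    by (rule integral_mult_right_zero)
  also have "(\<integral>t. std_normal_density t *\<^sub>R exp (\<i> * of_real (- 2 * pi * y * t)) \<partial>lborel) = char std_normal_distribution (- 2 * pi * y)"
    unfolding char_def by (subst integral_density) (auto simp: normal_density_nonneg)
  also have "\<dots> = of_real (exp (- ((- 2 * pi * y)\<^sup>2) / 2))" by (simp add: char_std_normal_distribution)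
  also have "of_real (sqrt (2 * pi)) * complex_of_real (exp (- ((- 2 * pi * y)\<^sup>2) / 2)) = of_real (normal_density 0 (1 / (2 * pi)) y)"
  proof -
    have "sqrt (2 * pi) = 1 / sqrt (2 * pi * (1 / (2 * pi))\<^sup>2)"
      by (simp add: power2_eq_square real_sqrt_divide real_sqrt_mult)
    moreover have "- ((- 2 * pi * y)\<^sup>2) / 2 = - (y - 0)\<^sup>2 / (2 * (1 / (2 * pi))\<^sup>2)"
      by (simp add: power2_eq_square field_simps)
    ultimately show ?thesis unfolding normal_density_def by simp
  qed
  finally show ?thesis .
qed

lemma character_prod: "character y x = (\<Prod>i\<in>UNIV. cis (- 2 * pi * (x $ i * y $ i)))"
  by (simp add: character_def cis_conv_exp inner_vec_def exp_sum[symmetric] sum_distrib_left sum_negf)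

lemma fourier_gauss: "fourier gauss y = gauss_hat y" and integrable_gauss: "integrable lborel gauss"
  and integrable_gauss_hat: "integrable lborel (gauss_hat :: real^'n \<Rightarrow> complex)"
  and integral_gauss_hat: "(\<integral>(x::real^'n). gauss_hat x \<partial>lborel) = 1"
proof -
  have i1: "integrable lborel (\<lambda>t. complex_of_real (exp (- t\<^sup>2 / 2)))"
  proof -
    have "integrable lborel (\<lambda>t. complex_of_real (sqrt (2 * pi) * std_normal_density t))"
      by (intro integrable_of_real integrable_mult_right integrable_normal_density) simp
    then show ?thesis by (simp add: std_normal_density_def)
  qed
  have i2: "integrable lborel (\<lambda>t. complex_of_real (exp (- t\<^sup>2 / 2)) * cis (- 2 * pi * (t * y)))" for y
    by (rule Bochner_Integration.integrable_bound[OF i1])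
       (auto simp: norm_mult intro!: borel_measurable_times borel_measurable_continuous_onI continuous_intros)
  have i3: "integrable lborel (\<lambda>t. complex_of_real (normal_density 0 (1 / (2 * pi)) t))"
    by (intro integrable_of_real integrable_normal_density) simp
  show "integrable lborel gauss" unfolding gauss_def[abs_def]
    by (rule lborel_integral_coordinate_prod) (rule i1)
  show "integrable lborel (gauss_hat :: real^'n \<Rightarrow> complex)" unfolding gauss_hat_def[abs_def]
    by (rule lborel_integral_coordinate_prod) (rule i3)
  have "(\<integral>(x::real^'n). gauss_hat x \<partial>lborel) = (\<Prod>i\<in>(UNIV::'n set). \<integral>t. complex_of_real (normal_density 0 (1 / (2 * pi)) t) \<partial>lborel)"
    unfolding gauss_hat_def by (rule lborel_integral_coordinate_prod) (rule i3)
  then show "(\<integral>(x::real^'n). gauss_hat x \<partial>lborel) = 1" by simp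
  have "fourier gauss y = (\<integral>x. (\<Prod>i\<in>UNIV. of_real (exp (- (x $ i)\<^sup>2 / 2)) * cis (- 2 * pi * (x $ i * y $ i))) \<partial>lborel)"
    unfolding fourier_character gauss_def character_prod prod.distrib ..
  also have "\<dots> = gauss_hat y"
    unfolding gauss_hat_def fourier_gauss_1d[symmetric] by (rule lborel_integral_coordinate_prod) (rule i2)
  finally show "fourier gauss y = gauss_hat y" .
qed

text \<open>The inversion integral is regularized by the factor \<open>gauss (c \<zeta>)\<close>. By Fubini it becomes the average of
  \<open>f (x + c z)\<close> against the density \<open>gauss_hat\<close>, and this tends to \<open>f x\<close> as \<open>c\<close> tends to \<open>0\<close>.\<close>

theorem fourier_inversion:
  fixes f :: "real^'n \<Rightarrow> complex"
  assumes f: "schwartz f"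
  shows "fourier (fourier f) (- x) = f x"
proof -
  have fi: "integrable lborel f" and Fi: "integrable lborel (fourier f)"
    using f by (auto intro: schwartz_integrable schwartz_fourier)
  have [measurable]: "f \<in> borel_measurable borel" "fourier f \<in> borel_measurable borel" using fi Fi by auto
  have gm[measurable]: "(gauss :: real^'n \<Rightarrow> complex) \<in> borel_measurable borel" "(gauss_hat :: real^'n \<Rightarrow> complex) \<in> borel_measurable borel"
    using borel_measurable_integrable[OF integrable_gauss] borel_measurable_integrable[OF integrable_gauss_hat]
    by simp_all
  have gb: "norm (gauss z) \<le> 1" for z :: "real^'n"
    unfolding gauss_def prod_norm[symmetric] by (rule prod_le_1) auto
  define t where "t n = 1 / real (Suc n)" for n
  have t: "t n > 0" "t n \<noteq> 0" for n by (auto simp: t_def)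
  have t0: "t \<longlonglongrightarrow> 0" unfolding t_def using LIMSEQ_Suc[OF lim_1_over_n] by simp
  \<comment> \<open>for \<open>c \<rightarrow> 0\<close> the left side tends to the inversion integral, the right side to \<open>f x\<close>\<close>
  have key: "(\<integral>\<zeta>. fourier f \<zeta> * gauss (c *\<^sub>R \<zeta>) * character (- x) \<zeta> \<partial>lborel) = (\<integral>z. f (x + c *\<^sub>R z) * gauss_hat z \<partial>lborel)"
    if c: "c > 0" for c
  proof -
    have c0: "c \<noteq> 0" using c by simp
    have gi: "integrable lborel (\<lambda>\<zeta>::real^'n. gauss (c *\<^sub>R \<zeta>))"
    proof -
      have "integrable (density (distr lborel borel (\<lambda>x::real^'n. 0 + c *\<^sub>R x)) (\<lambda>_. ennreal (\<bar>c\<bar>^CARD('n)))) gauss"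
        using integrable_gauss lborel_affine[OF c0, of "0::real^'n"] by simp
      then have "integrable (distr lborel borel (\<lambda>x::real^'n. 0 + c *\<^sub>R x)) (\<lambda>x. \<bar>c\<bar>^CARD('n) *\<^sub>R gauss x)"
        by (subst (asm) integrable_density) auto
      then have "integrable lborel (\<lambda>\<zeta>::real^'n. \<bar>c\<bar>^CARD('n) *\<^sub>R gauss (c *\<^sub>R \<zeta>))"
        by (subst (asm) integrable_distr_eq) auto
      from integrable_scaleR_right[OF this, of "1 / \<bar>c\<bar>^CARD('n)"] show ?thesis using c by simp
    qed
    have "(\<integral>\<zeta>. fourier f \<zeta> * gauss (c *\<^sub>R \<zeta>) * character (- x) \<zeta> \<partial>lborel)
       = (\<integral>\<zeta>. (\<integral>y. gauss (c *\<^sub>R \<zeta>) * f y * character \<zeta> (y - x) \<partial>lborel) \<partial>lborel)"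
    proof (rule Bochner_Integration.integral_cong[OF refl])
      fix \<zeta>
      have "character \<zeta> (y - x) = character \<zeta> y * character (- x) \<zeta>" for y
        using character_add_right[of \<zeta> y "-x"] by (simp add: character_minus_right character_commute[of "-x"])
      then have "(\<integral>y. gauss (c *\<^sub>R \<zeta>) * f y * character \<zeta> (y - x) \<partial>lborel) =
         (\<integral>y. (gauss (c *\<^sub>R \<zeta>) * character (- x) \<zeta>) * (f y * character \<zeta> y) \<partial>lborel)" by (simp add: mult_ac)
      also have "\<dots> = (gauss (c *\<^sub>R \<zeta>) * character (- x) \<zeta>) * fourier f \<zeta>"
        unfolding fourier_character by (rule integral_mult_right_zero)
      finally show "fourier f \<zeta> * gauss (c *\<^sub>R \<zeta>) * character (- x) \<zeta> = (\<integral>y. gauss (c *\<^sub>R \<zeta>) * f y * character \<zeta> (y - x) \<partial>lborel)"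
        by (simp add: mult_ac)
    qed
    also have "\<dots> = (\<integral>y. (\<integral>\<zeta>. gauss (c *\<^sub>R \<zeta>) * f y * character \<zeta> (y - x) \<partial>lborel) \<partial>lborel)"
      by (rule Fubini_bounded[OF gi fi]) (auto simp: character_def case_prod_beta' intro!: continuous_intros)
    also have "\<dots> = (\<integral>y. f y * (gauss_hat ((1/c) *\<^sub>R (y - x)) / of_real (c^CARD('n))) \<partial>lborel)"
    proof (rule Bochner_Integration.integral_cong[OF refl])
      fix y
      let ?w = "(1/c) *\<^sub>R (y - x)"
      have "of_real (c^CARD('n)) * (\<integral>\<zeta>. gauss (c *\<^sub>R \<zeta>) * character ?w (c *\<^sub>R \<zeta>) \<partial>lborel) = fourier gauss ?w"
        unfolding fourier_character
        using lborel_integral_scale[of "\<lambda>\<zeta>. gauss \<zeta> * character ?w \<zeta>" c 0] c by (simp add: scaleR_conv_of_real)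
      moreover have "character ?w (c *\<^sub>R \<zeta>) = character \<zeta> (y - x)" for \<zeta>
        using c by (simp add: character_def inner_commute)
      ultimately have "(\<integral>\<zeta>. gauss (c *\<^sub>R \<zeta>) * character \<zeta> (y - x) \<partial>lborel) = gauss_hat ?w / of_real (c^CARD('n))"
        using c by (simp add: fourier_gauss field_simps)
      moreover have "(\<integral>\<zeta>. gauss (c *\<^sub>R \<zeta>) * f y * character \<zeta> (y - x) \<partial>lborel) = f y * (\<integral>\<zeta>. gauss (c *\<^sub>R \<zeta>) * character \<zeta> (y - x) \<partial>lborel)"
        unfolding integral_mult_right_zero[symmetric] by (simp add: mult_ac)
      ultimately show "(\<integral>\<zeta>. gauss (c *\<^sub>R \<zeta>) * f y * character \<zeta> (y - x) \<partial>lborel) = f y * (gauss_hat ?w / of_real (c^CARD('n)))"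
        by simp
    qed
    also have "\<dots> = \<bar>c\<bar>^CARD('n) *\<^sub>R (\<integral>z. f (x + c *\<^sub>R z) * (gauss_hat ((1/c) *\<^sub>R (x + c *\<^sub>R z - x)) / of_real (c^CARD('n))) \<partial>lborel)"
      by (rule lborel_integral_scale[OF _ c0, symmetric]) simp
    also have "\<dots> = (\<integral>z. f (x + c *\<^sub>R z) * gauss_hat z \<partial>lborel)"
    proof -
      have "(1/c) *\<^sub>R (x + c *\<^sub>R z - x) = z" for z using c by simp
      moreover have "\<bar>c\<bar>^CARD('n) *\<^sub>R (a * (b / of_real (c^CARD('n)))) = a * b" for a b :: complex
        using c by (simp add: scaleR_conv_of_real)
      ultimately show ?thesis unfolding integral_scaleR_right[symmetric] by (simp only:)
    qed
    finally show ?thesis .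
  qed
  have cg: "continuous_on UNIV (gauss :: real^'n \<Rightarrow> complex)" unfolding gauss_def by (intro continuous_intros) auto
  have "(\<lambda>n. \<integral>\<zeta>. fourier f \<zeta> * gauss (t n *\<^sub>R \<zeta>) * character (- x) \<zeta> \<partial>lborel) \<longlonglongrightarrow> (\<integral>\<zeta>. fourier f \<zeta> * character (- x) \<zeta> \<partial>lborel)"
  proof (rule integral_dominated_convergence)
    show "integrable lborel (\<lambda>\<zeta>. norm (fourier f \<zeta>))" using Fi by simp
    show "AE \<zeta> in lborel. (\<lambda>n. fourier f \<zeta> * gauss (t n *\<^sub>R \<zeta>) * character (- x) \<zeta>) \<longlonglongrightarrow> fourier f \<zeta> * character (- x) \<zeta>"
    proof (rule AE_I2)
      fix \<zeta> :: "real^'n"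
      have "(\<lambda>n. t n *\<^sub>R \<zeta>) \<longlonglongrightarrow> 0 *\<^sub>R \<zeta>" by (intro tendsto_intros t0)
      then have "(\<lambda>n. gauss (t n *\<^sub>R \<zeta>)) \<longlonglongrightarrow> gauss (0::real^'n)"
        using continuous_on_tendsto_compose[OF cg, of _ 0 sequentially] by simp
      then have "(\<lambda>n. fourier f \<zeta> * gauss (t n *\<^sub>R \<zeta>) * character (- x) \<zeta>) \<longlonglongrightarrow> fourier f \<zeta> * gauss (0::real^'n) * character (- x) \<zeta>"
        by (intro tendsto_intros)
      then show "(\<lambda>n. fourier f \<zeta> * gauss (t n *\<^sub>R \<zeta>) * character (- x) \<zeta>) \<longlonglongrightarrow> fourier f \<zeta> * character (- x) \<zeta>"
        by (simp add: gauss_def)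
    qed
    show "AE \<zeta> in lborel. norm (fourier f \<zeta> * gauss (t n *\<^sub>R \<zeta>) * character (- x) \<zeta>) \<le> norm (fourier f \<zeta>)" for n
      using gb by (simp add: norm_mult mult_left_le)
  qed auto
  moreover have "(\<lambda>n. \<integral>z. f (x + t n *\<^sub>R z) * gauss_hat z \<partial>lborel) \<longlonglongrightarrow> (\<integral>(z::real^'n). f x * gauss_hat z \<partial>lborel)"
  proof -
    obtain B where B: "\<And>y. jet_le 0 f y (B / (1 + norm y)^0)" using schwartz_jet[OF f, of 0 0] by metis
    show ?thesis
    proof (rule integral_dominated_convergence)
      show "integrable lborel (\<lambda>z::real^'n. B * norm (gauss_hat z))"
        by (intro integrable_mult_right integrable_norm integrable_gauss_hat)
      show "AE z in lborel. (\<lambda>n. f (x + t n *\<^sub>R z) * gauss_hat z) \<longlonglongrightarrow> f x * gauss_hat z"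
      proof (rule AE_I2)
        fix z :: "real^'n"
        have "(\<lambda>n. x + t n *\<^sub>R z) \<longlonglongrightarrow> x + 0 *\<^sub>R z" by (intro tendsto_intros t0)
        then have l: "(\<lambda>n. x + t n *\<^sub>R z) \<longlonglongrightarrow> x" by simp
        have "(\<lambda>n. f (x + t n *\<^sub>R z)) \<longlonglongrightarrow> f x"
          by (rule continuous_on_tendsto_compose[OF smooth_continuous_on[OF schwartz_smooth[OF f], of UNIV] l]) auto
        then show "(\<lambda>n. f (x + t n *\<^sub>R z) * gauss_hat z) \<longlonglongrightarrow> f x * gauss_hat z" by (intro tendsto_intros)
      qed
      show "AE z in lborel. norm (f (x + t n *\<^sub>R z) * gauss_hat z) \<le> B * norm (gauss_hat z)" for n
        using B by (auto simp: norm_mult intro!: AE_I2 mult_right_mono)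
    qed auto
  qed
  ultimately have "(\<integral>\<zeta>. fourier f \<zeta> * character (- x) \<zeta> \<partial>lborel) = (\<integral>(z::real^'n). f x * gauss_hat z \<partial>lborel)"
    unfolding key[OF t(1)] by (rule LIMSEQ_unique)
  then show ?thesis by (simp add: fourier_character[of "fourier f"] integral_gauss_hat)
qed

text \<open>One factor of the convolution is written as an inverse transform: in the application it is
  prescribed on the frequency side.\<close>

lemma fourier_convolution:
  fixes A g :: "real^'n \<Rightarrow> complex"
  assumes A: "schwartz A" and g: "schwartz g"
  shows "(\<integral>y. fourier A (- y) * g (x - y) \<partial>lborel) = fourier (\<lambda>\<zeta>. A \<zeta> * fourier g \<zeta>) (- x)"
proof -
  have gi: "integrable lborel g" and Ai: "integrable lborel A" using A g schwartz_integrable by auto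
  have g2: "integrable lborel (\<lambda>y. g (x - y))" by (rule schwartz_integrable[OF schwartz_reflect[OF g]])
  have [measurable]: "g \<in> borel_measurable borel" using gi by simp
  have "(\<integral>y. fourier A (- y) * g (x - y) \<partial>lborel) = (\<integral>y. (\<integral>\<zeta>. g (x - y) * A \<zeta> * character \<zeta> (- y) \<partial>lborel) \<partial>lborel)"
    unfolding fourier_character integral_mult_left_zero[symmetric]
    by (simp add: mult_ac character_commute[of "- _"])
  also have "\<dots> = (\<integral>\<zeta>. (\<integral>y. g (x - y) * A \<zeta> * character \<zeta> (- y) \<partial>lborel) \<partial>lborel)"
    by (rule Fubini_bounded[OF g2 Ai]) (auto simp: character_def case_prod_beta' intro!: continuous_intros)
  also have "\<dots> = (\<integral>\<zeta>. A \<zeta> * fourier g \<zeta> * character (- x) \<zeta> \<partial>lborel)"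
  proof (rule Bochner_Integration.integral_cong[OF refl])
    fix \<zeta>
    have "(\<integral>y. g (x - y) * A \<zeta> * character \<zeta> (- y) \<partial>lborel) = (\<integral>y. g (x - y) * A \<zeta> * character \<zeta> ((x - y) - x) \<partial>lborel)" by simp
    also have "\<dots> = (\<integral>w. g w * A \<zeta> * character \<zeta> (w - x) \<partial>lborel)"
      by (rule lborel_integral_reflect[of "\<lambda>w. g w * A \<zeta> * character \<zeta> (w - x)" x]) simp
    also have "\<dots> = (\<integral>w. (A \<zeta> * character (- x) \<zeta>) * (g w * character \<zeta> w) \<partial>lborel)"
    proof -
      have "character \<zeta> (w - x) = character \<zeta> w * character (- x) \<zeta>" for w
        using character_add_right[of \<zeta> w "-x"] by (simp add: character_minus_right character_commute[of "-x"])
      then show ?thesis by (simp add: mult_ac)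
    qed
    also have "\<dots> = (A \<zeta> * character (- x) \<zeta>) * fourier g \<zeta>" unfolding fourier_character by (rule integral_mult_right_zero)
    finally show "(\<integral>y. g (x - y) * A \<zeta> * character \<zeta> (- y) \<partial>lborel) = A \<zeta> * fourier g \<zeta> * character (- x) \<zeta>" by (simp add: mult_ac)
  qed
  finally show ?thesis by (simp add: fourier_character)
qed

lemma character_adjoint: "character \<eta> (h *v w) = character (transpose h *v \<eta>) w"
proof -
  have "(h *v w) \<bullet> \<eta> = w \<bullet> (transpose h *v \<eta>)" by (metis dot_lmul_matrix inner_commute transpose_matrix_vector)
  then show ?thesis by (simp add: character_def)
qed

lemma matrix_inv_mult: "invertible A \<Longrightarrow> matrix_inv A ** A = mat 1" "invertible A \<Longrightarrow> A ** matrix_inv A = mat 1"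
  unfolding invertible_def matrix_inv_def by (rule someI2_ex, assumption, blast)+

lemma schwartz_quasi_regular:
  fixes h :: "real^'n^'n"
  assumes "invertible h" "schwartz \<psi>" shows "schwartz (quasi_regular (y, h) \<psi>)"
proof -
  have "schwartz (\<lambda>z. \<psi> (matrix_inv h *v z + (- (matrix_inv h *v y))))"
    using schwartz_affine[OF matrix_inv_mult(2)[OF assms(1)] assms(2)] .
  from schwartz_cmult[OF this, of "complex_of_real (\<bar>det h\<bar> powr (- 1 / 2))"]
  show ?thesis by (simp add: quasi_regular_def[abs_def] matrix_vector_mult_diff_distrib)
qed

text \<open>On the frequency side \<open>\<pi>(y,h)\<close> acts through the dual action: the support of \<open>fourier \<psi>\<close> is moved by
  the inverse transpose of \<open>h\<close>.\<close>

lemma fourier_quasi_regular: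
  fixes h :: "real^('n::{finite,wellorder})^('n::_)"
  assumes h: "invertible h" and psi: "schwartz \<psi>"
  shows "fourier (quasi_regular (y, h) \<psi>) \<eta> = of_real (\<bar>det h\<bar> powr (1 / 2)) * character \<eta> y * fourier \<psi> (transpose h *v \<eta>)"
proof -
  have d: "\<bar>det h\<bar> > 0" using h invertible_det_nz by auto
  have [measurable]: "quasi_regular (y, h) \<psi> \<in> borel_measurable borel"
    by (intro smooth_measurable schwartz_smooth schwartz_quasi_regular assms)
  let ?c = "complex_of_real (\<bar>det h\<bar> powr (- 1 / 2))"
  have "fourier (quasi_regular (y, h) \<psi>) \<eta> = \<bar>det h\<bar> *\<^sub>R (\<integral>w. quasi_regular (y, h) \<psi> (h *v w + y) * character \<eta> (h *v w + y) \<partial>lborel)"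
    unfolding fourier_character by (rule lborel_integral_affine[OF _ h, symmetric]) simp
  also have "(\<integral>w. quasi_regular (y, h) \<psi> (h *v w + y) * character \<eta> (h *v w + y) \<partial>lborel) =
     (\<integral>w. (?c * character \<eta> y) * (\<psi> w * character (transpose h *v \<eta>) w) \<partial>lborel)"
    by (simp add: quasi_regular_def matrix_vector_mul_assoc matrix_inv_mult[OF h] character_add_right character_adjoint mult_ac)
  also have "\<dots> = (?c * character \<eta> y) * fourier \<psi> (transpose h *v \<eta>)" unfolding fourier_character by (rule integral_mult_right_zero)
  also have "\<bar>det h\<bar> *\<^sub>R ((?c * character \<eta> y) * fourier \<psi> (transpose h *v \<eta>))
      = of_real (\<bar>det h\<bar> * \<bar>det h\<bar> powr (- 1 / 2)) * character \<eta> y * fourier \<psi> (transpose h *v \<eta>)"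
    by (simp add: scaleR_conv_of_real)
  also have "\<bar>det h\<bar> * \<bar>det h\<bar> powr (- 1 / 2) = \<bar>det h\<bar> powr (1 / 2)"
    using d powr_add[of "\<bar>det h\<bar>" 1 "-1/2"] by simp
  finally show ?thesis .
qed

section \<open>Interchanging tempered distributions and integrals\<close>

text \<open>One sequence of quadrature rules serves all functions that are dominated by, and Lipschitz with respect
  to, the weight \<open>w\<close>, and the error depends on the function only through \<open>b\<close>. The nodes are the values of simple
  functions \<open>s m\<close> converging to the identity, so \<open>\<Sum>c. q m c * g c\<close> is the integral of \<open>g \<circ> s m\<close> over the set \<open>G m\<close>.
  The uniformity is the point: for a family of Schwartz functions \<open>F \<eta>\<close> the same rule approximates the integrals
  of all derivatives at all points, that is, it converges in the Schwartz space.\<close>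

lemma quadrature:
  fixes w :: "real^'n \<Rightarrow> real"
  assumes w: "integrable lborel w" and w0: "\<And>\<eta>. 0 \<le> w \<eta>"
  obtains I :: "nat \<Rightarrow> (real^'n) set" and q :: "nat \<Rightarrow> real^'n \<Rightarrow> real" and e :: "nat \<Rightarrow> real" where
    "\<And>m. finite (I m)" "e \<longlonglongrightarrow> 0"
    "\<forall>m (g :: real^'n \<Rightarrow> complex) b. integrable lborel g \<and> (\<forall>\<eta>. norm (g \<eta>) \<le> b * w \<eta>) \<and>
       (\<forall>\<eta> \<eta>'. norm (\<eta>' - \<eta>) \<le> 1 \<longrightarrow> norm (g \<eta>' - g \<eta>) \<le> b * norm (\<eta>' - \<eta>) * w \<eta>) \<longrightarrow>
       norm ((\<integral>\<eta>. g \<eta> \<partial>lborel) - (\<Sum>c\<in>I m. of_real (q m c) * g c)) \<le> b * e m"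
proof -
  have "(\<lambda>\<eta>::real^'n. \<eta>) \<in> borel_measurable borel" by simp
  from borel_measurable_implies_sequence_metric[OF this, of 0] obtain s :: "nat \<Rightarrow> real^'n \<Rightarrow> real^'n"
    where s: "\<And>m. simple_function borel (s m)" "\<And>\<eta>. (\<lambda>m. s m \<eta>) \<longlonglongrightarrow> \<eta>" by auto
  have sm[measurable]: "s m \<in> borel_measurable borel" for m by (rule borel_measurable_simple_function[OF s(1)])
  have [measurable]: "w \<in> borel_measurable borel" using w by simp
  define G where "G m = {\<eta>. norm \<eta> \<le> real m \<and> norm (s m \<eta> - \<eta>) \<le> 1}" for m
  define I where "I m = range (s m)" for m
  define Q where "Q m c = {\<eta> \<in> G m. s m \<eta> = c}" for m c
  define q where "q m c = measure lborel (Q m c)" for m c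
  \<comment> \<open>the integrand of the error, relative to \<open>b * w\<close>: small where the node is close, and \<open>1\<close> on the part that is cut off\<close>
  define k where "k m \<eta> = (if \<eta> \<in> G m then norm (s m \<eta> - \<eta>) else 1)" for m \<eta>
  define e where "e m = (\<integral>\<eta>. k m \<eta> * w \<eta> \<partial>lborel)" for m
  have Gm[measurable]: "G m \<in> sets borel" for m unfolding G_def by measurable
  have Qm[measurable]: "Q m c \<in> sets borel" for m c
  proof -
    have "Q m c = G m \<inter> s m -` {c}" by (auto simp: Q_def)
    then show ?thesis using measurable_sets_borel[OF sm, of "{c}"] by auto
  qed
  have km[measurable]: "k m \<in> borel_measurable borel" for m unfolding k_def by measurable
  have kb: "0 \<le> k m \<eta>" "k m \<eta> \<le> 1" for m \<eta> by (auto simp: k_def G_def)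
  have fin: "finite (I m)" for m using simple_functionD(1)[OF s(1)] by (simp add: I_def)
  have Qfin: "emeasure lborel (Q m c) < \<infinity>" for m c
  proof -
    have "emeasure lborel (Q m c) \<le> emeasure lborel (cball (0::real^'n) (real m))"
      by (intro emeasure_mono) (auto simp: Q_def G_def)
    also have "\<dots> < \<infinity>" by (rule emeasure_lborel_cball_finite)
    finally show ?thesis .
  qed
  have ki: "integrable lborel (\<lambda>\<eta>. k m \<eta> * w \<eta>)" for m
    by (rule Bochner_Integration.integrable_bound[OF w])
       (use kb w0 in \<open>auto intro!: AE_I2 simp: abs_mult mult_left_le_one_le\<close>)
  have "(\<lambda>m. \<integral>\<eta>. k m \<eta> * w \<eta> \<partial>lborel) \<longlonglongrightarrow> (\<integral>\<eta>. 0 \<partial>(lborel :: (real^'n) measure))"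
  proof (rule integral_dominated_convergence[OF _ _ w])
    show "AE \<eta> in lborel. (\<lambda>m. k m \<eta> * w \<eta>) \<longlonglongrightarrow> 0"
    proof (rule AE_I2)
      fix \<eta> :: "real^'n"
      have d0: "(\<lambda>m. norm (s m \<eta> - \<eta>)) \<longlonglongrightarrow> 0" using s(2)[of \<eta>] LIM_zero tendsto_norm_zero by blast
      then have "\<forall>\<^sub>F m in sequentially. norm (s m \<eta> - \<eta>) < 1" by (rule order_tendstoD) simp
      moreover have "\<forall>\<^sub>F m in sequentially. norm \<eta> \<le> real m"
      proof -
        obtain N where "norm \<eta> \<le> real N" using real_arch_simple by blast
        then show ?thesis using eventually_ge_at_top[of N] by (elim eventually_mono) linarith
      qed
      ultimately have "\<forall>\<^sub>F m in sequentially. norm (s m \<eta> - \<eta>) = k m \<eta>"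
        by eventually_elim (auto simp: k_def G_def)
      from Lim_transform_eventually[OF d0 this] have "(\<lambda>m. k m \<eta>) \<longlonglongrightarrow> 0" .
      then show "(\<lambda>m. k m \<eta> * w \<eta>) \<longlonglongrightarrow> 0" by (rule tendsto_mult_left_zero)
    qed
    show "AE \<eta> in lborel. norm (k m \<eta> * w \<eta>) \<le> w \<eta>" for m
      using kb w0 by (auto intro!: AE_I2 simp: abs_mult mult_left_le_one_le)
  qed auto
  then have e0: "e \<longlonglongrightarrow> 0" by (simp add: e_def[abs_def])
  show thesis
  proof (rule that[of I e q, OF fin e0], intro allI impI, elim conjE)
    fix m and g :: "real^'n \<Rightarrow> complex" and b
    assume g: "integrable lborel g" and gb': "\<forall>\<eta>. norm (g \<eta>) \<le> b * w \<eta>"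
      and gL': "\<forall>\<eta> \<eta>'. norm (\<eta>' - \<eta>) \<le> 1 \<longrightarrow> norm (g \<eta>' - g \<eta>) \<le> b * norm (\<eta>' - \<eta>) * w \<eta>"
    note gb = gb'[rule_format] and gL = gL'[rule_format]
    define h where "h \<eta> = (\<Sum>c\<in>I m. indicator (Q m c) \<eta> *\<^sub>R g c)" for \<eta>
    have hi: "integrable lborel h" unfolding h_def
      by (intro Bochner_Integration.integrable_sum integrable_scaleR_left integrable_real_indicator) (use Qfin in auto)
    have "(\<integral>\<eta>. h \<eta> \<partial>lborel) = (\<Sum>c\<in>I m. (\<integral>\<eta>. indicator (Q m c) \<eta> *\<^sub>R g c \<partial>lborel))" unfolding h_def
      by (intro Bochner_Integration.integral_sum integrable_scaleR_left integrable_real_indicator) (use Qfin in auto)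
    also have "\<dots> = (\<Sum>c\<in>I m. of_real (q m c) * g c)"
      using Qfin by (intro sum.cong) (auto simp: q_def scaleR_conv_of_real)
    finally have "norm ((\<integral>\<eta>. g \<eta> \<partial>lborel) - (\<Sum>c\<in>I m. of_real (q m c) * g c)) = norm (\<integral>\<eta>. g \<eta> - h \<eta> \<partial>lborel)"
      using g hi by simp
    also have "\<dots> \<le> (\<integral>\<eta>. norm (g \<eta> - h \<eta>) \<partial>lborel)" by (rule integral_norm_bound)
    also have "\<dots> \<le> (\<integral>\<eta>. b * (k m \<eta> * w \<eta>) \<partial>lborel)"
    proof (rule integral_mono)
      show "integrable lborel (\<lambda>\<eta>. norm (g \<eta> - h \<eta>))" using g hi by simp
      show "integrable lborel (\<lambda>\<eta>. b * (k m \<eta> * w \<eta>))" using ki by simp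
      fix \<eta> :: "real^'n"
      show "norm (g \<eta> - h \<eta>) \<le> b * (k m \<eta> * w \<eta>)"
      proof (cases "\<eta> \<in> G m")
        case True
        have "h \<eta> = (\<Sum>c\<in>I m. if c = s m \<eta> then g c else 0)"
          unfolding h_def by (intro sum.cong) (use True in \<open>auto simp: Q_def indicator_def\<close>)
        also have "\<dots> = g (s m \<eta>)" using fin by (simp add: I_def)
        finally have "norm (g \<eta> - h \<eta>) = norm (g (s m \<eta>) - g \<eta>)" by (simp add: norm_minus_commute)
        also have "\<dots> \<le> b * norm (s m \<eta> - \<eta>) * w \<eta>" by (rule gL) (use True in \<open>simp add: G_def\<close>)
        finally show ?thesis using True by (simp add: k_def mult.assoc)
      next
        case False
        have "h \<eta> = 0" unfolding h_def by (intro sum.neutral) (use False in \<open>auto simp: Q_def\<close>)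
        then show ?thesis using gb[of \<eta>] False by (simp add: k_def)
      qed
    qed
    also have "\<dots> = b * e m" unfolding e_def by (rule integral_mult_right_zero)
    finally show "norm ((\<integral>\<eta>. g \<eta> \<partial>lborel) - (\<Sum>c\<in>I m. of_real (q m c) * g c)) \<le> b * e m" .
  qed
qed

lemma continuous_of_local_Lipschitz:
  fixes g :: "real^'n \<Rightarrow> complex"
  assumes "\<And>\<eta> \<eta>'. norm (\<eta>' - \<eta>) \<le> 1 \<Longrightarrow> norm (g \<eta>' - g \<eta>) \<le> norm (\<eta>' - \<eta>) * w \<eta>"
  shows "continuous_on UNIV g"
proof (rule continuous_at_imp_continuous_on, intro ballI)
  fix \<eta> :: "real^'n"
  have "(g \<longlongrightarrow> g \<eta>) (at \<eta>)"
  proof (rule LIM_zero_cancel, rule Lim_null_comparison)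
    have "\<forall>\<^sub>F \<eta>' in at \<eta>. dist \<eta>' \<eta> < 1" by (simp add: eventually_at) (metis zero_less_one)
    then show "\<forall>\<^sub>F \<eta>' in at \<eta>. norm (g \<eta>' - g \<eta>) \<le> norm (\<eta>' - \<eta>) * w \<eta>"
      by eventually_elim (rule assms, simp add: dist_norm)
    have "((\<lambda>\<eta>'. norm (\<eta>' - \<eta>) * w \<eta>) \<longlongrightarrow> norm (\<eta> - \<eta>) * w \<eta>) (at \<eta>)" by (intro tendsto_intros)
    then show "((\<lambda>\<eta>'. norm (\<eta>' - \<eta>) * w \<eta>) \<longlongrightarrow> 0) (at \<eta>)" by simp
  qed
  then show "isCont g \<eta>" by (simp add: isCont_def)
qed

text \<open>A tempered distribution commutes with finite sums, hence with quadrature sums. These converge in every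
  Schwartz seminorm because \<open>quadrature\<close> applies to the derivatives of \<open>F \<eta>\<close> uniformly in \<open>x\<close>.\<close>

lemma tempered_integral:
  fixes F :: "real^'m \<Rightarrow> real^'n \<Rightarrow> complex"
  assumes u: "tempered_distribution u" and sF: "\<And>\<eta>. schwartz (F \<eta>)"
    and bd: "\<And>k. \<exists>K\<ge>0. (\<forall>\<eta> x. jet_le k (F \<eta>) x (K / (1 + norm \<eta>)^(2 * CARD('m)) / (1 + norm x)^k)) \<and>
       (\<forall>\<eta> \<eta>' x. norm (\<eta>' - \<eta>) \<le> 1 \<longrightarrow>
          jet_le k (\<lambda>x. F \<eta>' x - F \<eta> x) x (norm (\<eta>' - \<eta>) * (K / (1 + norm \<eta>)^(2 * CARD('m))) / (1 + norm x)^k))"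
  shows "schwartz (\<lambda>x. \<integral>\<eta>. F \<eta> x \<partial>lborel)" "integrable lborel (\<lambda>\<eta>. u (F \<eta>))"
    "u (\<lambda>x. \<integral>\<eta>. F \<eta> x \<partial>lborel) = (\<integral>\<eta>. u (F \<eta>) \<partial>lborel)"
proof -
  define w where "w \<eta> = 1 / (1 + norm \<eta>)^(2 * CARD('m))" for \<eta> :: "real^'m"
  have wi: "integrable lborel w" unfolding w_def by (rule integrable_weight)
  have w0: "0 \<le> w \<eta>" for \<eta> by (simp add: w_def add_nonneg_nonneg)
  have smF: "smooth (F \<eta>)" for \<eta> by (rule schwartz_smooth[OF sF])
  have p: "0 < (1 + norm x)^k" "1 \<le> (1 + norm x)^k" for x :: "real^'n" and k
    by (simp_all add: add_pos_nonneg one_le_power)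
  have "\<exists>K. \<forall>k. K k \<ge> 0 \<and> (\<forall>\<eta> x. jet_le k (F \<eta>) x (K k / (1 + norm \<eta>)^(2 * CARD('m)) / (1 + norm x)^k)) \<and>
       (\<forall>\<eta> \<eta>' x. norm (\<eta>' - \<eta>) \<le> 1 \<longrightarrow>
          jet_le k (\<lambda>x. F \<eta>' x - F \<eta> x) x (norm (\<eta>' - \<eta>) * (K k / (1 + norm \<eta>)^(2 * CARD('m))) / (1 + norm x)^k))"
    using bd by (intro choice) blast
  then obtain K where K0: "\<And>k. K k \<ge> 0"
    and K1': "\<And>k \<eta> x. jet_le k (F \<eta>) x (K k / (1 + norm \<eta>)^(2 * CARD('m)) / (1 + norm x)^k)"
    and K2': "\<And>k \<eta> \<eta>' x. norm (\<eta>' - \<eta>) \<le> 1 \<Longrightarrow>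
          jet_le k (\<lambda>x. F \<eta>' x - F \<eta> x) x (norm (\<eta>' - \<eta>) * (K k / (1 + norm \<eta>)^(2 * CARD('m))) / (1 + norm x)^k)"
    by blast
  have K1: "jet_le k (F \<eta>) x (K k * w \<eta> / (1 + norm x)^k)" for k \<eta> x
    using K1' unfolding w_def by simp
  have K2: "jet_le k (\<lambda>x. F \<eta>' x - F \<eta> x) x (norm (\<eta>' - \<eta>) * (K k * w \<eta>) / (1 + norm x)^k)"
    if "norm (\<eta>' - \<eta>) \<le> 1" for k \<eta> \<eta>' x
    using K2'[OF that] unfolding w_def by simp
  have D1: "norm (partial_derivs is (F \<eta>) x) \<le> K k / (1 + norm x)^k * w \<eta>" if "length is \<le> k" for "is" k \<eta> x
    using K1[of k \<eta> x] that unfolding jet_le_def by (simp add: mult_ac)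
  have D2: "norm (partial_derivs is (F \<eta>') x - partial_derivs is (F \<eta>) x) \<le> K k / (1 + norm x)^k * norm (\<eta>' - \<eta>) * w \<eta>"
    if "length is \<le> k" "norm (\<eta>' - \<eta>) \<le> 1" for "is" k \<eta> \<eta>' x
    using K2[OF that(2), of k x] that(1) unfolding jet_le_def by (simp add: partial_derivs_diff smF mult_ac)
  have cont: "continuous_on UNIV (\<lambda>\<eta>. partial_derivs is (F \<eta>) x)" for "is" x
    by (rule continuous_of_local_Lipschitz[of _ "\<lambda>\<eta>. K (length is) / (1 + norm x)^length is * w \<eta>"])
       (use D2[of "is" "length is"] in \<open>simp add: mult_ac\<close>)
  have meas: "(\<lambda>\<eta>. partial_derivs is (F \<eta>) x) \<in> borel_measurable borel" for "is" x
    by (rule borel_measurable_continuous_onI[OF cont])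
  have intD: "integrable lborel (\<lambda>\<eta>. partial_derivs is (F \<eta>) x)" for "is" x
  proof (rule Bochner_Integration.integrable_bound)
    show "integrable lborel (\<lambda>\<eta>. K (length is) / (1 + norm x)^length is * w \<eta>)" using wi by simp
    have "norm (partial_derivs is (F \<eta>) x) \<le> norm (K (length is) / (1 + norm x)^length is * w \<eta>)" for \<eta>
      using order_trans[OF D1[of "is" "length is" \<eta> x] abs_ge_self] by simp
    then show "AE \<eta> in lborel. norm (partial_derivs is (F \<eta>) x) \<le> norm (K (length is) / (1 + norm x)^length is * w \<eta>)" by simp
  qed (use meas in simp)
  have dom: "\<exists>v. integrable lborel v \<and> (\<forall>\<eta> x. norm (partial_derivs is (F \<eta>) x) \<le> v \<eta>)" for "is"
  proof (intro exI[of _ "\<lambda>\<eta>. K (length is) * w \<eta>"] conjI allI)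
    show "integrable lborel (\<lambda>\<eta>. K (length is) * w \<eta>)" using wi by simp
    fix \<eta> x
    have "norm (partial_derivs is (F \<eta>) x) \<le> K (length is) / (1 + norm x)^length is * w \<eta>" by (rule D1) simp
    also have "\<dots> \<le> K (length is) / 1 * w \<eta>"
      using K0 p by (intro mult_right_mono divide_left_mono w0) auto
    finally show "norm (partial_derivs is (F \<eta>) x) \<le> K (length is) * w \<eta>" by simp
  qed
  let ?T = "\<lambda>x. \<integral>\<eta>. F \<eta> x \<partial>lborel"
  note dT = partial_derivs_integral(1)[of F, OF smF meas dom] and smT = partial_derivs_integral(2)[of F, OF smF meas dom]
  define J where "J = (\<integral>\<eta>. w \<eta> \<partial>lborel)"
  have TJ: "norm (partial_derivs is ?T x) \<le> K k * J / (1 + norm x)^k" if "length is \<le> k" for k x "is"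
  proof -
    have "norm (partial_derivs is ?T x) \<le> (\<integral>\<eta>. norm (partial_derivs is (F \<eta>) x) \<partial>lborel)"
      unfolding dT by (rule integral_norm_bound)
    also have "\<dots> \<le> (\<integral>\<eta>. K k / (1 + norm x)^k * w \<eta> \<partial>lborel)"
      using intD wi D1[OF that] by (intro integral_mono) auto
    also have "\<dots> = K k / (1 + norm x)^k * J" unfolding J_def by (rule integral_mult_right_zero)
    finally show ?thesis by simp
  qed
  show sT: "schwartz ?T"
  proof (rule schwartzI[OF smT])
    fix n N
    have "jet_le n ?T x (K (max n N) * J / (1 + norm x)^N)" for x
      unfolding jet_le_def
    proof (intro allI impI)
      fix "is" :: "'n list" assume "length is \<le> n"
      then have "norm (partial_derivs is ?T x) \<le> K (max n N) * J / (1 + norm x)^(max n N)" by (intro TJ) auto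
      also have "\<dots> \<le> K (max n N) * J / (1 + norm x)^N"
        using K0 w0 p by (intro divide_left_mono power_increasing mult_nonneg_nonneg mult_pos_pos)
           (auto simp: J_def intro!: integral_nonneg_AE AE_I2)
      finally show "norm (partial_derivs is ?T x) \<le> K (max n N) * J / (1 + norm x)^N" .
    qed
    then show "\<exists>B. \<forall>x. jet_le n ?T x (B / (1 + norm x)^N)" by blast
  qed
  obtain C k where C: "C \<ge> 0" "\<And>f B. schwartz f \<Longrightarrow> (\<And>x. jet_le k f x (B / (1 + norm x)^k)) \<Longrightarrow> norm (u f) \<le> C * B"
    using tempered_bound[OF u] by metis
  have uF1: "norm (u (F \<eta>)) \<le> (C * K k) * w \<eta>" for \<eta>
    using C(2)[OF sF K1, of \<eta>] by (simp add: mult_ac)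
  have uF2: "norm (u (F \<eta>') - u (F \<eta>)) \<le> (C * K k) * norm (\<eta>' - \<eta>) * w \<eta>" if "norm (\<eta>' - \<eta>) \<le> 1" for \<eta> \<eta>'
    using C(2)[OF schwartz_diff[OF sF sF] K2[OF that]] by (simp add: tempered_diff[OF u sF sF] mult_ac)
  have uc: "continuous_on UNIV (\<lambda>\<eta>. u (F \<eta>))"
    by (rule continuous_of_local_Lipschitz[of _ "\<lambda>\<eta>. C * K k * w \<eta>"]) (use uF2 in \<open>simp add: mult_ac\<close>)
  show ui: "integrable lborel (\<lambda>\<eta>. u (F \<eta>))"
  proof (rule Bochner_Integration.integrable_bound)
    show "integrable lborel (\<lambda>\<eta>. (C * K k) * w \<eta>)" using wi by simp
    show "AE \<eta> in lborel. norm (u (F \<eta>)) \<le> norm ((C * K k) * w \<eta>)"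
      using order_trans[OF uF1 abs_ge_self] by simp
    show "(\<lambda>\<eta>. u (F \<eta>)) \<in> borel_measurable lborel" using borel_measurable_continuous_onI[OF uc] by simp
  qed
  obtain I :: "nat \<Rightarrow> (real^'m) set" and q :: "nat \<Rightarrow> real^'m \<Rightarrow> real" and e :: "nat \<Rightarrow> real" where
    e: "e \<longlonglongrightarrow> 0" and
    quad': "\<forall>m (g :: real^'m \<Rightarrow> complex) b. integrable lborel g \<and> (\<forall>\<eta>. norm (g \<eta>) \<le> b * w \<eta>) \<and>
       (\<forall>\<eta> \<eta>'. norm (\<eta>' - \<eta>) \<le> 1 \<longrightarrow> norm (g \<eta>' - g \<eta>) \<le> b * norm (\<eta>' - \<eta>) * w \<eta>) \<longrightarrow>
       norm ((\<integral>\<eta>. g \<eta> \<partial>lborel) - (\<Sum>c\<in>I m. of_real (q m c) * g c)) \<le> b * e m"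
    by (rule quadrature[OF wi w0], rule that)
  have quad: "norm ((\<integral>\<eta>. g \<eta> \<partial>lborel) - (\<Sum>c\<in>I m. of_real (q m c) * g c)) \<le> b * e m"
    if "integrable lborel g" "\<And>\<eta>. norm (g \<eta>) \<le> b * w \<eta>"
       "\<And>\<eta> \<eta>'. norm (\<eta>' - \<eta>) \<le> 1 \<Longrightarrow> norm (g \<eta>' - g \<eta>) \<le> b * norm (\<eta>' - \<eta>) * w \<eta>" for m and g :: "real^'m \<Rightarrow> complex" and b
    using that by (intro quad'[rule_format]) auto
  have est: "norm (u ?T - (\<integral>\<eta>. u (F \<eta>) \<partial>lborel)) \<le> 2 * (C * K k) * e m" for m
  proof -
    let ?S = "\<lambda>x. \<Sum>c\<in>I m. of_real (q m c) * F c x"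
    have sS: "schwartz ?S" by (intro schwartz_sum schwartz_cmult sF)
    have uS: "u ?S = (\<Sum>c\<in>I m. of_real (q m c) * u (F c))"
      by (simp add: tempered_sum[OF u schwartz_cmult[OF sF]] tempered_cmult[OF u sF])
    have "jet_le k (\<lambda>x. ?T x - ?S x) x (K k * e m / (1 + norm x)^k)" for x
      unfolding jet_le_def
    proof (intro allI impI)
      fix "is" :: "'n list" assume l: "length is \<le> k"
      have "partial_derivs is (\<lambda>x. ?T x - ?S x) x = partial_derivs is ?T x - partial_derivs is ?S x"
        by (rule partial_derivs_diff[OF smT schwartz_smooth[OF sS]])
      also have "partial_derivs is ?S x = (\<Sum>c\<in>I m. of_real (q m c) * partial_derivs is (F c) x)"
        by (simp add: partial_derivs_sum smooth_mult smF partial_derivs_cmult)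
      finally have "norm (partial_derivs is (\<lambda>x. ?T x - ?S x) x) =
         norm ((\<integral>\<eta>. partial_derivs is (F \<eta>) x \<partial>lborel) - (\<Sum>c\<in>I m. of_real (q m c) * partial_derivs is (F c) x))"
        by (simp add: dT)
      also have "\<dots> \<le> K k / (1 + norm x)^k * e m"
        by (rule quad[OF intD D1[OF l] D2[OF l]])
      finally show "norm (partial_derivs is (\<lambda>x. ?T x - ?S x) x) \<le> K k * e m / (1 + norm x)^k" by simp
    qed
    from C(2)[OF schwartz_diff[OF sT sS] this]
    have 1: "norm (u ?T - u ?S) \<le> C * (K k * e m)" by (simp add: tempered_diff[OF u sT sS])
    have 2: "norm ((\<integral>\<eta>. u (F \<eta>) \<partial>lborel) - u ?S) \<le> (C * K k) * e m"
      unfolding uS by (rule quad[OF ui uF1 uF2])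
    have "norm (u ?T - (\<integral>\<eta>. u (F \<eta>) \<partial>lborel)) \<le> norm (u ?T - u ?S) + norm ((\<integral>\<eta>. u (F \<eta>) \<partial>lborel) - u ?S)"
      using norm_triangle_ineq4[of "u ?T - u ?S" "(\<integral>\<eta>. u (F \<eta>) \<partial>lborel) - u ?S"] by simp
    then show ?thesis using 1 2 by simp
  qed
  have "(\<lambda>m. 2 * (C * K k) * e m) \<longlonglongrightarrow> 0" using tendsto_mult_left[OF e] by simp
  then have "norm (u ?T - (\<integral>\<eta>. u (F \<eta>) \<partial>lborel)) \<le> 0" by (rule LIMSEQ_le_const) (use est in auto)
  then show "u ?T = (\<integral>\<eta>. u (F \<eta>) \<partial>lborel)" by simp
qed

lemma schwartz_bound:
  fixes f :: "real^'n \<Rightarrow> complex"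
  assumes "schwartz f" obtains B where "B \<ge> 0" "\<And>x. norm (f x) \<le> B / (1 + norm x)^N"
  using schwartz_jet[OF assms, of 0 N] by auto

text \<open>This is \<open>tempered_integral\<close> for the family \<open>M y * g (x - y)\<close>.\<close>

lemma tempered_convolution:
  fixes M g :: "real^'n \<Rightarrow> complex"
  assumes u: "tempered_distribution u" and M: "schwartz M" and g: "schwartz g"
  shows "integrable lborel (\<lambda>y. M y * u (\<lambda>x. g (x - y)))"
    "u (\<lambda>x. \<integral>y. M y * g (x - y) \<partial>lborel) = (\<integral>y. M y * u (\<lambda>x. g (x - y)) \<partial>lborel)"
proof -
  let ?d = "2 * CARD('n)"
  define F where "F y = (\<lambda>x. M y * g (x - y))" for y
  have sg: "schwartz (\<lambda>x. g (x - y))" for y by (rule schwartz_shift[OF g])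
  have smg: "smooth g" "smooth (\<lambda>x. g (x - y))" for y using g sg schwartz_smooth by auto
  have sF: "schwartz (F y)" for y unfolding F_def by (rule schwartz_cmult[OF sg])
  have uF: "u (F y) = M y * u (\<lambda>x. g (x - y))" for y unfolding F_def by (rule tempered_cmult[OF u sg])
  \<comment> \<open>Peetre's inequality moves the decay from \<open>x - y\<close> to \<open>x\<close>; the powers of \<open>y\<close> are paid for by \<open>M\<close>\<close>
  have peetre: "1 / (1 + norm (x - y))^k \<le> (1 + norm y)^k / (1 + norm x)^k" for x y :: "real^'n" and k
  proof -
    have "1 + norm x \<le> (1 + norm y) * (1 + norm (x - y))"
    proof -
      have "(1 + norm y) * (1 + norm (x - y)) = 1 + (norm y + norm (x - y)) + norm y * norm (x - y)" by (simp add: algebra_simps)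
      moreover have "0 \<le> norm y * norm (x - y)" by simp
      ultimately show ?thesis using norm_triangle_sub[of x y] by linarith
    qed
    then have "(1 + norm x)^k \<le> (1 + norm y)^k * (1 + norm (x - y))^k"
      by (metis power_mult_distrib power_mono add_nonneg_nonneg norm_ge_zero zero_le_one)
    then show ?thesis by (simp add: add_pos_nonneg divide_simps)
  qed
  have bd: "\<exists>K\<ge>0. (\<forall>\<eta> x. jet_le k (F \<eta>) x (K / (1 + norm \<eta>)^?d / (1 + norm x)^k)) \<and>
       (\<forall>\<eta> \<eta>' x. norm (\<eta>' - \<eta>) \<le> 1 \<longrightarrow>
          jet_le k (\<lambda>x. F \<eta>' x - F \<eta> x) x (norm (\<eta>' - \<eta>) * (K / (1 + norm \<eta>)^?d) / (1 + norm x)^k))" for k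
  proof -
    obtain A where A: "A \<ge> 0" "\<And>y. norm (M y) \<le> A / (1 + norm y)^(?d + k)" using schwartz_bound[OF M] by metis
    obtain A' where A': "A' \<ge> 0" "\<And>y y'. norm (y' - y) \<le> 1 \<Longrightarrow> norm (M y' - M y) \<le> A' * norm (y' - y) / (1 + norm y)^(?d + k)"
      using schwartz_Lipschitz[OF M] by metis
    obtain B where B: "B \<ge> 0" "\<And>x. jet_le k g x (B / (1 + norm x)^k)" using schwartz_jet[OF g] by metis
    have "\<exists>B'\<ge>0. \<forall>x y y'. norm (y - y') \<le> 1 \<longrightarrow>
       jet_le k (\<lambda>x. g (x - y') - g (x - y)) x (B' * norm (y - y') / (1 + norm (x - y))^k)"
      by (rule schwartz_shift_Lipschitz[OF g, where n = k and N = k]) auto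
    then obtain B' where B': "B' \<ge> 0" "\<And>x y y'. norm (y - y') \<le> 1 \<Longrightarrow>
       jet_le k (\<lambda>x. g (x - y') - g (x - y)) x (B' * norm (y - y') / (1 + norm (x - y))^k)" by auto
    have gs: "jet_le k (\<lambda>x. g (x - y)) x (B * ((1 + norm y)^k / (1 + norm x)^k))" for x y
    proof (rule jet_le_mono[OF jet_le_shift[OF smg(1) B(2)] order_refl])
      show "B / (1 + norm (x - y))^k \<le> B * ((1 + norm y)^k / (1 + norm x)^k)"
        using mult_left_mono[OF peetre B(1)] by simp
    qed
    have pos: "0 < 1 + norm x" for x :: "real^'n" by (simp add: add_pos_nonneg)
    have cancel: "(a / (1 + norm y)^(?d + k)) * (b * ((1 + norm y)^k / (1 + norm x)^k)) = a * b / (1 + norm y)^?d / (1 + norm x)^k"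
      for a b and x y :: "real^'n"
      using pos[of x] pos[of y] by (simp add: field_simps power_add)
    show ?thesis
    proof (intro exI[of _ "A * B + (A' * (2^k * B) + A * B')"] conjI allI impI)
      show "0 \<le> A * B + (A' * (2^k * B) + A * B')" using A A' B B' by simp
      fix y x :: "real^'n"
      have "jet_le k (F y) x (norm (M y) * (B * ((1 + norm y)^k / (1 + norm x)^k)))"
        unfolding F_def by (rule jet_le_cmult[OF smg(2) gs])
      moreover have "norm (M y) * (B * ((1 + norm y)^k / (1 + norm x)^k)) \<le> (A / (1 + norm y)^(?d + k)) * (B * ((1 + norm y)^k / (1 + norm x)^k))"
        using pos B by (intro mult_right_mono A) (auto simp: less_imp_le)
      moreover have "\<dots> \<le> (A * B + (A' * (2^k * B) + A * B')) / (1 + norm y)^?d / (1 + norm x)^k"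
        unfolding cancel using pos A A' B B' by (intro divide_right_mono) (auto simp: less_imp_le)
      ultimately show "jet_le k (F y) x ((A * B + (A' * (2^k * B) + A * B')) / (1 + norm y)^?d / (1 + norm x)^k)"
        using jet_le_mono[OF _ order_refl] order_trans by blast
      fix y' :: "real^'n" assume y': "norm (y' - y) \<le> 1"
      have y2: "norm (y - y') \<le> 1" using y' by (simp add: norm_minus_commute)
      let ?r = "norm (y' - y)"
      have e: "(\<lambda>x. F y' x - F y x) = (\<lambda>x. (M y' - M y) * g (x - y') + M y * (g (x - y') - g (x - y)))"
        by (auto simp: F_def algebra_simps)
      have g2: "jet_le k (\<lambda>x. g (x - y')) x (2^k * B * ((1 + norm y)^k / (1 + norm x)^k))"
      proof (rule jet_le_mono[OF gs order_refl])
        have "norm y' \<le> norm y + 1" using y' norm_triangle_sub[of y' y] by linarith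
        then have "1 + norm y' \<le> 2 * (1 + norm y)" using norm_ge_zero[of y] by (simp del: norm_ge_zero)
        then have "(1 + norm y')^k \<le> (2 * (1 + norm y))^k" by (rule power_mono) simp
        then have "(1 + norm y')^k \<le> 2^k * (1 + norm y)^k" by (simp only: power_mult_distrib)
        then have "B * ((1 + norm y')^k / (1 + norm x)^k) \<le> B * (2^k * (1 + norm y)^k / (1 + norm x)^k)"
          using pos by (intro mult_left_mono divide_right_mono B) (auto simp: less_imp_le)
        then show "B * ((1 + norm y')^k / (1 + norm x)^k) \<le> 2^k * B * ((1 + norm y)^k / (1 + norm x)^k)" by (simp add: mult_ac)
      qed
      have j1: "jet_le k (\<lambda>x. (M y' - M y) * g (x - y')) x (norm (M y' - M y) * (2^k * B * ((1 + norm y)^k / (1 + norm x)^k)))"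
        by (rule jet_le_cmult[OF smg(2) g2])
      have b1: "norm (M y' - M y) * (2^k * B * ((1 + norm y)^k / (1 + norm x)^k)) \<le>
          (A' * ?r) * (2^k * B) / (1 + norm y)^?d / (1 + norm x)^k"
        unfolding cancel[symmetric] using pos B y' by (intro mult_right_mono A') (auto simp: less_imp_le)
      have d3: "jet_le k (\<lambda>x. g (x - y') - g (x - y)) x (B' * ?r * ((1 + norm y)^k / (1 + norm x)^k))"
      proof (rule jet_le_mono[OF B'(2)[OF y2] order_refl])
        show "B' * norm (y - y') / (1 + norm (x - y))^k \<le> B' * ?r * ((1 + norm y)^k / (1 + norm x)^k)"
          using mult_left_mono[OF peetre, of "B' * ?r"] B'(1) by (simp add: norm_minus_commute)
      qed
      have j2: "jet_le k (\<lambda>x. M y * (g (x - y') - g (x - y))) x (norm (M y) * (B' * ?r * ((1 + norm y)^k / (1 + norm x)^k)))"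
        by (rule jet_le_cmult[OF smooth_diff[OF smg(2) smg(2)] d3])
      have b2: "norm (M y) * (B' * ?r * ((1 + norm y)^k / (1 + norm x)^k)) \<le> A * (B' * ?r) / (1 + norm y)^?d / (1 + norm x)^k"
        unfolding cancel[symmetric] using pos B' by (intro mult_right_mono A) (auto simp: less_imp_le)
      have "jet_le k (\<lambda>x. F y' x - F y x) x (norm (M y' - M y) * (2^k * B * ((1 + norm y)^k / (1 + norm x)^k))
          + norm (M y) * (B' * ?r * ((1 + norm y)^k / (1 + norm x)^k)))"
        unfolding e by (rule jet_le_add[OF smooth_mult[OF smooth_const smg(2)] smooth_mult[OF smooth_const smooth_diff[OF smg(2) smg(2)]] j1 j2])
      note jj = this
      have "norm (M y' - M y) * (2^k * B * ((1 + norm y)^k / (1 + norm x)^k))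
          + norm (M y) * (B' * ?r * ((1 + norm y)^k / (1 + norm x)^k))
         \<le> (A' * ?r) * (2^k * B) / (1 + norm y)^?d / (1 + norm x)^k + A * (B' * ?r) / (1 + norm y)^?d / (1 + norm x)^k"
        by (rule add_mono[OF b1 b2])
      also have "\<dots> = ?r * (A' * (2^k * B) + A * B') / (1 + norm y)^?d / (1 + norm x)^k"
        by (simp add: add_divide_distrib distrib_left mult_ac)
      also have "\<dots> \<le> ?r * (A * B + (A' * (2^k * B) + A * B')) / (1 + norm y)^?d / (1 + norm x)^k"
        using pos A B by (intro divide_right_mono mult_left_mono) (auto simp: less_imp_le)
      finally show "jet_le k (\<lambda>x. F y' x - F y x) x (?r * ((A * B + (A' * (2^k * B) + A * B')) / (1 + norm y)^?d) / (1 + norm x)^k)"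
        using jet_le_mono[OF jj order_refl] by simp
    qed
  qed
  from tempered_integral[OF u sF bd]
  show "integrable lborel (\<lambda>y. M y * u (\<lambda>x. g (x - y)))"
    "u (\<lambda>x. \<integral>y. M y * g (x - y) \<partial>lborel) = (\<integral>y. M y * u (\<lambda>x. g (x - y)) \<partial>lborel)"
    unfolding uF by (simp_all add: F_def)
qed

lemma jet_le_character_power: "jet_le n (character \<eta>) x ((1 + 2 * pi)^n * (1 + norm \<eta>)^n)"
proof (rule jet_le_mono[OF jet_le_character order_refl])
  have "1 + 2 * pi * norm \<eta> \<le> (1 + 2 * pi) * (1 + norm \<eta>)" by (simp add: algebra_simps)
  then show "(1 + 2 * pi * norm \<eta>)^n \<le> (1 + 2 * pi)^n * (1 + norm \<eta>)^n"
    unfolding power_mult_distrib[symmetric] by (rule power_mono) simp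
qed

lemma le_mult_one_add: "0 \<le> X \<Longrightarrow> X \<le> X * (1 + norm x)"
  using mult_left_mono[of 1 "1 + norm x" X] by simp

text \<open>The Fourier transform of the distribution \<open>\<phi>u\<close> is the function \<open>\<eta> \<mapsto> u (\<phi> e\<^sub>\<eta>)\<close>, where \<open>e\<^sub>\<eta>\<close> is the
  character; the second equation is the duality that defines the transform of
  a distribution. It is \<open>tempered_integral\<close> for the family \<open>G \<eta> * \<phi> x * e\<^sub>\<eta> x\<close>.\<close>

lemma tempered_fourier:
  fixes \<phi> G :: "real^'n \<Rightarrow> complex"
  assumes u: "tempered_distribution u" and phi: "schwartz \<phi>" and G: "schwartz G"
  shows "integrable lborel (\<lambda>\<eta>. G \<eta> * u (\<lambda>x. \<phi> x * character \<eta> x))"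
    "u (\<lambda>x. \<phi> x * fourier G x) = (\<integral>\<eta>. G \<eta> * u (\<lambda>x. \<phi> x * character \<eta> x) \<partial>lborel)"
proof -
  let ?d = "2 * CARD('n)"
  define F where "F \<eta> = (\<lambda>x. G \<eta> * (\<phi> x * character \<eta> x))" for \<eta>
  have sc: "schwartz (\<lambda>x. \<phi> x * character \<eta> x)" for \<eta>
    using schwartz_character_mult[OF phi, of \<eta>] by (simp add: mult.commute)
  have sF: "schwartz (F \<eta>)" for \<eta> unfolding F_def by (rule schwartz_cmult[OF sc])
  have uF: "u (F \<eta>) = G \<eta> * u (\<lambda>x. \<phi> x * character \<eta> x)" for \<eta> unfolding F_def by (rule tempered_cmult[OF u sc])
  have smp: "smooth \<phi>" by (rule schwartz_smooth[OF phi])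
  have pos: "0 < 1 + norm x" for x :: "real^'n" by (simp add: add_pos_nonneg)
  have bd: "\<exists>K\<ge>0. (\<forall>\<eta> x. jet_le k (F \<eta>) x (K / (1 + norm \<eta>)^?d / (1 + norm x)^k)) \<and>
       (\<forall>\<eta> \<eta>' x. norm (\<eta>' - \<eta>) \<le> 1 \<longrightarrow>
          jet_le k (\<lambda>x. F \<eta>' x - F \<eta> x) x (norm (\<eta>' - \<eta>) * (K / (1 + norm \<eta>)^?d) / (1 + norm x)^k))" for k
  proof -
    define c :: real where "c = (1 + 2 * pi)^k"
    have c: "c \<ge> 0" unfolding c_def by simp
    obtain A where A: "A \<ge> 0" "\<And>y. norm (G y) \<le> A / (1 + norm y)^(?d + k)" using schwartz_bound[OF G] by metis
    obtain A' where A': "A' \<ge> 0" "\<And>y y'. norm (y' - y) \<le> 1 \<Longrightarrow> norm (G y' - G y) \<le> A' * norm (y' - y) / (1 + norm y)^(?d + k)"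
      using schwartz_Lipschitz[OF G] by metis
    obtain B where B: "B \<ge> 0" "\<And>x. jet_le k \<phi> x (B / (1 + norm x)^Suc k)" using schwartz_jet[OF phi] by metis
    have cancel: "(a / (1 + norm y)^(?d + k)) * (b * (1 + norm y)^k) = a * b / (1 + norm y)^?d"
      for a b and y :: "real^'n" using pos[of y] by (simp add: field_simps power_add)
    have canc2: "2^k * (B / (1 + norm x)^Suc k) * (E / (1 + norm y)^?d * (1 + norm x)) = 2^k * B * E / (1 + norm y)^?d / (1 + norm x)^k"
      for E and x y :: "real^'n" using pos[of x] pos[of y] by (simp add: divide_simps)
    define K where "K = 2^k * B * (A * c + (A' * (2^k * c) + A * (2^k * c * (2 * pi * c))))"
    have K0: "K \<ge> 0" unfolding K_def using A A' B c by simp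
    show ?thesis
    proof (intro exI[of _ K] conjI allI impI K0)
      fix y x :: "real^'n"
      have j0: "jet_le k (\<lambda>x. G y * character y x) x (norm (G y) * (c * (1 + norm y)^k))"
        unfolding c_def by (rule jet_le_cmult[OF smooth_character jet_le_character_power])
      have "norm (G y) * (c * (1 + norm y)^k) \<le> A * c / (1 + norm y)^?d"
        unfolding cancel[symmetric] using pos c by (intro mult_right_mono A) (auto simp: less_imp_le)
      also have "\<dots> \<le> (A * c + (A' * (2^k * c) + A * (2^k * c * (2 * pi * c)))) / (1 + norm y)^?d"
        using pos A A' c by (intro divide_right_mono) (auto simp: less_imp_le)
      also have "\<dots> \<le> (A * c + (A' * (2^k * c) + A * (2^k * c * (2 * pi * c)))) / (1 + norm y)^?d * (1 + norm x)"
        using pos A A' c by (intro le_mult_one_add divide_nonneg_nonneg add_nonneg_nonneg mult_nonneg_nonneg) (auto simp: less_imp_le)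
      finally have j: "jet_le k (\<lambda>x. G y * character y x) x ((A * c + (A' * (2^k * c) + A * (2^k * c * (2 * pi * c)))) / (1 + norm y)^?d * (1 + norm x))"
        using jet_le_mono[OF j0 order_refl] by simp
      have "F y = (\<lambda>x. \<phi> x * (G y * character y x))" unfolding F_def by (auto simp: mult_ac)
      then show "jet_le k (F y) x (K / (1 + norm y)^?d / (1 + norm x)^k)"
        using jet_le_mult[OF smp smooth_mult[OF smooth_const smooth_character] B(2) j] unfolding canc2 K_def by simp
      fix y' :: "real^'n" assume y': "norm (y' - y) \<le> 1"
      let ?r = "norm (y' - y)"
      have ec: "character y' x = character y x * (character (y' - y) x - 1) + character y x" for x
        using character_add[of y "y' - y" x] by (simp add: algebra_simps)
      have e: "(\<lambda>x. F y' x - F y x) = (\<lambda>x. \<phi> x * ((G y' - G y) * character y' x + G y * (character y x * (character (y' - y) x - 1))))"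
      proof
        fix x
        have "F y' x - F y x = \<phi> x * ((G y' - G y) * character y' x + G y * (character y' x - character y x))"
          by (simp add: F_def algebra_simps)
        also have "character y' x - character y x = character y x * (character (y' - y) x - 1)" using ec[of x] by simp
        finally show "F y' x - F y x = \<phi> x * ((G y' - G y) * character y' x + G y * (character y x * (character (y' - y) x - 1)))" .
      qed
      have j1: "jet_le k (\<lambda>x. (G y' - G y) * character y' x) x (norm (G y' - G y) * (c * (1 + norm y')^k))"
        unfolding c_def by (rule jet_le_cmult[OF smooth_character jet_le_character_power])
      have "norm y' \<le> norm y + 1" using y' norm_triangle_sub[of y' y] by linarith
      then have "1 + norm y' \<le> 2 * (1 + norm y)" using norm_ge_zero[of y] by (simp del: norm_ge_zero)
      then have "(1 + norm y')^k \<le> (2 * (1 + norm y))^k" by (rule power_mono) simp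
      then have "(1 + norm y')^k \<le> 2^k * (1 + norm y)^k" by (simp only: power_mult_distrib)
      then have "norm (G y' - G y) * (c * (1 + norm y')^k) \<le> (A' * ?r / (1 + norm y)^(?d + k)) * (c * (2^k * (1 + norm y)^k))"
        using pos c y' by (intro mult_mono A' mult_left_mono) (auto simp: less_imp_le A'(1))
      also have "\<dots> = (A' * ?r / (1 + norm y)^(?d + k)) * ((2^k * c) * (1 + norm y)^k)" by (simp only: mult_ac)
      also have "\<dots> = A' * ?r * (2^k * c) / (1 + norm y)^?d" by (rule cancel)
      also have "\<dots> \<le> A' * ?r * (2^k * c) / (1 + norm y)^?d * (1 + norm x)"
        using pos A' c by (intro le_mult_one_add divide_nonneg_nonneg add_nonneg_nonneg mult_nonneg_nonneg) (auto simp: less_imp_le)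
      finally have j1': "jet_le k (\<lambda>x. (G y' - G y) * character y' x) x (A' * ?r * (2^k * c) / (1 + norm y)^?d * (1 + norm x))"
        using jet_le_mono[OF j1 order_refl] by simp
      have sm2: "smooth (\<lambda>x. character y x * (character (y' - y) x - 1))" "smooth (\<lambda>x. character (y' - y) x - 1)"
        by (intro smooth_mult smooth_diff smooth_character smooth_const)+
      have "jet_le k (\<lambda>x. character y x * (character (y' - y) x - 1)) x (2^k * (c * (1 + norm y)^k) * (2 * pi * c * ?r * (1 + norm x)))"
        unfolding c_def by (rule jet_le_mult[OF smooth_character sm2(2) jet_le_character_power jet_le_character_diff_1[OF y']])
      from jet_le_cmult[OF sm2(1) this]
      have j2: "jet_le k (\<lambda>x. G y * (character y x * (character (y' - y) x - 1))) x
         (norm (G y) * (2^k * (c * (1 + norm y)^k) * (2 * pi * c * ?r * (1 + norm x))))" .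
      have "norm (G y) * (2^k * (c * (1 + norm y)^k) * (2 * pi * c * ?r * (1 + norm x)))
         \<le> (A / (1 + norm y)^(?d + k)) * (2^k * (c * (1 + norm y)^k) * (2 * pi * c * ?r * (1 + norm x)))"
        using pos c by (intro mult_right_mono A) (auto simp: less_imp_le)
      also have "\<dots> = (A / (1 + norm y)^(?d + k)) * ((2^k * c * (2 * pi * c) * ?r * (1 + norm x)) * (1 + norm y)^k)" by (simp only: mult_ac)
      also have "\<dots> = A * (2^k * c * (2 * pi * c) * ?r * (1 + norm x)) / (1 + norm y)^?d" by (rule cancel)
      finally have j2': "jet_le k (\<lambda>x. G y * (character y x * (character (y' - y) x - 1))) x (A * (2^k * c * (2 * pi * c) * ?r * (1 + norm x)) / (1 + norm y)^?d)"
        using jet_le_mono[OF j2 order_refl] by simp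
      have "A' * ?r * (2^k * c) / (1 + norm y)^?d * (1 + norm x) + A * (2^k * c * (2 * pi * c) * ?r * (1 + norm x)) / (1 + norm y)^?d
        = (?r * (A' * (2^k * c) + A * (2^k * c * (2 * pi * c)))) / (1 + norm y)^?d * (1 + norm x)"
        by (simp add: add_divide_distrib distrib_left distrib_right mult_ac)
      also have "\<dots> \<le> (?r * (A * c + (A' * (2^k * c) + A * (2^k * c * (2 * pi * c))))) / (1 + norm y)^?d * (1 + norm x)"
        using pos A c by (intro mult_right_mono divide_right_mono mult_left_mono) (auto simp: less_imp_le)
      finally have "jet_le k (\<lambda>x. (G y' - G y) * character y' x + G y * (character y x * (character (y' - y) x - 1))) x
         ((?r * (A * c + (A' * (2^k * c) + A * (2^k * c * (2 * pi * c))))) / (1 + norm y)^?d * (1 + norm x))"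
        using jet_le_mono[OF jet_le_add[OF smooth_mult[OF smooth_const smooth_character] smooth_mult[OF smooth_const sm2(1)] j1' j2'] order_refl] by simp
      from jet_le_mult[OF smp _ B(2) this]
      have "jet_le k (\<lambda>x. F y' x - F y x) x (2^k * B * (?r * (A * c + (A' * (2^k * c) + A * (2^k * c * (2 * pi * c))))) / (1 + norm y)^?d / (1 + norm x)^k)"
        unfolding e canc2 by (simp add: smooth_add smooth_mult smooth_character sm2)
      moreover have "2^k * B * (?r * (A * c + (A' * (2^k * c) + A * (2^k * c * (2 * pi * c))))) / (1 + norm y)^?d / (1 + norm x)^k
         = ?r * (K / (1 + norm y)^?d) / (1 + norm x)^k" unfolding K_def by (simp only: times_divide_eq_right mult_ac)
      ultimately show "jet_le k (\<lambda>x. F y' x - F y x) x (?r * (K / (1 + norm y)^?d) / (1 + norm x)^k)" by (simp only:)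
    qed
  qed
  have FT: "(\<integral>\<eta>. F \<eta> x \<partial>lborel) = \<phi> x * fourier G x" for x
  proof -
    have "(\<integral>\<eta>. F \<eta> x \<partial>lborel) = (\<integral>\<eta>. \<phi> x * (G \<eta> * character x \<eta>) \<partial>lborel)"
      by (simp add: F_def character_commute[of x] mult_ac)
    also have "\<dots> = \<phi> x * fourier G x" unfolding fourier_character by (rule integral_mult_right_zero)
    finally show ?thesis .
  qed
  from tempered_integral[OF u sF bd]
  show "integrable lborel (\<lambda>\<eta>. G \<eta> * u (\<lambda>x. \<phi> x * character \<eta> x))"
    "u (\<lambda>x. \<phi> x * fourier G x) = (\<integral>\<eta>. G \<eta> * u (\<lambda>x. \<phi> x * character \<eta> x) \<partial>lborel)"
    unfolding uF FT by simp_all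
qed

section \<open>Bump functions\<close>

text \<open>The functions \<open>p (1/t) exp (-1/t)\<close>, extended by zero, form a family that is closed under
  differentiation, so their smoothness is an induction over all polynomials \<open>p\<close>.\<close>

definition flat_exp :: "real poly \<Rightarrow> real \<Rightarrow> real" where
  "flat_exp p t = (if t > 0 then poly p (1 / t) * exp (- 1 / t) else 0)"

text \<open>The derivative of \<open>p (1/t) exp (-1/t)\<close> is \<open>t\<^sup>-\<^sup>2 (p - p') (1/t) exp (-1/t)\<close>.\<close>

definition flat_step :: "real poly \<Rightarrow> real poly" where
  "flat_step p = [:0, 0, 1:] * (p - pderiv p)"

lemma poly_exp_tendsto_0: "((\<lambda>s. poly p s * exp (- s)) \<longlongrightarrow> (0::real)) at_top"
proof -
  have "((\<lambda>s. \<Sum>i\<le>degree p. coeff p i * (s ^ i / exp s)) \<longlongrightarrow> (\<Sum>i\<le>degree p. coeff p i * 0)) at_top"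
    by (intro tendsto_intros tendsto_power_div_exp_0)
  then show ?thesis by (simp add: poly_altdef exp_minus divide_inverse sum_distrib_right mult.assoc)
qed

lemma has_derivative_flat_exp: "(flat_exp p has_real_derivative flat_exp (flat_step p) t) (at t)"
proof -
  consider "t > 0" | "t < 0" | "t = 0" by linarith
  then show ?thesis
  proof cases
    case 1
    have "((\<lambda>t. poly p (1 / t) * exp (- 1 / t)) has_real_derivative flat_exp (flat_step p) t) (at t)"
      using 1 by (auto intro!: derivative_eq_intros simp: flat_exp_def flat_step_def field_simps power2_eq_square)
    moreover have ev: "\<forall>\<^sub>F s in nhds t. poly p (1 / s) * exp (- 1 / s) = flat_exp p s"
      using eventually_nhds_in_open[of "{0<..}" t] 1 by (auto elim!: eventually_mono simp: flat_exp_def)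
    ultimately show ?thesis by (simp only: DERIV_cong_ev[OF refl ev refl])
  next
    case 2
    have "((\<lambda>t. 0) has_real_derivative flat_exp (flat_step p) t) (at t)" using 2 by (simp add: flat_exp_def)
    moreover have ev: "\<forall>\<^sub>F s in nhds t. 0 = flat_exp p s"
      using eventually_nhds_in_open[of "{..<0}" t] 2 by (auto elim!: eventually_mono simp: flat_exp_def)
    ultimately show ?thesis by (simp only: DERIV_cong_ev[OF refl ev refl])
  next
    case 3
    have R: "((\<lambda>h. flat_exp p h / h) \<longlongrightarrow> 0) (at_right 0)"
    proof -
      have "((\<lambda>h. poly (p * [:0, 1:]) (inverse h) * exp (- inverse h)) \<longlongrightarrow> 0) (at_right (0::real))"
        by (rule filterlim_compose[OF poly_exp_tendsto_0 filterlim_inverse_at_top_right])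
      then show ?thesis
        by (rule Lim_transform_eventually) (auto simp: eventually_at_filter flat_exp_def field_simps)
    qed
    have L: "((\<lambda>h. flat_exp p h / h) \<longlongrightarrow> 0) (at_left 0)"
      by (rule Lim_transform_eventually[OF tendsto_const]) (auto simp: eventually_at_filter flat_exp_def)
    have "((\<lambda>h. flat_exp p h / h) \<longlongrightarrow> 0) (at 0)" using filterlim_split_at[OF L R] .
    then show ?thesis using 3 by (simp add: DERIV_def flat_exp_def)
  qed
qed

lemma smooth_coordinate: "smooth (\<lambda>x. of_real (x $ i))"
proof -
  have "smooth (\<lambda>x. (1 / (-2 * pi * \<i>)) * deriv_symbol i x)" by (intro smooth_mult smooth_const smooth_deriv_symbol)
  then show ?thesis by (simp add: deriv_symbol_def)
qed

lemma has_derivative_radial: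
  "((\<lambda>x. s * (K - (norm (x - a))\<^sup>2)) has_derivative (\<lambda>v. s * (- 2 * ((x - a) \<bullet> v)))) (at x)" for a :: "real^'n"
  unfolding power2_norm_eq_inner by (auto intro!: derivative_eq_intros simp: inner_commute algebra_simps)

lemma has_derivative_flat_radial:
  fixes a :: "real^'n"
  shows "((\<lambda>x. complex_of_real (flat_exp p (s * (K - (norm (x - a))\<^sup>2)))) has_derivative
    (\<lambda>v. of_real (s * (- 2 * ((x - a) \<bullet> v)) * flat_exp (flat_step p) (s * (K - (norm (x - a))\<^sup>2))))) (at x)"
  using bounded_linear.has_derivative[OF bounded_linear_of_real
    diff_chain_at[OF has_derivative_radial has_derivative_flat_exp[unfolded has_field_derivative_def]]]
  by (simp add: o_def mult_ac)

lemma smooth_flat_radial: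
  fixes a :: "real^'n"
  shows "smooth (\<lambda>x. of_real (flat_exp p (s * (K - (norm (x - a))\<^sup>2))))"
proof -
  have "Ck n (\<lambda>x. complex_of_real (flat_exp p (s * (K - (norm (x - a))\<^sup>2))))" for n p
  proof (induction n arbitrary: p)
    case 0 show ?case using has_derivative_flat_radial[of p s K a] by (auto simp: differentiable_def)
  next
    case (Suc n)
    have d: "partial_deriv i (\<lambda>x. complex_of_real (flat_exp p (s * (K - (norm (x - a))\<^sup>2)))) =
       (\<lambda>x. (of_real (- 2 * s) * of_real ((x - a) $ i)) * of_real (flat_exp (flat_step p) (s * (K - (norm (x - a))\<^sup>2))))" for i
      by (rule ext, subst partial_deriv_eq[OF has_derivative_flat_radial]) (simp add: inner_axis algebra_simps)
    have c: "Ck n (\<lambda>x. complex_of_real ((x - a) $ i))" for i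
      using smooth_shift[OF smooth_coordinate] unfolding smooth_iff_Ck by blast
    have "\<forall>x. (\<lambda>x. complex_of_real (flat_exp p (s * (K - (norm (x - a))\<^sup>2)))) differentiable (at x)"
      using has_derivative_flat_radial[of p s K a] unfolding differentiable_def by blast
    then show ?case unfolding Ck.simps d by (intro conjI allI Ck_mult Ck_const c Suc) auto
  qed
  then show ?thesis by (simp add: smooth_iff_Ck)
qed

lemma smooth_inverse:
  fixes q :: "real^'n \<Rightarrow> complex"
  assumes q: "smooth q" and nz: "\<And>x. q x \<noteq> 0"
  shows "smooth (\<lambda>x. inverse (q x))"
proof -
  have d: "((\<lambda>x. inverse (q x)) has_derivative (\<lambda>v. - (inverse (q x) * (\<Sum>i\<in>UNIV. of_real (v $ i) * partial_deriv i q x) * inverse (q x)))) (at x)" for x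
    by (rule Deriv.has_derivative_inverse[OF nz smooth_has_derivative[OF q]])
  have pd: "partial_deriv i (\<lambda>x. inverse (q x)) = (\<lambda>x. (-1) * (inverse (q x) * partial_deriv i q x * inverse (q x)))" for i
    using partial_deriv_eq[OF d, of i] partial_deriv_eq[OF smooth_has_derivative[OF q], of i] by auto
  have "Ck n (\<lambda>x. inverse (q x))" for n
  proof (induction n)
    case 0 then show ?case using d by (auto simp: differentiable_def)
  next
    case (Suc n)
    have "\<forall>x. (\<lambda>x. inverse (q x)) differentiable (at x)" using d unfolding differentiable_def by blast
    moreover have "Ck n (partial_deriv i q)" for i using smooth_partial_deriv[OF q] smooth_iff_Ck by blast
    ultimately show ?case unfolding Ck.simps pd by (intro conjI allI Ck_mult Ck_const Suc) auto
  qed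
  then show ?thesis by (simp add: smooth_iff_Ck)
qed

text \<open>The quotient \<open>g1 / (g1 + g2)\<close>, where \<open>g1\<close> is positive exactly inside radius \<open>R\<close> and \<open>g2\<close> exactly
  outside radius \<open>r\<close>.\<close>

lemma plateau_function:
  fixes a :: "real^'n"
  assumes r: "0 < r" "r < R"
  obtains b :: "real^'n \<Rightarrow> complex" where "test_function b" "\<And>x. norm (x - a) \<le> r \<Longrightarrow> b x = 1"
    "\<And>x. norm (x - a) \<ge> R \<Longrightarrow> b x = 0" "\<And>x. \<exists>t. b x = of_real t \<and> 0 \<le> t \<and> t \<le> 1"
proof -
  define g1 where "g1 x = flat_exp 1 (1 * (R\<^sup>2 - (norm (x - a))\<^sup>2))" for x
  define g2 where "g2 x = flat_exp 1 ((-1) * (r\<^sup>2 - (norm (x - a))\<^sup>2))" for x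
  define b where "b x = complex_of_real (g1 x) * inverse (of_real (g1 x) + of_real (g2 x))" for x
  have g0: "g1 x \<ge> 0" "g2 x \<ge> 0" for x by (auto simp: g1_def g2_def flat_exp_def)
  have g1p: "g1 x > 0 \<longleftrightarrow> norm (x - a) < R" for x
    using r power_mono_iff[of R "norm (x - a)" 2] by (auto simp: g1_def flat_exp_def not_le[symmetric])
  have g2p: "g2 x > 0 \<longleftrightarrow> r < norm (x - a)" for x
    using r power_mono_iff[of "norm (x - a)" r 2] by (auto simp: g2_def flat_exp_def not_le[symmetric])
  have s: "g1 x + g2 x > 0" for x
    using g1p[of x] g2p[of x] g0[of x] r by (cases "norm (x - a) < R") (auto simp: add_pos_nonneg add_nonneg_pos)
  have nz: "complex_of_real (g1 x) + of_real (g2 x) \<noteq> 0" for x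
    using s[of x] by (metis less_irrefl of_real_add of_real_eq_0_iff)
  have sm1: "smooth (\<lambda>x. complex_of_real (g1 x))" unfolding g1_def by (rule smooth_flat_radial)
  have sm2: "smooth (\<lambda>x. complex_of_real (g2 x))" unfolding g2_def by (rule smooth_flat_radial)
  have sm: "smooth b" unfolding b_def[abs_def] by (intro smooth_mult sm1 smooth_inverse smooth_add sm2 nz)
  have b0: "b x = 0" if "norm (x - a) \<ge> R" for x
    using g1p[of x] g0(1)[of x] that by (auto simp: b_def)
  have "{x. b x \<noteq> 0} \<subseteq> cball a R" using b0 by (force simp: dist_norm norm_minus_commute)
  then have "supp b \<subseteq> cball a R" unfolding supp_def by (simp add: closure_minimal)
  then have "compact (supp b)" unfolding supp_def by (metis bounded_cball bounded_subset closed_closure compact_eq_bounded_closed)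
  with sm have tf: "test_function b" by (simp add: test_function_def)
  have b1: "b x = 1" if "norm (x - a) \<le> r" for x
  proof -
    have "g2 x = 0" using g2p[of x] g0(2)[of x] that by auto
    then show ?thesis using nz[of x] by (simp add: b_def)
  qed
  have "\<exists>t. b x = of_real t \<and> 0 \<le> t \<and> t \<le> 1" for x
  proof (intro exI conjI)
    show "b x = of_real (g1 x / (g1 x + g2 x))" by (simp add: b_def divide_inverse)
    show "0 \<le> g1 x / (g1 x + g2 x)" "g1 x / (g1 x + g2 x) \<le> 1" using g0[of x] s[of x] by auto
  qed
  then show thesis using that[OF tf b1 b0] by blast
qed

section \<open>Wavelet decay at regular directed points\<close>

text \<open>The decay estimates gain arbitrary powers of \<open>op_norm h\<close>, so a loss of a fixed negative power is harmless.
  The predicate says that the normalizing factor of \<open>\<pi>(y,h)\<close> and the chain rule constant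
  \<open>1 + CARD('n) * op_norm (matrix_inv h)\<close> lose no more than \<open>p\<close> powers.\<close>

definition controlled :: "real \<Rightarrow> nat \<Rightarrow> real^'n^'n \<Rightarrow> bool" where
  "controlled K p h \<longleftrightarrow> invertible h \<and> op_norm h \<le> K \<and> \<bar>det h\<bar> powr (- 1 / 2) * op_norm h ^ p \<le> K \<and>
     (1 + real CARD('n) * op_norm (matrix_inv h)) * op_norm h ^ p \<le> K"

lemma norm_transpose_le: "norm (transpose h *v \<eta>) \<le> op_norm h * norm \<eta>"
proof -
  let ?w = "transpose h *v \<eta>"
  have "(norm ?w)\<^sup>2 = ?w \<bullet> ?w" by (simp add: power2_norm_eq_inner)
  also have "\<dots> = \<eta> \<bullet> (h *v ?w)" by (metis dot_lmul_matrix transpose_matrix_vector)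
  also have "\<dots> \<le> norm \<eta> * norm (h *v ?w)" by (rule norm_cauchy_schwarz)
  also have "\<dots> \<le> norm \<eta> * (op_norm h * norm ?w)" by (intro mult_left_mono op_norm) auto
  finally have "norm ?w * norm ?w \<le> (op_norm h * norm \<eta>) * norm ?w" by (simp add: power2_eq_square mult_ac)
  then show ?thesis using op_norm_nonneg[of h] by (cases "norm ?w = 0") (auto simp: mult_le_cancel_right)
qed

lemma norm_le_op_norm_inverse:
  assumes "invertible h" shows "norm w \<le> op_norm h * norm (matrix_inv h *v w)"
proof -
  have "w = h *v (matrix_inv h *v w)" by (simp add: matrix_vector_mul_assoc matrix_inv_mult assms)
  then show ?thesis using op_norm[of h "matrix_inv h *v w"] by simp
qed

lemma transpose_inverse:
  fixes h :: "real^'n^'n"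
  assumes "invertible h"
  shows "transpose h ** transpose (matrix_inv h) = mat 1" "transpose (matrix_inv h) ** transpose h = mat 1"
  by (simp_all add: matrix_transpose_mul[symmetric] matrix_inv_mult assms transpose_mat)

lemma invertible_transpose:
  fixes h :: "real^'n^'n"
  assumes "invertible h" shows "invertible (transpose h)"
  using transpose_inverse[OF assms] unfolding invertible_def by blast

lemma op_norm_pos:
  fixes h :: "real^'n^'n"
  assumes "invertible h" shows "0 < op_norm h"
proof -
  obtain i :: 'n where True by simp
  have "norm (axis i (1::real)) \<le> op_norm h * norm (matrix_inv h *v axis i 1)" by (rule norm_le_op_norm_inverse[OF assms])
  then have "op_norm h \<noteq> 0" by auto
  then show ?thesis using op_norm_nonneg[of h] by simp
qed

lemma cnj_fourier: "cnj (fourier f \<xi>) = fourier (\<lambda>x. cnj (f x)) (- \<xi>)"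
proof -
  have "(\<integral>x. cnj (f x) * character (- \<xi>) x \<partial>lborel) = (\<integral>x. cnj (f x * character \<xi> x) \<partial>lborel)" by (simp add: cnj_character)
  then show ?thesis unfolding fourier_character by (simp only: Bochner_Integration.integral_cnj)
qed

lemma inverse_power_le:
  fixes s r w :: real
  assumes "0 < s" "0 < r" "r \<le> s * w" "0 \<le> w"
  shows "1 / (1 + w)^N \<le> (s / r)^N"
proof -
  have "r \<le> s * (1 + w)" unfolding distrib_left using assms by linarith
  then have "1 / (1 + w) \<le> s / r" using assms by (simp add: divide_simps mult_ac)
  then have "(1 / (1 + w))^N \<le> (s / r)^N" using assms by (intro power_mono) auto
  then show ?thesis by (simp add: power_one_over)
qed

lemma jet_le_local_zero:
  assumes "open U" "x \<in> U" "\<And>y. y \<in> U \<Longrightarrow> f y = 0" "0 \<le> B"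
  shows "jet_le n f x B"
  by (rule jet_le_local[OF assms(1-3) jet_le_const]) (use assms(4) in simp_all)

text \<open>The pairing is the integral of the Fourier transform of \<open>\<phi>u\<close> against that of \<open>\<pi>(y,h)\<psi>\<close>. The latter lives on
  the dual translate of \<open>V\<close>, where \<open>norm \<eta>\<close> is at least \<open>c / op_norm h\<close>; there the rapid decay on \<open>\<Gamma>\<close> turns into
  powers of \<open>op_norm h\<close>.\<close>

lemma wavelet_localized_part:
  fixes u :: "(real^('n::{finite,wellorder}) \<Rightarrow> complex) \<Rightarrow> complex" and V :: "(real^('n::_)) set"
  assumes u: "tempered_distribution u" and psi: "schwartz \<psi>"
    and supp: "\<And>\<eta>. fourier \<psi> \<eta> \<noteq> 0 \<Longrightarrow> \<eta> \<in> V" and c: "c > 0" "\<And>v. v \<in> V \<Longrightarrow> c \<le> norm v"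
    and phi: "schwartz \<phi>"
    and dec: "\<And>\<eta>. \<eta> \<in> \<Gamma> \<Longrightarrow> norm (fourier_localized \<phi> u \<eta>) \<le> C / (1 + norm \<eta>)^(N + p)" and C: "C \<ge> 0"
    and h: "controlled K p h" and hV: "\<And>v. v \<in> V \<Longrightarrow> transpose (matrix_inv h) *v v \<in> \<Gamma>"
  shows "norm (u (\<lambda>x. \<phi> x * cnj (quasi_regular (y, h) \<psi> x)))
     \<le> C / c^(N + p) * K * (\<integral>\<eta>. norm (fourier \<psi> \<eta>) \<partial>lborel) * op_norm h ^ N"
proof -
  let ?s = "op_norm h" and ?I = "\<integral>\<eta>. norm (fourier \<psi> \<eta>) \<partial>lborel"
  have inv: "invertible h" using h by (simp add: controlled_def)
  have s: "?s > 0" by (rule op_norm_pos[OF inv])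
  have d0: "\<bar>det h\<bar> > 0" using inv invertible_det_nz by auto
  have tinv: "invertible (transpose h)" by (rule invertible_transpose[OF inv])
  let ?q = "quasi_regular (y, h) \<psi>"
  have sq: "schwartz ?q" by (rule schwartz_quasi_regular[OF inv psi])
  define G where "G \<zeta> = cnj (fourier ?q \<zeta>)" for \<zeta>
  have sG: "schwartz G" unfolding G_def by (intro schwartz_cnj schwartz_fourier sq)
  have g: "cnj (?q x) = fourier G x" for x
    using cnj_fourier[of "fourier ?q" "- x"] fourier_inversion[OF sq, of x] by (simp add: G_def[abs_def])
  have nG: "norm (G \<eta>) = \<bar>det h\<bar> powr (1 / 2) * norm (fourier \<psi> (transpose h *v \<eta>))" for \<eta>
    unfolding G_def fourier_quasi_regular[OF inv psi] by (simp add: norm_mult)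
  have Gi: "integrable lborel G" by (rule schwartz_integrable[OF sG])
  have L: "norm (G \<eta> * u (\<lambda>x. \<phi> x * character \<eta> x)) \<le> norm (G \<eta>) * (C * (?s / c)^(N + p))" for \<eta>
  proof (cases "G \<eta> = 0")
    case False
    then have "transpose h *v \<eta> \<in> V" using nG[of \<eta>] supp by force
    then have 1: "c \<le> norm (transpose h *v \<eta>)" and 2: "transpose (matrix_inv h) *v (transpose h *v \<eta>) \<in> \<Gamma>" using c hV by auto
    have "transpose (matrix_inv h) *v (transpose h *v \<eta>) = \<eta>"
      by (simp only: matrix_vector_mul_assoc transpose_inverse(2)[OF inv] matrix_vector_mul_lid)
    then have "norm (fourier_localized \<phi> u \<eta>) \<le> C / (1 + norm \<eta>)^(N + p)" using dec 2 by simp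
    also have "\<dots> = C * (1 / (1 + norm \<eta>)^(N + p))" by simp
    also have "\<dots> \<le> C * (?s / c)^(N + p)"
      using norm_transpose_le[of h \<eta>] 1 s c by (intro mult_left_mono inverse_power_le C) auto
    finally show ?thesis unfolding norm_mult fourier_localized_def character_def by (rule mult_left_mono) simp
  qed simp
  have "norm (u (\<lambda>x. \<phi> x * cnj (?q x))) = norm (\<integral>\<eta>. G \<eta> * u (\<lambda>x. \<phi> x * character \<eta> x) \<partial>lborel)"
    unfolding g tempered_fourier(2)[OF u phi sG] ..
  also have "\<dots> \<le> (\<integral>\<eta>. norm (G \<eta> * u (\<lambda>x. \<phi> x * character \<eta> x)) \<partial>lborel)" by (rule integral_norm_bound)
  also have "\<dots> \<le> (\<integral>\<eta>. norm (G \<eta>) * (C * (?s / c)^(N + p)) \<partial>lborel)"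
    using L Gi tempered_fourier(1)[OF u phi sG] by (intro integral_mono integrable_mult_left integrable_norm) auto
  also have "\<dots> = (\<integral>\<eta>. norm (G \<eta>) \<partial>lborel) * (C * (?s / c)^(N + p))" by (rule integral_mult_left_zero)
  also have "(\<integral>\<eta>. norm (G \<eta>) \<partial>lborel) = \<bar>det h\<bar> powr (- 1 / 2) * ?I"
  proof -
    have [measurable]: "fourier \<psi> \<in> borel_measurable borel" by (intro smooth_measurable smooth_fourier psi)
    have "\<bar>det h\<bar> * (\<integral>\<eta>. norm (fourier \<psi> (transpose h *v \<eta> + 0)) \<partial>lborel) = ?I"
      using lborel_integral_affine[of "\<lambda>\<eta>. norm (fourier \<psi> \<eta>)" "transpose h" 0] tinv by (simp add: det_transpose)
    then have "(\<integral>\<eta>. norm (fourier \<psi> (transpose h *v \<eta>)) \<partial>lborel) = ?I / \<bar>det h\<bar>" using d0 by (simp add: field_simps)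
    then have "(\<integral>\<eta>. norm (G \<eta>) \<partial>lborel) = (\<bar>det h\<bar> powr (1 / 2) / \<bar>det h\<bar>) * ?I" unfolding nG by simp
    also have "\<bar>det h\<bar> powr (1 / 2) / \<bar>det h\<bar> = \<bar>det h\<bar> powr (- 1 / 2)"
      using d0 powr_diff[of "\<bar>det h\<bar>" "1/2" 1] by simp
    finally show ?thesis .
  qed
  also have "\<bar>det h\<bar> powr (- 1 / 2) * ?I * (C * (?s / c)^(N + p)) = (\<bar>det h\<bar> powr (- 1 / 2) * ?s^p) * (C / c^(N + p) * ?I * ?s^N)"
    by (simp add: power_divide power_add)
  also have "\<dots> \<le> K * (C / c^(N + p) * ?I * ?s^N)"
    using h C c s by (intro mult_right_mono mult_nonneg_nonneg divide_nonneg_nonneg) (auto simp: controlled_def intro!: integral_nonneg_AE)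
  finally show ?thesis by (simp add: mult_ac)
qed

text \<open>For \<open>y\<close> near \<open>x\<close> the factor \<open>1 - \<phi>\<close> vanishes unless \<open>norm (z - y) \<ge> 2 \<delta>\<close>, and then \<open>\<psi>\<close> is evaluated at a
  point of norm at least \<open>norm (z - y) / op_norm h\<close>. Its rapid decay yields powers of \<open>op_norm h\<close> and decay in \<open>z\<close>.\<close>

lemma wavelet_far_part:
  fixes u :: "(real^'n \<Rightarrow> complex) \<Rightarrow> complex"
  assumes u: "tempered_distribution u" and psi: "schwartz \<psi>" and phi: "schwartz \<phi>"
    and \<delta>: "\<delta> > 0" and one: "\<And>z. norm (z - x) < 3 * \<delta> \<Longrightarrow> \<phi> z = 1"
  shows "\<exists>C\<ge>0. \<forall>y h. norm (y - x) < \<delta> \<and> controlled K p h \<longrightarrow>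
     norm (u (\<lambda>z. (1 - \<phi> z) * cnj (quasi_regular (y, h) \<psi> z))) \<le> C * op_norm h ^ N"
proof -
  let ?n = "real CARD('n)"
  obtain C k where C: "C \<ge> 0" "\<And>f B. schwartz f \<Longrightarrow> (\<And>x. jet_le k f x (B / (1 + norm x)^k)) \<Longrightarrow> norm (u f) \<le> C * B"
    using tempered_bound[OF u] by metis
  \<comment> \<open>\<open>N\<close> powers for the claim; \<open>p * k\<close> and \<open>p\<close> powers for the chain rule constant and the normalizing factor of the wavelet\<close>
  define M where "M = N + (p * k + p)"
  obtain B where B: "B \<ge> 0" "\<And>x. jet_le k \<psi> x (B / (1 + norm x)^(M + k))" using schwartz_jet[OF psi] by metis
  obtain A where A: "A \<ge> 0" "\<And>x. jet_le k \<phi> x (A / (1 + norm x)^0)" using schwartz_jet[OF phi] by metis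
  define c3 where "c3 = 1 + (1 + norm x + \<delta>) / (2 * \<delta>)"
  define Q where "Q = 2^k * (1 + A) * B * (1 / (2 * \<delta>))^M * c3^k * \<bar>K\<bar>^k * \<bar>K\<bar>^k * \<bar>K\<bar>"
  have c3: "c3 \<ge> 0" unfolding c3_def using \<delta> by simp
  have Q0: "Q \<ge> 0" unfolding Q_def using A B c3 \<delta> by simp
  have "norm (u (\<lambda>z. (1 - \<phi> z) * cnj (quasi_regular (y, h) \<psi> z))) \<le> C * (Q * op_norm h ^ N)"
    if y: "norm (y - x) < \<delta>" and h: "controlled K p h" for y h
  proof (rule C(2))
    let ?s = "op_norm h" and ?d = "\<bar>det h\<bar> powr (- 1 / 2)" and ?t = "1 + ?n * op_norm (matrix_inv h)"
    have inv: "invertible h" using h by (simp add: controlled_def)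
    have s: "?s > 0" by (rule op_norm_pos[OF inv])
    have K: "?s \<le> K" "?d * ?s^p \<le> K" "?t * ?s^p \<le> K" using h by (simp_all add: controlled_def)
    have t0: "?t \<ge> 0" using op_norm_nonneg[of "matrix_inv h"] by simp
    have sq: "schwartz (quasi_regular (y, h) \<psi>)" by (rule schwartz_quasi_regular[OF inv psi])
    have scq: "schwartz (\<lambda>z. cnj (quasi_regular (y, h) \<psi> z))" by (rule schwartz_cnj[OF sq])
    have s1p: "smooth (\<lambda>z. 1 - \<phi> z)" by (intro smooth_diff smooth_const schwartz_smooth phi)
    have j1p: "jet_le k (\<lambda>z. 1 - \<phi> z) z (1 + A)" for z
      using jet_le_diff[OF smooth_const schwartz_smooth[OF phi], of k 1 z 1 A] A(2)[of z] by (simp add: jet_le_const)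
    show "schwartz (\<lambda>z. (1 - \<phi> z) * cnj (quasi_regular (y, h) \<psi> z))"
    proof (rule schwartz_mult_bounded[OF scq s1p])
      fix n
      obtain A' where A': "A' \<ge> 0" "\<And>x. jet_le n \<phi> x (A' / (1 + norm x)^0)" using schwartz_jet[OF phi] by metis
      have "jet_le n (\<lambda>z. 1 - \<phi> z) z ((1 + A') * (1 + norm z)^0)" for z
        using jet_le_diff[OF smooth_const schwartz_smooth[OF phi], of n 1 z 1 A'] A'(2)[of z] by (simp add: jet_le_const)
      then show "\<exists>C m. \<forall>x. jet_le n (\<lambda>z. 1 - \<phi> z) x (C * (1 + norm x)^m)" by blast
    qed
    fix z
    show "jet_le k (\<lambda>z. (1 - \<phi> z) * cnj (quasi_regular (y, h) \<psi> z)) z (Q * ?s ^ N / (1 + norm z)^k)"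
    proof (cases "norm (z - y) < 2 * \<delta>")
      case True
      have zero: "(1 - \<phi> w) * cnj (quasi_regular (y, h) \<psi> w) = 0" if "w \<in> ball y (2 * \<delta>)" for w
      proof -
        have "norm (w - x) \<le> norm (w - y) + norm (y - x)" using norm_triangle_ineq[of "w - y" "y - x"] by simp
        also have "\<dots> < 3 * \<delta>" using that y by (simp add: dist_norm norm_minus_commute)
        finally show ?thesis by (simp add: one)
      qed
      have "z \<in> ball y (2 * \<delta>)" using True by (simp add: dist_norm norm_minus_commute)
      moreover have "0 \<le> Q * ?s ^ N / (1 + norm z)^k" using Q0 s by (simp add: add_nonneg_nonneg)
      ultimately show ?thesis using jet_le_local_zero[of "ball y (2 * \<delta>)" z "\<lambda>z. (1 - \<phi> z) * cnj (quasi_regular (y, h) \<psi> z)"] zero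
        by simp
    next
      case False
      define r where "r = norm (z - y)"
      have r: "r \<ge> 2 * \<delta>" "r > 0" using False \<delta> by (auto simp: r_def)
      let ?w = "matrix_inv h *v (z - y)"
      have rw: "r \<le> ?s * norm ?w" unfolding r_def by (rule norm_le_op_norm_inverse[OF inv])
      have z1: "1 + norm z \<le> c3 * r"
      proof -
        have "norm z \<le> norm (z - y) + norm (y - x) + norm x"
          using norm_triangle_ineq[of "z - y" "y"] norm_triangle_ineq[of "y - x" x] by simp
        then have "1 + norm z \<le> (1 + norm x + \<delta>) + r" using y unfolding r_def by linarith
        also have "(1 + norm x + \<delta>) \<le> (1 + norm x + \<delta>) / (2 * \<delta>) * r"
        proof -
          have "(1 + norm x + \<delta>) / (2 * \<delta>) * (2 * \<delta>) \<le> (1 + norm x + \<delta>) / (2 * \<delta>) * r"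
            using \<delta> r by (intro mult_left_mono) auto
          then show ?thesis using \<delta> by simp
        qed
        finally show ?thesis by (simp add: c3_def algebra_simps)
      qed
      have zp: "1 + norm z > 0" by (simp add: add_pos_nonneg)
      have w1: "1 / (1 + norm ?w)^(M + k) \<le> (?s / (2 * \<delta>))^M * ((?s * c3)^k / (1 + norm z)^k)"
      proof -
        have "1 / (1 + norm ?w)^(M + k) \<le> (?s / r)^(M + k)" by (rule inverse_power_le[OF s r(2) rw]) simp
        also have "\<dots> = (?s / r)^M * (?s / r)^k" by (rule power_add)
        also have "\<dots> \<le> (?s / (2 * \<delta>))^M * (?s * c3 / (1 + norm z))^k"
        proof (intro mult_mono power_mono)
          show "?s / r \<le> ?s / (2 * \<delta>)" using r \<delta> s by (intro divide_left_mono) auto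
          show "?s / r \<le> ?s * c3 / (1 + norm z)"
            using mult_left_mono[OF z1, of ?s] r s zp by (simp add: divide_simps mult_ac)
        qed (use s r \<delta> in auto)
        finally show ?thesis by (simp add: power_divide)
      qed
      have jp: "jet_le k \<psi> (matrix_inv h *v z + (- (matrix_inv h *v y))) (B * ((?s / (2 * \<delta>))^M * ((?s * c3)^k / (1 + norm z)^k)))"
      proof -
        have e: "matrix_inv h *v z + (- (matrix_inv h *v y)) = ?w" by (simp add: matrix_vector_mult_diff_distrib)
        show ?thesis unfolding e using jet_le_mono[OF B(2) order_refl, of ?w] mult_left_mono[OF w1 B(1)] by simp
      qed
      have sa: "smooth (\<lambda>z. \<psi> (matrix_inv h *v z + (- (matrix_inv h *v y))))" by (intro smooth_affine schwartz_smooth psi)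
      have "jet_le k (\<lambda>z. of_real ?d * \<psi> (matrix_inv h *v z + (- (matrix_inv h *v y)))) z
         (norm (complex_of_real ?d) * (?t^k * (B * ((?s / (2 * \<delta>))^M * ((?s * c3)^k / (1 + norm z)^k)))))"
        by (intro jet_le_cmult sa jet_le_affine[OF abs_entry_le_op_norm schwartz_smooth[OF psi] jp])
      then have jq: "jet_le k (quasi_regular (y, h) \<psi>) z (?d * (?t^k * (B * ((?s / (2 * \<delta>))^M * ((?s * c3)^k / (1 + norm z)^k)))))"
        by (simp add: quasi_regular_def[abs_def] matrix_vector_mult_diff_distrib)
      have "jet_le k (\<lambda>z. (1 - \<phi> z) * cnj (quasi_regular (y, h) \<psi> z)) z
         (2^k * (1 + A) * (?d * (?t^k * (B * ((?s / (2 * \<delta>))^M * ((?s * c3)^k / (1 + norm z)^k))))))"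
        by (rule jet_le_mult[OF s1p schwartz_smooth[OF scq] j1p jet_le_cnj[OF schwartz_smooth[OF sq] jq]])
      moreover have "2^k * (1 + A) * (?d * (?t^k * (B * ((?s / (2 * \<delta>))^M * ((?s * c3)^k / (1 + norm z)^k)))))
         \<le> Q * ?s ^ N / (1 + norm z)^k"
      proof -
        have "2^k * (1 + A) * (?d * (?t^k * (B * ((?s / (2 * \<delta>))^M * ((?s * c3)^k / (1 + norm z)^k)))))
          = (2^k * (1 + A) * B * (1 / (2 * \<delta>))^M * c3^k) * ((?t * ?s^p)^k * ?s^k * (?d * ?s^p)) * (?s ^ N / (1 + norm z)^k)"
          unfolding M_def by (simp add: power_add power_mult power_mult_distrib power_divide)
        also have "\<dots> \<le> (2^k * (1 + A) * B * (1 / (2 * \<delta>))^M * c3^k) * (\<bar>K\<bar>^k * \<bar>K\<bar>^k * \<bar>K\<bar>) * (?s ^ N / (1 + norm z)^k)"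
          using K s t0 A B c3 \<delta> zp
          by (intro mult_right_mono mult_left_mono mult_mono power_mono) (auto simp: less_imp_le intro!: mult_nonneg_nonneg)
        finally show ?thesis by (simp add: Q_def mult_ac)
      qed
      ultimately show ?thesis using jet_le_mono[OF _ order_refl] by blast
    qed
  qed
  then show ?thesis using C(1) Q0 by (intro exI[of _ "C * Q"]) (simp add: mult.assoc)
qed

lemma open_contains_ball3:
  assumes "open U" "x \<in> U"
  obtains \<delta> where "\<delta> > 0" "\<And>z. norm (z - x) < 3 * \<delta> \<Longrightarrow> z \<in> U"
proof -
  obtain e where e: "e > 0" "ball x e \<subseteq> U" using assms open_contains_ball by blast
  show thesis by (rule that[of "e/3"]) (use e in \<open>auto simp: dist_norm norm_minus_commute\<close>)
qed

text \<open>Splitting the wavelet by \<open>\<phi>\<close> reduces the claim to \<open>wavelet_localized_part\<close> and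
  \<open>wavelet_far_part\<close>. In the application \<open>\<Gamma>\<close> is the cone of a regular directed point and \<open>Hs\<close> consists of group
  elements that move \<open>V\<close> into it.\<close>

theorem wavelet_decay_of_regular:
  fixes u :: "(real^('n::{finite,wellorder}) \<Rightarrow> complex) \<Rightarrow> complex" and V :: "(real^('n::_)) set"
  assumes u: "tempered_distribution u" and psi: "schwartz \<psi>"
    and supp: "\<And>\<eta>. fourier \<psi> \<eta> \<noteq> 0 \<Longrightarrow> \<eta> \<in> V" and c: "c > 0" "\<And>v. v \<in> V \<Longrightarrow> c \<le> norm v"
    and phi: "test_function \<phi>" and U: "open U" "x \<in> U" "\<And>y. y \<in> U \<Longrightarrow> \<phi> y = 1"
    and dec: "\<And>N. \<exists>C\<ge>0. \<forall>\<eta>\<in>\<Gamma>. norm (fourier_localized \<phi> u \<eta>) \<le> C / (1 + norm \<eta>)^N"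
    and h: "\<And>h. h \<in> Hs \<Longrightarrow> controlled K p h" and hV: "\<And>h v. h \<in> Hs \<Longrightarrow> v \<in> V \<Longrightarrow> transpose (matrix_inv h) *v v \<in> \<Gamma>"
  obtains U' where "open U'" "x \<in> U'" "\<And>N. \<exists>C>0. \<forall>y\<in>U'. \<forall>h\<in>Hs. norm (wavelet_transform \<psi> u y h) \<le> C * op_norm h ^ N"
proof -
  have sphi: "schwartz \<phi>" by (rule test_function_schwartz[OF phi])
  obtain \<delta> where \<delta>: "\<delta> > 0" "\<And>z. norm (z - x) < 3 * \<delta> \<Longrightarrow> z \<in> U" using open_contains_ball3[OF U(1,2)] by metis
  show thesis
  proof (rule that[of "ball x \<delta>"])
    fix N
    obtain C1 where C1: "C1 \<ge> 0" "\<And>\<eta>. \<eta> \<in> \<Gamma> \<Longrightarrow> norm (fourier_localized \<phi> u \<eta>) \<le> C1 / (1 + norm \<eta>)^(N + p)"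
      using dec by meson
    obtain C2 where C2: "C2 \<ge> 0" "\<And>y h. norm (y - x) < \<delta> \<Longrightarrow> controlled K p h \<Longrightarrow>
       norm (u (\<lambda>z. (1 - \<phi> z) * cnj (quasi_regular (y, h) \<psi> z))) \<le> C2 * op_norm h ^ N"
      using wavelet_far_part[OF u psi sphi \<delta>(1), of x K p N] \<delta>(2) U(3) by blast
    define E where "E = C1 / c^(N + p) * K * (\<integral>\<eta>. norm (fourier \<psi> \<eta>) \<partial>lborel)"
    have "norm (wavelet_transform \<psi> u y h) \<le> (\<bar>E\<bar> + C2 + 1) * op_norm h ^ N" if y: "y \<in> ball x \<delta>" and hh: "h \<in> Hs" for y h
    proof -
      let ?g = "\<lambda>z. cnj (quasi_regular (y, h) \<psi> z)"
      have inv: "invertible h" using h[OF hh] by (simp add: controlled_def)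
      have sg: "schwartz ?g" by (intro schwartz_cnj schwartz_quasi_regular[OF inv psi])
      have s1: "schwartz (\<lambda>z. \<phi> z * ?g z)" by (rule schwartz_mult[OF sg sphi])
      have e: "(\<lambda>z. ?g z - \<phi> z * ?g z) = (\<lambda>z. (1 - \<phi> z) * ?g z)" by (auto simp: algebra_simps)
      have "u ?g - u (\<lambda>z. \<phi> z * ?g z) = u (\<lambda>z. (1 - \<phi> z) * ?g z)"
        using tempered_diff[OF u sg s1] unfolding e by simp
      then have "wavelet_transform \<psi> u y h = u (\<lambda>z. \<phi> z * ?g z) + u (\<lambda>z. (1 - \<phi> z) * ?g z)"
        by (simp add: wavelet_transform_def dist_inner_def algebra_simps)
      also have "norm \<dots> \<le> E * op_norm h ^ N + C2 * op_norm h ^ N"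
      proof (intro norm_triangle_mono)
        show "norm (u (\<lambda>z. \<phi> z * ?g z)) \<le> E * op_norm h ^ N"
          unfolding E_def by (rule wavelet_localized_part[OF u psi supp c sphi C1(2,1) h[OF hh] hV[OF hh]])
        show "norm (u (\<lambda>z. (1 - \<phi> z) * ?g z)) \<le> C2 * op_norm h ^ N"
          using y by (intro C2 h[OF hh]) (simp add: dist_norm norm_minus_commute)
      qed
      also have "\<dots> = (E + C2) * op_norm h ^ N" by (simp add: distrib_right)
      also have "\<dots> \<le> (\<bar>E\<bar> + C2 + 1) * op_norm h ^ N" by (intro mult_right_mono) (auto simp: op_norm_nonneg)
      finally show ?thesis .
    qed
    moreover have "\<bar>E\<bar> + C2 + 1 > 0" using C2(1) by simp
    ultimately show "\<exists>C>0. \<forall>y\<in>ball x \<delta>. \<forall>h\<in>Hs. norm (wavelet_transform \<psi> u y h) \<le> C * op_norm h ^ N" by blast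
  qed (use \<delta> in auto)
qed

section \<open>Regularity at points of wavelet decay\<close>

text \<open>The wavelet can be inverted on the frequency side near a point where its transform does not vanish: \<open>\<kappa>\<close> is
  the cutoff \<open>\<rho>\<close> divided by \<open>cnj \<Psi>\<close>.\<close>

lemma local_division:
  fixes \<Psi> :: "real^'n \<Rightarrow> complex"
  assumes P: "smooth \<Psi>" and nz: "\<Psi> a \<noteq> 0"
  obtains \<kappa> \<rho> :: "real^'n \<Rightarrow> complex" and \<epsilon> where "\<epsilon> > 0" "schwartz \<kappa>" "schwartz \<rho>"
    "\<And>z. norm (z - a) < \<epsilon> \<Longrightarrow> \<rho> z = 1" "\<And>z. \<kappa> z * cnj (\<Psi> z) = \<rho> z"
proof -
  have "isCont \<Psi> a" using smooth_continuous_on[OF P, of UNIV] by (simp add: continuous_on_eq_continuous_at)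
  then obtain e where e: "e > 0" "\<And>z. norm (z - a) < e \<Longrightarrow> \<Psi> z \<noteq> 0"
    using continuous_at_avoid[of a \<Psi> 0] nz by (auto simp: dist_norm norm_minus_commute)
  define r where "r = e / 3"
  have r: "r > 0" "3 * r = e" using e by (auto simp: r_def)
  have pl: "\<exists>b. test_function b \<and> (\<forall>z. norm (z - a) \<le> r1 \<longrightarrow> b z = 1) \<and> (\<forall>z. norm (z - a) \<ge> r2 \<longrightarrow> b z = 0) \<and>
     (\<forall>z. \<exists>t. b z = of_real t \<and> 0 \<le> t \<and> t \<le> 1)" if "0 < r1" "r1 < r2" for r1 r2
    by (rule plateau_function[OF that, of a]) blast
  obtain \<rho> where c: "test_function \<rho>" "\<And>z. norm (z - a) \<le> r \<Longrightarrow> \<rho> z = 1" "\<And>z. norm (z - a) \<ge> 2 * r \<Longrightarrow> \<rho> z = 0"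
    using pl[of r "2 * r"] r(1) by auto
  obtain \<rho>' where c': "test_function \<rho>'" "\<And>z. norm (z - a) \<le> 2 * r \<Longrightarrow> \<rho>' z = 1" "\<And>z. norm (z - a) \<ge> 3 * r \<Longrightarrow> \<rho>' z = 0"
     "\<And>z. \<exists>t. \<rho>' z = of_real t \<and> 0 \<le> t \<and> t \<le> 1"
    using pl[of "2 * r" "3 * r"] r(1) by auto
  \<comment> \<open>equal to \<open>\<bar>\<Psi>\<bar>\<^sup>2\<close> on the support of \<open>\<rho>\<close>, but positive everywhere\<close>
  define q where "q z = \<Psi> z * cnj (\<Psi> z) + (1 - \<rho>' z)" for z
  have smq: "smooth q" unfolding q_def[abs_def]
    by (intro smooth_add smooth_mult smooth_diff smooth_const smooth_cnj P) (use c' in \<open>simp add: test_function_def\<close>)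
  have q0: "q z \<noteq> 0" for z
  proof -
    obtain t where t: "\<rho>' z = of_real t" "0 \<le> t" "t \<le> 1" using c'(4) by blast
    have "q z = of_real ((norm (\<Psi> z))\<^sup>2 + (1 - t))" by (simp only: q_def complex_norm_square t of_real_add of_real_diff of_real_1)
    moreover have "(norm (\<Psi> z))\<^sup>2 + (1 - t) > 0"
    proof (cases "norm (z - a) < e")
      case True
      then have "(norm (\<Psi> z))\<^sup>2 > 0" using e(2) by simp
      then show ?thesis using t by linarith
    next
      case False
      then have "t = 0" using c'(3)[of z] r t by simp
      then show ?thesis using zero_le_power2[of "norm (\<Psi> z)"] by linarith
    qed
    ultimately show ?thesis by (metis less_irrefl of_real_eq_0_iff)
  qed
  define \<kappa> where "\<kappa> z = \<rho> z * (\<Psi> z * inverse (q z))" for z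
  have smk: "smooth \<kappa>" unfolding \<kappa>_def[abs_def]
    by (intro smooth_mult P smooth_inverse smq q0) (use c in \<open>simp add: test_function_def\<close>)
  have "{z. \<kappa> z \<noteq> 0} \<subseteq> {z. \<rho> z \<noteq> 0}" by (auto simp: \<kappa>_def)
  then have "supp \<kappa> \<subseteq> supp \<rho>" unfolding supp_def by (rule closure_mono)
  moreover have "compact (supp \<rho>)" using c by (simp add: test_function_def)
  moreover have "closed (supp \<kappa>)" by (simp add: supp_def)
  ultimately have "compact (supp \<kappa>)" by (metis compact_Int_closed inf.absorb2)
  then have tk: "test_function \<kappa>" using smk by (simp add: test_function_def)
  have "\<kappa> z * cnj (\<Psi> z) = \<rho> z" for z
  proof (cases "\<rho> z = 0")
    case False
    then have "norm (z - a) < 2 * r" using c(3)[of z] by linarith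
    then have "q z = \<Psi> z * cnj (\<Psi> z)" using c'(2)[of z] by (simp add: q_def)
    then show ?thesis using q0[of z] by (simp add: \<kappa>_def field_simps)
  qed (simp add: \<kappa>_def)
  then show thesis using that[of r \<kappa> \<rho>] r c test_function_schwartz tk by auto
qed

lemma jet_le_reflect:
  fixes f :: "real^'n \<Rightarrow> complex"
  assumes "smooth f" "jet_le n f (- x) B"
  shows "jet_le n (\<lambda>x. f (- x)) x ((1 + real CARD('n))^n * B)"
proof -
  have m: "(- mat 1 :: real^'n^'n) *v y = - y" for y
    by (metis matrix_vector_mul_lid matrix_vector_mult_minus_left)
  have "\<bar>(- mat 1 :: real^'n^'n) $ i $ j\<bar> \<le> 1" for i j by (simp add: mat_def)
  from jet_le_affine[OF this assms(1), of n x 0 B] assms(2) show ?thesis by (simp add: m)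
qed

lemma matrix_vector_mult_minus: "A *v (- (x::real^'n)) = - (A *v x)"
  by (simp add: vec_eq_iff matrix_vector_mult_def sum_negf)

lemma cutoff_schwartz:
  fixes h :: "real^'n^'n"
  assumes "invertible h" "schwartz \<rho>"
  shows "schwartz (\<lambda>\<omega>. \<rho> (a - transpose h *v \<omega>))"
proof -
  have "(- transpose (matrix_inv h)) *v ((- transpose h) *v x) = x" for x
  proof -
    have "(- transpose (matrix_inv h)) *v ((- transpose h) *v x) = transpose (matrix_inv h) *v (transpose h *v x)"
      by (simp only: matrix_vector_mult_minus_left matrix_vector_mult_minus minus_minus)
    also have "\<dots> = x" by (simp only: matrix_vector_mul_assoc transpose_inverse(2)[OF assms(1)] matrix_vector_mul_lid)
    finally show ?thesis .
  qed
  then have "(- transpose (matrix_inv h)) ** (- transpose h) = mat 1"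
    unfolding matrix_eq matrix_vector_mul_assoc[symmetric] by simp
  from schwartz_affine[OF this assms(2), of a] show ?thesis by (simp add: matrix_vector_mult_minus_left)
qed

lemma abs_entry_transpose: "\<bar>(- transpose h) $ i $ j\<bar> \<le> op_norm h"
  using abs_entry_le_op_norm[of h j i] by (simp add: transpose_def)

text \<open>For \<open>\<Phi> = fourier \<phi>\<close> the function is \<open>\<phi> e\<^sub>\<eta>\<close> with its dominant frequencies removed. What is left of \<open>\<Phi>\<close> lives
  where \<open>norm (h\<^sup>T \<omega>) \<ge> \<epsilon>\<close>, hence where \<open>norm \<omega> \<ge> \<epsilon> / op_norm h\<close>, so its size is any power of \<open>op_norm h\<close>; this beats
  the polynomial growth of the jets of the character.\<close>

lemma frequency_far_part:
  fixes u :: "(real^'n \<Rightarrow> complex) \<Rightarrow> complex"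
  assumes u: "tempered_distribution u" and chi: "schwartz \<rho>" "\<epsilon> > 0" "\<And>z. norm (z - a) < \<epsilon> \<Longrightarrow> \<rho> z = 1"
    and Phi: "schwartz \<Phi>"
  shows "\<exists>C\<ge>0. \<forall>h \<eta>. controlled K p h \<and> op_norm h ^ p * (1 + norm \<eta>) \<le> K \<longrightarrow>
    norm (u (\<lambda>x. character \<eta> x * fourier (\<lambda>\<omega>. \<Phi> \<omega> - \<rho> (a - transpose h *v \<omega>) * \<Phi> \<omega>) (- x))) \<le> C * op_norm h ^ N"
proof -
  let ?n = "real CARD('n)" and ?d = "2 * CARD('n)"
  obtain C k where C: "C \<ge> 0" "\<And>f B. schwartz f \<Longrightarrow> (\<And>x. jet_le k f x (B / (1 + norm x)^k)) \<Longrightarrow> norm (u f) \<le> C * B"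
    using tempered_bound[OF u] by metis
  \<comment> \<open>the last \<open>p * k\<close> powers absorb the factor \<open>(1 + norm \<eta>)^k\<close> from the jets of the character\<close>
  define M where "M = N + p * k"
  obtain B where B: "B \<ge> 0" "\<And>x. jet_le k \<Phi> x (B / (1 + norm x)^((?d + k) + M))" using schwartz_jet[OF Phi] by metis
  obtain A where A: "A \<ge> 0" "\<And>x. jet_le k \<rho> x (A / (1 + norm x)^0)" using schwartz_jet[OF chi(1)] by metis
  define X where "X = 1 + (1 + ?n * \<bar>K\<bar>)^k * A"
  have X: "X \<ge> 0" unfolding X_def using A by simp
  define F where "F = (1 + ?n)^k * fourier_jet_const TYPE('n) k k"
  have F: "F \<ge> 0" unfolding F_def by (intro mult_nonneg_nonneg fourier_jet_const_nonneg) auto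
  define Q where "Q = 2^k * (1 + 2 * pi)^k * F * 2^k * X * B * (1 / \<epsilon>)^M * \<bar>K\<bar>^k"
  have Q: "Q \<ge> 0" unfolding Q_def using X B F chi(2) by simp
  have "norm (u (\<lambda>x. character \<eta> x * fourier (\<lambda>\<omega>. \<Phi> \<omega> - \<rho> (a - transpose h *v \<omega>) * \<Phi> \<omega>) (- x))) \<le> C * (Q * op_norm h ^ N)"
    if h: "controlled K p h" and \<eta>: "op_norm h ^ p * (1 + norm \<eta>) \<le> K" for h \<eta>
  proof (rule C(2))
    let ?s = "op_norm h"
    define \<Theta> where "\<Theta> \<omega> = \<Phi> \<omega> - \<rho> (a - transpose h *v \<omega>) * \<Phi> \<omega>" for \<omega>
    have inv: "invertible h" and sK: "?s \<le> \<bar>K\<bar>" using h by (auto simp: controlled_def)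
    have s: "?s > 0" by (rule op_norm_pos[OF inv])
    have sc: "schwartz (\<lambda>\<omega>. \<rho> (a - transpose h *v \<omega>))" by (rule cutoff_schwartz[OF inv chi(1)])
    have sT: "schwartz \<Theta>" unfolding \<Theta>_def by (intro schwartz_diff Phi schwartz_mult sc)
    have sF: "schwartz (\<lambda>x. fourier \<Theta> (- x))" using schwartz_reflect[OF schwartz_fourier[OF sT], of 0] by simp
    show "schwartz (\<lambda>x. character \<eta> x * fourier (\<lambda>\<omega>. \<Phi> \<omega> - \<rho> (a - transpose h *v \<omega>) * \<Phi> \<omega>) (- x))"
      unfolding \<Theta>_def[symmetric] by (rule schwartz_character_mult[OF sF])
    define B' where "B' = 2^k * X * (B * (?s / \<epsilon>)^M)"
    have B': "B' \<ge> 0" unfolding B'_def using X B s chi(2) by simp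
    have j: "jet_le k \<Theta> \<omega> (B' / (1 + norm \<omega>)^(?d + k))" for \<omega>
    proof (cases "norm (transpose h *v \<omega>) < \<epsilon>")
      case True
      let ?U = "{\<omega>. norm (transpose h *v \<omega>) < \<epsilon>}"
      have o: "open ?U" by (intro open_Collect_less continuous_intros matrix_vector_mult_linear_continuous_on)
      have zero: "\<Theta> y = 0" if "y \<in> ?U" for y using that by (simp add: \<Theta>_def chi(3))
      have "0 \<le> B' / (1 + norm \<omega>)^(?d + k)" using B' by (simp add: add_nonneg_nonneg)
      moreover have "\<omega> \<in> ?U" using True by simp
      ultimately show ?thesis using jet_le_local_zero[of ?U \<omega> \<Theta>] o zero by simp
    next
      case False
      have "(- transpose h) *v \<omega> + a = a - transpose h *v \<omega>" for \<omega> by (simp add: matrix_vector_mult_minus_left)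
      then have "jet_le k (\<lambda>\<omega>. \<rho> (a - transpose h *v \<omega>)) \<omega> ((1 + ?n * ?s)^k * A)"
        using jet_le_affine[OF abs_entry_transpose schwartz_smooth[OF chi(1)], of k h \<omega> a A] A(2) by simp
      moreover have "(1 + ?n * ?s)^k * A \<le> (1 + ?n * \<bar>K\<bar>)^k * A"
        using A s sK by (intro mult_right_mono power_mono add_mono mult_left_mono) auto
      ultimately have j1: "jet_le k (\<lambda>\<omega>. \<rho> (a - transpose h *v \<omega>)) \<omega> ((1 + ?n * \<bar>K\<bar>)^k * A)" using jet_le_mono by blast
      have j2: "jet_le k (\<lambda>\<omega>. 1 - \<rho> (a - transpose h *v \<omega>)) \<omega> X"
        unfolding X_def by (rule jet_le_diff[OF smooth_const schwartz_smooth[OF sc] _ j1]) (simp add: jet_le_const)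
      have "B / (1 + norm \<omega>)^((?d + k) + M) = B * (1 / (1 + norm \<omega>)^M) / (1 + norm \<omega>)^(?d + k)" by (simp add: power_add)
      also have "\<dots> \<le> B * (?s / \<epsilon>)^M / (1 + norm \<omega>)^(?d + k)"
        using False norm_transpose_le[of h \<omega>] chi(2) s
        by (intro divide_right_mono mult_left_mono inverse_power_le B) (auto simp: add_nonneg_nonneg)
      finally have j3: "jet_le k \<Phi> \<omega> (B * (?s / \<epsilon>)^M / (1 + norm \<omega>)^(?d + k))" using jet_le_mono[OF B(2) order_refl] by simp
      have "\<Theta> = (\<lambda>\<omega>. (1 - \<rho> (a - transpose h *v \<omega>)) * \<Phi> \<omega>)" by (auto simp: \<Theta>_def algebra_simps)
      then show ?thesis
        using jet_le_mult[OF smooth_diff[OF smooth_const schwartz_smooth[OF sc]] schwartz_smooth[OF Phi] j2 j3] by (simp add: B'_def)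
    qed
    fix x
    have "jet_le k (fourier \<Theta>) (- x) (fourier_jet_const TYPE('n) k k * B' / (1 + norm x)^k)"
      using jet_le_fourier[OF sT j, of "- x"] by simp
    from jet_le_reflect[OF schwartz_smooth[OF schwartz_fourier[OF sT]] this]
    have "jet_le k (\<lambda>x. fourier \<Theta> (- x)) x (F * B' / (1 + norm x)^k)" by (simp add: F_def mult_ac)
    from jet_le_mult[OF smooth_character schwartz_smooth[OF sF] jet_le_character_power this]
    have "jet_le k (\<lambda>x. character \<eta> x * fourier \<Theta> (- x)) x (2^k * ((1 + 2 * pi)^k * (1 + norm \<eta>)^k) * (F * B' / (1 + norm x)^k))" .
    moreover have "2^k * ((1 + 2 * pi)^k * (1 + norm \<eta>)^k) * (F * B' / (1 + norm x)^k) \<le> Q * ?s^N / (1 + norm x)^k"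
    proof -
      have "2^k * ((1 + 2 * pi)^k * (1 + norm \<eta>)^k) * (F * B' / (1 + norm x)^k)
         = 2^k * (1 + 2 * pi)^k * F * 2^k * X * B * (1 / \<epsilon>)^M * (?s^p * (1 + norm \<eta>))^k * (?s^N / (1 + norm x)^k)"
        unfolding B'_def M_def by (simp add: power_add power_mult power_mult_distrib power_divide)
      also have "\<dots> \<le> 2^k * (1 + 2 * pi)^k * F * 2^k * X * B * (1 / \<epsilon>)^M * \<bar>K\<bar>^k * (?s^N / (1 + norm x)^k)"
        using \<eta> s X B F chi(2)
        by (intro mult_right_mono mult_left_mono power_mono) (auto simp: add_nonneg_nonneg intro!: mult_nonneg_nonneg)
      finally show ?thesis by (simp add: Q_def)
    qed
    ultimately show "jet_le k (\<lambda>x. character \<eta> x * fourier (\<lambda>\<omega>. \<Phi> \<omega> - \<rho> (a - transpose h *v \<omega>) * \<Phi> \<omega>) (- x)) x (Q * ?s^N / (1 + norm x)^k)"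
      unfolding \<Theta>_def[symmetric] using jet_le_mono[OF _ order_refl] by blast
  qed
  then show ?thesis using C(1) Q by (intro exI[of _ "C * Q"]) (simp add: mult.assoc)
qed

text \<open>Away from the base point no decay of the wavelet transform is available, only this growth bound.\<close>

lemma wavelet_polynomial_bound:
  fixes u :: "(real^'n \<Rightarrow> complex) \<Rightarrow> complex"
  assumes u: "tempered_distribution u" and psi: "schwartz \<psi>"
  shows "\<exists>C k. C \<ge> 0 \<and> (\<forall>y h. invertible h \<longrightarrow> norm (wavelet_transform \<psi> u y h) \<le>
     C * \<bar>det h\<bar> powr (- 1 / 2) * (1 + op_norm h)^k * (1 + real CARD('n) * op_norm (matrix_inv h))^(2 * k) * (1 + norm y)^k)"
proof -
  let ?n = "real CARD('n)"
  obtain C k where C: "C \<ge> 0" "\<And>f B. schwartz f \<Longrightarrow> (\<And>x. jet_le k f x (B / (1 + norm x)^k)) \<Longrightarrow> norm (u f) \<le> C * B"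
    using tempered_bound[OF u] by metis
  obtain B where B: "B \<ge> 0" "\<And>x. jet_le k \<psi> x (B / (1 + norm x)^k)" using schwartz_jet[OF psi] by metis
  have "norm (wavelet_transform \<psi> u y h) \<le>
     C * B * \<bar>det h\<bar> powr (- 1 / 2) * (1 + op_norm h)^k * (1 + ?n * op_norm (matrix_inv h))^(2 * k) * (1 + norm y)^k"
    if inv: "invertible h" for y h
  proof -
    let ?s = "op_norm h" and ?d = "\<bar>det h\<bar> powr (- 1 / 2)" and ?t = "1 + ?n * op_norm (matrix_inv h)"
    let ?b = "- (matrix_inv h *v y)"
    have s: "?s > 0" by (rule op_norm_pos[OF inv])
    have m0: "op_norm (matrix_inv h) \<ge> 0" by (rule op_norm_nonneg)
    have sq: "schwartz (quasi_regular (y, h) \<psi>)" by (rule schwartz_quasi_regular[OF inv psi])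
    have sa: "smooth (\<lambda>z. \<psi> (matrix_inv h *v z + ?b))" by (intro smooth_affine schwartz_smooth psi)
    have b1: "1 + norm ?b \<le> ?t * (1 + norm y)"
    proof -
      have "norm ?b \<le> op_norm (matrix_inv h) * norm y" using op_norm[of "matrix_inv h" y] by simp
      also have "\<dots> \<le> (?n * op_norm (matrix_inv h)) * norm y"
        using m0 by (intro mult_right_mono mult_le_cancel_right1[THEN iffD2]) (auto simp: Suc_leI)
      finally show ?thesis using m0 by (simp add: algebra_simps add_nonneg_nonneg add_increasing)
    qed
    have "jet_le k (\<lambda>z. of_real ?d * \<psi> (matrix_inv h *v z + ?b)) z
       (norm (complex_of_real ?d) * (?t^k * B * ((1 + ?s) * (1 + norm ?b))^k / (1 + norm z)^k))" for z
      by (intro jet_le_cmult sa jet_le_affine_decay[OF matrix_inv_mult(2)[OF inv] schwartz_smooth[OF psi] B(2)])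
    then have j: "jet_le k (quasi_regular (y, h) \<psi>) z ((?d * (?t^k * B * ((1 + ?s) * (1 + norm ?b))^k)) / (1 + norm z)^k)" for z
      by (simp add: quasi_regular_def[abs_def] matrix_vector_mult_diff_distrib)
    have "norm (wavelet_transform \<psi> u y h) \<le> C * (?d * (?t^k * B * ((1 + ?s) * (1 + norm ?b))^k))"
      unfolding wavelet_transform_def dist_inner_def
      by (rule C(2)[OF schwartz_cnj[OF sq] jet_le_cnj[OF schwartz_smooth[OF sq] j]])
    also have "\<dots> \<le> C * (?d * (?t^k * B * ((1 + ?s) * (?t * (1 + norm y)))^k))"
      using C B s m0 b1 by (intro mult_left_mono power_mono mult_nonneg_nonneg) auto
    also have "\<dots> = C * B * ?d * (1 + ?s)^k * ?t^(2 * k) * (1 + norm y)^k"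
      by (simp add: power_mult_distrib mult_2 power_add)
    finally show ?thesis .
  qed
  then show ?thesis using C(1) B(1) by (intro exI[of _ "C * B"] exI[of _ k]) auto
qed

lemma fourier_cmult: "fourier (\<lambda>x. c * f x) \<xi> = c * fourier f \<xi>"
  unfolding fourier_character mult.assoc by (rule integral_mult_right_zero)

text \<open>A reproducing formula with a single group element. The Fourier transform of \<open>\<phi> e\<^sub>\<eta>\<close> at \<open>\<zeta>\<close> is
  \<open>fourier \<phi> (\<zeta> + \<eta>)\<close>. The cutoff restricts it to those \<open>\<zeta>\<close> for which the transform of \<open>cnj (\<pi>(0,h)\<psi>)\<close> can be
  divided out with the help of \<open>\<kappa>\<close>, and the quotient is the transform of the kernel \<open>M\<close>. So the function is the
  convolution of \<open>M\<close> with \<open>cnj (\<pi>(0,h)\<psi>)\<close>, and \<open>u\<close> turns the translates of the latter into wavelet coefficients.\<close>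

lemma frequency_near_part:
  fixes u :: "(real^('n::{finite,wellorder}) \<Rightarrow> complex) \<Rightarrow> complex"
  assumes u: "tempered_distribution u" and psi: "schwartz \<psi>" and phi: "schwartz \<phi>"
    and kap: "schwartz \<kappa>" "schwartz \<rho>" "\<And>z. \<kappa> z * cnj (fourier \<psi> z) = \<rho> z"
    and inv: "invertible h" and \<eta>: "transpose h *v \<eta> = a"
  defines "M \<equiv> \<lambda>y. of_real (1 / \<bar>det h\<bar>) * (\<integral>z. \<phi> z * character \<eta> z * quasi_regular (0, h) (fourier \<kappa>) (y - z) \<partial>lborel)"
  shows "integrable lborel (\<lambda>y. M y * wavelet_transform \<psi> u y h)"
    "u (\<lambda>x. character \<eta> x * fourier (\<lambda>\<omega>. \<rho> (a - transpose h *v \<omega>) * fourier \<phi> \<omega>) (- x))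
      = (\<integral>y. M y * wavelet_transform \<psi> u y h \<partial>lborel)"
proof -
  define T where "T z = \<phi> z * character \<eta> z" for z
  have sT: "schwartz T" unfolding T_def using schwartz_character_mult[OF phi, of \<eta>] by (simp add: mult.commute)
  define qk where "qk = quasi_regular (0, h) (fourier \<kappa>)"
  have sk: "schwartz (fourier \<kappa>)" by (rule schwartz_fourier[OF kap(1)])
  have sqk: "schwartz qk" unfolding qk_def by (rule schwartz_quasi_regular[OF inv sk])
  define g where "g x = cnj (quasi_regular (0, h) \<psi> x)" for x
  have sg: "schwartz g" unfolding g_def by (intro schwartz_cnj schwartz_quasi_regular[OF inv psi])
  have d0: "\<bar>det h\<bar> > 0" using inv invertible_det_nz by auto
  let ?e = "complex_of_real (\<bar>det h\<bar> powr (1 / 2))"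
  have ee: "?e * ?e = of_real \<bar>det h\<bar>" using d0 powr_add[of "\<bar>det h\<bar>" "1/2" "1/2"] by (simp flip: of_real_mult)
  have Fqk: "fourier qk \<zeta> = ?e * \<kappa> (- (transpose h *v \<zeta>))" for \<zeta>
    unfolding qk_def fourier_quasi_regular[OF inv sk]
    using fourier_inversion[OF kap(1), of "- (transpose h *v \<zeta>)"] by simp
  have Fg: "fourier g \<zeta> = ?e * cnj (fourier \<psi> (- (transpose h *v \<zeta>)))" for \<zeta>
  proof -
    have "fourier g \<zeta> = cnj (fourier (quasi_regular (0, h) \<psi>) (- \<zeta>))" unfolding g_def[abs_def] cnj_fourier by simp
    then show ?thesis unfolding fourier_quasi_regular[OF inv psi] by (simp add: matrix_vector_mult_minus)
  qed
  have FT: "fourier T \<zeta> = fourier \<phi> (\<zeta> + \<eta>)" for \<zeta>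
    unfolding fourier_character T_def by (simp add: character_add mult_ac)
  define A where "A \<zeta> = of_real (1 / \<bar>det h\<bar>) * (fourier T \<zeta> * fourier qk \<zeta>)" for \<zeta>
  have sA: "schwartz A" unfolding A_def[abs_def]
    by (intro schwartz_cmult schwartz_mult schwartz_fourier sT sqk)
  have M: "M y = fourier A (- y)" for y
  proof -
    have "(\<integral>z. T z * qk (y - z) \<partial>lborel) = (\<integral>z. fourier (fourier T) (- z) * qk (y - z) \<partial>lborel)"
      by (simp add: fourier_inversion[OF sT])
    also have "\<dots> = fourier (\<lambda>\<zeta>. fourier T \<zeta> * fourier qk \<zeta>) (- y)" by (rule fourier_convolution[OF schwartz_fourier[OF sT] sqk])
    finally show ?thesis unfolding M_def A_def[abs_def] fourier_cmult by (simp add: T_def qk_def)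
  qed
  have sM: "schwartz M" unfolding M using schwartz_reflect[OF schwartz_fourier[OF sA], of 0] by simp
  have Ag: "A \<zeta> * fourier g \<zeta> = \<rho> (- (transpose h *v \<zeta>)) * fourier \<phi> (\<zeta> + \<eta>)" for \<zeta>
  proof -
    have "A \<zeta> * fourier g \<zeta> = of_real (1 / \<bar>det h\<bar>) * (?e * ?e) * (\<kappa> (- (transpose h *v \<zeta>)) * cnj (fourier \<psi> (- (transpose h *v \<zeta>)))) * fourier \<phi> (\<zeta> + \<eta>)"
      unfolding A_def FT Fqk Fg by (simp add: mult_ac)
    also have "\<dots> = \<rho> (- (transpose h *v \<zeta>)) * fourier \<phi> (\<zeta> + \<eta>)"
      unfolding ee kap(3) using d0 by simp
    finally show ?thesis .
  qed
  have T1: "character \<eta> x * fourier (\<lambda>\<omega>. \<rho> (a - transpose h *v \<omega>) * fourier \<phi> \<omega>) (- x) = (\<integral>y. M y * g (x - y) \<partial>lborel)" for x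
  proof -
    let ?f = "\<lambda>\<omega>. \<rho> (a - transpose h *v \<omega>) * fourier \<phi> \<omega> * character (- x) \<omega>"
    have "schwartz (\<lambda>\<omega>. \<rho> (a - transpose h *v \<omega>) * fourier \<phi> \<omega>)"
      by (intro schwartz_mult cutoff_schwartz[OF inv kap(2)] schwartz_fourier phi)
    from schwartz_character_mult[OF this, of "-x"] have "schwartz ?f" by (simp add: mult_ac)
    then have fm: "?f \<in> borel_measurable borel" by (intro smooth_measurable schwartz_smooth)
    have "character \<eta> x * fourier (\<lambda>\<omega>. \<rho> (a - transpose h *v \<omega>) * fourier \<phi> \<omega>) (- x) = character \<eta> x * (\<integral>\<omega>. ?f \<omega> \<partial>lborel)"
      by (simp add: fourier_character)
    also have "(\<integral>\<omega>. ?f \<omega> \<partial>lborel) = (\<integral>\<zeta>. ?f (\<eta> + \<zeta>) \<partial>lborel)" by (rule lborel_integral_translate[OF fm, symmetric])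
    also have "character \<eta> x * (\<integral>\<zeta>. ?f (\<eta> + \<zeta>) \<partial>lborel) = (\<integral>\<zeta>. character \<eta> x * ?f (\<eta> + \<zeta>) \<partial>lborel)" by (rule integral_mult_right_zero[symmetric])
    also have "\<dots> = (\<integral>\<zeta>. A \<zeta> * fourier g \<zeta> * character (- x) \<zeta> \<partial>lborel)"
    proof (rule Bochner_Integration.integral_cong[OF refl])
      fix \<zeta>
      have "character \<eta> x * character (- x) (\<eta> + \<zeta>) = character (- x) \<zeta>"
      proof -
        have "character \<eta> x * character (- x) \<eta> = character \<eta> (x + (- x))"
          unfolding character_add_right by (simp add: character_minus_right character_commute[of "-x" \<eta>])
        then show ?thesis by (simp add: character_add_right flip: mult.assoc)
      qed
      moreover have "a - transpose h *v (\<eta> + \<zeta>) = - (transpose h *v \<zeta>)"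
        using \<eta> by (simp add: matrix_vector_right_distrib)
      ultimately show "character \<eta> x * ?f (\<eta> + \<zeta>) = A \<zeta> * fourier g \<zeta> * character (- x) \<zeta>"
        unfolding Ag by (simp add: add.commute mult_ac)
    qed
    also have "\<dots> = fourier (\<lambda>\<zeta>. A \<zeta> * fourier g \<zeta>) (- x)" by (simp add: fourier_character)
    also have "\<dots> = (\<integral>y. M y * g (x - y) \<partial>lborel)" unfolding M by (rule fourier_convolution[OF sA sg, symmetric])
    finally show ?thesis .
  qed
  have W: "u (\<lambda>x. g (x - y)) = wavelet_transform \<psi> u y h" for y
    unfolding wavelet_transform_def dist_inner_def g_def by (simp add: quasi_regular_def)
  show "integrable lborel (\<lambda>y. M y * wavelet_transform \<psi> u y h)"
    using tempered_convolution(1)[OF u sM sg] by (simp add: W)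
  show "u (\<lambda>x. character \<eta> x * fourier (\<lambda>\<omega>. \<rho> (a - transpose h *v \<omega>) * fourier \<phi> \<omega>) (- x))
      = (\<integral>y. M y * wavelet_transform \<psi> u y h \<partial>lborel)"
    unfolding T1 using tempered_convolution(2)[OF u sM sg] by (simp add: W)
qed

lemma kernel_bound:
  fixes h :: "real^'n^'n"
  assumes phi: "schwartz \<phi>" and k: "schwartz k" and inv: "invertible h" and B: "B \<ge> 0"
    and b: "\<And>z. \<phi> z \<noteq> 0 \<Longrightarrow> norm (k (matrix_inv h *v (y - z))) \<le> B"
  shows "norm (of_real (1 / \<bar>det h\<bar>) * (\<integral>z. \<phi> z * character \<eta> z * quasi_regular (0, h) k (y - z) \<partial>lborel))
    \<le> (\<bar>det h\<bar> powr (- 1 / 2))^3 * B * (\<integral>z. norm (\<phi> z) \<partial>lborel)"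
proof -
  let ?d = "\<bar>det h\<bar> powr (- 1 / 2)"
  have d0: "\<bar>det h\<bar> > 0" using inv invertible_det_nz by auto
  have dd: "1 / \<bar>det h\<bar> = ?d * ?d" using d0 powr_add[of "\<bar>det h\<bar>" "-1/2" "-1/2"] by (simp add: powr_minus_divide)
  have "norm (\<integral>z. \<phi> z * character \<eta> z * quasi_regular (0, h) k (y - z) \<partial>lborel)
     \<le> (\<integral>z. norm (\<phi> z * character \<eta> z * quasi_regular (0, h) k (y - z)) \<partial>lborel)" by (rule integral_norm_bound)
  also have "\<dots> \<le> (\<integral>z. norm (\<phi> z) * (?d * B) \<partial>lborel)"
  proof (rule integral_mono)
    have "schwartz (\<lambda>z. character \<eta> z * \<phi> z * quasi_regular (0, h) k (y - z))"
      by (intro schwartz_mult schwartz_character_mult phi schwartz_reflect schwartz_quasi_regular inv k)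
    from schwartz_integrable[OF this]
    show "integrable lborel (\<lambda>z. norm (\<phi> z * character \<eta> z * quasi_regular (0, h) k (y - z)))" by (simp add: mult_ac)
    show "integrable lborel (\<lambda>z. norm (\<phi> z) * (?d * B))" using schwartz_integrable[OF phi] by simp
    fix z
    show "norm (\<phi> z * character \<eta> z * quasi_regular (0, h) k (y - z)) \<le> norm (\<phi> z) * (?d * B)"
    proof (cases "\<phi> z = 0")
      case False
      then have "norm (quasi_regular (0, h) k (y - z)) \<le> ?d * B"
        using b[of z] by (simp add: quasi_regular_def norm_mult mult_left_mono)
      then show ?thesis by (simp add: norm_mult mult_left_mono)
    qed simp
  qed
  also have "\<dots> = (\<integral>z. norm (\<phi> z) \<partial>lborel) * (?d * B)" by (rule integral_mult_left_zero)
  finally have "norm (\<integral>z. \<phi> z * character \<eta> z * quasi_regular (0, h) k (y - z) \<partial>lborel) \<le> (\<integral>z. norm (\<phi> z) \<partial>lborel) * (?d * B)" .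
  from mult_left_mono[OF this, of "1 / \<bar>det h\<bar>"]
  have "norm (of_real (1 / \<bar>det h\<bar>) * (\<integral>z. \<phi> z * character \<eta> z * quasi_regular (0, h) k (y - z) \<partial>lborel))
     \<le> (1 / \<bar>det h\<bar>) * ((\<integral>z. norm (\<phi> z) \<partial>lborel) * (?d * B))" by (simp only: norm_mult norm_of_real) simp
  also have "\<dots> = ?d^3 * B * (\<integral>z. norm (\<phi> z) \<partial>lborel)" unfolding dd by (simp add: power3_eq_cube mult_ac)
  finally show ?thesis .
qed

text \<open>In the integral of \<open>frequency_near_part\<close>, points \<open>y\<close> near \<open>x\<close> profit from the assumed decay of the wavelet
  transform. For the others \<open>y - z\<close> is bounded below on the support of \<open>\<phi>\<close>, so the kernel evaluates the Schwartz
  function \<open>fourier \<kappa>\<close> far out and beats the polynomial bound on the wavelet transform.\<close>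

lemma frequency_near_estimate:
  fixes u :: "(real^('n::{finite,wellorder}) \<Rightarrow> complex) \<Rightarrow> complex"
  assumes u: "tempered_distribution u" and psi: "schwartz \<psi>" and phi: "schwartz \<phi>"
    and kap: "schwartz \<kappa>" "schwartz \<rho>" "\<And>z. \<kappa> z * cnj (fourier \<psi> z) = \<rho> z"
    and \<delta>: "\<delta> > 0" and sp: "\<And>z. \<phi> z \<noteq> 0 \<Longrightarrow> norm (z - x) < 2 * \<delta>"
    and U: "\<And>z. norm (z - x) < 3 * \<delta> \<Longrightarrow> z \<in> U"
    and dec: "\<And>N. \<exists>C>0. \<forall>y\<in>U. \<forall>h\<in>Hs. norm (wavelet_transform \<psi> u y h) \<le> C * op_norm h ^ N"
  shows "\<exists>C\<ge>0. \<forall>h \<eta>. controlled K p h \<and> h \<in> Hs \<and> transpose h *v \<eta> = a \<longrightarrow>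
    norm (u (\<lambda>x. character \<eta> x * fourier (\<lambda>\<omega>. \<rho> (a - transpose h *v \<omega>) * fourier \<phi> \<omega>) (- x))) \<le> C * op_norm h ^ N"
proof -
  let ?n = "real CARD('n)" and ?e = "2 * CARD('n)"
  define J where "J = (\<integral>z. norm (\<phi> z) \<partial>lborel)"
  have J: "J \<ge> 0" unfolding J_def by (intro integral_nonneg_AE) auto
  obtain Cu k where Cu: "Cu \<ge> 0" "\<And>y h. invertible h \<Longrightarrow> norm (wavelet_transform \<psi> u y h) \<le>
     Cu * \<bar>det h\<bar> powr (- 1 / 2) * (1 + op_norm h)^k * (1 + ?n * op_norm (matrix_inv h))^(2 * k) * (1 + norm y)^k"
    using wavelet_polynomial_bound[OF u psi] by blast
  \<comment> \<open>\<open>p * 4 + p * (2 * k)\<close> powers absorb the normalizing factors and the inverse in the kernel bound and the polynomial bound, \<open>k\<close> powers the growth in \<open>y\<close>, and \<open>2 * CARD('n)\<close> powers make the integral converge\<close>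
  define L where "L = N + (p * 4 + p * (2 * k)) + (k + ?e)"
  have sk: "schwartz (fourier \<kappa>)" by (rule schwartz_fourier[OF kap(1)])
  obtain B0 where B0: "B0 \<ge> 0" "\<And>w. norm (fourier \<kappa> w) \<le> B0 / (1 + norm w)^0" using schwartz_bound[OF sk] by metis
  obtain B where B: "B \<ge> 0" "\<And>w. norm (fourier \<kappa> w) \<le> B / (1 + norm w)^L" using schwartz_bound[OF sk] by metis
  obtain C1 where C1: "C1 > 0" "\<And>y h. y \<in> U \<Longrightarrow> h \<in> Hs \<Longrightarrow> norm (wavelet_transform \<psi> u y h) \<le> C1 * op_norm h ^ (N + p * 3)"
    using dec by meson
  define c5 where "c5 = 1 + (1 + norm x) / (3 * \<delta>)"
  define c6 where "c6 = 1 + norm x + 3 * \<delta>"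
  have c5: "c5 > 0" and c6: "c6 > 0" unfolding c5_def c6_def using \<delta> by (auto simp: add_pos_nonneg intro!: add_pos_nonneg divide_nonneg_nonneg)
  define E1 where "E1 = \<bar>K\<bar>^3 * B0 * J * C1 * c6^?e"
  define E2 where "E2 = \<bar>K\<bar>^4 * \<bar>K\<bar>^(2 * k) * (1 + \<bar>K\<bar>)^k * \<bar>K\<bar>^(k + ?e) * B * (3 * c5)^L * J * Cu"
  have E: "E1 \<ge> 0" "E2 \<ge> 0" unfolding E1_def E2_def using B0 B J C1 c5 c6 Cu by auto
  have "norm (u (\<lambda>x. character \<eta> x * fourier (\<lambda>\<omega>. \<rho> (a - transpose h *v \<omega>) * fourier \<phi> \<omega>) (- x))) \<le> (E1 + E2) * weight_integral TYPE('n) * op_norm h ^ N"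
    if h: "controlled K p h" and hH: "h \<in> Hs" and \<eta>: "transpose h *v \<eta> = a" for h \<eta>
  proof -
    let ?s = "op_norm h" and ?d = "\<bar>det h\<bar> powr (- 1 / 2)" and ?t = "1 + ?n * op_norm (matrix_inv h)"
    have inv: "invertible h" using h by (simp add: controlled_def)
    have s: "?s > 0" by (rule op_norm_pos[OF inv])
    have K: "?s \<le> \<bar>K\<bar>" "?d * ?s^p \<le> \<bar>K\<bar>" "?t * ?s^p \<le> \<bar>K\<bar>" using h by (auto simp: controlled_def)
    have t0: "?t \<ge> 0" using op_norm_nonneg[of "matrix_inv h"] by simp
    define M where "M y = of_real (1 / \<bar>det h\<bar>) * (\<integral>z. \<phi> z * character \<eta> z * quasi_regular (0, h) (fourier \<kappa>) (y - z) \<partial>lborel)" for y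
    have b: "norm (M y * wavelet_transform \<psi> u y h) \<le> (E1 + E2) * ?s^N * (1 / (1 + norm y)^?e)" for y
    proof (cases "norm (y - x) < 3 * \<delta>")
      case True
      have "norm (M y) \<le> ?d^3 * B0 * J" unfolding M_def J_def
        by (rule kernel_bound[OF phi sk inv B0(1)]) (use B0(2) in simp)
      moreover have "norm (wavelet_transform \<psi> u y h) \<le> C1 * ?s ^ (N + p * 3)" by (rule C1(2)[OF U[OF True] hH])
      ultimately have "norm (M y * wavelet_transform \<psi> u y h) \<le> (?d^3 * B0 * J) * (C1 * ?s ^ (N + p * 3))"
        unfolding norm_mult using B0 J by (intro mult_mono) auto
      also have "\<dots> = (?d * ?s^p)^3 * (B0 * J * C1) * ?s^N" by (simp add: power_add power_mult power_mult_distrib)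
      also have "\<dots> \<le> \<bar>K\<bar>^3 * (B0 * J * C1) * ?s^N"
        using K s B0 J C1 by (intro mult_right_mono power_mono) auto
      also have "\<dots> \<le> E1 * ?s^N * (1 / (1 + norm y)^?e)"
      proof -
        have "1 + norm y \<le> c6" using True norm_triangle_ineq[of "y - x" x] unfolding c6_def by simp
        then have "(1 + norm y)^?e \<le> c6^?e" by (intro power_mono) auto
        then have "1 \<le> c6^?e / (1 + norm y)^?e" by (simp add: pos_le_divide_eq add_pos_nonneg)
        then have "(\<bar>K\<bar>^3 * (B0 * J * C1) * ?s^N) * 1 \<le> (\<bar>K\<bar>^3 * (B0 * J * C1) * ?s^N) * (c6^?e / (1 + norm y)^?e)"
          using B0 J C1 s by (intro mult_left_mono) auto
        then show ?thesis unfolding E1_def by (simp add: mult_ac)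
      qed
      also have "\<dots> \<le> (E1 + E2) * ?s^N * (1 / (1 + norm y)^?e)"
        using E s by (intro mult_right_mono) (auto simp: add_nonneg_nonneg)
      finally show ?thesis .
    next
      case False
      have yp: "1 + norm y > 0" by (simp add: add_pos_nonneg)
      define r where "r = (1 + norm y) / (3 * c5)"
      have r: "r > 0" unfolding r_def using yp c5 by simp
      have y1: "1 + norm y \<le> c5 * norm (y - x)"
      proof -
        have "1 + norm y \<le> (1 + norm x) + norm (y - x)" using norm_triangle_ineq[of "y - x" x] by simp
        also have "(1 + norm x) \<le> (1 + norm x) / (3 * \<delta>) * norm (y - x)"
        proof -
          have "(1 + norm x) / (3 * \<delta>) * (3 * \<delta>) \<le> (1 + norm x) / (3 * \<delta>) * norm (y - x)"
            using \<delta> False by (intro mult_left_mono) auto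
          then show ?thesis using \<delta> by simp
        qed
        finally show ?thesis by (simp add: c5_def distrib_right)
      qed
      have kb: "norm (fourier \<kappa> (matrix_inv h *v (y - z))) \<le> B * (?s / r)^L" if "\<phi> z \<noteq> 0" for z
      proof -
        have "norm (y - x) \<le> norm (y - z) + norm (z - x)" using norm_triangle_ineq[of "y - z" "z - x"] by simp
        then have "norm (y - x) / 3 \<le> norm (y - z)" using sp[OF that] False by linarith
        moreover have "r \<le> norm (y - x) / 3" unfolding r_def using y1 c5 by (simp add: divide_simps mult_ac)
        ultimately have "r \<le> ?s * norm (matrix_inv h *v (y - z))" using norm_le_op_norm_inverse[OF inv, of "y - z"] by linarith
        then have "1 / (1 + norm (matrix_inv h *v (y - z)))^L \<le> (?s / r)^L" by (intro inverse_power_le s r) auto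
        from mult_left_mono[OF this B(1)] B(2)[of "matrix_inv h *v (y - z)"] show ?thesis by simp
      qed
      have "norm (M y) \<le> ?d^3 * (B * (?s / r)^L) * J" unfolding M_def J_def
        by (rule kernel_bound[OF phi sk inv _ kb]) (use B s r in auto)
      moreover note Cu(2)[OF inv, of y]
      ultimately have "norm (M y * wavelet_transform \<psi> u y h) \<le> (?d^3 * (B * (?s / r)^L) * J) *
          (Cu * ?d * (1 + ?s)^k * ?t^(2 * k) * (1 + norm y)^k)"
        unfolding norm_mult using B J s r by (intro mult_mono) auto
      also have "\<dots> = ((?d * ?s^p)^4 * (?t * ?s^p)^(2 * k) * (1 + ?s)^k * ?s^(k + ?e)) * (B * (3 * c5)^L * J * Cu) * ?s^N
           * ((1 + norm y)^k / (1 + norm y)^L)"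
      proof -
        have 1: "(?s / r)^L = ?s^L * (3 * c5)^L / (1 + norm y)^L" unfolding r_def by (simp add: power_divide power_mult_distrib)
        have 2: "?s^L = ?s^N * ((?s^p)^4 * (?s^p)^(2 * k)) * ?s^(k + ?e)" unfolding L_def by (simp only: power_add power_mult)
        have 3: "?d^3 * ?d = ?d^4" by (simp add: power_numeral_reduce)
        have "(?d^3 * (B * (?s / r)^L) * J) * (Cu * ?d * (1 + ?s)^k * ?t^(2 * k) * (1 + norm y)^k)
           = (?d^3 * ?d) * (B * J * Cu) * ?t^(2 * k) * (1 + ?s)^k * (?s / r)^L * (1 + norm y)^k" by (simp only: mult_ac)
        also have "\<dots> = ?d^4 * (B * J * Cu) * ?t^(2 * k) * (1 + ?s)^k *
            (?s^N * ((?s^p)^4 * (?s^p)^(2 * k)) * ?s^(k + ?e) * (3 * c5)^L / (1 + norm y)^L) * (1 + norm y)^k"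
          unfolding 3 1 2 ..
        finally show ?thesis by (simp only: power_mult_distrib times_divide_eq_right times_divide_eq_left mult_ac)
      qed
      also have "\<dots> \<le> (\<bar>K\<bar>^4 * \<bar>K\<bar>^(2 * k) * (1 + \<bar>K\<bar>)^k * \<bar>K\<bar>^(k + ?e)) * (B * (3 * c5)^L * J * Cu) * ?s^N * (1 / (1 + norm y)^?e)"
      proof -
        have "(?d * ?s^p)^4 \<le> \<bar>K\<bar>^4" "(?t * ?s^p)^(2 * k) \<le> \<bar>K\<bar>^(2 * k)" "(1 + ?s)^k \<le> (1 + \<bar>K\<bar>)^k" "?s^(k + ?e) \<le> \<bar>K\<bar>^(k + ?e)"
          using K s t0 by (intro power_mono mult_nonneg_nonneg add_left_mono; simp)+
        then have *: "(?d * ?s^p)^4 * (?t * ?s^p)^(2 * k) * (1 + ?s)^k * ?s^(k + ?e) \<le> \<bar>K\<bar>^4 * \<bar>K\<bar>^(2 * k) * (1 + \<bar>K\<bar>)^k * \<bar>K\<bar>^(k + ?e)"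
          using s t0 by (intro mult_mono mult_nonneg_nonneg zero_le_power) simp_all
        have "(1 + norm y)^k * (1 + norm y)^?e \<le> (1 + norm y)^L" unfolding L_def power_add[symmetric]
          by (intro power_increasing) auto
        then have **: "(1 + norm y)^k / (1 + norm y)^L \<le> 1 / (1 + norm y)^?e" using yp by (simp add: divide_simps mult_ac)
        have n: "0 \<le> B * (3 * c5)^L * J * Cu" "0 \<le> ?s^N" "0 \<le> (1 + norm y)^k / (1 + norm y)^L"
          using B c5 J Cu s yp by simp_all
        have "0 \<le> \<bar>K\<bar>^4 * \<bar>K\<bar>^(2 * k) * (1 + \<bar>K\<bar>)^k * \<bar>K\<bar>^(k + ?e)" by simp
        then show ?thesis
          by (rule mult_mono[OF mult_right_mono[OF mult_right_mono[OF * n(1)] n(2)] ** mult_nonneg_nonneg[OF mult_nonneg_nonneg[OF _ n(1)] n(2)] n(3)])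
      qed
      also have "\<dots> = E2 * ?s^N * (1 / (1 + norm y)^?e)" unfolding E2_def by (simp only: mult_ac)
      also have "\<dots> \<le> (E1 + E2) * ?s^N * (1 / (1 + norm y)^?e)"
        using E s by (intro mult_right_mono) (auto simp: add_nonneg_nonneg)
      finally show ?thesis .
    qed
    note near = frequency_near_part[OF u psi phi kap inv \<eta>, folded M_def]
    have "norm (\<integral>y. M y * wavelet_transform \<psi> u y h \<partial>lborel) \<le> (\<integral>y. norm (M y * wavelet_transform \<psi> u y h) \<partial>lborel)"
      by (rule integral_norm_bound)
    also have "\<dots> \<le> (\<integral>(y::real^('n::_)). (E1 + E2) * ?s^N * (1 / (1 + norm y)^?e) \<partial>lborel)"
      using near(1) b by (intro integral_mono integrable_mult_right integrable_weight integrable_norm) auto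
    also have "\<dots> = (E1 + E2) * ?s^N * weight_integral TYPE('n)" unfolding weight_integral_def by (rule integral_mult_right_zero)
    finally show ?thesis unfolding near(2) by (simp only: mult_ac)
  qed
  moreover have "0 \<le> (E1 + E2) * weight_integral TYPE('n)" using E weight_integral_nonneg by (intro mult_nonneg_nonneg) auto
  ultimately show ?thesis by blast
qed

lemma fourier_diff: "integrable lborel f \<Longrightarrow> integrable lborel g \<Longrightarrow> fourier (\<lambda>x. f x - g x) \<xi> = fourier f \<xi> - fourier g \<xi>"
  unfolding fourier_character left_diff_distrib
  by (rule Bochner_Integration.integral_diff; rule integrable_mult_character)

text \<open>For each frequency \<open>\<eta>\<close> of \<open>\<Gamma>\<close> one group element that moves \<open>\<eta>\<close> to \<open>a\<close> suffices: \<open>\<phi> e\<^sub>\<eta>\<close> is split into its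
  dominant frequencies and the rest, both parts are \<open>O(op_norm h ^ N)\<close> for every \<open>N\<close>, and \<open>op_norm h\<close> is dominated by
  a negative power of \<open>norm \<eta>\<close>.\<close>

theorem regular_of_wavelet_decay:
  fixes u :: "(real^('n::{finite,wellorder}) \<Rightarrow> complex) \<Rightarrow> complex"
  assumes u: "tempered_distribution u" and psi: "schwartz \<psi>" and nz: "fourier \<psi> a \<noteq> 0"
    and U: "open U" "x \<in> U"
    and dec: "\<And>N. \<exists>C>0. \<forall>y\<in>U. \<forall>h\<in>Hs. norm (wavelet_transform \<psi> u y h) \<le> C * op_norm h ^ N"
    and h: "\<And>\<eta>. \<eta> \<in> \<Gamma> \<Longrightarrow> \<exists>h\<in>Hs. controlled K p h \<and> transpose h *v \<eta> = a \<and> op_norm h ^ p * (1 + norm \<eta>) \<le> K"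
  obtains \<phi> U' where "test_function \<phi>" "open U'" "x \<in> U'" "\<And>y. y \<in> U' \<Longrightarrow> \<phi> y = 1"
    "\<And>N. \<exists>C\<ge>0. \<forall>\<eta>\<in>\<Gamma>. norm (fourier_localized \<phi> u \<eta>) \<le> C / (1 + norm \<eta>)^N"
proof -
  obtain \<delta> where \<delta>: "\<delta> > 0" "\<And>z. norm (z - x) < 3 * \<delta> \<Longrightarrow> z \<in> U" using open_contains_ball3[OF U] by metis
  have "\<exists>b. test_function b \<and> (\<forall>z. norm (z - x) \<le> \<delta> \<longrightarrow> b z = 1) \<and> (\<forall>z. norm (z - x) \<ge> 2 * \<delta> \<longrightarrow> b z = 0)"
    by (rule plateau_function[of \<delta> "2 * \<delta>" x]) (use \<delta>(1) in auto)
  then obtain \<phi> where phi: "test_function \<phi>" "\<And>z. norm (z - x) \<le> \<delta> \<Longrightarrow> \<phi> z = 1" "\<And>z. norm (z - x) \<ge> 2 * \<delta> \<Longrightarrow> \<phi> z = 0"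
    by blast
  have sphi: "schwartz \<phi>" by (rule test_function_schwartz[OF phi(1)])
  have sp: "norm (z - x) < 2 * \<delta>" if "\<phi> z \<noteq> 0" for z using phi(3)[of z] that by linarith
  have "\<exists>\<epsilon> \<kappa> \<rho>. \<epsilon> > 0 \<and> schwartz \<kappa> \<and> schwartz \<rho> \<and> (\<forall>z. norm (z - a) < \<epsilon> \<longrightarrow> \<rho> z = 1) \<and> (\<forall>z. \<kappa> z * cnj (fourier \<psi> z) = \<rho> z)"
    by (rule local_division[OF smooth_fourier[OF psi] nz]) blast
  then obtain \<epsilon> \<kappa> \<rho> where k: "\<epsilon> > 0" "schwartz \<kappa>" "schwartz \<rho>"
    "\<And>z. norm (z - a) < \<epsilon> \<Longrightarrow> \<rho> z = 1" "\<And>z. \<kappa> z * cnj (fourier \<psi> z) = \<rho> z" by blast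
  show thesis
  proof (rule that[OF phi(1), of "ball x \<delta>"])
    fix N
    obtain C1 where C1: "C1 \<ge> 0" "\<And>h \<eta>. controlled K p h \<Longrightarrow> op_norm h ^ p * (1 + norm \<eta>) \<le> K \<Longrightarrow>
      norm (u (\<lambda>x. character \<eta> x * fourier (\<lambda>\<omega>. fourier \<phi> \<omega> - \<rho> (a - transpose h *v \<omega>) * fourier \<phi> \<omega>) (- x))) \<le> C1 * op_norm h ^ (p * N)"
      using frequency_far_part[OF u k(3,1,4) schwartz_fourier[OF sphi], where K = K and p = p and N = "p * N"] by blast
    obtain C2 where C2: "C2 \<ge> 0" "\<And>h \<eta>. controlled K p h \<Longrightarrow> h \<in> Hs \<Longrightarrow> transpose h *v \<eta> = a \<Longrightarrow>
      norm (u (\<lambda>x. character \<eta> x * fourier (\<lambda>\<omega>. \<rho> (a - transpose h *v \<omega>) * fourier \<phi> \<omega>) (- x))) \<le> C2 * op_norm h ^ (p * N)"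
      using frequency_near_estimate[OF u psi sphi k(2,3,5) \<delta>(1) sp \<delta>(2) dec, where K = K and p = p and a = a and N = "p * N"] by blast
    have "norm (fourier_localized \<phi> u \<eta>) \<le> ((C1 + C2) * \<bar>K\<bar>^N) / (1 + norm \<eta>)^N" if "\<eta> \<in> \<Gamma>" for \<eta>
    proof -
      obtain h where hh: "h \<in> Hs" "controlled K p h" "transpose h *v \<eta> = a" "op_norm h ^ p * (1 + norm \<eta>) \<le> K"
        using h[OF \<open>\<eta> \<in> \<Gamma>\<close>] by blast
      have inv: "invertible h" using hh by (simp add: controlled_def)
      let ?\<Phi> = "fourier \<phi>"
      let ?a = "\<lambda>\<omega>. \<rho> (a - transpose h *v \<omega>) * ?\<Phi> \<omega>"
      have sF: "schwartz ?\<Phi>" by (rule schwartz_fourier[OF sphi])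
      have sa: "schwartz ?a" by (intro schwartz_mult cutoff_schwartz[OF inv k(3)] sF)
      have sb: "schwartz (\<lambda>\<omega>. ?\<Phi> \<omega> - ?a \<omega>)" by (rule schwartz_diff[OF sF sa])
      have st: "schwartz (\<lambda>x. character \<eta> x * fourier f (- x))" if "schwartz f" for f
        using schwartz_character_mult[OF schwartz_reflect[OF schwartz_fourier[OF that], of 0]] by simp
      have split: "\<phi> x * character \<eta> x = character \<eta> x * fourier ?a (- x) + character \<eta> x * fourier (\<lambda>\<omega>. ?\<Phi> \<omega> - ?a \<omega>) (- x)" for x
      proof -
        have "fourier (\<lambda>\<omega>. ?\<Phi> \<omega> - ?a \<omega>) (- x) = fourier ?\<Phi> (- x) - fourier ?a (- x)"
          by (intro fourier_diff schwartz_integrable sF sa)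
        moreover have "p * c = c * q + c * r" if "r = p - q" for p q r c :: complex
          unfolding that by (simp add: right_diff_distrib)
        ultimately show ?thesis unfolding fourier_inversion[OF sphi] by blast
      qed
      have "fourier_localized \<phi> u \<eta> = u (\<lambda>x. \<phi> x * character \<eta> x)" by (simp add: fourier_localized_def character_def)
      also have "\<dots> = u (\<lambda>x. character \<eta> x * fourier ?a (- x)) + u (\<lambda>x. character \<eta> x * fourier (\<lambda>\<omega>. ?\<Phi> \<omega> - ?a \<omega>) (- x))"
        unfolding split by (rule tempered_add[OF u st[OF sa] st[OF sb]])
      also have "norm \<dots> \<le> C2 * op_norm h ^ (p * N) + C1 * op_norm h ^ (p * N)"
        by (intro norm_triangle_mono C1(2) C2(2) hh)
      also have "\<dots> = (C1 + C2) * (op_norm h ^ p)^N" by (simp only: power_mult[of _ p N] distrib_right add.commute)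
      also have "\<dots> \<le> (C1 + C2) * (\<bar>K\<bar> / (1 + norm \<eta>))^N"
      proof (intro mult_left_mono power_mono)
        have "op_norm h ^ p * (1 + norm \<eta>) \<le> \<bar>K\<bar>" using hh(4) by linarith
        then show "op_norm h ^ p \<le> \<bar>K\<bar> / (1 + norm \<eta>)" by (simp add: pos_le_divide_eq add_pos_nonneg)
      qed (use C1(1) C2(1) zero_le_power[OF op_norm_nonneg[of h]] in simp_all)
      finally show ?thesis by (simp add: power_divide)
    qed
    moreover have "0 \<le> (C1 + C2) * \<bar>K\<bar>^N" using C1(1) C2(1) by simp
    ultimately show "\<exists>C\<ge>0. \<forall>\<eta>\<in>\<Gamma>. norm (fourier_localized \<phi> u \<eta>) \<le> C / (1 + norm \<eta>)^N" by blast
  next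
    fix y assume "y \<in> ball x \<delta>"
    then show "\<phi> y = 1" by (intro phi(2)) (simp add: dist_norm norm_minus_commute)
  qed (use \<delta> in auto)
qed

text \<open>Low frequencies of a cone form a bounded set, where polynomial growth already amounts to any decay.\<close>

lemma fourier_localized_bound:
  fixes u :: "(real^'n \<Rightarrow> complex) \<Rightarrow> complex"
  assumes u: "tempered_distribution u" and phi: "test_function \<phi>"
  shows "\<exists>C k. C \<ge> 0 \<and> (\<forall>\<eta>. norm (fourier_localized \<phi> u \<eta>) \<le> C * (1 + norm \<eta>)^k)"
proof -
  have sphi: "schwartz \<phi>" by (rule test_function_schwartz[OF phi(1)])
  obtain C k where C: "C \<ge> 0" "\<And>f B. schwartz f \<Longrightarrow> (\<And>x. jet_le k f x (B / (1 + norm x)^k)) \<Longrightarrow> norm (u f) \<le> C * B"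
    using tempered_bound[OF u] by metis
  obtain B where B: "B \<ge> 0" "\<And>x. jet_le k \<phi> x (B / (1 + norm x)^k)" using schwartz_jet[OF sphi] by metis
  have "norm (fourier_localized \<phi> u \<eta>) \<le> (C * (2^k * (1 + 2 * pi)^k * B)) * (1 + norm \<eta>)^k" for \<eta>
  proof -
    have j: "jet_le k (\<lambda>x. character \<eta> x * \<phi> x) x ((2^k * (1 + 2 * pi)^k * B * (1 + norm \<eta>)^k) / (1 + norm x)^k)" for x
      using jet_le_mult[OF smooth_character schwartz_smooth[OF sphi] jet_le_character_power B(2), of \<eta> x] by (simp add: mult_ac)
    have "norm (u (\<lambda>x. character \<eta> x * \<phi> x)) \<le> C * (2^k * (1 + 2 * pi)^k * B * (1 + norm \<eta>)^k)"
      by (rule C(2)[OF schwartz_character_mult[OF sphi] j])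
    then show ?thesis by (simp add: fourier_localized_def character_def mult_ac)
  qed
  then show ?thesis using C(1) B(1) by (intro exI[of _ "C * (2^k * (1 + 2 * pi)^k * B)"] exI[of _ k]) auto
qed

section \<open>Irreducibility and dense dual orbits\<close>

lemma matrix_inv_unique:
  fixes A B :: "real^'n^'n"
  assumes "A ** B = mat 1" shows "matrix_inv A = B"
proof -
  have "invertible A" using assms invertible_right_inverse by blast
  then have "matrix_inv A ** (A ** B) = B" by (simp add: matrix_mul_assoc matrix_inv_mult)
  then show ?thesis using assms by simp
qed

lemma fourier_surjective:
  fixes b :: "real^'n \<Rightarrow> complex"
  assumes "schwartz b" shows "\<exists>\<phi>. schwartz \<phi> \<and> fourier \<phi> = b"
proof (intro exI conjI)
  have s: "schwartz (fourier b)" by (rule schwartz_fourier[OF assms])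
  show s2: "schwartz (\<lambda>x. fourier b (- x))" using schwartz_reflect[OF s, of 0] by simp
  show "fourier (\<lambda>x. fourier b (- x)) = b"
  proof
    fix \<zeta>
    have m: "(\<lambda>x. fourier b x * character \<zeta> (- x)) \<in> borel_measurable borel"
      using schwartz_character_mult[OF s, of "- \<zeta>"] by (intro smooth_measurable schwartz_smooth) (simp add: character_minus_right mult.commute)
    have "fourier (\<lambda>x. fourier b (- x)) \<zeta> = (\<integral>x. fourier b (0 - x) * character \<zeta> (- (0 - x)) \<partial>lborel)" by (simp add: fourier_character)
    also have "\<dots> = (\<integral>x. fourier b x * character \<zeta> (- x) \<partial>lborel)" by (rule lborel_integral_reflect[OF m])
    also have "\<dots> = fourier (fourier b) (- \<zeta>)" by (simp add: fourier_character character_minus_right)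
    also have "\<dots> = b \<zeta>" by (rule fourier_inversion[OF assms])
    finally show "fourier (\<lambda>x. fourier b (- x)) \<zeta> = b \<zeta>" .
  qed
qed

lemma parseval:
  fixes f k :: "real^'n \<Rightarrow> complex"
  assumes f: "schwartz f" and k: "schwartz k"
  shows "L2_inner f k = (\<integral>\<zeta>. fourier f \<zeta> * cnj (fourier k \<zeta>) \<partial>lborel)"
proof -
  let ?G = "\<lambda>\<zeta>. cnj (fourier k \<zeta>)"
  have sG: "schwartz ?G" by (intro schwartz_cnj schwartz_fourier k)
  have g: "cnj (k x) = fourier ?G x" for x
    using cnj_fourier[of "fourier k" "- x"] fourier_inversion[OF k, of x] by simp
  have "L2_inner f k = (\<integral>x. (\<integral>\<zeta>. f x * ?G \<zeta> * character x \<zeta> \<partial>lborel) \<partial>lborel)"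
    unfolding L2_inner_def g fourier_character[of ?G] integral_mult_right_zero[symmetric] by (simp only: mult.assoc)
  also have "\<dots> = (\<integral>\<zeta>. (\<integral>x. f x * ?G \<zeta> * character x \<zeta> \<partial>lborel) \<partial>lborel)"
    by (rule Fubini_bounded[OF schwartz_integrable[OF f] schwartz_integrable[OF sG]])
       (auto simp: character_def case_prod_beta' intro!: continuous_intros)
  also have "\<dots> = (\<integral>\<zeta>. fourier f \<zeta> * ?G \<zeta> \<partial>lborel)"
  proof (rule Bochner_Integration.integral_cong[OF refl])
    fix \<zeta>
    have "(\<integral>x. f x * ?G \<zeta> * character x \<zeta> \<partial>lborel) = (\<integral>x. (f x * character \<zeta> x) * ?G \<zeta> \<partial>lborel)"
      by (simp add: mult_ac character_commute[of _ \<zeta>])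
    also have "\<dots> = fourier f \<zeta> * ?G \<zeta>" unfolding fourier_character[of f] by (rule integral_mult_left_zero)
    finally show "(\<integral>x. f x * ?G \<zeta> * character x \<zeta> \<partial>lborel) = fourier f \<zeta> * ?G \<zeta>" .
  qed
  finally show ?thesis .
qed

lemma L2_fun_mult_integrable:
  assumes "f \<in> L2_fun" "k \<in> L2_fun" shows "integrable lborel (\<lambda>x. f x * cnj (k x))"
proof (rule Bochner_Integration.integrable_bound)
  show "integrable lborel (\<lambda>x. (norm (f x))\<^sup>2 + (norm (k x))\<^sup>2)" using assms by (simp add: L2_fun_def)
  have [measurable]: "f \<in> borel_measurable borel" "k \<in> borel_measurable borel" using assms by (auto simp: L2_fun_def)
  have "(\<lambda>x. cnj (k x)) \<in> borel_measurable borel"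
    by (rule measurable_compose[of k _ borel]) (auto intro!: borel_measurable_continuous_onI continuous_intros)
  then show "(\<lambda>x. f x * cnj (k x)) \<in> borel_measurable lborel" by simp
  have "norm (f x * cnj (k x)) \<le> norm ((norm (f x))\<^sup>2 + (norm (k x))\<^sup>2)" for x
  proof -
    have "2 * (norm (f x) * norm (k x)) \<le> (norm (f x))\<^sup>2 + (norm (k x))\<^sup>2"
      using sum_squares_bound[of "norm (f x)" "norm (k x)"] by simp
    moreover have "0 \<le> norm (f x) * norm (k x)" by simp
    ultimately have "norm (f x) * norm (k x) \<le> (norm (f x))\<^sup>2 + (norm (k x))\<^sup>2" by linarith
    then show ?thesis by (simp add: norm_mult)
  qed
  then show "AE x in lborel. norm (f x * cnj (k x)) \<le> norm ((norm (f x))\<^sup>2 + (norm (k x))\<^sup>2)" by simp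
qed

lemma L2_fun_diff_integrable:
  assumes "f \<in> L2_fun" "k \<in> L2_fun" shows "integrable lborel (\<lambda>x. (norm (f x - k x))\<^sup>2)"
proof (rule Bochner_Integration.integrable_bound)
  show "integrable lborel (\<lambda>x. 2 * (norm (f x))\<^sup>2 + 2 * (norm (k x))\<^sup>2)" using assms by (simp add: L2_fun_def)
  have [measurable]: "f \<in> borel_measurable borel" "k \<in> borel_measurable borel" using assms by (auto simp: L2_fun_def)
  show "(\<lambda>x. (norm (f x - k x))\<^sup>2) \<in> borel_measurable lborel" by simp
  have "norm ((norm (f x - k x))\<^sup>2) \<le> norm (2 * (norm (f x))\<^sup>2 + 2 * (norm (k x))\<^sup>2)" for x
  proof -
    have "(norm (f x - k x))\<^sup>2 \<le> (norm (f x) + norm (k x))\<^sup>2" by (intro power_mono norm_triangle_ineq4) auto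
    also have "\<dots> \<le> 2 * (norm (f x))\<^sup>2 + 2 * (norm (k x))\<^sup>2"
      using sum_squares_bound[of "norm (f x)" "norm (k x)"] by (simp add: power2_sum)
    finally show ?thesis by simp
  qed
  then show "AE x in lborel. norm ((norm (f x - k x))\<^sup>2) \<le> norm (2 * (norm (f x))\<^sup>2 + 2 * (norm (k x))\<^sup>2)" by simp
qed

lemma L2_fun_add:
  assumes "f \<in> L2_fun" "g \<in> L2_fun" shows "(\<lambda>x. f x + g x) \<in> L2_fun"
proof -
  have [measurable]: "f \<in> borel_measurable borel" "g \<in> borel_measurable borel" using assms by (auto simp: L2_fun_def)
  have "(\<lambda>x. - g x) \<in> L2_fun" using assms(2) by (simp add: L2_fun_def)
  from L2_fun_diff_integrable[OF assms(1) this] show ?thesis by (simp add: L2_fun_def)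
qed

lemma L2_fun_cmult:
  assumes "f \<in> L2_fun" shows "(\<lambda>x. c * f x) \<in> L2_fun"
proof -
  have [measurable]: "f \<in> borel_measurable borel" using assms by (simp add: L2_fun_def)
  have "(\<lambda>x. c * f x) \<in> borel_measurable borel" by measurable
  then show ?thesis using assms by (simp add: L2_fun_def norm_mult power_mult_distrib)
qed

lemma schwartz_L2_fun: assumes "schwartz f" shows "f \<in> L2_fun"
proof -
  have "schwartz (\<lambda>x. f x * cnj (f x))" by (intro schwartz_mult schwartz_cnj assms)
  then have "integrable lborel (\<lambda>x. norm (f x * cnj (f x)))" by (intro integrable_norm schwartz_integrable)
  then have "integrable lborel (\<lambda>x. (norm (f x))\<^sup>2)" by (simp add: norm_mult power2_eq_square)
  then show ?thesis using smooth_measurable[OF schwartz_smooth[OF assms]] by (simp add: L2_fun_def)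
qed

text \<open>The inequality \<open>a b \<le> a\<^sup>2 / \<epsilon> + \<epsilon> b\<^sup>2\<close>, with \<open>\<epsilon>\<close> sent to zero after the limit, takes the place of the
  Cauchy-Schwarz inequality.\<close>

lemma L2_annihilator_closed:
  fixes \<Phi> :: "(real^'n \<Rightarrow> complex) set"
  assumes \<Phi>: "\<Phi> \<subseteq> L2_fun"
  shows "L2_closed_subspace {f \<in> L2_fun. \<forall>k\<in>\<Phi>. L2_inner f k = 0}"
  unfolding L2_closed_subspace_def
proof (intro conjI allI ballI impI; (elim conjE)?)
  let ?E = "{f \<in> L2_fun. \<forall>k\<in>\<Phi>. L2_inner f k = 0}"
  show "?E \<subseteq> L2_fun" by blast
  show "(\<lambda>_. 0) \<in> ?E" by (simp add: L2_fun_def L2_inner_def)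
  show "(\<lambda>x. f x + g x) \<in> ?E" if "f \<in> ?E" "g \<in> ?E" for f g
  proof -
    have "L2_inner (\<lambda>x. f x + g x) k = L2_inner f k + L2_inner g k" if "k \<in> \<Phi>" for k
      unfolding L2_inner_def distrib_right
      using \<open>f \<in> ?E\<close> \<open>g \<in> ?E\<close> \<Phi> that by (intro Bochner_Integration.integral_add L2_fun_mult_integrable) auto
    then show ?thesis using that L2_fun_add by auto
  qed
  show "(\<lambda>x. c * f x) \<in> ?E" if "f \<in> ?E" for c f
  proof -
    have "L2_inner (\<lambda>x. c * f x) k = c * L2_inner f k" for k
      unfolding L2_inner_def mult.assoc by (rule integral_mult_right_zero)
    then show ?thesis using that L2_fun_cmult by auto
  qed
  fix F :: "nat \<Rightarrow> real^'n \<Rightarrow> complex" and f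
  assume F: "\<forall>n. F n \<in> ?E" and f: "f \<in> L2_fun" and lim: "(\<lambda>n. LINT x|lborel. (norm (F n x - f x))\<^sup>2) \<longlonglongrightarrow> 0"
  have "L2_inner f k = 0" if k: "k \<in> \<Phi>" for k
  proof -
    have kL: "k \<in> L2_fun" using k \<Phi> by blast
    define b where "b = (\<integral>x. (norm (k x))\<^sup>2 \<partial>lborel)"
    define a where "a n = (\<integral>x. (norm (F n x - f x))\<^sup>2 \<partial>lborel)" for n
    have FL: "F n \<in> L2_fun" for n using F by blast
    have est: "norm (L2_inner f k) \<le> (1 / \<epsilon>) * a n + \<epsilon> * b" if "\<epsilon> > 0" for \<epsilon> n
    proof -
      have "L2_inner f k = - (L2_inner (F n) k - L2_inner f k)" using F k by simp
      also have "L2_inner (F n) k - L2_inner f k = (\<integral>x. (F n x - f x) * cnj (k x) \<partial>lborel)"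
        unfolding L2_inner_def left_diff_distrib
        by (rule Bochner_Integration.integral_diff[symmetric]; rule L2_fun_mult_integrable[OF _ kL]) (use FL f in auto)
      finally have "norm (L2_inner f k) \<le> (\<integral>x. norm ((F n x - f x) * cnj (k x)) \<partial>lborel)"
        by (simp add: integral_norm_bound)
      also have "\<dots> \<le> (\<integral>x. (1 / \<epsilon>) * (norm (F n x - f x))\<^sup>2 + \<epsilon> * (norm (k x))\<^sup>2 \<partial>lborel)"
      proof (rule integral_mono)
        have "integrable lborel (\<lambda>x. F n x * cnj (k x) - f x * cnj (k x))"
          by (intro Bochner_Integration.integrable_diff L2_fun_mult_integrable FL f kL)
        then show "integrable lborel (\<lambda>x. norm ((F n x - f x) * cnj (k x)))" by (simp add: left_diff_distrib)
        show "integrable lborel (\<lambda>x. (1 / \<epsilon>) * (norm (F n x - f x))\<^sup>2 + \<epsilon> * (norm (k x))\<^sup>2)"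
          using L2_fun_diff_integrable[OF FL f] kL by (simp add: L2_fun_def)
        fix x
        let ?p = "norm (F n x - f x)" and ?q = "norm (k x)"
        have "0 \<le> (?p - \<epsilon> * ?q)\<^sup>2" by simp
        then have "2 * \<epsilon> * (?p * ?q) \<le> ?p\<^sup>2 + \<epsilon>\<^sup>2 * ?q\<^sup>2" by (simp add: power2_eq_square algebra_simps)
        moreover have "0 \<le> \<epsilon> * (?p * ?q)" using that by simp
        ultimately have "\<epsilon> * (?p * ?q) \<le> ?p\<^sup>2 + \<epsilon>\<^sup>2 * ?q\<^sup>2" by linarith
        then have "?p * ?q \<le> (?p\<^sup>2 + \<epsilon>\<^sup>2 * ?q\<^sup>2) / \<epsilon>" using that by (simp add: pos_le_divide_eq mult.commute)
        also have "\<dots> = (1 / \<epsilon>) * ?p\<^sup>2 + \<epsilon> * ?q\<^sup>2" using that by (simp add: add_divide_distrib power2_eq_square)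
        finally show "norm ((F n x - f x) * cnj (k x)) \<le> (1 / \<epsilon>) * ?p\<^sup>2 + \<epsilon> * ?q\<^sup>2" by (simp add: norm_mult)
      qed
      also have "\<dots> = (1 / \<epsilon>) * a n + \<epsilon> * b"
        using L2_fun_diff_integrable[OF FL f, of n] kL unfolding a_def b_def by (simp add: L2_fun_def)
      finally show ?thesis .
    qed
    have est2: "norm (L2_inner f k) \<le> \<epsilon> * b" if "\<epsilon> > 0" for \<epsilon>
    proof (rule LIMSEQ_le_const)
      have "(\<lambda>n. (1 / \<epsilon>) * a n + \<epsilon> * b) \<longlonglongrightarrow> (1 / \<epsilon>) * 0 + \<epsilon> * b"
        unfolding a_def by (intro tendsto_intros lim)
      then show "(\<lambda>n. (1 / \<epsilon>) * a n + \<epsilon> * b) \<longlonglongrightarrow> \<epsilon> * b" by simp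
    qed (use est[OF that] in blast)
    have "norm (L2_inner f k) \<le> 0"
    proof (rule LIMSEQ_le_const)
      have "(\<lambda>n. 1 / real (Suc n) * b) \<longlonglongrightarrow> 0 * b" by (intro tendsto_intros LIMSEQ_Suc[OF lim_1_over_n])
      then show "(\<lambda>n. 1 / real (Suc n) * b) \<longlonglongrightarrow> 0" by simp
      show "\<exists>N. \<forall>n\<ge>N. norm (L2_inner f k) \<le> 1 / real (Suc n) * b" by (intro exI allI impI est2) simp
    qed
    then show ?thesis by simp
  qed
  then show "f \<in> ?E" using f by simp
qed

lemma quasi_regular_L2_fun:
  fixes h :: "real^('n::{finite,wellorder})^('n::_)"
  assumes f: "f \<in> L2_fun" and h: "invertible h"
  shows "quasi_regular (x, h) f \<in> L2_fun"
proof -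
  have [measurable]: "f \<in> borel_measurable borel" using f by (simp add: L2_fun_def)
  have inv: "invertible (matrix_inv h)" unfolding invertible_def using matrix_inv_mult[OF h] by blast
  have m: "(\<lambda>z. f (matrix_inv h *v (z - x))) \<in> borel_measurable borel"
    by (rule measurable_compose[of _ _ borel]) (auto intro!: borel_measurable_continuous_onI continuous_intros matrix_vector_mult_linear_continuous_on continuous_on_compose2[of UNIV "(*v) (matrix_inv h)"])
  have "integrable lborel (\<lambda>z. (norm (f (matrix_inv h *v z + (- (matrix_inv h *v x)))))\<^sup>2)"
    by (rule lborel_integrable_affine[of "\<lambda>z. (norm (f z))\<^sup>2", OF _ inv]) (use f in \<open>simp add: L2_fun_def\<close>)
  then have "integrable lborel (\<lambda>z. (norm (f (matrix_inv h *v (z - x))))\<^sup>2)" by (simp add: matrix_vector_mult_diff_distrib)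
  then have "(\<lambda>z. f (matrix_inv h *v (z - x))) \<in> L2_fun" using m by (simp add: L2_fun_def)
  from L2_fun_cmult[OF this] show ?thesis by (simp add: quasi_regular_def[abs_def])
qed

lemma quasi_regular_unitary:
  fixes h h' :: "real^('n::{finite,wellorder})^('n::_)"
  assumes f: "f \<in> L2_fun" and k: "k \<in> L2_fun" and h: "invertible h" and h': "invertible h'"
  shows "L2_inner (quasi_regular (x', h') f) (quasi_regular (x, h) k)
     = L2_inner f (quasi_regular (matrix_inv h' *v (x - x'), matrix_inv h' ** h) k)"
proof -
  let ?d = "\<bar>det h\<bar>" and ?d' = "\<bar>det h'\<bar>"
  have d: "?d > 0" "?d' > 0" using h h' invertible_det_nz by auto
  have inv: "matrix_inv (matrix_inv h' ** h) = matrix_inv h ** h'"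
  proof (rule matrix_inv_unique)
    have "matrix_inv h' ** h ** (matrix_inv h ** h') = matrix_inv h' ** (h ** matrix_inv h) ** h'" by (simp add: matrix_mul_assoc)
    then show "matrix_inv h' ** h ** (matrix_inv h ** h') = mat 1" by (simp add: matrix_inv_mult h h')
  qed
  have det: "det (matrix_inv h' ** h) = det h / det h'"
  proof -
    have "det (matrix_inv h') * det h' = 1" by (metis matrix_inv_mult(1)[OF h'] det_I det_mul)
    then show ?thesis using d by (simp add: det_mul field_simps)
  qed
  have e: "?d' * (?d' powr (- 1 / 2) * ?d powr (- 1 / 2)) = \<bar>det h / det h'\<bar> powr (- 1 / 2)"
  proof -
    have 1: "?d' * ?d' powr (- 1 / 2) = ?d' powr (1 / 2)" using d powr_add[of ?d' 1 "-1/2"] by simp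
    have 2: "\<bar>det h / det h'\<bar> powr (- 1 / 2) = ?d powr (- 1 / 2) / ?d' powr (- 1 / 2)"
      unfolding abs_divide by (rule powr_divide)
    have 3: "?d' powr (- 1 / 2) = inverse (?d' powr (1 / 2))" using powr_minus[of ?d' "1/2"] by simp
    have "?d' * (?d' powr (- 1 / 2) * ?d powr (- 1 / 2)) = ?d' powr (1 / 2) * ?d powr (- 1 / 2)"
      by (simp only: mult.assoc[symmetric] 1)
    also have "\<dots> = ?d powr (- 1 / 2) / inverse (?d' powr (1 / 2))" by (simp only: divide_inverse inverse_inverse_eq mult.commute)
    finally show ?thesis by (simp only: 2 3)
  qed
  have i: "integrable lborel (\<lambda>z. quasi_regular (x', h') f z * cnj (quasi_regular (x, h) k z))"
    by (intro L2_fun_mult_integrable quasi_regular_L2_fun f k h h')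
  then have m: "(\<lambda>z. quasi_regular (x', h') f z * cnj (quasi_regular (x, h) k z)) \<in> borel_measurable borel" by simp
  have "L2_inner (quasi_regular (x', h') f) (quasi_regular (x, h) k) =
    ?d' *\<^sub>R (\<integral>w. quasi_regular (x', h') f (h' *v w + x') * cnj (quasi_regular (x, h) k (h' *v w + x')) \<partial>lborel)"
    unfolding L2_inner_def by (rule lborel_integral_affine[OF m h', symmetric])
  also have "\<dots> = (\<integral>w. ?d' *\<^sub>R (quasi_regular (x', h') f (h' *v w + x') * cnj (quasi_regular (x, h) k (h' *v w + x'))) \<partial>lborel)"
    by (rule integral_scaleR_right[symmetric])
  also have "\<dots> = L2_inner f (quasi_regular (matrix_inv h' *v (x - x'), matrix_inv h' ** h) k)"
    unfolding L2_inner_def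
  proof (rule Bochner_Integration.integral_cong[OF refl])
    fix w
    have 1: "matrix_inv h' *v (h' *v w + x' - x') = w" by (simp add: matrix_vector_mul_assoc matrix_inv_mult h')
    have 2: "(matrix_inv h ** h') *v (w - matrix_inv h' *v (x - x')) = matrix_inv h *v (h' *v w + x' - x)"
    proof -
      have "h' *v (w - matrix_inv h' *v (x - x')) = h' *v w + x' - x"
        by (simp add: matrix_vector_mult_diff_distrib matrix_vector_mul_assoc matrix_inv_mult h')
      then show ?thesis by (simp add: matrix_vector_mul_assoc[symmetric])
    qed
    have "?d' *\<^sub>R (quasi_regular (x', h') f (h' *v w + x') * cnj (quasi_regular (x, h) k (h' *v w + x')))
      = of_real (?d' * (?d' powr (- 1 / 2) * ?d powr (- 1 / 2))) * (f w * cnj (k (matrix_inv h *v (h' *v w + x' - x))))"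
      unfolding quasi_regular_def by (simp only: fst_conv snd_conv 1 scaleR_conv_of_real complex_cnj_mult complex_cnj_complex_of_real of_real_mult mult_ac)
    then show "?d' *\<^sub>R (quasi_regular (x', h') f (h' *v w + x') * cnj (quasi_regular (x, h) k (h' *v w + x')))
      = f w * cnj (quasi_regular (matrix_inv h' *v (x - x'), matrix_inv h' ** h) k w)"
      unfolding e quasi_regular_def by (simp only: fst_conv snd_conv inv det 2 complex_cnj_mult complex_cnj_complex_of_real mult_ac)
  qed
  finally show ?thesis .
qed

lemma bump_exists:
  fixes U :: "(real^'n) set"
  assumes "open U" "a \<in> U"
  shows "\<exists>b. schwartz b \<and> b a = 1 \<and> (\<forall>z. b z \<noteq> 0 \<longrightarrow> z \<in> U)"
proof -
  obtain \<delta> where \<delta>: "\<delta> > 0" "\<And>z. norm (z - a) < 3 * \<delta> \<Longrightarrow> z \<in> U" using open_contains_ball3[OF assms] by metis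
  have "\<exists>b. test_function b \<and> (\<forall>z. norm (z - a) \<le> \<delta> \<longrightarrow> b z = 1) \<and> (\<forall>z. norm (z - a) \<ge> 3 * \<delta> \<longrightarrow> b z = 0)"
    by (rule plateau_function[of \<delta> "3 * \<delta>" a]) (use \<delta>(1) in auto)
  then obtain b where "test_function b" "\<And>z. norm (z - a) \<le> \<delta> \<Longrightarrow> b z = 1" "\<And>z. norm (z - a) \<ge> 3 * \<delta> \<Longrightarrow> b z = 0" by blast
  then show ?thesis using \<delta> by (intro exI[of _ b] conjI test_function_schwartz) (auto simp: not_le[symmetric])
qed

lemma fourier_AE_0:
  assumes "AE x in lborel. f x = 0" shows "fourier f \<xi> = 0"
proof -
  have "AE x in lborel. f x * character \<xi> x = 0" using assms by eventually_elim simp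
  then show ?thesis unfolding fourier_character by (rule integral_eq_zero_AE)
qed

text \<open>Choose \<open>\<phi>\<close> and \<open>f\<close> with frequencies in \<open>U1\<close> and \<open>U2\<close>. If no dual translate of \<open>U1\<close> met \<open>U2\<close>, then \<open>f\<close> would be
  orthogonal to all \<open>\<pi>(y,h)\<phi>\<close> by Parseval, so the orthogonal complement of these functions would be a closed
  invariant subspace that contains \<open>f\<close> but not \<open>\<phi>\<close>.\<close>

theorem irreducible_imp_transitive:
  fixes H :: "(real^('n::{finite,wellorder})^('n::_)) set"
  assumes H: "matrix_group H" and irr: "quasi_regular_irreducible H"
    and U1: "open U1" "U1 \<noteq> {}" and U2: "open U2" "U2 \<noteq> {}"
  shows "\<exists>h\<in>H. \<exists>\<xi>\<in>U1. transpose h *v \<xi> \<in> U2"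
proof (rule ccontr)
  assume no: "\<not> (\<exists>h\<in>H. \<exists>\<xi>\<in>U1. transpose h *v \<xi> \<in> U2)"
  have inv: "invertible h" if "h \<in> H" for h using H that by (auto simp: matrix_group_def GL_def)
  obtain a1 a2 where a: "a1 \<in> U1" "a2 \<in> U2" using U1 U2 by blast
  obtain b1 where b1: "schwartz b1" "b1 a1 = 1" "\<And>z. b1 z \<noteq> 0 \<Longrightarrow> z \<in> U1" using bump_exists[OF U1(1) a(1)] by blast
  obtain b2 where b2: "schwartz b2" "b2 a2 = 1" "\<And>z. b2 z \<noteq> 0 \<Longrightarrow> z \<in> U2" using bump_exists[OF U2(1) a(2)] by blast
  obtain \<phi> where phi: "schwartz \<phi>" "fourier \<phi> = b1" using fourier_surjective[OF b1(1)] by blast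
  obtain f where f: "schwartz f" "fourier f = b2" using fourier_surjective[OF b2(1)] by blast
  define \<Phi> where "\<Phi> = (\<lambda>g. quasi_regular g \<phi>) ` semidirect H"
  have pL: "\<phi> \<in> L2_fun" and fL: "f \<in> L2_fun" using phi f schwartz_L2_fun by auto
  have \<Phi>: "\<Phi> \<subseteq> L2_fun" unfolding \<Phi>_def semidirect_def using quasi_regular_L2_fun[OF pL] inv by auto
  let ?E = "{f \<in> L2_fun. \<forall>k\<in>\<Phi>. L2_inner f k = 0}"
  have "\<forall>g\<in>semidirect H. \<forall>f\<in>?E. quasi_regular g f \<in> ?E"
  proof (intro ballI)
    fix g' f assume g': "g' \<in> semidirect H" and fE: "f \<in> ?E"
    obtain x' h' where g'e: "g' = (x', h')" by (cases g')
    have h': "h' \<in> H" using g' by (simp add: g'e semidirect_def)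
    have "L2_inner (quasi_regular g' f) (quasi_regular (x, h) \<phi>) = 0" if "h \<in> H" for x h
    proof -
      have "matrix_inv h' ** h \<in> H" using H h' that by (auto simp: matrix_group_def)
      then have "quasi_regular (matrix_inv h' *v (x - x'), matrix_inv h' ** h) \<phi> \<in> \<Phi>" by (simp add: \<Phi>_def semidirect_def)
      then show ?thesis using fE quasi_regular_unitary[OF _ pL inv[OF that] inv[OF h'], of f x' x] by (simp add: g'e)
    qed
    then show "quasi_regular g' f \<in> ?E" using fE quasi_regular_L2_fun[OF _ inv[OF h']] by (auto simp: g'e \<Phi>_def semidirect_def)
  qed
  with irr L2_annihilator_closed[OF \<Phi>] have "?E = {f\<in>L2_fun. AE x in lborel. f x = 0} \<or> ?E = L2_fun"
    unfolding quasi_regular_irreducible_def by blast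
  then show False
  proof
    assume E: "?E = {f\<in>L2_fun. AE x in lborel. f x = 0}"
    have "L2_inner f (quasi_regular (y, h) \<phi>) = 0" if "h \<in> H" for y h
    proof -
      have z: "fourier f \<zeta> * cnj (fourier (quasi_regular (y, h) \<phi>) \<zeta>) = 0" for \<zeta>
      proof (rule ccontr)
        assume "fourier f \<zeta> * cnj (fourier (quasi_regular (y, h) \<phi>) \<zeta>) \<noteq> 0"
        then have "b2 \<zeta> \<noteq> 0" "b1 (transpose h *v \<zeta>) \<noteq> 0" by (auto simp: f fourier_quasi_regular[OF inv[OF that] phi(1)] phi(2))
        then have "\<zeta> \<in> U2" "transpose h *v \<zeta> \<in> U1" using b1 b2 by auto
        moreover have "transpose (matrix_inv h) *v (transpose h *v \<zeta>) = \<zeta>"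
          by (simp only: matrix_vector_mul_assoc transpose_inverse(2)[OF inv[OF that]] matrix_vector_mul_lid)
        moreover have "matrix_inv h \<in> H" using H that by (auto simp: matrix_group_def)
        ultimately show False using no by metis
      qed
      show ?thesis unfolding parseval[OF f(1) schwartz_quasi_regular[OF inv[OF that] phi(1)]] z by simp
    qed
    then have "f \<in> ?E" using fL by (auto simp: \<Phi>_def semidirect_def)
    then have "AE x in lborel. f x = 0" unfolding E by blast
    from fourier_AE_0[OF this, of a2] show False using b2 f by simp
  next
    assume "?E = L2_fun"
    then have pE: "\<phi> \<in> ?E" using pL by blast
    have "matrix_inv (mat 1 :: real^('n::_)^('n::_)) = mat 1" by (rule matrix_inv_unique) simp
    then have "quasi_regular (0, mat 1) \<phi> = \<phi>" by (simp add: quasi_regular_def[abs_def])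
    moreover have "quasi_regular (0, mat 1) \<phi> \<in> \<Phi>"
      unfolding \<Phi>_def using H by (intro imageI) (simp add: semidirect_def matrix_group_def)
    ultimately have "\<phi> \<in> \<Phi>" by simp
    then have "L2_inner \<phi> \<phi> = 0" using pE by blast
    moreover have "L2_inner \<phi> \<phi> = of_real (\<integral>x. (norm (\<phi> x))\<^sup>2 \<partial>lborel)"
      unfolding L2_inner_def complex_norm_square[symmetric] by (rule integral_complex_of_real)
    ultimately have "(\<integral>x. (norm (\<phi> x))\<^sup>2 \<partial>lborel) = 0" by simp
    then have "AE x in lborel. (norm (\<phi> x))\<^sup>2 = 0"
      using pL integral_nonneg_eq_0_iff_AE[of lborel "\<lambda>x. (norm (\<phi> x))\<^sup>2"] by (simp add: L2_fun_def)
    then have "AE x in lborel. \<phi> x = 0" by simp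
    from fourier_AE_0[OF this, of a1] show False using b1 phi by simp
  qed
qed

text \<open>For a countable basis of open sets, the points whose orbit meets a given basic set form an open
  set, which is dense by \<open>irreducible_imp_transitive\<close>. Baire's theorem provides a point in all of them.\<close>

theorem dense_dual_orbit:
  fixes H :: "(real^('n::{finite,wellorder})^('n::_)) set"
  assumes "matrix_group H" "quasi_regular_irreducible H"
  obtains \<xi> where "\<And>U. open U \<Longrightarrow> U \<noteq> {} \<Longrightarrow> \<exists>h\<in>H. transpose h *v \<xi> \<in> U"
proof -
  obtain \<B> :: "(real^('n::_)) set set" where B: "countable \<B>" "topological_basis \<B>" using ex_countable_basis by blast
  define O' where "O' B = (\<Union>h\<in>H. (\<lambda>\<xi>. transpose h *v \<xi>) -` B)" for B :: "(real^('n::_)) set"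
  let ?G = "O' ` (\<B> - {{}})"
  have "UNIV \<subseteq> closure (\<Inter>?G)"
  proof (rule Baire)
    show "countable ?G" using B by auto
    fix T assume "T \<in> ?G"
    then obtain B' where B': "B' \<in> \<B>" "B' \<noteq> {}" "T = O' B'" by blast
    have oB: "open B'" using B(2) B'(1) by (rule topological_basis_open)
    have oT: "open T" unfolding B'(3) O'_def
      by (intro open_UN ballI open_vimage oB matrix_vector_mult_linear_continuous_on)
    moreover have "UNIV \<subseteq> closure T"
    proof
      fix x :: "real^('n::_)"
      have "\<exists>y\<in>T. y \<in> S" if S: "open S" "x \<in> S" for S
      proof -
        obtain h \<xi> where "h \<in> H" "\<xi> \<in> S" "transpose h *v \<xi> \<in> B'"
          using irreducible_imp_transitive[OF assms S(1) _ oB B'(2)] S(2) by blast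
        then show ?thesis unfolding B'(3) O'_def by blast
      qed
      then show "x \<in> closure T" unfolding closure_iff_nhds_not_empty by blast
    qed
    ultimately show "openin (top_of_set UNIV) T \<and> UNIV \<subseteq> closure T" by simp
  qed simp
  then have "\<Inter>?G \<noteq> {}" by (metis UNIV_I closure_empty empty_iff subsetD)
  then obtain \<xi> where xi: "\<And>B. B \<in> \<B> \<Longrightarrow> B \<noteq> {} \<Longrightarrow> \<xi> \<in> O' B" by auto
  show thesis
  proof (rule that)
    fix U :: "(real^('n::_)) set" assume U: "open U" "U \<noteq> {}"
    obtain x where "x \<in> U" using U by blast
    then obtain B' where "B' \<in> \<B>" "x \<in> B'" "B' \<subseteq> U" using topological_basisE[OF B(2) U(1)] by blast
    then show "\<exists>h\<in>H. transpose h *v \<xi> \<in> U" using xi[of B'] unfolding O'_def by blast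
  qed
qed

section \<open>Transitivity of the shears\<close>

text \<open>The one-parameter group generated by the diagonal matrix of \<open>l\<close> (see \<open>matrix_exp_diag\<close>).\<close>

definition diag_exp :: "('n \<Rightarrow> real) \<Rightarrow> real \<Rightarrow> real^'n^'n" where
  "diag_exp l r = diag_matrix (\<lambda>i. exp (r * l i))"

lemma diag_matrix_mult: "(diag_matrix a ** A) $ i $ j = a i * A $ i $ j"
  by (simp add: diag_matrix_def matrix_matrix_mult_def if_distrib[of "\<lambda>x. x * _"] cong: if_cong)

lemma mult_diag_matrix: "(A ** diag_matrix a) $ i $ j = A $ i $ j * a j"
  by (simp add: diag_matrix_def matrix_matrix_mult_def if_distrib[of "\<lambda>x. _ * x"] cong: if_cong)

lemma diag_exp_add: "diag_exp l r ** diag_exp l t = diag_exp l (r + t)"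
  unfolding vec_eq_iff diag_exp_def diag_matrix_mult by (simp add: diag_matrix_def distrib_right exp_add)

lemma diag_exp_0: "diag_exp l 0 = mat 1"
  by (simp add: vec_eq_iff diag_exp_def diag_matrix_def mat_def)

lemma diag_exp_vec: "(diag_exp l r *v x) $ i = exp (r * l i) * x $ i"
  by (simp add: diag_exp_def diag_matrix_def matrix_vector_mult_def if_distrib[of "\<lambda>x. x * _"] cong: if_cong)

lemma transpose_diag_exp: "transpose (diag_exp l r) = diag_exp l r"
  by (simp add: vec_eq_iff diag_exp_def diag_matrix_def transpose_def)

lemma matrix_exp_diag: "matrix_exp (r *\<^sub>R diag_matrix l) = diag_exp l r"
proof -
  have rl: "r *\<^sub>R diag_matrix l = diag_matrix (\<lambda>i. r * l i)" by (simp add: vec_eq_iff diag_matrix_def)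
  have p: "(((**) (diag_matrix (\<lambda>i. r * l i)) ^^ k) (mat 1)) = diag_matrix (\<lambda>i. (r * l i) ^ k)" for k
  proof (induction k)
    case (Suc k)
    have "((**) (diag_matrix (\<lambda>i. r * l i)) ^^ Suc k) (mat 1) = diag_matrix (\<lambda>i. r * l i) ** diag_matrix (\<lambda>i. (r * l i) ^ k)"
      by (simp add: Suc)
    also have "\<dots> = diag_matrix (\<lambda>i. (r * l i) ^ Suc k)"
      unfolding vec_eq_iff diag_matrix_mult by (simp add: diag_matrix_def)
    finally show ?case .
  qed (simp add: vec_eq_iff diag_matrix_def mat_def)
  have "(\<lambda>k. (1 / fact k) *\<^sub>R diag_matrix (\<lambda>i. (r * l i) ^ k)) sums diag_exp l r"
    unfolding sums_def
  proof (intro vec_tendstoI)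
    fix i j
    have e: "(\<lambda>k. (r * l i) ^ k /\<^sub>R fact k) sums exp (r * l i)" by (rule exp_converges)
    show "(\<lambda>n. (\<Sum>k<n. (1 / fact k) *\<^sub>R diag_matrix (\<lambda>i. (r * l i) ^ k)) $ i $ j) \<longlonglongrightarrow> diag_exp l r $ i $ j"
      using e by (cases "i = j") (simp_all add: sums_def diag_matrix_def diag_exp_def divide_inverse)
  qed
  then show ?thesis unfolding matrix_exp_def rl p by (rule sums_unique[symmetric])
qed

lemma op_norm_le: "(\<And>x. norm (A *v x) \<le> c * norm x) \<Longrightarrow> op_norm A \<le> c"
  unfolding op_norm_def by (rule onorm_le)

lemma op_norm_le_norm: "op_norm (A::real^'n^'n) \<le> real CARD('n) * real CARD('n) * norm A"
proof -
  have "op_norm A \<le> (\<Sum>i\<in>UNIV. \<Sum>j\<in>UNIV. \<bar>A $ i $ j\<bar>)" unfolding op_norm_def by (rule onorm_le_matrix_component_sum)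
  also have "\<dots> \<le> (\<Sum>i\<in>(UNIV::'n set). \<Sum>j\<in>(UNIV::'n set). norm A)"
    by (intro sum_mono) (meson Finite_Cartesian_Product.norm_nth_le component_le_norm_cart order_trans)
  finally show ?thesis by simp
qed

lemma norm_le_op_norm: "norm (A::real^'n^'n) \<le> real CARD('n) * real CARD('n) * op_norm A"
proof -
  have "norm A \<le> (\<Sum>i\<in>UNIV. norm (A $ i))" unfolding norm_vec_def by (rule L2_set_le_sum) simp
  also have "\<dots> \<le> (\<Sum>i\<in>UNIV. \<Sum>j\<in>UNIV. \<bar>A $ i $ j\<bar>)" by (intro sum_mono norm_le_l1_cart)
  also have "\<dots> \<le> (\<Sum>i\<in>(UNIV::'n set). \<Sum>j\<in>(UNIV::'n set). op_norm A)" by (intro sum_mono abs_entry_le_op_norm)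
  finally show ?thesis by simp
qed

lemma op_norm_transpose_le: "op_norm (transpose A) \<le> op_norm A"
  by (rule op_norm_le) (rule norm_transpose_le)

text \<open>The situation of a generalized shearlet group whose generator is the diagonal matrix of \<open>lam\<close>, with
  \<open>m\<close> the first index. Only the elements of \<open>S\<close> and the dilations are known to lie in \<open>H\<close> at the outset; that \<open>H\<close> also
  contains \<open>-1\<close> is a consequence of irreducibility (\<open>neg_H\<close>).\<close>

locale shearlet =
  fixes H S :: "(real^('n::{finite,wellorder})^('n::_)) set" and lam :: "('n::_) \<Rightarrow> real" and m :: "'n::_"
  assumes grpH: "matrix_group H" and grpS: "matrix_group S" and SH: "S \<subseteq> H" and diag_expH: "\<And>r. diag_exp lam r \<in> H"
    and Suni: "S \<subseteq> unitriangular" and Scomm: "\<And>A B. A \<in> S \<Longrightarrow> B \<in> S \<Longrightarrow> A ** B = B ** A"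
    and Sclosed: "closed S"
    and decomp: "\<And>h. h \<in> H \<Longrightarrow> \<exists>\<epsilon>\<in>{1,-1}. \<exists>r. \<exists>s\<in>S. h = \<epsilon> *\<^sub>R (diag_exp lam r ** s)"
    and irr: "quasi_regular_irreducible H"
    and m_le: "\<And>i. m \<le> i" and lam_m: "lam m = 1" and lam: "\<And>i. i \<noteq> m \<Longrightarrow> 0 < lam i \<and> lam i < 1"
begin

text \<open>The dual action consists of transposes, so the shears enter as lower triangular matrices.\<close>

definition ST where "ST = transpose ` S"

lemma H_mult: "A \<in> H \<Longrightarrow> B \<in> H \<Longrightarrow> A ** B \<in> H" and H_inv: "A \<in> H \<Longrightarrow> matrix_inv A \<in> H"
  and H_invertible: "A \<in> H \<Longrightarrow> invertible A"
  using grpH by (auto simp: matrix_group_def GL_def)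

lemma S_mult: "A \<in> S \<Longrightarrow> B \<in> S \<Longrightarrow> A ** B \<in> S" and S_inv: "A \<in> S \<Longrightarrow> matrix_inv A \<in> S"
  and S_invertible: "A \<in> S \<Longrightarrow> invertible A"
  using grpS by (auto simp: matrix_group_def GL_def)

lemma ST_mult: "A \<in> ST \<Longrightarrow> B \<in> ST \<Longrightarrow> A ** B \<in> ST"
  unfolding ST_def using S_mult by (auto simp: matrix_transpose_mul[symmetric])

lemma ST_invertible: "A \<in> ST \<Longrightarrow> invertible A"
  unfolding ST_def using S_invertible invertible_transpose by blast

lemma ST_inv: assumes "A \<in> ST" shows "matrix_inv A \<in> ST"
proof -
  obtain s where s: "s \<in> S" "A = transpose s" using assms by (auto simp: ST_def)
  have "matrix_inv A = transpose (matrix_inv s)"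
    unfolding s(2) by (rule matrix_inv_unique) (rule transpose_inverse(1)[OF S_invertible[OF s(1)]])
  then show ?thesis unfolding ST_def using S_inv[OF s(1)] by blast
qed

lemma ST_comm: "A \<in> ST \<Longrightarrow> B \<in> ST \<Longrightarrow> A ** B = B ** A"
  unfolding ST_def using Scomm by (auto simp: matrix_transpose_mul[symmetric])

lemma ST_first: assumes "\<sigma> \<in> ST" shows "(\<sigma> *v x) $ m = x $ m"
proof -
  obtain s where s: "s \<in> S" "\<sigma> = transpose s" using assms by (auto simp: ST_def)
  have "\<sigma> $ m $ j = (if j = m then 1 else 0)" for j
    using s Suni m_le[of j] by (auto simp: unitriangular_def transpose_def)
  then show ?thesis by (simp add: matrix_vector_mult_def if_distrib[of "\<lambda>x. x * _"] cong: if_cong)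
qed

lemma ST_closed: "closed ST"
proof -
  have "ST = transpose -` S"
    unfolding ST_def by (auto simp: image_iff) (metis transpose_transpose)
  moreover have "continuous_on UNIV (transpose :: real^('n::_)^('n::_) \<Rightarrow> _)"
    unfolding transpose_def by (intro continuous_intros)
  ultimately show ?thesis using Sclosed closed_vimage by metis
qed

text \<open>The conjugate lies in \<open>H\<close>; comparing the diagonal entry at \<open>m\<close> shows that its decomposition has
  trivial sign and trivial dilation.\<close>

lemma conj_S: assumes "s \<in> S" shows "diag_exp lam r ** s ** diag_exp lam (- r) \<in> S"
proof -
  let ?h = "diag_exp lam r ** s ** diag_exp lam (- r)"
  have "?h \<in> H" using assms SH by (intro H_mult diag_expH) auto
  then obtain \<epsilon> r' s' where h: "\<epsilon> \<in> {1, -1}" "s' \<in> S" "?h = \<epsilon> *\<^sub>R (diag_exp lam r' ** s')" using decomp by blast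
  have "?h $ m $ m = s $ m $ m" unfolding diag_exp_def mult_diag_matrix diag_matrix_mult by (simp add: exp_minus)
  moreover have "s $ m $ m = 1" "s' $ m $ m = 1" using assms h(2) Suni by (auto simp: unitriangular_def)
  moreover have "(\<epsilon> *\<^sub>R (diag_exp lam r' ** s')) $ m $ m = \<epsilon> * exp r' * s' $ m $ m" unfolding diag_exp_def by (simp add: diag_matrix_mult lam_m)
  ultimately have e: "\<epsilon> * exp r' = 1" using h(3) by simp
  then have "\<epsilon> = 1" using h(1) by (auto simp: minus_equation_iff) (metis exp_gt_zero less_minus_iff not_one_less_zero neg_0_less_iff_less zero_less_one less_asym)
  with e have "r' = 0" by simp
  then show ?thesis using h \<open>\<epsilon> = 1\<close> by (simp add: diag_exp_0)
qed

lemma conj_ST: assumes "\<sigma> \<in> ST" shows "diag_exp lam r ** \<sigma> ** diag_exp lam (- r) \<in> ST"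
proof -
  obtain s where s: "s \<in> S" "\<sigma> = transpose s" using assms by (auto simp: ST_def)
  have "transpose (diag_exp lam (- r) ** s ** diag_exp lam r) = diag_exp lam r ** \<sigma> ** diag_exp lam (- r)"
    by (simp add: matrix_transpose_mul transpose_diag_exp s(2) matrix_mul_assoc)
  moreover have "diag_exp lam (- r) ** s ** diag_exp lam r \<in> S" using conj_S[OF s(1), of "- r"] by simp
  ultimately show ?thesis unfolding ST_def by (metis imageI)
qed

lemma dual_action:
  assumes "h \<in> H"
  obtains \<epsilon> r \<sigma> where "\<epsilon> \<in> {1, -1}" "\<sigma> \<in> ST" "h = \<epsilon> *\<^sub>R (diag_exp lam r ** transpose \<sigma>)"
    "\<And>x. transpose h *v x = \<epsilon> *\<^sub>R (\<sigma> *v (diag_exp lam r *v x))"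
proof -
  obtain \<epsilon> r s where h: "\<epsilon> \<in> {1, -1}" "s \<in> S" "h = \<epsilon> *\<^sub>R (diag_exp lam r ** s)" using decomp[OF assms] by blast
  have "transpose h = \<epsilon> *\<^sub>R transpose (diag_exp lam r ** s)" unfolding h(3) by (simp add: vec_eq_iff transpose_def)
  then have "transpose h = \<epsilon> *\<^sub>R (transpose s ** diag_exp lam r)" by (simp add: matrix_transpose_mul transpose_diag_exp)
  then have "transpose h *v x = \<epsilon> *\<^sub>R (transpose s *v (diag_exp lam r *v x))" for x
    by (simp only: scaleR_matrix_vector_assoc[symmetric] matrix_vector_mul_assoc)
  then show thesis using that[of \<epsilon> "transpose s" r] h by (auto simp: ST_def)
qed

lemma dual_action_first:
  assumes "\<sigma> \<in> ST" shows "(\<epsilon> *\<^sub>R (\<sigma> *v (diag_exp lam r *v x))) $ m = \<epsilon> * exp r * x $ m"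
  by (simp add: ST_first[OF assms] diag_exp_vec lam_m)

text \<open>Shears and dilations preserve the half-spaces \<open>x $ m > 0\<close> and \<open>x $ m < 0\<close>, whereas topological transitivity
  provides an element that joins them.\<close>

lemma neg_H: "- mat 1 \<in> H"
proof -
  have "open {x::real^('n::_). x $ m > 0}" "open {x::real^('n::_). x $ m < 0}"
    by (intro open_Collect_less continuous_intros)+
  moreover have "axis m 1 \<in> {x::real^('n::_). x $ m > 0}" "axis m (-1) \<in> {x::real^('n::_). x $ m < 0}" by auto
  ultimately obtain h \<xi> where h: "h \<in> H" "\<xi> $ m > 0" "(transpose h *v \<xi>) $ m < 0"
    using irreducible_imp_transitive[OF grpH irr, of "{x. x $ m > 0}" "{x. x $ m < 0}"] by blast
  obtain \<epsilon> r \<sigma> where e: "\<epsilon> \<in> {1, -1}" "\<sigma> \<in> ST" "h = \<epsilon> *\<^sub>R (diag_exp lam r ** transpose \<sigma>)" "transpose h *v \<xi> = \<epsilon> *\<^sub>R (\<sigma> *v (diag_exp lam r *v \<xi>))"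
    using dual_action[OF h(1)] by metis
  have "\<epsilon> * exp r * \<xi> $ m < 0" using h(3) unfolding e(4) dual_action_first[OF e(2)] .
  then have "\<epsilon> = -1" using e(1) h(2) by (auto simp: mult_less_0_iff)
  then have hm: "h = - (diag_exp lam r ** transpose \<sigma>)" using e by simp
  have "transpose \<sigma> \<in> S" using e(2) by (auto simp: ST_def)
  then have dH: "diag_exp lam r ** transpose \<sigma> \<in> H" using SH by (intro H_mult diag_expH) auto
  let ?d = "diag_exp lam r ** transpose \<sigma>"
  have "h ** matrix_inv ?d = - (?d ** matrix_inv ?d)" unfolding hm
    by (simp add: vec_eq_iff matrix_matrix_mult_def sum_negf)
  then have "h ** matrix_inv ?d = - mat 1" by (simp add: matrix_inv_mult[OF H_invertible[OF dH]])
  then show ?thesis using H_mult[OF h(1) H_inv[OF dH]] by simp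
qed

lemma action_exists:
  assumes "\<epsilon> \<in> {1, -1}" "\<sigma> \<in> ST" shows "\<epsilon> *\<^sub>R (diag_exp lam r ** transpose \<sigma>) \<in> H"
proof -
  have "transpose \<sigma> \<in> S" using assms(2) by (auto simp: ST_def)
  then have dH: "diag_exp lam r ** transpose \<sigma> \<in> H" using SH by (intro H_mult diag_expH) auto
  have "(- mat 1) ** (diag_exp lam r ** transpose \<sigma>) = - (diag_exp lam r ** transpose \<sigma>)"
    by (simp add: matrix_eq matrix_vector_mul_assoc[symmetric] matrix_vector_mult_minus_left)
  then show ?thesis using assms(1) dH H_mult[OF neg_H dH] by auto
qed

text \<open>Off the hyperplane \<open>x $ m = 0\<close>, every orbit of the signed dilations meets the hyperplane \<open>x $ m = 1\<close> in
  exactly one point.\<close>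

definition to_hyperplane where "to_hyperplane x = sgn (x $ m) *\<^sub>R (diag_exp lam (- ln \<bar>x $ m\<bar>) *v x)"

lemma to_hyperplane_first: "x $ m \<noteq> 0 \<Longrightarrow> to_hyperplane x $ m = 1"
  unfolding to_hyperplane_def by (simp add: diag_exp_vec lam_m exp_minus sgn_if)

lemma to_hyperplane_id: "x $ m = 1 \<Longrightarrow> to_hyperplane x = x"
  unfolding to_hyperplane_def by (simp add: diag_exp_0)

lemma to_hyperplane_unique:
  assumes "\<epsilon> \<in> {1, -1}" "(\<epsilon> *\<^sub>R (diag_exp lam r *v x)) $ m = 1" shows "\<epsilon> *\<^sub>R (diag_exp lam r *v x) = to_hyperplane x"
proof -
  have e: "\<epsilon> * (exp r * x $ m) = 1" using assms(2) by (simp add: diag_exp_vec lam_m)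
  have "exp r * \<bar>x $ m\<bar> = 1" using arg_cong[OF e, of abs] assms(1) by (auto simp: abs_mult)
  then have "\<bar>x $ m\<bar> = exp (- r)" by (simp add: exp_minus field_simps)
  then have r: "r = - ln \<bar>x $ m\<bar>" by simp
  have "\<epsilon> = sgn (x $ m)"
  proof (cases "\<epsilon> = 1")
    case True
    then have "exp r * x $ m > 0" using e by simp
    then show ?thesis using True by (simp add: zero_less_mult_iff)
  next
    case False
    then have "exp r * x $ m < 0" using e assms(1) by auto
    then show ?thesis using False assms(1) by (simp add: mult_less_0_iff)
  qed
  then show ?thesis unfolding to_hyperplane_def r by simp
qed

lemma continuous_on_to_hyperplane: "continuous_on {x. x $ m \<noteq> 0} to_hyperplane"
proof -
  have "continuous_on {x. x $ m \<noteq> 0} (\<lambda>x. \<chi> i. sgn (x $ m) * (exp (- ln \<bar>x $ m\<bar> * lam i) * x $ i))"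
    by (intro continuous_intros continuous_on_sgn) auto
  moreover have "to_hyperplane = (\<lambda>x. \<chi> i. sgn (x $ m) * (exp (- ln \<bar>x $ m\<bar> * lam i) * x $ i))"
    by (auto simp: fun_eq_iff vec_eq_iff to_hyperplane_def diag_exp_vec)
  ultimately show ?thesis by simp
qed

text \<open>The dilations normalize the shears, so the projection carries \<open>H\<close>-orbits to orbits of shears.\<close>

lemma to_hyperplane_orbit:
  assumes "h \<in> H" "x $ m \<noteq> 0"
  obtains \<sigma> where "\<sigma> \<in> ST" "to_hyperplane (transpose h *v x) = \<sigma> *v to_hyperplane x"
proof -
  obtain \<epsilon> r \<sigma> where e: "\<epsilon> \<in> {1, -1}" "\<sigma> \<in> ST" "transpose h *v x = \<epsilon> *\<^sub>R (\<sigma> *v (diag_exp lam r *v x))"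
    using dual_action[OF assms(1)] by metis
  let ?y = "transpose h *v x"
  have y: "?y $ m \<noteq> 0" unfolding e(3) dual_action_first[OF e(2)] using e(1) assms(2) by auto
  let ?\<epsilon> = "sgn (?y $ m)" and ?r = "- ln \<bar>?y $ m\<bar>"
  let ?\<sigma> = "diag_exp lam ?r ** \<sigma> ** diag_exp lam (- ?r)"
  have s: "?\<sigma> \<in> ST" by (rule conj_ST[OF e(2)])
  have z: "to_hyperplane ?y = ?\<sigma> *v ((?\<epsilon> * \<epsilon>) *\<^sub>R (diag_exp lam (?r + r) *v x))"
  proof -
    have "?\<sigma> *v (diag_exp lam (?r + r) *v x) = (diag_exp lam ?r ** \<sigma> ** (diag_exp lam (- ?r) ** diag_exp lam (?r + r))) *v x"
      by (simp add: matrix_vector_mul_assoc matrix_mul_assoc)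
    also have "\<dots> = diag_exp lam ?r *v (\<sigma> *v (diag_exp lam r *v x))" by (simp add: diag_exp_add matrix_vector_mul_assoc matrix_mul_assoc)
    finally have "?\<sigma> *v (diag_exp lam (?r + r) *v x) = diag_exp lam ?r *v (\<sigma> *v (diag_exp lam r *v x))" .
    moreover have "to_hyperplane ?y = ?\<epsilon> *\<^sub>R (diag_exp lam ?r *v (\<epsilon> *\<^sub>R (\<sigma> *v (diag_exp lam r *v x))))" unfolding to_hyperplane_def using e(3) by metis
    ultimately show ?thesis by (simp add: matrix_vector_mult_scaleR)
  qed
  have "((?\<epsilon> * \<epsilon>) *\<^sub>R (diag_exp lam (?r + r) *v x)) $ m = to_hyperplane ?y $ m" unfolding z ST_first[OF s] ..
  then have "((?\<epsilon> * \<epsilon>) *\<^sub>R (diag_exp lam (?r + r) *v x)) $ m = 1" using to_hyperplane_first[OF y] by simp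
  moreover have "?\<epsilon> * \<epsilon> \<in> {1, -1}" using e(1) y by (auto simp: sgn_if)
  ultimately have "(?\<epsilon> * \<epsilon>) *\<^sub>R (diag_exp lam (?r + r) *v x) = to_hyperplane x" by (intro to_hyperplane_unique)
  then show thesis using that[OF s] z by simp
qed

definition dense_shear_orbit :: "real^('n::_) \<Rightarrow> bool" where
  "dense_shear_orbit \<zeta> \<longleftrightarrow> (\<forall>U w. open U \<longrightarrow> w \<in> U \<longrightarrow> w $ m = 1 \<longrightarrow> (\<exists>\<sigma>\<in>ST. \<sigma> *v \<zeta> \<in> U))"

lemma dense_shear_orbit_exists: obtains \<zeta> where "dense_shear_orbit \<zeta>" "\<zeta> $ m = 1"
proof -
  obtain \<xi> where xi: "\<And>U. open U \<Longrightarrow> U \<noteq> {} \<Longrightarrow> \<exists>h\<in>H. transpose h *v \<xi> \<in> U"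
    using dense_dual_orbit[OF grpH irr] by metis
  have oN: "open {x::real^('n::_). x $ m \<noteq> 0}" by (intro open_Collect_neq continuous_intros)
  have "axis m 1 \<in> {x::real^('n::_). x $ m \<noteq> 0}" by simp
  then obtain h where "h \<in> H" "(transpose h *v \<xi>) $ m \<noteq> 0" using xi[OF oN] by blast
  then have x0: "\<xi> $ m \<noteq> 0" using dual_action[of h] dual_action_first by (metis mult_zero_right)
  have "dense_shear_orbit (to_hyperplane \<xi>)" unfolding dense_shear_orbit_def
  proof (intro allI impI)
    fix U and w :: "real^('n::_)" assume U: "open U" "w \<in> U" "w $ m = 1"
    let ?V = "{x. x $ m \<noteq> 0} \<inter> to_hyperplane -` U"
    have "open ?V" by (rule continuous_open_preimage[OF continuous_on_to_hyperplane oN U(1)])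
    moreover have "w \<in> ?V" using U to_hyperplane_id[of w] by simp
    ultimately obtain h where h: "h \<in> H" "transpose h *v \<xi> \<in> ?V" using xi[of ?V] by blast
    obtain \<sigma> where "\<sigma> \<in> ST" "to_hyperplane (transpose h *v \<xi>) = \<sigma> *v to_hyperplane \<xi>" using to_hyperplane_orbit[OF h(1) x0] by metis
    then show "\<exists>\<sigma>\<in>ST. \<sigma> *v to_hyperplane \<xi> \<in> U" using h(2) by auto
  qed
  then show thesis using that to_hyperplane_first[OF x0] by blast
qed

text \<open>The algebra of shears is commutative, hence \<open>a\<close> commutes with every shear and its kernel is invariant.
  If the kernel contains \<open>\<zeta>\<close>, it contains the dense orbit of \<open>\<zeta>\<close> and so the whole hyperplane \<open>x $ m = 1\<close>, which spans
  the space.\<close>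

lemma span_injective:
  assumes z: "dense_shear_orbit \<zeta>" and a: "a \<in> span ST" "a *v \<zeta> = 0" shows "a = 0"
proof -
  have comm: "a ** \<sigma> = \<sigma> ** a" if s: "\<sigma> \<in> ST" for \<sigma>
  proof -
    have "\<forall>x. a *v (\<sigma> *v x) = \<sigma> *v (a *v x)"
    proof (rule span_induct[OF a(1), where P = "\<lambda>a. \<forall>x. a *v (\<sigma> *v x) = \<sigma> *v (a *v x)"])
      show "subspace {a. \<forall>x. a *v (\<sigma> *v x) = \<sigma> *v (a *v x)}"
        by (auto simp: subspace_def matrix_vector_mult_add_rdistrib matrix_vector_right_distrib matrix_vector_mult_scaleR
            scaleR_matrix_vector_assoc[symmetric])
      show "\<forall>x. b *v (\<sigma> *v x) = \<sigma> *v (b *v x)" if "b \<in> ST" for b using ST_comm that s by (simp add: matrix_vector_mul_assoc)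
    qed
    then show ?thesis by (simp add: matrix_eq matrix_vector_mul_assoc[symmetric])
  qed
  have A0: "a *v w = 0" if w: "w $ m = 1" for w
  proof (rule ccontr)
    assume n: "a *v w \<noteq> 0"
    have "open {v. a *v v \<noteq> 0}" by (intro open_Collect_neq continuous_intros matrix_vector_mult_linear_continuous_on)
    then obtain \<sigma> where s: "\<sigma> \<in> ST" "a *v (\<sigma> *v \<zeta>) \<noteq> 0" using z w n unfolding dense_shear_orbit_def by blast
    have "a *v (\<sigma> *v \<zeta>) = \<sigma> *v (a *v \<zeta>)" by (simp add: matrix_vector_mul_assoc comm[OF s(1)])
    then show False using s(2) a(2) by simp
  qed
  have "a *v x = 0" for x
  proof -
    let ?e = "axis m (1::real)"
    have "a *v (x + (1 - x $ m) *\<^sub>R ?e) = 0" by (rule A0) simp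
    moreover have "a *v ?e = 0" by (rule A0) simp
    ultimately show ?thesis by (simp add: matrix_vector_right_distrib matrix_vector_mult_scaleR)
  qed
  then show ?thesis by (simp add: matrix_eq)
qed

lemma span_bounded_below:
  assumes z: "dense_shear_orbit \<zeta>"
  obtains e where "e > 0" "\<And>a. a \<in> span ST \<Longrightarrow> e * norm a \<le> norm (a *v \<zeta>)"
proof -
  have "linear (\<lambda>a::real^('n::_)^('n::_). a *v \<zeta>)"
    by (rule linearI) (simp_all add: matrix_vector_mult_add_rdistrib scaleR_matrix_vector_assoc)
  then have bl: "bounded_linear (\<lambda>a::real^('n::_)^('n::_). a *v \<zeta>)" by (simp add: linear_conv_bounded_linear)
  have "\<exists>e>0. \<forall>x\<in>span ST. norm (x *v \<zeta>) \<ge> e * norm x"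
    by (rule injective_imp_isometric[OF closed_span subspace_span bl]) (use span_injective[OF z] in auto)
  then show thesis using that by blast
qed

text \<open>Shears that move \<open>\<zeta>\<close> closer and closer to \<open>w\<close> stay bounded by \<open>span_bounded_below\<close>, and a limit
  of a subsequence moves \<open>\<zeta>\<close> to \<open>w\<close>: the dense orbit is closed.\<close>

lemma dense_shear_orbit_transitive:
  assumes z: "dense_shear_orbit \<zeta>" and w: "w $ m = 1" shows "\<exists>\<sigma>\<in>ST. \<sigma> *v \<zeta> = w"
proof -
  obtain e where e: "e > 0" "\<And>a. a \<in> span ST \<Longrightarrow> e * norm a \<le> norm (a *v \<zeta>)" using span_bounded_below[OF z] by metis
  have "\<exists>\<sigma>\<in>ST. \<sigma> *v \<zeta> \<in> ball w (1 / real (Suc n))" for n using z w unfolding dense_shear_orbit_def by (meson centre_in_ball of_nat_0_less_iff open_ball zero_less_Suc zero_less_divide_1_iff)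
  then obtain \<sigma> where s: "\<And>n. \<sigma> n \<in> ST" "\<And>n. norm (\<sigma> n *v \<zeta> - w) < 1 / real (Suc n)"
    by (metis dist_norm dist_commute mem_ball)
  have lim: "(\<lambda>n. \<sigma> n *v \<zeta>) \<longlonglongrightarrow> w"
  proof (rule LIM_zero_cancel, rule Lim_null_comparison)
    show "\<forall>\<^sub>F n in sequentially. norm (\<sigma> n *v \<zeta> - w) \<le> 1 / real (Suc n)" using s(2) by (simp add: less_imp_le)
    show "(\<lambda>n. 1 / real (Suc n)) \<longlonglongrightarrow> 0" by (rule LIMSEQ_Suc[OF lim_1_over_n])
  qed
  have "norm (\<sigma> n) \<le> (norm w + 1) / e" for n
  proof -
    have "norm (\<sigma> n *v \<zeta>) \<le> norm w + norm (\<sigma> n *v \<zeta> - w)" using norm_triangle_sub by blast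
    also have "norm (\<sigma> n *v \<zeta> - w) \<le> 1" using s(2)[of n] by (rule order_trans[OF less_imp_le]) simp
    finally have "e * norm (\<sigma> n) \<le> norm w + 1" using e(2)[OF span_base[OF s(1)], of n] by simp
    then show ?thesis using e(1) by (simp add: pos_le_divide_eq mult.commute)
  qed
  then have "range \<sigma> \<subseteq> ST \<inter> cball 0 ((norm w + 1) / e)" using s(1) by auto
  moreover have "compact (ST \<inter> cball 0 ((norm w + 1) / e))" by (rule closed_Int_compact[OF ST_closed compact_cball])
  ultimately obtain \<tau> f where t: "\<tau> \<in> ST" "strict_mono f" "(\<sigma> \<circ> f) \<longlonglongrightarrow> \<tau>"
    unfolding compact_def by (metis IntD1 image_subset_iff UNIV_I)
  have "linear (\<lambda>a::real^('n::_)^('n::_). a *v \<zeta>)"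
    by (rule linearI) (simp_all add: matrix_vector_mult_add_rdistrib scaleR_matrix_vector_assoc)
  then have bl: "bounded_linear (\<lambda>a::real^('n::_)^('n::_). a *v \<zeta>)" by (simp add: linear_conv_bounded_linear)
  have "(\<lambda>n. (\<sigma> \<circ> f) n *v \<zeta>) \<longlonglongrightarrow> \<tau> *v \<zeta>" by (rule bounded_linear.tendsto[OF bl t(3)])
  moreover have "(\<lambda>n. (\<sigma> \<circ> f) n *v \<zeta>) \<longlonglongrightarrow> w" using LIMSEQ_subseq_LIMSEQ[OF lim t(2)] by (simp add: o_def)
  ultimately have "\<tau> *v \<zeta> = w" by (rule LIMSEQ_unique)
  then show ?thesis using t(1) by blast
qed

lemma ST_transitive:
  assumes "v $ m = 1" "w $ m = 1" shows "\<exists>\<sigma>\<in>ST. \<sigma> *v v = w"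
proof -
  obtain \<zeta> where z: "dense_shear_orbit \<zeta>" "\<zeta> $ m = 1" using dense_shear_orbit_exists by metis
  obtain s1 s2 where s: "s1 \<in> ST" "s1 *v \<zeta> = v" "s2 \<in> ST" "s2 *v \<zeta> = w" using dense_shear_orbit_transitive[OF z(1)] assms by metis
  have "(s2 ** matrix_inv s1) *v v = w"
    unfolding s(2)[symmetric] using s(4) by (simp add: matrix_vector_mul_assoc matrix_mul_assoc[symmetric] matrix_inv_mult[OF ST_invertible[OF s(1)]])
  then show ?thesis using ST_mult[OF s(3) ST_inv[OF s(1)]] by blast
qed

lemma dense_shear_orbit_first: "v $ m = 1 \<Longrightarrow> dense_shear_orbit v"
  unfolding dense_shear_orbit_def using ST_transitive by blast

text \<open>For \<open>z = 0\<close> this is \<open>span_bounded_below\<close>, and a bound from below survives small perturbations of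
  the vector.\<close>

lemma ST_norm_bound:
  obtains C \<theta> where "C \<ge> 1" "\<theta> > 0" "\<And>\<sigma> z. \<sigma> \<in> ST \<Longrightarrow> norm z \<le> \<theta> \<Longrightarrow> op_norm \<sigma> \<le> C * norm (\<sigma> *v (axis m 1 + z))"
proof -
  have "dense_shear_orbit (axis m 1)" by (rule dense_shear_orbit_first) simp
  then obtain e where e: "e > 0" "\<And>a. a \<in> span ST \<Longrightarrow> e * norm a \<le> norm (a *v axis m 1)" using span_bounded_below by metis
  define N where "N = real CARD('n) * real CARD('n)"
  have N: "N > 0" unfolding N_def by simp
  \<comment> \<open>so small that the perturbation by \<open>z\<close> costs at most half of the lower bound\<close>
  define \<theta> where "\<theta> = e / (2 * N)"
  have b: "op_norm \<sigma> \<le> (2 * N / e) * norm (\<sigma> *v (axis m 1 + z))" if s: "\<sigma> \<in> ST" and z: "norm z \<le> \<theta>" for \<sigma> z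
  proof -
    have "op_norm \<sigma> \<le> N * norm \<sigma>" unfolding N_def by (rule op_norm_le_norm)
    then have "e * op_norm \<sigma> \<le> e * (N * norm \<sigma>)" using e(1) by simp
    also have "\<dots> = N * (e * norm \<sigma>)" by simp
    also have "\<dots> \<le> N * norm (\<sigma> *v axis m 1)" using N e(2)[OF span_base[OF s]] by simp
    also have "\<sigma> *v axis m 1 = \<sigma> *v (axis m 1 + z) - \<sigma> *v z" by (simp add: matrix_vector_right_distrib)
    also have "N * norm \<dots> \<le> N * (norm (\<sigma> *v (axis m 1 + z)) + op_norm \<sigma> * \<theta>)"
      using N op_norm[of \<sigma> z] mult_left_mono[OF z op_norm_nonneg[of \<sigma>]] norm_triangle_ineq4[of "\<sigma> *v (axis m 1 + z)" "\<sigma> *v z"]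
      by (intro mult_left_mono) linarith+
    also have "\<dots> = N * norm (\<sigma> *v (axis m 1 + z)) + e * op_norm \<sigma> / 2" unfolding \<theta>_def using N by (simp add: field_simps)
    finally have "e * op_norm \<sigma> \<le> 2 * N * norm (\<sigma> *v (axis m 1 + z))" by simp
    then show ?thesis using e(1) by (simp add: pos_le_divide_eq mult.commute)
  qed
  show thesis
  proof (rule that[of "max 1 (2 * N / e)" \<theta>])
    show "\<theta> > 0" unfolding \<theta>_def using e N by simp
    fix \<sigma> and z :: "real^('n::_)" assume "\<sigma> \<in> ST" "norm z \<le> \<theta>"
    from b[OF this] show "op_norm \<sigma> \<le> max 1 (2 * N / e) * norm (\<sigma> *v (axis m 1 + z))"
      by (meson max.cobounded2 mult_right_mono norm_ge_zero order_trans)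
  qed simp
qed

text \<open>On the compact set of shears of bounded norm, \<open>norm (\<sigma> v)\<close> for unit vectors \<open>v\<close> attains a positive
  minimum.\<close>

lemma ST_inverse_bound:
  obtains C where "C \<ge> 0" "\<And>\<sigma>. \<sigma> \<in> ST \<Longrightarrow> op_norm \<sigma> \<le> \<kappa> \<Longrightarrow> op_norm (matrix_inv \<sigma>) \<le> C"
proof -
  define N where "N = real CARD('n) * real CARD('n)"
  let ?K = "(ST \<inter> cball 0 (N * \<bar>\<kappa>\<bar>)) \<times> sphere (0::real^('n::_)) 1"
  have cK: "compact ?K" by (intro compact_Times closed_Int_compact[OF ST_closed compact_cball] compact_sphere)
  have "continuous_on ?K (\<lambda>p. \<chi> i. \<Sum>j\<in>UNIV. fst p $ i $ j * snd p $ j)" by (intro continuous_intros)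
  then have "continuous_on ?K (\<lambda>p. fst p *v snd p)" by (simp add: matrix_vector_mult_def)
  then have cont: "continuous_on ?K (\<lambda>p. norm (fst p *v snd p))" by (rule continuous_on_norm)
  have "\<exists>c>0. \<forall>p\<in>?K. c \<le> norm (fst p *v snd p)"
  proof (cases "?K = {}")
    case False
    obtain q where q: "q \<in> ?K" "\<And>p. p \<in> ?K \<Longrightarrow> norm (fst q *v snd q) \<le> norm (fst p *v snd p)"
      using continuous_attains_inf[OF cK False cont] by blast
    have iq: "invertible (fst q)" using q(1) ST_invertible by auto
    have "fst q *v snd q \<noteq> 0"
    proof
      assume "fst q *v snd q = 0"
      then have "matrix_inv (fst q) *v (fst q *v snd q) = 0" by simp
      then have "snd q = 0" by (simp add: matrix_vector_mul_assoc matrix_inv_mult[OF iq])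
      then show False using q(1) by auto
    qed
    then show ?thesis using q(2) by (intro exI[of _ "norm (fst q *v snd q)"]) auto
  qed (auto intro: exI[of _ 1])
  then obtain c where c: "c > 0" "\<And>p. p \<in> ?K \<Longrightarrow> c \<le> norm (fst p *v snd p)" by blast
  show thesis
  proof (rule that[of "1 / c"])
    fix \<sigma> assume s: "\<sigma> \<in> ST" "op_norm \<sigma> \<le> \<kappa>"
    have "N \<ge> 0" unfolding N_def by simp
    have "norm \<sigma> \<le> N * op_norm \<sigma>" unfolding N_def by (rule norm_le_op_norm)
    also have "\<dots> \<le> N * \<bar>\<kappa>\<bar>" using s(2) \<open>N \<ge> 0\<close> by (intro mult_left_mono) auto
    finally have sK: "\<sigma> \<in> ST \<inter> cball 0 (N * \<bar>\<kappa>\<bar>)" using s(1) by simp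
    show "op_norm (matrix_inv \<sigma>) \<le> 1 / c"
    proof (rule op_norm_le)
      fix x
      let ?y = "matrix_inv \<sigma> *v x"
      have x: "x = \<sigma> *v ?y" by (simp add: matrix_vector_mul_assoc matrix_inv_mult[OF ST_invertible[OF s(1)]])
      show "norm ?y \<le> 1 / c * norm x"
      proof (cases "?y = 0")
        case False
        have "(\<sigma>, (1 / norm ?y) *\<^sub>R ?y) \<in> ?K" using sK False by simp
        from c(2)[OF this] have "c \<le> norm (\<sigma> *v ((1 / norm ?y) *\<^sub>R ?y))" by simp
        also have "\<dots> = norm x / norm ?y" using x by (simp add: matrix_vector_mult_scaleR)
        finally show ?thesis using c(1) False by (simp add: field_simps)
      qed (use c in simp)
    qed
  qed (use c in simp)
qed

end

section \<open>Cones under the dual action\<close>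

lemma finite_positive_lower_bound:
  fixes f :: "'a::finite \<Rightarrow> real"
  assumes "\<And>i. 0 < f i" obtains \<nu> where "\<nu> > 0" "\<And>i. \<nu> \<le> f i"
proof (rule that[of "Min (range f)"])
  show "0 < Min (range f)" using assms by (subst Min_gr_iff) auto
qed auto

lemma norm_diag_exp_le:
  fixes x :: "real^'n"
  assumes "\<And>i. exp (r * l i) \<le> c" shows "norm (diag_exp l r *v x) \<le> c * norm x"
proof -
  have c: "0 \<le> c" using assms exp_ge_zero order_trans by blast
  have "norm (diag_exp l r *v x) \<le> norm (c *\<^sub>R x)"
    by (rule norm_le_componentwise_cart) (auto simp: diag_exp_vec abs_mult c intro!: mult_right_mono assms)
  then show ?thesis using c by simp
qed

lemma abs_det_minus: "\<bar>det (- A)\<bar> = \<bar>det (A::real^'n^'n)\<bar>"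
proof -
  have "(- A) ** (- A) = A ** A" by (simp add: vec_eq_iff matrix_matrix_mult_def)
  then have "det (- A) * det (- A) = det A * det A" by (metis det_mul)
  then show ?thesis by (metis abs_mult_self_eq abs_eq_iff square_eq_iff)
qed

text \<open>Directions on one side of the hyperplane \<open>\<zeta> $ m = 0\<close> are compared in the chart \<open>\<zeta> \<mapsto> \<zeta> / \<zeta> $ m\<close>, in which
  the shears act linearly. Together with \<open>direction_nbhd\<close> this translates between cones over neighborhoods in the
  sphere and balls in the chart.\<close>

lemma cone_of_direction:
  fixes \<xi> :: "real^'n"
  assumes W: "sphere_nbhd W \<xi>" and xm: "\<xi> $ m \<noteq> 0"
  obtains \<tau> where "\<tau> > 0"
    "\<And>\<zeta>. \<zeta> $ m * \<xi> $ m > 0 \<Longrightarrow> norm ((1 / \<zeta> $ m) *\<^sub>R \<zeta> - (1 / \<xi> $ m) *\<^sub>R \<xi>) < \<tau> \<Longrightarrow> \<zeta> \<in> cone W"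
proof -
  have xW: "\<xi> \<in> W" and oW: "openin (top_of_set (sphere 0 1)) W"
    using W unfolding sphere_nbhd_def by auto
  then have xs: "norm \<xi> = 1" using openin_imp_subset[OF oW] by auto
  obtain e where e: "e > 0" "\<And>x. norm x = 1 \<Longrightarrow> dist x \<xi> < e \<Longrightarrow> x \<in> W"
    using oW xW unfolding openin_euclidean_subtopology_iff by force
  let ?w0 = "(1 / \<xi> $ m) *\<^sub>R \<xi>"
  define g where "g w = (sgn (\<xi> $ m) / norm w) *\<^sub>R w" for w :: "real^'n"
  have n0: "norm ?w0 = 1 / \<bar>\<xi> $ m\<bar>" using xs by simp
  have w0: "?w0 \<noteq> 0" using n0 xm by (metis divide_eq_0_iff abs_eq_0 norm_zero zero_neq_one)
  have g0: "g ?w0 = \<xi>" unfolding g_def n0 using xm by (simp add: sgn_if)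
  have "isCont g ?w0" unfolding g_def using w0 by (intro continuous_intros) auto
  then obtain d where d: "d > 0" "\<And>w. dist w ?w0 < d \<Longrightarrow> dist (g w) \<xi> < e"
    using e(1) g0 unfolding continuous_at_eps_delta by metis
  show thesis
  proof (rule that[of d])
    fix \<zeta> :: "real^'n" assume z: "\<zeta> $ m * \<xi> $ m > 0" "norm ((1 / \<zeta> $ m) *\<^sub>R \<zeta> - ?w0) < d"
    have zm: "\<zeta> $ m \<noteq> 0" using z(1) by auto
    then have zn: "norm \<zeta> > 0" by (metis zero_index zero_less_norm_iff)
    have s: "sgn (\<xi> $ m) = sgn (\<zeta> $ m)" using z(1) by (auto simp: sgn_if zero_less_mult_iff)
    have gw: "g ((1 / \<zeta> $ m) *\<^sub>R \<zeta>) = (1 / norm \<zeta>) *\<^sub>R \<zeta>"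
      unfolding g_def s using zm zn by (simp add: sgn_if)
    have "dist (g ((1 / \<zeta> $ m) *\<^sub>R \<zeta>)) \<xi> < e" using z(2) by (intro d(2)) (simp add: dist_norm)
    then have "(1 / norm \<zeta>) *\<^sub>R \<zeta> \<in> W" unfolding gw using zn by (intro e(2)) auto
    moreover have "\<zeta> = norm \<zeta> *\<^sub>R ((1 / norm \<zeta>) *\<^sub>R \<zeta>)" using zn by simp
    ultimately show "\<zeta> \<in> cone W" unfolding cone_def using zn by blast
  qed (use d in simp)
qed

lemma direction_nbhd:
  fixes \<xi> :: "real^'n"
  assumes xi: "norm \<xi> = 1" "\<xi> $ m \<noteq> 0" and \<tau>: "\<tau> > 0"
  obtains W where "sphere_nbhd W \<xi>" "W \<subseteq> {\<zeta>. \<zeta> $ m \<noteq> 0}"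
    "\<And>\<zeta>. \<zeta> \<in> cone W \<Longrightarrow> \<zeta> $ m * \<xi> $ m > 0 \<and> norm ((1 / \<zeta> $ m) *\<^sub>R \<zeta> - (1 / \<xi> $ m) *\<^sub>R \<xi>) < \<tau>"
proof -
  let ?P = "{\<zeta>. \<zeta> $ m * \<xi> $ m > 0}" and ?f = "\<lambda>\<zeta>. (1 / \<zeta> $ m) *\<^sub>R \<zeta>"
  have oP: "open ?P" by (intro open_Collect_less continuous_intros)
  have "continuous_on ?P ?f" by (intro continuous_intros) auto
  then have oQ: "open (?P \<inter> ?f -` ball (?f \<xi>) \<tau>)" using oP by (rule continuous_open_preimage) simp
  let ?W = "sphere 0 1 \<inter> (?P \<inter> ?f -` ball (?f \<xi>) \<tau>)"
  show thesis
  proof (rule that[of ?W])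
    show "sphere_nbhd ?W \<xi>" unfolding sphere_nbhd_def
      using xi \<tau> openin_open_Int[OF oQ, of "sphere 0 1"] by (auto simp: zero_less_mult_iff linorder_neq_iff)
    show "?W \<subseteq> {\<zeta>. \<zeta> $ m \<noteq> 0}" by auto
    fix \<zeta> assume "\<zeta> \<in> cone ?W"
    then obtain t w where t: "\<zeta> = t *\<^sub>R w" "t > 0" "w \<in> ?W" unfolding cone_def by blast
    have f: "?f \<zeta> = ?f w" using t by simp
    have "w $ m * \<xi> $ m > 0" "norm (?f w - ?f \<xi>) < \<tau>" using t(3) by (auto simp: dist_norm norm_minus_commute)
    then show "\<zeta> $ m * \<xi> $ m > 0 \<and> norm (?f \<zeta> - ?f \<xi>) < \<tau>" unfolding f using t by (simp add: mult.assoc)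
  qed
qed

context shearlet begin

lemma dual_orbit_full:
  assumes x: "x $ m \<noteq> 0" shows "dual_orbit H x = {y. y $ m \<noteq> 0}"
proof (intro set_eqI iffI)
  fix y assume "y \<in> dual_orbit H x"
  then obtain h where h: "h \<in> H" "y = transpose h *v x" by (auto simp: dual_orbit_def)
  obtain \<epsilon> r \<sigma> where e: "\<epsilon> \<in> {1, -1}" "\<sigma> \<in> ST" "transpose h *v x = \<epsilon> *\<^sub>R (\<sigma> *v (diag_exp lam r *v x))"
    using dual_action[OF h(1)] by metis
  have "y $ m = \<epsilon> * exp r * x $ m" unfolding h(2) e(3) by (rule dual_action_first[OF e(2)])
  then show "y \<in> {y. y $ m \<noteq> 0}" using e(1) x by auto
next
  fix y :: "real^('n::_)" assume "y \<in> {y. y $ m \<noteq> 0}"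
  then have y: "y $ m \<noteq> 0" by simp
  define \<epsilon> where "\<epsilon> = sgn (x $ m) * sgn (y $ m)"
  define r where "r = ln (\<bar>y $ m\<bar> / \<bar>x $ m\<bar>)"
  have \<epsilon>: "\<epsilon> \<in> {1, -1}" unfolding \<epsilon>_def using x y by (auto simp: sgn_if)
  have er: "exp r = \<bar>y $ m\<bar> / \<bar>x $ m\<bar>" unfolding r_def using x y by simp
  have "\<epsilon> * exp r * x $ m = y $ m" unfolding er \<epsilon>_def using x y by (auto simp: sgn_if)
  then have u: "((1 / y $ m) *\<^sub>R (\<epsilon> *\<^sub>R (diag_exp lam r *v x))) $ m = 1" using y by (simp add: diag_exp_vec lam_m)
  have w: "((1 / y $ m) *\<^sub>R y) $ m = 1" using y by simp
  obtain \<sigma> where s: "\<sigma> \<in> ST" "\<sigma> *v ((1 / y $ m) *\<^sub>R (\<epsilon> *\<^sub>R (diag_exp lam r *v x))) = (1 / y $ m) *\<^sub>R y"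
    using ST_transitive[OF u w] by blast
  then have "(1 / y $ m) *\<^sub>R (\<epsilon> *\<^sub>R (\<sigma> *v (diag_exp lam r *v x))) = (1 / y $ m) *\<^sub>R y" by (simp add: matrix_vector_mult_scaleR)
  then have "y $ m *\<^sub>R ((1 / y $ m) *\<^sub>R (\<epsilon> *\<^sub>R (\<sigma> *v (diag_exp lam r *v x)))) = y $ m *\<^sub>R ((1 / y $ m) *\<^sub>R y)" by (simp only:)
  then have yy: "\<epsilon> *\<^sub>R (\<sigma> *v (diag_exp lam r *v x)) = y" unfolding scaleR_scaleR using y by simp
  let ?h = "\<epsilon> *\<^sub>R (diag_exp lam r ** transpose \<sigma>)"
  have "transpose ?h = \<epsilon> *\<^sub>R transpose (diag_exp lam r ** transpose \<sigma>)" by (simp add: vec_eq_iff transpose_def)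
  then have "transpose ?h = \<epsilon> *\<^sub>R (\<sigma> ** diag_exp lam r)" by (simp add: matrix_transpose_mul transpose_diag_exp)
  then have "transpose ?h *v x = y" using yy by (simp only: scaleR_matrix_vector_assoc[symmetric] matrix_vector_mul_assoc)
  then show "y \<in> dual_orbit H x" unfolding dual_orbit_def using action_exists[OF \<epsilon> s(1), of r] by blast
qed

text \<open>The hyperplane \<open>x $ m = 0\<close> is invariant, so no open orbit meets it, and its complement is a single
  orbit because shears are transitive on \<open>x $ m = 1\<close>.\<close>

lemma open_dual_orbit_eq: "open_dual_orbit H = {x. x $ m \<noteq> 0}"
  unfolding open_dual_orbit_def
proof (rule the_equality)
  have "dual_orbit H (axis m 1) = {x. x $ m \<noteq> 0}" by (rule dual_orbit_full) simp
  moreover have "open {x::real^('n::_). x $ m \<noteq> 0}" by (intro open_Collect_neq continuous_intros)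
  ultimately show "open {x::real^('n::_). x $ m \<noteq> 0} \<and> (\<exists>\<xi>. {x. x $ m \<noteq> 0} = dual_orbit H \<xi>)" by metis
  fix U :: "(real^('n::_)) set" assume "open U \<and> (\<exists>\<xi>. U = dual_orbit H \<xi>)"
  then obtain \<xi> where U: "open U" "U = dual_orbit H \<xi>" by blast
  have "mat 1 \<in> H" using grpH by (simp add: matrix_group_def)
  moreover have "transpose (mat 1) *v \<xi> = \<xi>" by (simp add: transpose_mat)
  ultimately have xU: "\<xi> \<in> U" unfolding U(2) dual_orbit_def by force
  show "U = {x. x $ m \<noteq> 0}"
  proof (cases "\<xi> $ m = 0")
    case True
    have "y $ m = 0" if "y \<in> U" for y
    proof -
      obtain h where h: "h \<in> H" "y = transpose h *v \<xi>" using \<open>y \<in> U\<close> unfolding U(2) dual_orbit_def by blast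
      obtain \<epsilon> r \<sigma> where e: "\<epsilon> \<in> {1, -1}" "\<sigma> \<in> ST" "transpose h *v \<xi> = \<epsilon> *\<^sub>R (\<sigma> *v (diag_exp lam r *v \<xi>))"
        using dual_action[OF h(1)] by metis
      show ?thesis unfolding h(2) e(3) dual_action_first[OF e(2)] using True by simp
    qed
    moreover obtain d where d: "d > 0" "ball \<xi> d \<subseteq> U" using U(1) xU open_contains_ball by blast
    moreover have "\<xi> + (d/2) *\<^sub>R axis m 1 \<in> ball \<xi> d" using d(1) by (simp add: dist_norm)
    ultimately have "(\<xi> + (d/2) *\<^sub>R axis m 1) $ m = 0" by blast
    then show ?thesis using True d(1) by simp
  next
    case False
    then show ?thesis using dual_orbit_full U(2) by simp
  qed
qed

lemma ST_det: assumes "\<sigma> \<in> ST" shows "det \<sigma> = 1"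
proof -
  obtain s where s: "s \<in> S" "\<sigma> = transpose s" using assms by (auto simp: ST_def)
  then have "det s = (\<Prod>i\<in>UNIV. s $ i $ i)" using Suni by (intro det_upperdiagonal) (auto simp: unitriangular_def)
  also have "\<dots> = 1" using s Suni by (intro prod.neutral) (auto simp: unitriangular_def)
  finally show ?thesis by (simp add: s(2) det_transpose)
qed

text \<open>The shear is placed so that in the inverse transpose it acts after the dilation. Both formulas are
  recorded because \<open>h\<close> is needed on frequencies in either direction.\<close>

definition shearlet_coords :: "real^('n::_)^('n::_) \<Rightarrow> real \<Rightarrow> real \<Rightarrow> real^('n::_)^('n::_) \<Rightarrow> bool" where
  "shearlet_coords h \<epsilon> r \<sigma> \<longleftrightarrow> \<epsilon> \<in> {1, -1} \<and> \<sigma> \<in> ST \<and> transpose h = \<epsilon> *\<^sub>R (diag_exp lam r ** matrix_inv \<sigma>) \<and>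
     transpose (matrix_inv h) = \<epsilon> *\<^sub>R (\<sigma> ** diag_exp lam (- r))"

lemma shearlet_coords_exist:
  assumes "h \<in> H" obtains \<epsilon> r \<sigma> where "shearlet_coords h \<epsilon> r \<sigma>"
proof -
  obtain \<epsilon> r \<sigma> where e: "\<epsilon> \<in> {1, -1}" "\<sigma> \<in> ST" "\<And>x. transpose (matrix_inv h) *v x = \<epsilon> *\<^sub>R (\<sigma> *v (diag_exp lam r *v x))"
    using dual_action[OF H_inv[OF assms]] by metis
  have 1: "transpose (matrix_inv h) = \<epsilon> *\<^sub>R (\<sigma> ** diag_exp lam (- (- r)))"
    by (simp only: matrix_eq e(3) minus_minus scaleR_matrix_vector_assoc[symmetric] matrix_vector_mul_assoc[symmetric]) simp
  have ee: "\<epsilon> * \<epsilon> = 1" using e(1) by auto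
  have "transpose (matrix_inv h) ** (\<epsilon> *\<^sub>R (diag_exp lam (- r) ** matrix_inv \<sigma>)) = (\<epsilon> * \<epsilon>) *\<^sub>R (\<sigma> ** (diag_exp lam r ** diag_exp lam (- r)) ** matrix_inv \<sigma>)"
    unfolding 1 by (simp add: matrix_eq matrix_vector_mul_assoc[symmetric] scaleR_matrix_vector_assoc[symmetric] matrix_vector_mult_scaleR)
  also have "\<dots> = mat 1" by (simp add: ee diag_exp_add diag_exp_0 matrix_inv_mult[OF ST_invertible[OF e(2)]])
  finally have q: "transpose (matrix_inv h) ** (\<epsilon> *\<^sub>R (diag_exp lam (- r) ** matrix_inv \<sigma>)) = mat 1" .
  have "transpose h = transpose h ** (transpose (matrix_inv h) ** (\<epsilon> *\<^sub>R (diag_exp lam (- r) ** matrix_inv \<sigma>)))" unfolding q by simp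
  also have "\<dots> = \<epsilon> *\<^sub>R (diag_exp lam (- r) ** matrix_inv \<sigma>)"
    by (simp only: matrix_mul_assoc transpose_inverse(1)[OF H_invertible[OF assms]] matrix_mul_lid)
  finally show thesis using that[of \<epsilon> "- r" \<sigma>] e 1 by (simp add: shearlet_coords_def)
qed

lemma shearlet_coords_realize:
  assumes "\<epsilon> \<in> {1, -1}" "\<sigma> \<in> ST"
  obtains h where "h \<in> H" "shearlet_coords h \<epsilon> r \<sigma>"
proof -
  let ?g = "\<epsilon> *\<^sub>R (diag_exp lam (- r) ** transpose \<sigma>)"
  let ?h = "matrix_inv ?g"
  have gH: "?g \<in> H" by (rule action_exists[OF assms])
  then have hH: "?h \<in> H" by (rule H_inv)
  have hi: "matrix_inv ?h = ?g" by (rule matrix_inv_unique) (rule matrix_inv_mult(1)[OF H_invertible[OF gH]])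
  have tg: "transpose ?g = \<epsilon> *\<^sub>R (\<sigma> ** diag_exp lam (- r))"
  proof -
    have "transpose ?g = \<epsilon> *\<^sub>R transpose (diag_exp lam (- r) ** transpose \<sigma>)" by (simp add: vec_eq_iff transpose_def)
    then show ?thesis by (simp add: matrix_transpose_mul transpose_diag_exp)
  qed
  have ee: "\<epsilon> * \<epsilon> = 1" using assms(1) by auto
  have "transpose (matrix_inv ?h) ** (\<epsilon> *\<^sub>R (diag_exp lam r ** matrix_inv \<sigma>)) = (\<epsilon> * \<epsilon>) *\<^sub>R (\<sigma> ** (diag_exp lam (- r) ** diag_exp lam r) ** matrix_inv \<sigma>)"
    unfolding hi tg by (simp add: matrix_eq matrix_vector_mul_assoc[symmetric] scaleR_matrix_vector_assoc[symmetric] matrix_vector_mult_scaleR)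
  also have "\<dots> = mat 1" by (simp add: ee diag_exp_add diag_exp_0 matrix_inv_mult[OF ST_invertible[OF assms(2)]])
  finally have q: "transpose (matrix_inv ?h) ** (\<epsilon> *\<^sub>R (diag_exp lam r ** matrix_inv \<sigma>)) = mat 1" .
  have "transpose ?h = transpose ?h ** (transpose (matrix_inv ?h) ** (\<epsilon> *\<^sub>R (diag_exp lam r ** matrix_inv \<sigma>)))" unfolding q by simp
  also have "\<dots> = \<epsilon> *\<^sub>R (diag_exp lam r ** matrix_inv \<sigma>)"
    by (simp only: matrix_mul_assoc transpose_inverse(1)[OF H_invertible[OF hH]] matrix_mul_lid)
  finally have "transpose ?h = \<epsilon> *\<^sub>R (diag_exp lam r ** matrix_inv \<sigma>)" .
  then have "shearlet_coords ?h \<epsilon> r \<sigma>" unfolding shearlet_coords_def hi tg using assms by simp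
  then show thesis using that hH by blast
qed

lemma lam_le_1: "lam i \<le> 1" and lam_pos: "lam i > 0"
  using lam_m lam[of i] by (cases "i = m"; simp)+

text \<open>As all exponents are positive, \<open>op_norm h\<close> is \<open>O(exp (r * \<nu>))\<close> with \<open>\<nu> > 0\<close>, while the determinant factor and
  the inverse are at most of size \<open>exp (- r * CARD('n))\<close> and \<open>exp (- r)\<close> since no exponent exceeds one. A large power
  of \<open>op_norm h\<close> therefore compensates the latter.\<close>

lemma controlled_of_shearlet_coords:
  assumes \<kappa>: "\<kappa> \<ge> 0"
  obtains K p where "\<And>h \<epsilon> r \<sigma>. h \<in> H \<Longrightarrow> shearlet_coords h \<epsilon> r \<sigma> \<Longrightarrow> op_norm \<sigma> \<le> \<kappa> \<Longrightarrow> r \<le> 0 \<Longrightarrow>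
     controlled K p h \<and> op_norm h ^ p * (1 + 2 * \<kappa> * exp (- r)) \<le> K"
proof -
  let ?n = "real CARD('n)"
  obtain \<nu> where \<nu>: "\<nu> > 0" "\<And>i. \<nu> \<le> lam i" using finite_positive_lower_bound[of lam] lam_pos by blast
  obtain C where C: "C \<ge> 0" "\<And>\<sigma>. \<sigma> \<in> ST \<Longrightarrow> op_norm \<sigma> \<le> \<kappa> \<Longrightarrow> op_norm (matrix_inv \<sigma>) \<le> C" using ST_inverse_bound by metis
  \<comment> \<open>with \<open>\<nu> * p \<ge> CARD('n) + 1\<close> the power \<open>op_norm h ^ p\<close> outweighs \<open>exp (- r * CARD('n))\<close> and \<open>exp (- r)\<close>\<close>
  obtain p where p: "(?n + 1) / \<nu> \<le> real p" using real_arch_simple by blast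
  then have p': "?n + 1 \<le> \<nu> * real p" using \<nu>(1) by (simp add: pos_divide_le_eq mult.commute)
  define K where "K = C + C^p + (1 + ?n * \<kappa>) * C^p + (1 + 2 * \<kappa>) * C^p"
  have b: "controlled K p h \<and> op_norm h ^ p * (1 + 2 * \<kappa> * exp (- r)) \<le> K"
    if h: "h \<in> H" and c: "shearlet_coords h \<epsilon> r \<sigma>" and s: "op_norm \<sigma> \<le> \<kappa>" and r: "r \<le> 0" for h \<epsilon> r \<sigma>
  proof -
    have cc: "\<epsilon> \<in> {1, -1}" "\<sigma> \<in> ST" and Th: "transpose h = \<epsilon> *\<^sub>R (diag_exp lam r ** matrix_inv \<sigma>)"
      and Ti: "transpose (matrix_inv h) = \<epsilon> *\<^sub>R (\<sigma> ** diag_exp lam (- r))" using c by (auto simp: shearlet_coords_def)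
    have inv: "invertible h" by (rule H_invertible[OF h])
    have ne: "norm (\<epsilon> *\<^sub>R v) = norm v" for v :: "real^('n::_)" using cc(1) by auto
    have e1: "exp (r * lam i) \<le> exp (r * \<nu>)" for i using r \<nu>(2)[of i] by (simp add: mult_left_mono_neg)
    have e2: "exp (- r * lam i) \<le> exp (- r)" for i using r lam_le_1[of i] mult_left_mono[of "lam i" 1 "- r"] by simp
    have hi: "op_norm (matrix_inv h) \<le> \<kappa> * exp (- r)"
    proof -
      have "op_norm (matrix_inv h) \<le> op_norm (transpose (matrix_inv h))"
        using op_norm_transpose_le[of "transpose (matrix_inv h)"] by simp
      also have "\<dots> \<le> \<kappa> * exp (- r)"
      proof (rule op_norm_le)
        fix x
        have "norm (transpose (matrix_inv h) *v x) = norm (\<sigma> *v (diag_exp lam (- r) *v x))"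
          unfolding Ti by (simp only: scaleR_matrix_vector_assoc[symmetric] ne matrix_vector_mul_assoc)
        also have "\<dots> \<le> op_norm \<sigma> * norm (diag_exp lam (- r) *v x)" by (rule op_norm)
        also have "\<dots> \<le> \<kappa> * (exp (- r) * norm x)" using e2 by (intro mult_mono s norm_diag_exp_le \<kappa>) auto
        finally show "norm (transpose (matrix_inv h) *v x) \<le> \<kappa> * exp (- r) * norm x" by simp
      qed
      finally show ?thesis .
    qed
    have hn: "op_norm h \<le> C * exp (r * \<nu>)"
    proof -
      have "op_norm h \<le> op_norm (transpose h)" using op_norm_transpose_le[of "transpose h"] by simp
      also have "\<dots> \<le> C * exp (r * \<nu>)"
      proof (rule op_norm_le)
        fix x
        have "norm (transpose h *v x) = norm (diag_exp lam r *v (matrix_inv \<sigma> *v x))"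
          unfolding Th by (simp only: scaleR_matrix_vector_assoc[symmetric] ne matrix_vector_mul_assoc)
        also have "\<dots> \<le> exp (r * \<nu>) * norm (matrix_inv \<sigma> *v x)" by (rule norm_diag_exp_le[OF e1])
        also have "\<dots> \<le> exp (r * \<nu>) * (C * norm x)"
          by (intro mult_left_mono order_trans[OF op_norm] mult_right_mono C(2) cc s) auto
        finally show "norm (transpose h *v x) \<le> C * exp (r * \<nu>) * norm x" by (simp add: mult_ac)
      qed
      finally show ?thesis .
    qed
    have hp: "op_norm h ^ p \<le> C^p * exp (r * (?n + 1))"
    proof -
      have "op_norm h ^ p \<le> (C * exp (r * \<nu>))^p" by (intro power_mono hn op_norm_nonneg)
      also have "\<dots> = C^p * exp (r * (\<nu> * real p))" by (simp add: power_mult_distrib exp_of_nat_mult[symmetric] mult_ac)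
      also have "\<dots> \<le> C^p * exp (r * (?n + 1))" using C(1) r p' by (intro mult_left_mono) (auto simp: mult_left_mono_neg)
      finally show ?thesis .
    qed
    have det: "\<bar>det h\<bar> = exp (r * (\<Sum>i\<in>UNIV. lam i))"
    proof -
      have "\<bar>det h\<bar> = \<bar>det (\<epsilon> *\<^sub>R (diag_exp lam r ** matrix_inv \<sigma>))\<bar>" using Th by (metis det_transpose)
      also have "\<dots> = \<bar>det (diag_exp lam r ** matrix_inv \<sigma>)\<bar>" using cc(1) by (auto simp: abs_det_minus)
      also have "\<dots> = \<bar>det (diag_exp lam r)\<bar>" by (simp add: det_mul ST_det[OF ST_inv[OF cc(2)]])
      also have "det (diag_exp lam r) = (\<Prod>i\<in>UNIV. diag_exp lam r $ i $ i)" by (rule det_diagonal) (simp add: diag_exp_def diag_matrix_def)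
      also have "\<dots> = exp (r * (\<Sum>i\<in>UNIV. lam i))" by (simp add: diag_exp_def diag_matrix_def exp_sum[symmetric] sum_distrib_left)
      finally show ?thesis by simp
    qed
    have d: "\<bar>det h\<bar> powr (- 1 / 2) \<le> exp (- r * ?n)"
    proof -
      have "(\<Sum>i\<in>UNIV. lam i) \<le> (\<Sum>i\<in>(UNIV::'n set). 1)" by (intro sum_mono lam_le_1)
      then have l: "(\<Sum>i\<in>UNIV. lam i) \<le> ?n" by simp
      have l0: "0 \<le> (\<Sum>i\<in>UNIV. lam i)" by (intro sum_nonneg less_imp_le lam_pos)
      have "\<bar>det h\<bar> powr (- 1 / 2) = exp (- r * ((\<Sum>i\<in>UNIV. lam i) / 2))" unfolding det by (simp add: powr_def)
      also have "\<dots> \<le> exp (- r * ?n)" using r l l0 by (subst exp_le_cancel_iff) (intro mult_left_mono; linarith)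
      finally show ?thesis .
    qed
    have er: "exp r \<le> 1" "exp (r * ?n) \<le> 1" using r by (auto simp: mult_nonpos_nonneg)
    have Cp: "0 \<le> C^p" using C(1) by simp
    have er1: "1 \<le> exp (- r)" using r by simp
    have merge: "exp (- r) * exp (r * (?n + 1)) = exp (r * ?n)" by (simp add: exp_add[symmetric] algebra_simps)
    have c1: "op_norm h \<le> C"
    proof -
      have "exp (r * \<nu>) \<le> 1" using r \<nu>(1) by (simp add: mult_nonpos_nonneg)
      then have "C * exp (r * \<nu>) \<le> C * 1" using C(1) by (rule mult_left_mono)
      then show ?thesis using hn by simp
    qed
    have c2: "\<bar>det h\<bar> powr (- 1 / 2) * op_norm h ^ p \<le> C^p"
    proof -
      have "\<bar>det h\<bar> powr (- 1 / 2) * op_norm h ^ p \<le> exp (- r * ?n) * (C^p * exp (r * (?n + 1)))"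
        by (intro mult_mono d hp) (auto simp: op_norm_nonneg)
      also have "\<dots> = C^p * exp r" by (simp add: exp_add[symmetric] algebra_simps flip: exp_add)
      also have "\<dots> \<le> C^p * 1" by (intro mult_left_mono er Cp)
      finally show ?thesis by simp
    qed
    have gen: "(1 + a * exp (- r)) * op_norm h ^ p \<le> (1 + a) * C^p" if a: "a \<ge> 0" for a
    proof -
      have "(1 + a * exp (- r)) * op_norm h ^ p \<le> ((1 + a) * exp (- r)) * (C^p * exp (r * (?n + 1)))"
        using a er1 by (intro mult_mono hp) (auto simp: op_norm_nonneg distrib_right)
      also have "\<dots> = (1 + a) * C^p * exp (r * ?n)" unfolding merge[symmetric] by (simp only: mult_ac)
      also have "\<dots> \<le> (1 + a) * C^p * 1" using a Cp by (intro mult_left_mono er) auto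
      finally show ?thesis by simp
    qed
    have c3: "(1 + ?n * op_norm (matrix_inv h)) * op_norm h ^ p \<le> (1 + ?n * \<kappa>) * C^p"
    proof -
      have "(1 + ?n * op_norm (matrix_inv h)) * op_norm h ^ p \<le> (1 + (?n * \<kappa>) * exp (- r)) * op_norm h ^ p"
        using hi by (intro mult_right_mono add_left_mono) (auto simp: op_norm_nonneg mult.assoc)
      also have "\<dots> \<le> (1 + ?n * \<kappa>) * C^p" using \<kappa> by (intro gen) simp
      finally show ?thesis .
    qed
    have c4: "op_norm h ^ p * (1 + 2 * \<kappa> * exp (- r)) \<le> (1 + 2 * \<kappa>) * C^p" using gen[of "2 * \<kappa>"] \<kappa> by (simp add: mult.commute)
    have n: "0 \<le> (1 + ?n * \<kappa>) * C^p" "0 \<le> (1 + 2 * \<kappa>) * C^p" using \<kappa> Cp by auto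
    show ?thesis unfolding controlled_def K_def using inv c1 c2 c3 c4 n Cp C(1) by (intro conjI) linarith+
  qed
  then show thesis using that by blast
qed

text \<open>The position of \<open>exp (- r Y) v\<close> relative to the first axis, in the chart \<open>\<zeta> \<mapsto> \<zeta> / \<zeta> $ m\<close> (see
  \<open>diag_exp_slope\<close>). Here the hypothesis that the other exponents are less than one enters: for \<open>r \<rightarrow> -\<infinity>\<close> the slope tends to
  zero, and the dilation contracts all directions towards the axis.\<close>

definition dilated_slope :: "real \<Rightarrow> real^('n::_) \<Rightarrow> real^('n::_)" where
  "dilated_slope r v = (\<chi> i. if i = m then 0 else exp (r * (1 - lam i)) * (v $ i / v $ m))"

lemma diag_exp_slope: "v $ m \<noteq> 0 \<Longrightarrow> diag_exp lam (- r) *v v = (v $ m * exp (- r)) *\<^sub>R (axis m 1 + dilated_slope r v)"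
  by (simp add: vec_eq_iff diag_exp_vec dilated_slope_def axis_def lam_m right_diff_distrib exp_diff exp_minus field_simps)

lemma dilated_slope_first: "(axis m 1 + dilated_slope r v) $ m = 1" by (simp add: dilated_slope_def)

lemma dilated_slope_small:
  obtains \<nu> where "\<nu> > 0" "\<And>r v. r \<le> 0 \<Longrightarrow> (\<And>i. \<bar>v $ i\<bar> \<le> \<bar>v $ m\<bar>) \<Longrightarrow> norm (dilated_slope r v) \<le> real CARD('n) * exp (r * \<nu>)"
proof -
  have "\<And>i. 0 < (if i = m then 1 else 1 - lam i)" using lam by auto
  then obtain \<nu> where \<nu>: "\<nu> > 0" "\<And>i. \<nu> \<le> (if i = m then 1 else 1 - lam i)"
    using finite_positive_lower_bound[of "\<lambda>i. if i = m then 1 else 1 - lam i"] by blast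
  have "norm (dilated_slope r v) \<le> real CARD('n) * exp (r * \<nu>)" if r: "r \<le> 0" and v: "\<And>i. \<bar>v $ i\<bar> \<le> \<bar>v $ m\<bar>" for r v
  proof -
    have "norm (dilated_slope r v) \<le> (\<Sum>i\<in>UNIV. \<bar>dilated_slope r v $ i\<bar>)" by (rule norm_le_l1_cart)
    also have "\<dots> \<le> (\<Sum>i\<in>(UNIV::'n set). exp (r * \<nu>))"
    proof (rule sum_mono)
      fix i
      show "\<bar>dilated_slope r v $ i\<bar> \<le> exp (r * \<nu>)"
      proof (cases "i = m")
        case False
        have "\<bar>v $ i / v $ m\<bar> \<le> 1" using v[of i] by (simp add: abs_divide divide_le_eq_1)
        moreover have "exp (r * (1 - lam i)) \<le> exp (r * \<nu>)" using \<nu>(2)[of i] False r by (simp add: mult_left_mono_neg)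
        ultimately have "exp (r * (1 - lam i)) * \<bar>v $ i / v $ m\<bar> \<le> exp (r * \<nu>) * 1" by (intro mult_mono) auto
        then show ?thesis using False by (simp add: dilated_slope_def abs_mult)
      qed (simp add: dilated_slope_def)
    qed
    finally show ?thesis by simp
  qed
  then show thesis using that \<nu>(1) by blast
qed

text \<open>On this ball the coordinate \<open>v $ m\<close> stays away from zero and dominates the other coordinates.\<close>

definition freq_window :: "(real^('n::_)) set" where "freq_window = ball (axis m 1) (1/2)"

lemma freq_window: assumes "v \<in> freq_window" shows "1/2 < v $ m" "v $ m < 3/2" "\<bar>v $ i\<bar> \<le> \<bar>v $ m\<bar>" "norm v < 3/2" "1/2 \<le> norm v"
proof -
  have n: "norm (v - axis m 1) < 1/2" using assms by (simp add: freq_window_def dist_norm norm_minus_commute)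
  have c: "\<bar>(v - axis m 1) $ j\<bar> < 1/2" for j using component_le_norm_cart[of "v - axis m 1" j] n by linarith
  have cm: "\<bar>v $ m - 1\<bar> < 1/2" using c[of m] by (simp add: axis_def)
  show vm: "1/2 < v $ m" "v $ m < 3/2" using cm by linarith+
  show "\<bar>v $ i\<bar> \<le> \<bar>v $ m\<bar>" using c[of i] vm by (cases "i = m") (auto simp: axis_def)
  show "norm v < 3/2" using norm_triangle_ineq[of "v - axis m 1" "axis m 1"] n by simp
  show "1/2 \<le> norm v" using component_le_norm_cart[of v m] vm by linarith
qed

lemma shearlet_coords_apply:
  assumes c: "shearlet_coords h \<epsilon> r \<sigma>" and v: "v $ m \<noteq> 0"
  shows "transpose (matrix_inv h) *v v = (\<epsilon> * v $ m * exp (- r)) *\<^sub>R (\<sigma> *v (axis m 1 + dilated_slope r v))"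
    "(transpose (matrix_inv h) *v v) $ m = \<epsilon> * v $ m * exp (- r)"
    "(1 / (transpose (matrix_inv h) *v v) $ m) *\<^sub>R (transpose (matrix_inv h) *v v) = \<sigma> *v (axis m 1 + dilated_slope r v)"
proof -
  have cc: "\<epsilon> \<in> {1, -1}" "\<sigma> \<in> ST" "transpose (matrix_inv h) = \<epsilon> *\<^sub>R (\<sigma> ** diag_exp lam (- r))" using c by (auto simp: shearlet_coords_def)
  have "transpose (matrix_inv h) *v v = \<epsilon> *\<^sub>R (\<sigma> *v (diag_exp lam (- r) *v v))"
    unfolding cc(3) by (simp only: scaleR_matrix_vector_assoc[symmetric] matrix_vector_mul_assoc)
  then show 1: "transpose (matrix_inv h) *v v = (\<epsilon> * v $ m * exp (- r)) *\<^sub>R (\<sigma> *v (axis m 1 + dilated_slope r v))"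
    unfolding diag_exp_slope[OF v] by (simp only: matrix_vector_mult_scaleR scaleR_scaleR mult.assoc)
  show 2: "(transpose (matrix_inv h) *v v) $ m = \<epsilon> * v $ m * exp (- r)"
    unfolding 1 vector_scaleR_component ST_first[OF cc(2)] dilated_slope_first by simp
  show "(1 / (transpose (matrix_inv h) *v v) $ m) *\<^sub>R (transpose (matrix_inv h) *v v) = \<sigma> *v (axis m 1 + dilated_slope r v)"
    unfolding 2 unfolding 1 using cc(1) v by auto
qed

lemma small_scale:
  fixes \<nu> c :: real
  assumes "\<nu> > 0" "c > 0"
  obtains r0 where "r0 \<le> 0" "\<And>r. r \<le> r0 \<Longrightarrow> real CARD('n) * exp (r * \<nu>) \<le> c"
proof (rule that[of "min 0 (ln (c / real CARD('n)) / \<nu>)"])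
  fix r assume "r \<le> min 0 (ln (c / real CARD('n)) / \<nu>)"
  then have "r * \<nu> \<le> ln (c / real CARD('n))" using assms by (simp add: pos_le_divide_eq)
  then have "exp (r * \<nu>) \<le> c / real CARD('n)" using assms by (metis exp_le_cancel_iff exp_ln divide_pos_pos of_nat_0_less_iff zero_less_card_finite)
  then show "real CARD('n) * exp (r * \<nu>) \<le> c" by (simp add: pos_le_divide_eq mult.commute)
qed simp

text \<open>In a cone around \<open>\<xi>\<close> the norm is comparable to the coordinate at \<open>m\<close>, so a large frequency forces a
  very negative scale \<open>r\<close>.\<close>

lemma scale_of_large:
  assumes "\<epsilon> \<in> {1, -1}" "v \<in> freq_window" "\<eta> $ m = \<epsilon> * v $ m * exp (- r)" "norm ((1 / \<eta> $ m) *\<^sub>R \<eta>) \<le> \<kappa>" "\<kappa> > 0"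
    and "norm \<eta> > 2 * \<kappa> * exp (- r0)"
  shows "r \<le> r0"
proof -
  have vm: "1/2 < v $ m" "v $ m < 3/2" using freq_window[OF assms(2)] by auto
  have a: "\<bar>\<eta> $ m\<bar> = v $ m * exp (- r)" using assms(1,3) vm by (auto simp: abs_mult)
  have "\<eta> $ m \<noteq> 0" using a vm by auto
  then have "norm \<eta> \<le> \<kappa> * \<bar>\<eta> $ m\<bar>" using assms(4) by (simp add: divide_le_eq)
  also have "\<dots> \<le> \<kappa> * (2 * exp (- r))" unfolding a using vm assms(5) by (intro mult_left_mono mult_right_mono) auto
  finally have "2 * \<kappa> * exp (- r0) < 2 * \<kappa> * exp (- r)" using assms(6) by (simp add: mult_ac)
  then show ?thesis using assms(5) by simp
qed

text \<open>One point of the dual translate of the window is known to be large and in a narrow cone. Its size makes \<open>r\<close>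
  very negative, so that all slopes are small; its direction bounds the shear by \<open>ST_norm_bound\<close>. A bounded shear
  maps small slopes to nearby directions, hence the whole translate of the window stays in the given cone.\<close>

lemma dual_window_in_cone:
  assumes xi: "norm \<xi> = 1" "\<xi> $ m \<noteq> 0" and W: "sphere_nbhd W \<xi>"
  obtains W' R K p where "sphere_nbhd W' \<xi>" "W' \<subseteq> {\<zeta>. \<zeta> $ m \<noteq> 0}" "R > 0"
    "\<And>h. h \<in> K_o H W' freq_window R \<Longrightarrow> controlled K p h"
    "\<And>h v. h \<in> K_o H W' freq_window R \<Longrightarrow> v \<in> freq_window \<Longrightarrow> transpose (matrix_inv h) *v v \<in> cone W"
proof -
  obtain \<tau> where \<tau>: "\<tau> > 0" "\<And>\<zeta>. \<zeta> $ m * \<xi> $ m > 0 \<Longrightarrow> norm ((1 / \<zeta> $ m) *\<^sub>R \<zeta> - (1 / \<xi> $ m) *\<^sub>R \<xi>) < \<tau> \<Longrightarrow> \<zeta> \<in> cone W"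
    using cone_of_direction[OF W xi(2)] by metis
  let ?w0 = "(1 / \<xi> $ m) *\<^sub>R \<xi>"
  obtain W' where W': "sphere_nbhd W' \<xi>" "W' \<subseteq> {\<zeta>. \<zeta> $ m \<noteq> 0}"
    "\<And>\<zeta>. \<zeta> \<in> cone W' \<Longrightarrow> \<zeta> $ m * \<xi> $ m > 0 \<and> norm ((1 / \<zeta> $ m) *\<^sub>R \<zeta> - ?w0) < min 1 (\<tau> / 2)"
    using direction_nbhd[OF xi, of "min 1 (\<tau> / 2)"] \<tau>(1) by (metis half_gt_zero min_less_iff_conj zero_less_one)
  obtain C \<theta> where C: "C \<ge> 1" "\<theta> > 0" "\<And>\<sigma> z. \<sigma> \<in> ST \<Longrightarrow> norm z \<le> \<theta> \<Longrightarrow> op_norm \<sigma> \<le> C * norm (\<sigma> *v (axis m 1 + z))"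
    using ST_norm_bound by metis
  define \<kappa>1 where "\<kappa>1 = norm ?w0 + 1"
  define \<kappa> where "\<kappa> = C * \<kappa>1"
  have k1: "\<kappa>1 > 0" unfolding \<kappa>1_def by (simp add: add_nonneg_pos)
  have k: "\<kappa> > 0" unfolding \<kappa>_def using k1 C(1) by simp
  obtain K p where K: "\<And>h \<epsilon> r \<sigma>. h \<in> H \<Longrightarrow> shearlet_coords h \<epsilon> r \<sigma> \<Longrightarrow> op_norm \<sigma> \<le> \<kappa> \<Longrightarrow> r \<le> 0 \<Longrightarrow>
     controlled K p h \<and> op_norm h ^ p * (1 + 2 * \<kappa> * exp (- r)) \<le> K"
    using controlled_of_shearlet_coords[of \<kappa>] k less_imp_le by metis
  obtain \<nu> where \<nu>: "\<nu> > 0" "\<And>r v. r \<le> 0 \<Longrightarrow> (\<And>i. \<bar>v $ i\<bar> \<le> \<bar>v $ m\<bar>) \<Longrightarrow> norm (dilated_slope r v) \<le> real CARD('n) * exp (r * \<nu>)"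
    using dilated_slope_small by metis
  \<comment> \<open>two slopes below \<open>\<tau> / (8 * \<kappa>)\<close> are moved by a shear of norm at most \<open>\<kappa>\<close> to points at distance at most \<open>\<tau> / 4\<close>\<close>
  have cp: "min \<theta> (\<tau> / (8 * \<kappa>)) > 0" using C(2) \<tau>(1) k by simp
  obtain r0 where r0: "r0 \<le> 0" "\<And>r. r \<le> r0 \<Longrightarrow> real CARD('n) * exp (r * \<nu>) \<le> min \<theta> (\<tau> / (8 * \<kappa>))"
    using small_scale[OF \<nu>(1) cp] by metis
  define R where "R = 2 * \<kappa>1 * exp (- r0)"
  have main: "controlled K p h \<and> (\<forall>v'\<in>freq_window. transpose (matrix_inv h) *v v' \<in> cone W)" if hK: "h \<in> K_o H W' freq_window R" for h
  proof -
    obtain v where h: "h \<in> H" and v: "v \<in> freq_window" "transpose (matrix_inv h) *v v \<in> truncated_cone W' R"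
      using hK unfolding K_o_def by blast
    define \<eta> where "\<eta> = transpose (matrix_inv h) *v v"
    have \<eta>: "\<eta> \<in> cone W'" "norm \<eta> > R" using v(2) unfolding \<eta>_def truncated_cone_def by auto
    obtain \<epsilon> r \<sigma> where c: "shearlet_coords h \<epsilon> r \<sigma>" using shearlet_coords_exist[OF h] by metis
    have cc: "\<epsilon> \<in> {1, -1}" "\<sigma> \<in> ST" using c by (auto simp: shearlet_coords_def)
    have vm: "v $ m \<noteq> 0" using freq_window(1)[OF v(1)] by simp
    note ca = shearlet_coords_apply[OF c vm, folded \<eta>_def]
    have ex: "\<eta> $ m * \<xi> $ m > 0" "norm ((1 / \<eta> $ m) *\<^sub>R \<eta> - ?w0) < min 1 (\<tau> / 2)" using W'(3)[OF \<eta>(1)] by auto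
    have nk: "norm ((1 / \<eta> $ m) *\<^sub>R \<eta>) \<le> \<kappa>1"
      using norm_triangle_sub[of "(1 / \<eta> $ m) *\<^sub>R \<eta>" ?w0] ex(2) unfolding \<kappa>1_def by linarith
    have r: "r \<le> r0" by (rule scale_of_large[OF cc(1) v(1) ca(2) nk k1 \<eta>(2)[unfolded R_def]])
    then have rn: "r \<le> 0" using r0(1) by simp
    have zb: "norm (dilated_slope r v') \<le> min \<theta> (\<tau> / (8 * \<kappa>))" if "v' \<in> freq_window" for v'
      using order_trans[OF \<nu>(2)[OF rn freq_window(3)[OF that]] r0(2)[OF r]] .
    have "op_norm \<sigma> \<le> C * norm (\<sigma> *v (axis m 1 + dilated_slope r v))" using zb[OF v(1)] by (intro C(3) cc) simp
    also have "\<dots> \<le> \<kappa>" unfolding \<kappa>_def ca(3)[symmetric] using C(1) nk by (intro mult_left_mono) auto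
    finally have sk: "op_norm \<sigma> \<le> \<kappa>" .
    \<comment> \<open>the known point and the point of \<open>v'\<close> have the same sign and, up to a shear of norm at most \<open>\<kappa>\<close>, nearly the same slope\<close>
    have "transpose (matrix_inv h) *v v' \<in> cone W" if v': "v' \<in> freq_window" for v'
    proof (rule \<tau>(2))
      have vm': "v' $ m \<noteq> 0" using freq_window(1)[OF v'] by simp
      note ca' = shearlet_coords_apply[OF c vm']
      have "\<eta> $ m * \<xi> $ m = (\<epsilon> * \<xi> $ m) * (v $ m * exp (- r))" unfolding ca(2) by (simp add: mult_ac)
      then have "0 < (\<epsilon> * \<xi> $ m) * (v $ m * exp (- r))" using ex(1) by (simp only:)
      moreover have "0 < v $ m * exp (- r)" using freq_window(1)[OF v(1)] by simp
      ultimately have "\<epsilon> * \<xi> $ m > 0" by (rule zero_less_mult_pos2)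
      moreover have "0 < v' $ m * exp (- r)" using freq_window(1)[OF v'] by simp
      ultimately have "(\<epsilon> * \<xi> $ m) * (v' $ m * exp (- r)) > 0" by (rule mult_pos_pos)
      then show "(transpose (matrix_inv h) *v v') $ m * \<xi> $ m > 0" unfolding ca'(2) by (simp add: mult_ac)
      have "norm (\<sigma> *v (axis m 1 + dilated_slope r v') - \<sigma> *v (axis m 1 + dilated_slope r v)) = norm (\<sigma> *v (dilated_slope r v' - dilated_slope r v))"
        by (simp add: matrix_vector_right_distrib matrix_vector_mult_diff_distrib)
      also have "\<dots> \<le> op_norm \<sigma> * norm (dilated_slope r v' - dilated_slope r v)" by (rule op_norm)
      also have "\<dots> \<le> \<kappa> * (\<tau> / (8 * \<kappa>) + \<tau> / (8 * \<kappa>))"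
        using sk k zb[OF v'] zb[OF v(1)] norm_triangle_ineq4[of "dilated_slope r v'" "dilated_slope r v"]
        by (intro mult_mono) (simp_all del: norm_ge_zero, simp_all)
      also have "\<dots> < \<tau> / 2" using k \<tau>(1) by (simp add: field_simps)
      finally have "norm (\<sigma> *v (axis m 1 + dilated_slope r v') - \<sigma> *v (axis m 1 + dilated_slope r v)) < \<tau> / 2" .
      moreover have "norm (\<sigma> *v (axis m 1 + dilated_slope r v) - ?w0) < \<tau> / 2" using ex(2) unfolding ca(3) by simp
      ultimately show "norm ((1 / (transpose (matrix_inv h) *v v') $ m) *\<^sub>R (transpose (matrix_inv h) *v v') - ?w0) < \<tau>"
        unfolding ca'(3) using norm_triangle_ineq[of "\<sigma> *v (axis m 1 + dilated_slope r v') - \<sigma> *v (axis m 1 + dilated_slope r v)" "\<sigma> *v (axis m 1 + dilated_slope r v) - ?w0"]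
        by simp
    qed
    then show ?thesis using K[OF h c sk rn] by blast
  qed
  have "R > 0" unfolding R_def using k1 by simp
  then show thesis using that[OF W'(1,2)] main by blast
qed

text \<open>Sign and scale of \<open>h\<close> are determined by the coordinate \<open>\<eta> $ m\<close>. After the dilation, a shear moves the
  direction of \<open>a\<close> to that of \<open>\<eta>\<close> because the shears are transitive on the hyperplane \<open>x $ m = 1\<close>; it is bounded by
  \<open>ST_norm_bound\<close>.\<close>

lemma cone_covered_by_window:
  assumes xi: "norm \<xi> = 1" "\<xi> $ m \<noteq> 0" and W: "sphere_nbhd W \<xi>" and R: "R > 0" and a: "a \<in> freq_window"
  obtains W' R' K p where "sphere_nbhd W' \<xi>"
    "\<And>\<eta>. \<eta> \<in> cone W' \<Longrightarrow> norm \<eta> > R' \<Longrightarrow> \<exists>h\<in>K_o H W freq_window R. controlled K p h \<and> transpose h *v \<eta> = a \<and> op_norm h ^ p * (1 + norm \<eta>) \<le> K"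
proof -
  obtain \<tau> where \<tau>: "\<tau> > 0" "\<And>\<zeta>. \<zeta> $ m * \<xi> $ m > 0 \<Longrightarrow> norm ((1 / \<zeta> $ m) *\<^sub>R \<zeta> - (1 / \<xi> $ m) *\<^sub>R \<xi>) < \<tau> \<Longrightarrow> \<zeta> \<in> cone W"
    using cone_of_direction[OF W xi(2)] by metis
  let ?w0 = "(1 / \<xi> $ m) *\<^sub>R \<xi>"
  obtain W' where W': "sphere_nbhd W' \<xi>"
    "\<And>\<zeta>. \<zeta> \<in> cone W' \<Longrightarrow> \<zeta> $ m * \<xi> $ m > 0 \<and> norm ((1 / \<zeta> $ m) *\<^sub>R \<zeta> - ?w0) < min 1 \<tau>"
    using direction_nbhd[OF xi, of "min 1 \<tau>"] \<tau>(1) by (metis min_less_iff_conj zero_less_one)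
  obtain C \<theta> where C: "C \<ge> 1" "\<theta> > 0" "\<And>\<sigma> z. \<sigma> \<in> ST \<Longrightarrow> norm z \<le> \<theta> \<Longrightarrow> op_norm \<sigma> \<le> C * norm (\<sigma> *v (axis m 1 + z))"
    using ST_norm_bound by metis
  define \<kappa>1 where "\<kappa>1 = norm ?w0 + 1"
  define \<kappa> where "\<kappa> = C * \<kappa>1"
  have k1: "\<kappa>1 > 0" unfolding \<kappa>1_def by (simp add: add_nonneg_pos)
  have k: "\<kappa> > 0" unfolding \<kappa>_def using k1 C(1) by simp
  have k1k: "\<kappa>1 \<le> \<kappa>" unfolding \<kappa>_def using k1 mult_right_mono[OF C(1), of \<kappa>1] by simp
  obtain K p where K: "\<And>h \<epsilon> r \<sigma>. h \<in> H \<Longrightarrow> shearlet_coords h \<epsilon> r \<sigma> \<Longrightarrow> op_norm \<sigma> \<le> \<kappa> \<Longrightarrow> r \<le> 0 \<Longrightarrow>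
     controlled K p h \<and> op_norm h ^ p * (1 + 2 * \<kappa> * exp (- r)) \<le> K"
    using controlled_of_shearlet_coords[of \<kappa>] k less_imp_le by metis
  obtain \<nu> where \<nu>: "\<nu> > 0" "\<And>r v. r \<le> 0 \<Longrightarrow> (\<And>i. \<bar>v $ i\<bar> \<le> \<bar>v $ m\<bar>) \<Longrightarrow> norm (dilated_slope r v) \<le> real CARD('n) * exp (r * \<nu>)"
    using dilated_slope_small by metis
  obtain r0 where r0: "r0 \<le> 0" "\<And>r. r \<le> r0 \<Longrightarrow> real CARD('n) * exp (r * \<nu>) \<le> \<theta>"
    using small_scale[OF \<nu>(1) C(2)] by metis
  define R' where "R' = max R (2 * \<kappa>1 * exp (- r0))"
  have am: "a $ m > 1/2" "a $ m \<noteq> 0" "a $ m < 3/2" using freq_window[OF a] by auto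
  have main: "\<exists>h\<in>K_o H W freq_window R. controlled K p h \<and> transpose h *v \<eta> = a \<and> op_norm h ^ p * (1 + norm \<eta>) \<le> K"
    if \<eta>: "\<eta> \<in> cone W'" "norm \<eta> > R'" for \<eta>
  proof -
    have ex: "\<eta> $ m * \<xi> $ m > 0" "norm ((1 / \<eta> $ m) *\<^sub>R \<eta> - ?w0) < min 1 \<tau>" using W'(2)[OF \<eta>(1)] by auto
    have em: "\<eta> $ m \<noteq> 0" using ex(1) by auto
    have nk: "norm ((1 / \<eta> $ m) *\<^sub>R \<eta>) \<le> \<kappa>1"
      using norm_triangle_sub[of "(1 / \<eta> $ m) *\<^sub>R \<eta>" ?w0] ex(2) unfolding \<kappa>1_def by linarith
    define \<epsilon> where "\<epsilon> = sgn (\<eta> $ m)"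
    \<comment> \<open>sign and scale are chosen so that \<open>(h\<^sup>-\<^sup>T a) $ m = \<eta> $ m\<close>\<close>
    define r where "r = ln (a $ m / \<bar>\<eta> $ m\<bar>)"
    have \<epsilon>: "\<epsilon> \<in> {1, -1}" unfolding \<epsilon>_def using em by (auto simp: sgn_if)
    have er: "exp (- r) = \<bar>\<eta> $ m\<bar> / a $ m" unfolding r_def using em am by (simp add: exp_minus)
    have em2: "\<eta> $ m = \<epsilon> * a $ m * exp (- r)" unfolding er \<epsilon>_def using am by (simp add: sgn_if)
    have "norm \<eta> > 2 * \<kappa>1 * exp (- r0)" using \<eta>(2) unfolding R'_def by simp
    then have r: "r \<le> r0" by (intro scale_of_large[OF \<epsilon> a em2 nk k1])
    then have rn: "r \<le> 0" using r0(1) by simp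
    have "((1 / \<eta> $ m) *\<^sub>R \<eta>) $ m = 1" using em by simp
    then obtain \<sigma> where s: "\<sigma> \<in> ST" "\<sigma> *v (axis m 1 + dilated_slope r a) = (1 / \<eta> $ m) *\<^sub>R \<eta>"
      using ST_transitive[OF dilated_slope_first[of r a]] by blast
    have "op_norm \<sigma> \<le> C * norm (\<sigma> *v (axis m 1 + dilated_slope r a))"
      by (intro C(3) s(1) order_trans[OF \<nu>(2)[OF rn freq_window(3)[OF a]] r0(2)[OF r]])
    also have "\<dots> \<le> \<kappa>" unfolding \<kappa>_def s(2) using C(1) nk by (intro mult_left_mono) auto
    finally have sk: "op_norm \<sigma> \<le> \<kappa>" .
    obtain h where h: "h \<in> H" "shearlet_coords h \<epsilon> r \<sigma>" using shearlet_coords_realize[OF \<epsilon> s(1)] by metis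
    have Ta: "transpose (matrix_inv h) *v a = \<eta>"
      unfolding shearlet_coords_apply(1)[OF h(2) am(2)] s(2) em2[symmetric] using em by simp
    have "transpose h *v (transpose (matrix_inv h) *v a) = a"
      by (simp only: matrix_vector_mul_assoc transpose_inverse(1)[OF H_invertible[OF h(1)]] matrix_vector_mul_lid)
    then have Th: "transpose h *v \<eta> = a" unfolding Ta .
    have "\<eta> \<in> cone W" using ex by (intro \<tau>(2)) auto
    then have "\<eta> \<in> truncated_cone W R" unfolding truncated_cone_def using \<eta>(2) by (auto simp: R'_def)
    then have hK: "h \<in> K_o H W freq_window R" unfolding K_o_def using h(1) a Ta by blast
    have "norm \<eta> \<le> \<kappa>1 * \<bar>\<eta> $ m\<bar>" using nk em by (simp add: divide_le_eq)
    also have "\<bar>\<eta> $ m\<bar> = a $ m * exp (- r)" unfolding er using am by simp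
    also have "\<kappa>1 * (a $ m * exp (- r)) \<le> \<kappa> * (2 * exp (- r))" using k1k k1 am by (intro mult_mono) auto
    finally have "1 + norm \<eta> \<le> 1 + 2 * \<kappa> * exp (- r)" by simp
    then have "op_norm h ^ p * (1 + norm \<eta>) \<le> op_norm h ^ p * (1 + 2 * \<kappa> * exp (- r))"
      by (intro mult_left_mono) (auto simp: op_norm_nonneg)
    then show ?thesis using K[OF h sk rn] hK Th by (intro bexI[of _ h]) auto
  qed
  show thesis by (rule that[OF W'(1) main])
qed

section \<open>Characterization of the wavefront set\<close>

lemma powr_minus_nat: "0 < x \<Longrightarrow> C * x powr (- real N) = C / x ^ N"
  by (simp add: powr_minus powr_realpow divide_inverse)

text \<open>Both implications combine a geometric lemma with the corresponding analytic theorem. In the second one the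
  estimate is obtained only for large frequencies of the cone and is completed by \<open>fourier_localized_bound\<close>.\<close>

theorem characterizes: "characterizes_wavefront_set H"
  unfolding characterizes_wavefront_set_def
proof (intro exI[of _ freq_window] conjI allI impI)
  show "freq_window \<noteq> {}" "open freq_window" by (auto simp: freq_window_def)
  have cb: "closure freq_window = cball (axis m 1) (1/2)" by (simp add: freq_window_def)
  have sub: "cball (axis m 1) (1/2) \<subseteq> {x::real^('n::_). x $ m \<noteq> 0}"
  proof
    fix v :: "real^('n::_)" assume "v \<in> cball (axis m 1) (1/2)"
    then have "\<bar>(v - axis m 1) $ m\<bar> \<le> 1/2"
      using component_le_norm_cart[of "v - axis m 1" m] by (simp add: dist_norm norm_minus_commute)
    then show "v \<in> {x. x $ m \<noteq> 0}" by (auto simp: axis_def abs_le_iff)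
  qed
  show "compactly_inside freq_window (open_dual_orbit H)"
    unfolding compactly_inside_def open_dual_orbit_eq cb Int_absorb1[OF sub]
    using order_trans[OF ball_subset_cball sub] by (simp add: freq_window_def)
  fix \<psi> :: "real^('n::_) \<Rightarrow> complex" and u :: "(real^('n::_) \<Rightarrow> complex) \<Rightarrow> complex" and x \<xi> :: "real^('n::_)"
  assume psi: "schwartz \<psi> \<and> \<psi> \<noteq> (\<lambda>_. 0) \<and> supp (fourier \<psi>) \<subseteq> freq_window"
    and "tempered_distribution u \<and> \<xi> \<in> open_dual_orbit H \<inter> sphere 0 1"
  then have u: "tempered_distribution u" and xi: "norm \<xi> = 1" "\<xi> $ m \<noteq> 0" by (auto simp: open_dual_orbit_eq)
  have sp: "schwartz \<psi>" using psi by blast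
  have supp: "\<eta> \<in> freq_window" if "fourier \<psi> \<eta> \<noteq> 0" for \<eta>
    using psi that closure_subset[of "{x. fourier \<psi> x \<noteq> 0}"] by (auto simp: supp_def)
  have pos: "0 < 1 + norm \<eta>" for \<eta> :: "real^('n::_)" by (simp add: add_pos_nonneg)
  show "regular_directed_point u x \<xi> \<longleftrightarrow> wavelet_decay_point H freq_window \<psi> u x \<xi>"
  proof
    assume "regular_directed_point u x \<xi>"
    then obtain \<phi> W U where phi: "test_function \<phi>" and U: "open U" "x \<in> U" "\<And>y. y \<in> U \<Longrightarrow> \<phi> y = 1"
      and W: "sphere_nbhd W \<xi>"
      and dec: "\<And>N::nat. \<exists>C>0. \<forall>\<eta>\<in>cone W. norm (fourier_localized \<phi> u \<eta>) \<le> C * (1 + norm \<eta>) powr (- real N)"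
      unfolding regular_directed_point_def by blast
    have dec': "\<exists>C\<ge>0. \<forall>\<eta>\<in>cone W. norm (fourier_localized \<phi> u \<eta>) \<le> C / (1 + norm \<eta>)^N" for N
      using dec[of N] unfolding powr_minus_nat[OF pos] using less_imp_le by blast
    obtain W' R K p where g: "sphere_nbhd W' \<xi>" "W' \<subseteq> {\<zeta>. \<zeta> $ m \<noteq> 0}" "R > 0"
      "\<And>h. h \<in> K_o H W' freq_window R \<Longrightarrow> controlled K p h"
      "\<And>h v. h \<in> K_o H W' freq_window R \<Longrightarrow> v \<in> freq_window \<Longrightarrow> transpose (matrix_inv h) *v v \<in> cone W"
      using dual_window_in_cone[OF xi W] by metis
    have half: "(0::real) < 1/2" by simp
    obtain U' where "open U'" "x \<in> U'" "\<And>N. \<exists>C>0. \<forall>y\<in>U'. \<forall>h\<in>K_o H W' freq_window R. norm (wavelet_transform \<psi> u y h) \<le> C * op_norm h ^ N"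
      using wavelet_decay_of_regular[OF u sp supp half freq_window(5) phi U dec' g(4,5)] by metis
    then show "wavelet_decay_point H freq_window \<psi> u x \<xi>"
      unfolding wavelet_decay_point_def open_dual_orbit_eq using g(1-3) by blast
  next
    assume "wavelet_decay_point H freq_window \<psi> u x \<xi>"
    then obtain U R W where U: "open U" "x \<in> U" and R: "R > 0" and W: "sphere_nbhd W \<xi>"
      and dec: "\<And>N. \<exists>C>0. \<forall>y\<in>U. \<forall>h\<in>K_o H W freq_window R. norm (wavelet_transform \<psi> u y h) \<le> C * op_norm h ^ N"
      unfolding wavelet_decay_point_def by blast
    \<comment> \<open>by inversion, the transform of a nonzero wavelet does not vanish identically\<close>
    have "\<exists>a. fourier \<psi> a \<noteq> 0"
    proof (rule ccontr)
      assume "\<nexists>a. fourier \<psi> a \<noteq> 0"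
      then have "fourier \<psi> = (\<lambda>_. 0)" by auto
      then have "\<psi> z = 0" for z using fourier_inversion[OF sp, of z] by (simp add: fourier_character)
      then show False using psi by auto
    qed
    then obtain a where a: "fourier \<psi> a \<noteq> 0" by blast
    obtain W' R' K p where g: "sphere_nbhd W' \<xi>"
      "\<And>\<eta>. \<eta> \<in> cone W' \<Longrightarrow> norm \<eta> > R' \<Longrightarrow> \<exists>h\<in>K_o H W freq_window R. controlled K p h \<and> transpose h *v \<eta> = a \<and> op_norm h ^ p * (1 + norm \<eta>) \<le> K"
      using cone_covered_by_window[OF xi W R supp[OF a]] by metis
    define \<Gamma> where "\<Gamma> = {\<eta> \<in> cone W'. norm \<eta> > R'}"
    have hh: "\<exists>h\<in>K_o H W freq_window R. controlled K p h \<and> transpose h *v \<eta> = a \<and> op_norm h ^ p * (1 + norm \<eta>) \<le> K" if "\<eta> \<in> \<Gamma>" for \<eta>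
      using that g(2) unfolding \<Gamma>_def by blast
    obtain \<phi> U' where phi: "test_function \<phi>" "open U'" "x \<in> U'" "\<And>y. y \<in> U' \<Longrightarrow> \<phi> y = 1"
      "\<And>N. \<exists>C\<ge>0. \<forall>\<eta>\<in>\<Gamma>. norm (fourier_localized \<phi> u \<eta>) \<le> C / (1 + norm \<eta>)^N"
      using regular_of_wavelet_decay[OF u sp a U dec hh] by metis
    obtain D k where D: "D \<ge> 0" "\<And>\<eta>. norm (fourier_localized \<phi> u \<eta>) \<le> D * (1 + norm \<eta>)^k"
      using fourier_localized_bound[OF u phi(1)] by metis
    have "\<exists>C>0. \<forall>\<eta>\<in>cone W'. norm (fourier_localized \<phi> u \<eta>) \<le> C * (1 + norm \<eta>) powr (- real N)" for N :: nat
    proof -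
      obtain C where C: "C \<ge> 0" "\<And>\<eta>. \<eta> \<in> \<Gamma> \<Longrightarrow> norm (fourier_localized \<phi> u \<eta>) \<le> C / (1 + norm \<eta>)^N" using phi(5) by meson
      let ?B = "D * (1 + \<bar>R'\<bar>)^(k + N)"
      have B: "?B \<ge> 0" using D(1) by simp
      have "norm (fourier_localized \<phi> u \<eta>) \<le> (C + ?B + 1) / (1 + norm \<eta>)^N" if e: "\<eta> \<in> cone W'" for \<eta>
      proof (cases "norm \<eta> > R'")
        case True
        then have "norm (fourier_localized \<phi> u \<eta>) \<le> C / (1 + norm \<eta>)^N" using e by (intro C(2)) (simp add: \<Gamma>_def)
        also have "\<dots> \<le> (C + ?B + 1) / (1 + norm \<eta>)^N" using B by (intro divide_right_mono) (auto simp: add_nonneg_nonneg)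
        finally show ?thesis .
      next
        case False
        have "norm (fourier_localized \<phi> u \<eta>) * (1 + norm \<eta>)^N \<le> D * (1 + norm \<eta>)^k * (1 + norm \<eta>)^N"
          by (intro mult_right_mono D(2)) (simp add: add_nonneg_nonneg)
        also have "\<dots> = D * (1 + norm \<eta>)^(k + N)" by (simp add: power_add)
        also have "\<dots> \<le> ?B" using False by (intro mult_left_mono power_mono D(1)) auto
        finally have "norm (fourier_localized \<phi> u \<eta>) * (1 + norm \<eta>)^N \<le> C + ?B + 1" using C(1) by linarith
        then show ?thesis using pos[of \<eta>] by (simp add: pos_le_divide_eq)
      qed
      moreover have "C + ?B + 1 > 0" using C(1) B by linarith
      ultimately show ?thesis unfolding powr_minus_nat[OF pos] by blast
    qed
    then show "regular_directed_point u x \<xi>"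
      unfolding regular_directed_point_def using phi(1-4) g(1) by blast
  qed
qed

end

theorem theorem28:
  fixes H S D :: "(real^('n::{finite,wellorder})^('n::_)) set"
    and Y :: "real^('n::_)^('n::_)" and lam :: "('n::_) \<Rightarrow> real"
  assumes "generalized_shearlet_group H S D Y"
    and "Y = diag_matrix lam"
    and "lam (Min UNIV) = 1"
    and "\<And>i. i \<noteq> Min UNIV \<Longrightarrow> 0 < lam i \<and> lam i < 1"
  shows "characterizes_wavefront_set H"
proof -
  note G = assms(1)[unfolded generalized_shearlet_group_def]
  have g: "irreducibly_admissible H" "closed_subgroup_of S H" "closed_subgroup_of D H" "S \<subseteq> unitriangular"
    "\<forall>A\<in>S. \<forall>B\<in>S. A ** B = B ** A" "D = {matrix_exp (r *\<^sub>R Y) | r. True}"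
    "\<forall>h\<in>H. \<exists>!(\<epsilon>, \<delta>, s). \<epsilon> \<in> {1, -1} \<and> \<delta> \<in> D \<and> s \<in> S \<and> h = \<epsilon> *\<^sub>R (\<delta> ** s)"
    by (use G in argo)+
  have D: "D = {diag_exp lam r | r. True}" unfolding g(6) assms(2) matrix_exp_diag ..
  have H: "closed_GL_subgroup H" and irr: "quasi_regular_irreducible H" using g(1) by (auto simp: irreducibly_admissible_def)
  have "det A = 1" if "A \<in> unitriangular" for A :: "real^('n::_)^('n::_)"
  proof -
    have "det A = (\<Prod>i\<in>UNIV. A $ i $ i)" using that by (intro det_upperdiagonal) (auto simp: unitriangular_def)
    also have "\<dots> = 1" using that by (intro prod.neutral) (auto simp: unitriangular_def)
    finally show ?thesis .
  qed
  then have uGL: "unitriangular \<subseteq> (GL :: (real^('n::_)^('n::_)) set)" by (auto simp: GL_def invertible_det_nz)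
  have cu: "closed (unitriangular :: (real^('n::_)^('n::_)) set)"
    unfolding unitriangular_def
    by (intro closed_Collect_conj closed_Collect_all closed_Collect_imp open_Collect_const closed_Collect_eq continuous_intros)
  obtain T1 where T1: "closed T1" "S = H \<inter> T1" using g(2) unfolding closed_subgroup_of_def closedin_closed by blast
  obtain T2 where T2: "closed T2" "H = GL \<inter> T2" using H unfolding closed_GL_subgroup_def closedin_closed by blast
  have "S = unitriangular \<inter> T2 \<inter> T1" using T1 T2 uGL g(4) by blast
  \<comment> \<open>\<open>S\<close> is closed among all matrices, since every unitriangular matrix is invertible\<close>
  then have cS: "closed S" using cu T1(1) T2(1) by (simp add: closed_Int)
  interpret shearlet H S lam "Min UNIV"
  proof
    show "matrix_group H" using H by (simp add: closed_GL_subgroup_def)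
    show "matrix_group S" "S \<subseteq> H" using g(2) by (auto simp: closed_subgroup_of_def)
    show "diag_exp lam r \<in> H" for r using g(3) D by (auto simp: closed_subgroup_of_def)
    show "A ** B = B ** A" if "A \<in> S" "B \<in> S" for A B using g(5) that by blast
    show "\<exists>\<epsilon>\<in>{1,-1}. \<exists>r. \<exists>s\<in>S. h = \<epsilon> *\<^sub>R (diag_exp lam r ** s)" if "h \<in> H" for h
    proof -
      have "\<exists>!(\<epsilon>, \<delta>, s). \<epsilon> \<in> {1, -1} \<and> \<delta> \<in> D \<and> s \<in> S \<and> h = \<epsilon> *\<^sub>R (\<delta> ** s)"
        using bspec[OF g(7) that] .
      from ex1_implies_ex[OF this] obtain \<epsilon> \<delta> s where "\<epsilon> \<in> {1, -1}" "\<delta> \<in> D" "s \<in> S" "h = \<epsilon> *\<^sub>R (\<delta> ** s)"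
        unfolding split_paired_Ex prod.case by blast
      then show ?thesis unfolding D by blast
    qed
  qed (use g(4) cS irr assms(3,4) in auto)
  show ?thesis by (rule characterizes)
qed

end
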